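(* There exists a holomorphic section $\mathfrak m$ (the duality interface) of a certain line bundle on $\mathrm{Ell}_{\mathsf T\times\mathsf T'}(X\times X')$ such that, for every fixed point $I\in X^{\mathsf T}$ with corresponding fixed point $J\in(X')^{\mathsf T'}$ (i.e. $J=I^{-1}$ as a permutation), $$(i_J^* )^*(\mathfrak m)=\mathbf{Stab}(I),\qquad (i_I^* )^*(\mathfrak m)=\mathbf{Stab}'(J).$$
   Context: Elliptic curve and theta function. Fix $q\in\mathbb C^*$, $|q|<1$, $E=\mathbb C^*/q^{\mathbb Z}$, and $$\vartheta(x)=(x^{1/2}-x^{-1/2})\,\phi(qx)\,\phi(q/x),\qquad \phi(x)=\prod_{s\ge 0}(1-q^s x),$$ so that $\vartheta(1/x)=-\vartheta(x)$. (Functions involving $x^{1/2}$ are understood as functions of the logarithms of the variables, i.e. as sections of line bundles over products of copies of $E$.) Permutations. A permutation $I\in\mathfrak S_n$ is written $I=(I_1,\dots,I_n)$, $I_k=I(k)$. For $1\le k\le n$ write $\{i^{(k)}_1<\dots<i^{(k)}_k\}=\{I_1,\dots,I_k\}$. $\sigma_0=(n,n-1,\dots,1)$ is the longest permutation. For variables $z=(z_1,\dots,z_n)$ put $z_\sigma=(z_{\sigma(1)},\dots,z_{\sigma(n)})$ and $1/z=(1/z_1,\dots,1/z_n)$; for $\sigma\in\mathfrak S_n$, $\sigma^{-1}(I)=(\sigma^{-1}(I_1),\dots,\sigma^{-1}(I_n))$. Elliptic weight functions. Let $t=(t^{(k)}_a)_{1\le a\le k\le n-1}$, $t^{(n)}_i=z_i$,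 and $\mu=(\mu_1,\dots,\mu_n)$. Define $W_I(t,z,\hbar,\mu)=\mathrm{Sym}_{t^{(1)}}\cdots\mathrm{Sym}_{t^{(n-1)}}U_I(t,z,\hbar,\mu)$, where $\mathrm{Sym}_{t^{(k)}}$ is the sum over all permutations of $t^{(k)}_1,\dots,t^{(k)}_k$ and $$U_I=\prod_{k=1}^{n-1}\frac{\prod_{a=1}^{k}\prod_{c=1}^{k+1}\psi_{I,k,a,c}\big(t^{(k+1)}_c/t^{(k)}_a\big)}{\prod_{1\le a<b\le k}\vartheta\big(\hbar t^{(k)}_a/t^{(k)}_b\big)\,\vartheta\big(t^{(k)}_b/t^{(k)}_a\big)},$$ $$\psi_{I,k,a,c}(x)=\begin{cases}\vartheta(\hbar x), & i^{(k+1)}_c<i^{(k)}_a,\\ \vartheta\big(x\,\hbar^{1-p_{I,k+1}(i^{(k)}_a)}\,\mu_{k+1}/\mu_{j(I,k,a)}\big), & i^{(k+1)}_c=i^{(k)}_a,\\ \vartheta(x), & i^{(k+1)}_c>i^{(k)}_a.\end{cases}$$ Here $j(I,k,a)$ is the index with $I_{j(I,k,a)}=i^{(k)}_a$, and $p_{I,j}(m)=1$ if $I_j<m$, $p_{I,j}(m)=0$ if $I_j\ge m$. For $\sigma\in\mathfrak S_n$ put $W_{\sigma,I}(t,z,\hbar,\mu)=W_{\sigma^{-1}(I)}(t,z_\sigma,\hbar,\mu)$. The variety $X$ and its extended elliptic cohomology. $X$ is the cotangent bundle of the variety of complete flags in $\mathbb C^n$, with the torus $\mathsf T=(\mathbb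 C^* )^n\times\mathbb C^*_\hbar$, where $(\mathbb C^* )^n$ acts through its action on $\mathbb C^n$ by $(x_1,\dots,x_n)\mapsto(x_1z_1^{-1},\dots,x_nz_n^{-1})$ and $\mathbb C_\hbar^*$ scales the cotangent fibers by $\hbar^{-1}$. Fixed points $X^{\mathsf T}$ are the coordinate flags $V_k(I)=\mathrm{Span}(e_{I_1},\dots,e_{I_k})$, $I\in\mathfrak S_n$. Let $\mathscr E_{\mathsf T}$ (coordinates $z_1,\dots,z_n,\hbar$, the equivariant parameters) be the $\mathsf T$-equivariant elliptic cohomology of a point and let $\mathscr E_{\mathrm{Pic}(X)}=\mathrm{Pic}(X)\otimes_{\mathbb Z}E$ (coordinates $\mu_1,\dots,\mu_n$, the Kähler parameters). The extended elliptic cohomology $\mathsf E_{\mathsf T}(X)=\mathrm{Ell}_{\mathsf T}(X)\times\mathscr E_{\mathrm{Pic}(X)}$ is embedded by the elliptic Chern classes of the tautological bundles, $c_X:\mathsf E_{\mathsf T}(X)\hookrightarrow \mathsf S(X)\times\mathscr E_{\mathsf T}\times\mathscr E_{\mathrm{Pic}(X)}$, $\mathsf S(X)=\prod_{k=1}^{n-1}S^kE$, where $t^{(k)}_1,\dots,t^{(k)}_k$ (Chern roots of the rank $k$ tautological bundle) are the coordinates on the $k$-th factor. It is the union of components $\widehat{\mathsf O}_I\cong\mathscr E_{\mathsf T}\times\mathscr E_{\mathrm{Pic}(X)}$, $I\in\mathfrak S_n$, where $\widehat{\mathsf O}_I$ is cut out by $t^{(k)}_l=z_{i^{(k)}_l}$,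 $1\le l\le k\le n-1$; restriction of a section to $\widehat{\mathsf O}_I$ is this substitution. Stable envelopes. The normalized (holomorphic) elliptic stable envelope of $I$ is $\mathbf{Stab}(I)=c_X^*W_{I}(t,z,\hbar,\mu)$ (chamber $\sigma=\mathrm{id}$). Dual variety. $X'$ is a second copy of $X$, with torus $\mathsf T'$, equivariant parameters $z_1',\dots,z_n',\hbar'$, Kähler parameters $\mu_1',\dots,\mu_n'$, Chern roots $t'$ (all defined in the same way). Its elliptic stable envelope (chamber $\sigma_0$) is $\mathbf{Stab}'(I)=(-1)^{n(n-1)/2}\,c_{X'}^*W_{\sigma_0,I}(t',z',\hbar',1/\mu')$. The fixed point of $X'$ corresponding to $I\in X^{\mathsf T}$ is $I^{-1}$. Identification of parameters. Equivariant and Kähler parameters of $X$ and $X'$ are identified by $\kappa$: $\mu'_i\mapsto z_i$, $z_i'\mapsto\mu_i$, $\hbar'\mapsto\hbar$, so $\mathscr E_{\mathrm{Pic}(X)}\cong\mathscr E_{\mathsf T'}$, $\mathscr E_{\mathrm{Pic}(X')}\cong\mathscr E_{\mathsf T}$ (with $\hbar$ and $\hbar'$ identified throughout, so that $\mathscr E_{\mathsf T\times\mathsf T'}$ has coordinates $z,z',\hbar$). The product. $\mathsf T\times\mathsf T'$ acts on $X\times X'$, with fixed points $(I,J)$. By elliptic Chern classes $\mathrm{Ell}_{\mathsf T\times\mathsf T'}(X\times X')$ embeds into $\mathsf S(X)\times\mathsf S(X')\times\mathscr E_{\mathsf T\times\mathsf T'}$; it is the union of components $\mathsf O_{I,J}\cong\mathscr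 E_{\mathsf T\times\mathsf T'}$ on which the Chern roots $t$ and $t'$ are specialized to the values at the fixed points $I$ and $J$ (that is, $t^{(k)}_l=z_{i^{(k)}_l}$, and similarly $t'$ in terms of $z'$ and $J$). A section is holomorphic if its restriction to each $\mathsf O_{I,J}$ is holomorphic. For $I\in X^{\mathsf T}$, $J\in(X')^{\mathsf T'}$ consider the equivariant embeddings $X\times\{J\}\xrightarrow{i_J}X\times X'\xleftarrow{i_I}\{I\}\times X'$. Using $\kappa$ one has $\mathrm{Ell}_{\mathsf T\times\mathsf T'}(X\times\{J\})=\mathrm{Ell}_{\mathsf T}(X)\times\mathscr E_{\mathsf T'}\cong\mathsf E_{\mathsf T}(X)$ and $\mathrm{Ell}_{\mathsf T\times\mathsf T'}(\{I\}\times X')\cong\mathsf E_{\mathsf T'}(X')$. Denote by $i_J^*:\mathsf E_{\mathsf T}(X)\to\mathrm{Ell}_{\mathsf T\times\mathsf T'}(X\times X')$ and $i_I^*:\mathsf E_{\mathsf T'}(X')\to\mathrm{Ell}_{\mathsf T\times\mathsf T'}(X\times X')$ the induced embeddings of schemes; $(i_J^* )^*$ and $(i_I^* )^*$ are pullbacks of sections along them. *)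

theory Defs
  imports "HOL-Analysis.Analysis" "HOL-Combinatorics.Permutations"
begin

text \<open>
  Throughout, multiplicative variables are replaced by their logarithms: a variable of the
  elliptic curve \<open>E = \<complex>\<^sup>* / q\<^sup>\<int>\<close> is \<open>exp u\<close> with \<open>u :: complex\<close>, taken modulo
  the lattice \<open>log_lattice q\<close>.  Functions involving square roots of the variables are then
  honest functions of the logarithms.
\<close>

definition log_lattice :: "complex \<Rightarrow> complex set" where
  "log_lattice q = {w. \<exists>m::int. exp w = q powi m}"

section \<open>Theta function and elliptic weight functions\<close>

definition phi :: "complex \<Rightarrow> complex \<Rightarrow> complex" where
  "phi q x = (\<Prod>s. 1 - q ^ s * x)"

definition theta :: "complex \<Rightarrow> complex \<Rightarrow> complex" where
  "theta q u = (exp (u / 2) - exp (- u / 2)) * phi q (q * exp u) * phi q (q / exp u)"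

text \<open>\<open>sorted_val I k a\<close> is \<open>i\<^sup>(\<^sup>k\<^sup>)\<^sub>a\<close>: the \<open>a\<close>-th smallest (counted from 1) of
  \<open>I 1, \<dots>, I k\<close>.\<close>

definition sorted_val :: "(nat \<Rightarrow> nat) \<Rightarrow> nat \<Rightarrow> nat \<Rightarrow> nat" where
  "sorted_val I k a = sorted_list_of_set (I ` {1..k}) ! (a - 1)"

definition p_ind :: "(nat \<Rightarrow> nat) \<Rightarrow> nat \<Rightarrow> nat \<Rightarrow> complex" where
  "p_ind I j m = (if I j < m then 1 else 0)"

definition psi ::
  "complex \<Rightarrow> (nat \<Rightarrow> nat) \<Rightarrow> complex \<Rightarrow> (nat \<Rightarrow> complex) \<Rightarrow> nat \<Rightarrow> nat \<Rightarrow> nat \<Rightarrow> complex \<Rightarrow> complex"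
where
  "psi q I h \<mu> k a c u =
    (let i = sorted_val I k a; i' = sorted_val I (k + 1) c in
     if i' < i then theta q (h + u)
     else if i' = i then theta q (u + (1 - p_ind I (k + 1) i) * h + \<mu> (k + 1) - \<mu> (inv I i))
     else theta q u)"

definition weight_U ::
  "complex \<Rightarrow> nat \<Rightarrow> (nat \<Rightarrow> nat) \<Rightarrow> complex \<Rightarrow> (nat \<Rightarrow> complex) \<Rightarrow> (nat \<Rightarrow> nat \<Rightarrow> complex) \<Rightarrow> complex"
where
  "weight_U q n I h \<mu> t =
    (\<Prod>k\<in>{1..<n}.
       (\<Prod>a\<in>{1..k}. \<Prod>c\<in>{1..k+1}. psi q I h \<mu> k a c (t (k + 1) c - t k a)) /
       (\<Prod>b\<in>{1..k}. \<Prod>a\<in>{1..<b}. theta q (h + t k a - t k b) * theta q (t k b - t k a)))"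

definition Sym_level ::
  "nat \<Rightarrow> ((nat \<Rightarrow> nat \<Rightarrow> complex) \<Rightarrow> complex) \<Rightarrow> (nat \<Rightarrow> nat \<Rightarrow> complex) \<Rightarrow> complex"
where
  "Sym_level k F t = (\<Sum>\<pi> | \<pi> permutes {1..k}. F (t(k := t k \<circ> \<pi>)))"

definition weight_W ::
  "complex \<Rightarrow> nat \<Rightarrow> (nat \<Rightarrow> nat) \<Rightarrow> (nat \<Rightarrow> nat \<Rightarrow> complex) \<Rightarrow> (nat \<Rightarrow> complex) \<Rightarrow> complex
    \<Rightarrow> (nat \<Rightarrow> complex) \<Rightarrow> complex"
where
  "weight_W q n I t z h \<mu> = foldr Sym_level [1..<n] (weight_U q n I h \<mu>) (t(n := z))"

definition weight_W_chamber ::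
  "complex \<Rightarrow> nat \<Rightarrow> (nat \<Rightarrow> nat) \<Rightarrow> (nat \<Rightarrow> nat) \<Rightarrow> (nat \<Rightarrow> nat \<Rightarrow> complex) \<Rightarrow> (nat \<Rightarrow> complex)
    \<Rightarrow> complex \<Rightarrow> (nat \<Rightarrow> complex) \<Rightarrow> complex"
where
  "weight_W_chamber q n \<sigma> I t z h \<mu> = weight_W q n (inv \<sigma> \<circ> I) t (z \<circ> \<sigma>) h \<mu>"

definition longest_perm :: "nat \<Rightarrow> nat \<Rightarrow> nat" where
  "longest_perm n i = (if i \<in> {1..n} then n + 1 - i else i)"

section \<open>Holomorphic functions on subsets of \<open>\<complex>\<^sup>A\<close>\<close>

text \<open>For a finite index set \<open>A\<close>, the space \<open>\<complex>\<^sup>A\<close> is \<open>A \<rightarrow>\<^sub>E UNIV\<close>.\<close>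

definition polydisc :: "'c set \<Rightarrow> ('c \<Rightarrow> complex) \<Rightarrow> real \<Rightarrow> ('c \<Rightarrow> complex) set" where
  "polydisc A x r = {y \<in> A \<rightarrow>\<^sub>E UNIV. \<forall>c\<in>A. dist (y c) (x c) < r}"

definition complex_differentiable_at ::
  "'c set \<Rightarrow> (('c \<Rightarrow> complex) \<Rightarrow> complex) \<Rightarrow> ('c \<Rightarrow> complex) \<Rightarrow> bool"
where
  "complex_differentiable_at A f x \<longleftrightarrow>
    (\<exists>D. \<forall>\<epsilon>>0. \<exists>\<delta>>0. \<forall>y\<in>polydisc A x \<delta>.
       cmod (f y - f x - (\<Sum>c\<in>A. D c * (y c - x c))) \<le> \<epsilon> * (\<Sum>c\<in>A. cmod (y c - x c)))"

text \<open>Holomorphy in the sense of reduced analytic spaces: locally on \<open>X\<close>, the function is the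
  restriction of a holomorphic function of the ambient \<open>\<complex>\<^sup>A\<close>.  For \<open>X = \<complex>\<^sup>A\<close> this is ordinary
  holomorphy.\<close>

definition holomorphic_along ::
  "'c set \<Rightarrow> ('c \<Rightarrow> complex) set \<Rightarrow> (('c \<Rightarrow> complex) \<Rightarrow> complex) \<Rightarrow> bool"
where
  "holomorphic_along A X f \<longleftrightarrow>
    (\<forall>x\<in>X. \<exists>r>0. \<exists>g. (\<forall>y\<in>polydisc A x r. complex_differentiable_at A g y) \<and>
                      (\<forall>y\<in>X \<inter> polydisc A x r. f y = g y))"

section \<open>Fixed points and Chern roots\<close>

text \<open>The values of the Chern roots at the fixed point \<open>K\<close>, and the condition that
  \<open>(t, z)\<close> maps to the locus \<open>t\<^sup>(\<^sup>k\<^sup>)\<^sub>l = z\<^bsub>i\<^sup>(\<^sup>k\<^sup>)\<^sub>l\<^esub>\<close> of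
  \<open>\<Prod>\<^sub>k S\<^sup>k E \<times> E\<^sup>n\<close>.\<close>

definition fixed_roots :: "(nat \<Rightarrow> nat) \<Rightarrow> (nat \<Rightarrow> complex) \<Rightarrow> nat \<Rightarrow> nat \<Rightarrow> complex" where
  "fixed_roots K z k l = z (sorted_val K k l)"

definition lies_over ::
  "complex \<Rightarrow> nat \<Rightarrow> (nat \<Rightarrow> nat) \<Rightarrow> (nat \<Rightarrow> nat \<Rightarrow> complex) \<Rightarrow> (nat \<Rightarrow> complex) \<Rightarrow> bool"
where
  "lies_over q n K t z \<longleftrightarrow>
    (\<forall>k\<in>{1..<n}. \<exists>\<pi>. \<pi> permutes {1..k} \<and>
       (\<forall>l\<in>{1..k}. t k (\<pi> l) - fixed_roots K z k l \<in> log_lattice q))"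

section \<open>Extended elliptic cohomology of \<open>X\<close> and stable envelopes\<close>

text \<open>Logarithmic coordinates on \<open>S(X) \<times> E\<^sub>T \<times> E\<^bsub>Pic(X)\<^esub>\<close>.  The same type
  serves the second copy \<open>X'\<close>, with all coordinates read as primed.\<close>

datatype xcoord = Root nat nat | Equi nat | Hbar | Kahler nat

definition root_indices :: "nat \<Rightarrow> (nat \<times> nat) set" where
  "root_indices n = {(k, a). 1 \<le> a \<and> a \<le> k \<and> k \<le> n - 1}"

definition xcoords :: "nat \<Rightarrow> xcoord set" where
  "xcoords n = case_prod Root ` root_indices n \<union> Equi ` {1..n} \<union> {Hbar} \<union> Kahler ` {1..n}"

text \<open>The preimage, in logarithmic coordinates, of the extended elliptic cohomology
  \<open>\<Union>\<^sub>K O\<^sub>K\<close> of \<open>X\<close>.\<close>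

definition ext_ell_X :: "complex \<Rightarrow> nat \<Rightarrow> (xcoord \<Rightarrow> complex) set" where
  "ext_ell_X q n = {x \<in> xcoords n \<rightarrow>\<^sub>E UNIV. \<exists>K. K permutes {1..n} \<and>
     lies_over q n K (\<lambda>k a. x (Root k a)) (\<lambda>i. x (Equi i))}"

definition Stab :: "complex \<Rightarrow> nat \<Rightarrow> (nat \<Rightarrow> nat) \<Rightarrow> (xcoord \<Rightarrow> complex) \<Rightarrow> complex" where
  "Stab q n I x =
     weight_W q n I (\<lambda>k a. x (Root k a)) (\<lambda>i. x (Equi i)) (x Hbar) (\<lambda>i. x (Kahler i))"

definition Stab_dual :: "complex \<Rightarrow> nat \<Rightarrow> (nat \<Rightarrow> nat) \<Rightarrow> (xcoord \<Rightarrow> complex) \<Rightarrow> complex" where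
  "Stab_dual q n J x = (-1) ^ (n * (n - 1) div 2) *
     weight_W_chamber q n (longest_perm n) J
       (\<lambda>k a. x (Root k a)) (\<lambda>i. x (Equi i)) (x Hbar) (\<lambda>i. - x (Kahler i))"

text \<open>The weight functions are given by formulas with denominators, so a stable envelope is
  a section defined a priori only where none of these denominators vanishes.  The locus is the
  same for all \<open>I\<close> and all chambers, and it is open and dense in every component of
  \<open>ext_ell_X q n\<close>; a holomorphic section is therefore determined by its values there.\<close>

definition weight_regular :: "complex \<Rightarrow> nat \<Rightarrow> (xcoord \<Rightarrow> complex) \<Rightarrow> bool" where
  "weight_regular q n x \<longleftrightarrow>
    (\<forall>k\<in>{1..<n}. \<forall>a\<in>{1..k}. \<forall>b\<in>{1..k}. a \<noteq> b \<longrightarrow>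
       theta q (x Hbar + x (Root k a) - x (Root k b)) \<noteq> 0 \<and>
       theta q (x (Root k b) - x (Root k a)) \<noteq> 0)"

definition sections_agree ::
  "complex \<Rightarrow> nat \<Rightarrow> ((xcoord \<Rightarrow> complex) \<Rightarrow> complex) \<Rightarrow> ((xcoord \<Rightarrow> complex) \<Rightarrow> complex) \<Rightarrow> bool"
where
  "sections_agree q n f g \<longleftrightarrow> (\<forall>x\<in>ext_ell_X q n. weight_regular q n x \<longrightarrow> f x = g x)"

section \<open>Elliptic cohomology of \<open>X \<times> X'\<close>\<close>

text \<open>Logarithmic coordinates on \<open>S(X) \<times> S(X') \<times> E\<^bsub>T\<times>T'\<^esub>\<close>: the Chern roots
  \<open>t\<close>, \<open>t'\<close> and the equivariant parameters \<open>z\<close>, \<open>z'\<close>, \<open>\<hbar> = \<hbar>'\<close>.\<close>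

datatype pcoord = RootL nat nat | RootR nat nat | EquiL nat | EquiR nat | HbarP

definition base_coords :: "nat \<Rightarrow> pcoord set" where
  "base_coords n = EquiL ` {1..n} \<union> EquiR ` {1..n} \<union> {HbarP}"

definition pcoords :: "nat \<Rightarrow> pcoord set" where
  "pcoords n = case_prod RootL ` root_indices n \<union> case_prod RootR ` root_indices n \<union> base_coords n"

definition ell_prod :: "complex \<Rightarrow> nat \<Rightarrow> (pcoord \<Rightarrow> complex) set" where
  "ell_prod q n = {x \<in> pcoords n \<rightarrow>\<^sub>E UNIV. \<exists>I J. I permutes {1..n} \<and> J permutes {1..n} \<and>
     lies_over q n I (\<lambda>k a. x (RootL k a)) (\<lambda>i. x (EquiL i)) \<and>
     lies_over q n J (\<lambda>k a. x (RootR k a)) (\<lambda>i. x (EquiR i))}"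

text \<open>The parametrisation of the component \<open>O\<^sub>I\<^sub>,\<^sub>J\<close> by \<open>E\<^bsub>T\<times>T'\<^esub>\<close>.\<close>

definition component ::
  "nat \<Rightarrow> (nat \<Rightarrow> nat) \<Rightarrow> (nat \<Rightarrow> nat) \<Rightarrow> (pcoord \<Rightarrow> complex) \<Rightarrow> pcoord \<Rightarrow> complex"
where
  "component n I J p = restrict (\<lambda>c. case c of
       RootL k l \<Rightarrow> fixed_roots I (\<lambda>i. p (EquiL i)) k l
     | RootR k l \<Rightarrow> fixed_roots J (\<lambda>i. p (EquiR i)) k l
     | _ \<Rightarrow> p c) (pcoords n)"

lemma zero_in_log_lattice: "0 \<in> log_lattice q"
  unfolding log_lattice_def by (auto intro!: exI[of _ 0])

lemma sorted_val_mem: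
  assumes "I permutes {1..n}" "1 \<le> a" "a \<le> k" "k \<le> n"
  shows "sorted_val I k a \<in> {1..n}"
proof -
  have inj: "inj_on I {1..k}"
    using assms(1) permutes_inj_on by blast
  have "sorted_val I k a \<in> set (sorted_list_of_set (I ` {1..k}))"
    unfolding sorted_val_def by (rule nth_mem) (use assms inj in \<open>auto simp: card_image\<close>)
  then have "sorted_val I k a \<in> I ` {1..k}" by simp
  also have "\<dots> \<subseteq> I ` {1..n}" using assms by (intro image_mono) auto
  also have "\<dots> = {1..n}" using assms(1) by (rule permutes_image)
  finally show ?thesis .
qed

lemma lies_over_fixed:
  assumes "\<And>k a. 1 \<le> a \<Longrightarrow> a \<le> k \<Longrightarrow> k < n \<Longrightarrow> t k a = fixed_roots K z k a"
  shows "lies_over q n K t z"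
  unfolding lies_over_def
proof (intro ballI exI conjI)
  fix k l assume "k \<in> {1..<n}" "l \<in> {1..k}"
  then show "t k (id l) - fixed_roots K z k l \<in> log_lattice q"
    using assms[of l k] zero_in_log_lattice by auto
qed (rule permutes_id)

lemma component_in_ell_prod:
  assumes "I permutes {1..n}" "J permutes {1..n}"
  shows "component n I J p \<in> ell_prod q n"
proof -
  have "lies_over q n I (\<lambda>k a. component n I J p (RootL k a)) (\<lambda>i. component n I J p (EquiL i))"
    using sorted_val_mem[OF assms(1)]
    by (intro lies_over_fixed)
       (auto simp: component_def pcoords_def base_coords_def root_indices_def fixed_roots_def)
  moreover have "lies_over q n J (\<lambda>k a. component n I J p (RootR k a)) (\<lambda>i. component n I J p (EquiR i))"
    using sorted_val_mem[OF assms(2)]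
    by (intro lies_over_fixed)
       (auto simp: component_def pcoords_def base_coords_def root_indices_def fixed_roots_def)
  ultimately show ?thesis
    unfolding ell_prod_def using assms by (auto simp: component_def)
qed

text \<open>Deck transformations: translations of all coordinates by the lattice, and permutations of
  the Chern roots on each level.  The quotient of \<open>\<complex>\<^sup>N\<close> by this group is
  \<open>S(X) \<times> S(X') \<times> E\<^bsub>T\<times>T'\<^esub>\<close>, and the quotient of \<open>ell_prod q n\<close> is
  the elliptic cohomology scheme of \<open>X \<times> X'\<close>.\<close>

definition deck :: "complex \<Rightarrow> nat \<Rightarrow> ((pcoord \<Rightarrow> complex) \<Rightarrow> pcoord \<Rightarrow> complex) set" where
  "deck q n = {\<gamma>. \<exists>\<pi> \<pi>' v.
     (\<forall>k\<in>{1..<n}. \<pi> k permutes {1..k} \<and> \<pi>' k permutes {1..k}) \<and>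
     (\<forall>c\<in>pcoords n. v c \<in> log_lattice q) \<and>
     \<gamma> = (\<lambda>x. restrict (\<lambda>c. (case c of
            RootL k a \<Rightarrow> x (RootL k (\<pi> k a))
          | RootR k a \<Rightarrow> x (RootR k (\<pi>' k a))
          | _ \<Rightarrow> x c) + v c) (pcoords n))}"

definition same_point ::
  "complex \<Rightarrow> nat \<Rightarrow> (pcoord \<Rightarrow> complex) \<Rightarrow> (pcoord \<Rightarrow> complex) \<Rightarrow> bool"
where
  "same_point q n x y \<longleftrightarrow> x \<in> ell_prod q n \<and> (\<exists>\<gamma>\<in>deck q n. y = \<gamma> x)"

text \<open>A line bundle on the quotient, given by a factor of automorphy: \<open>e x y\<close> is the
  multiplier identifying the fibres of the trivial bundle over two points \<open>x\<close>, \<open>y\<close> with the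
  same image.  As it depends on \<open>x\<close> and \<open>y\<close> only, and not on the deck transformation
  relating them, stabilisers act trivially on the fibres and the bundle descends to the
  quotient.\<close>

definition line_bundle ::
  "complex \<Rightarrow> nat \<Rightarrow> ((pcoord \<Rightarrow> complex) \<Rightarrow> (pcoord \<Rightarrow> complex) \<Rightarrow> complex) \<Rightarrow> bool"
where
  "line_bundle q n e \<longleftrightarrow>
    (\<forall>x y. same_point q n x y \<longrightarrow> e x y \<noteq> 0) \<and>
    (\<forall>x y w. same_point q n x y \<longrightarrow> same_point q n y w \<longrightarrow> e x w = e x y * e y w) \<and>
    (\<forall>\<gamma>\<in>deck q n. holomorphic_along (pcoords n) (ell_prod q n) (\<lambda>x. e x (\<gamma> x)))"

definition is_section ::
  "complex \<Rightarrow> nat \<Rightarrow> ((pcoord \<Rightarrow> complex) \<Rightarrow> (pcoord \<Rightarrow> complex) \<Rightarrow> complex)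
    \<Rightarrow> ((pcoord \<Rightarrow> complex) \<Rightarrow> complex) \<Rightarrow> bool"
where
  "is_section q n e f \<longleftrightarrow> (\<forall>x y. same_point q n x y \<longrightarrow> f y = e x y * f x)"

text \<open>A section is called holomorphic when its restriction to every component is.\<close>

definition holomorphic_section :: "nat \<Rightarrow> ((pcoord \<Rightarrow> complex) \<Rightarrow> complex) \<Rightarrow> bool" where
  "holomorphic_section n f \<longleftrightarrow>
    (\<forall>I J. I permutes {1..n} \<longrightarrow> J permutes {1..n} \<longrightarrow>
       holomorphic_along (base_coords n) (base_coords n \<rightarrow>\<^sub>E UNIV) (\<lambda>p. f (component n I J p)))"

section \<open>The embeddings induced by \<open>X \<times> {J}\<close> and \<open>{I} \<times> X'\<close>\<close>

text \<open>Both maps incorporate the identification \<open>\<mu>' = z\<close>, \<open>z' = \<mu>\<close>, \<open>\<hbar>' = \<hbar>\<close>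
  of the parameters: the argument of \<open>embed_X\<close> is \<open>(t, z, \<hbar>, \<mu>)\<close>, that of \<open>embed_X_dual\<close>
  is \<open>(t', z', \<hbar>', \<mu>')\<close>.\<close>

definition embed_X :: "nat \<Rightarrow> (nat \<Rightarrow> nat) \<Rightarrow> (xcoord \<Rightarrow> complex) \<Rightarrow> pcoord \<Rightarrow> complex" where
  "embed_X n J x = restrict (\<lambda>c. case c of
       RootL k a \<Rightarrow> x (Root k a)
     | RootR k a \<Rightarrow> fixed_roots J (\<lambda>i. x (Kahler i)) k a
     | EquiL i \<Rightarrow> x (Equi i)
     | EquiR i \<Rightarrow> x (Kahler i)
     | HbarP \<Rightarrow> x Hbar) (pcoords n)"

definition embed_X_dual :: "nat \<Rightarrow> (nat \<Rightarrow> nat) \<Rightarrow> (xcoord \<Rightarrow> complex) \<Rightarrow> pcoord \<Rightarrow> complex" where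
  "embed_X_dual n I x = restrict (\<lambda>c. case c of
       RootL k a \<Rightarrow> fixed_roots I (\<lambda>i. x (Kahler i)) k a
     | RootR k a \<Rightarrow> x (Root k a)
     | EquiL i \<Rightarrow> x (Kahler i)
     | EquiR i \<Rightarrow> x (Equi i)
     | HbarP \<Rightarrow> x Hbar) (pcoords n)"

lemma lies_over_cong:
  assumes "\<And>k a. 1 \<le> a \<Longrightarrow> a \<le> k \<Longrightarrow> k < n \<Longrightarrow> t k a = t' k a" "\<And>i. i \<in> {1..n} \<Longrightarrow> z i = z' i"
    and "K permutes {1..n}" "lies_over q n K t z"
  shows "lies_over q n K t' z'"
  unfolding lies_over_def
proof
  fix k assume k: "k \<in> {1..<n}"
  with assms(4) obtain \<pi> where \<pi>: "\<pi> permutes {1..k}"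
    "\<And>l. l \<in> {1..k} \<Longrightarrow> t k (\<pi> l) - fixed_roots K z k l \<in> log_lattice q"
    unfolding lies_over_def by blast
  have "t' k (\<pi> l) - fixed_roots K z' k l \<in> log_lattice q" if l: "l \<in> {1..k}" for l
  proof -
    have "\<pi> l \<in> {1..k}" using permutes_in_image[OF \<pi>(1)] l by blast
    then have "t k (\<pi> l) = t' k (\<pi> l)" using assms(1) k by auto
    moreover have "fixed_roots K z k l = fixed_roots K z' k l"
      using assms(2) sorted_val_mem[OF assms(3), of l k] k l by (auto simp: fixed_roots_def)
    ultimately show ?thesis using \<pi>(2)[OF l] by simp
  qed
  with \<pi>(1) show "\<exists>\<pi>. \<pi> permutes {1..k} \<and>
      (\<forall>l\<in>{1..k}. t' k (\<pi> l) - fixed_roots K z' k l \<in> log_lattice q)" by blast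
qed

lemma embed_X_in_ell_prod:
  assumes "J permutes {1..n}" "x \<in> ext_ell_X q n"
  shows "embed_X n J x \<in> ell_prod q n"
proof -
  obtain K where K: "K permutes {1..n}"
    "lies_over q n K (\<lambda>k a. x (Root k a)) (\<lambda>i. x (Equi i))"
    using assms(2) unfolding ext_ell_X_def by blast
  have "lies_over q n K (\<lambda>k a. embed_X n J x (RootL k a)) (\<lambda>i. embed_X n J x (EquiL i))"
    by (rule lies_over_cong[OF _ _ K])
       (auto simp: embed_X_def pcoords_def base_coords_def root_indices_def)
  moreover have "lies_over q n J (\<lambda>k a. embed_X n J x (RootR k a)) (\<lambda>i. embed_X n J x (EquiR i))"
    using sorted_val_mem[OF assms(1)]
    by (intro lies_over_fixed)
       (auto simp: embed_X_def pcoords_def base_coords_def root_indices_def fixed_roots_def)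
  ultimately show ?thesis
    unfolding ell_prod_def using assms(1) K(1) by (auto simp: embed_X_def)
qed

lemma embed_X_dual_in_ell_prod:
  assumes "I permutes {1..n}" "x \<in> ext_ell_X q n"
  shows "embed_X_dual n I x \<in> ell_prod q n"
proof -
  obtain K where K: "K permutes {1..n}"
    "lies_over q n K (\<lambda>k a. x (Root k a)) (\<lambda>i. x (Equi i))"
    using assms(2) unfolding ext_ell_X_def by blast
  have "lies_over q n K (\<lambda>k a. embed_X_dual n I x (RootR k a)) (\<lambda>i. embed_X_dual n I x (EquiR i))"
    by (rule lies_over_cong[OF _ _ K])
       (auto simp: embed_X_dual_def pcoords_def base_coords_def root_indices_def)
  moreover have "lies_over q n I (\<lambda>k a. embed_X_dual n I x (RootL k a)) (\<lambda>i. embed_X_dual n I x (EquiL i))"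
    using sorted_val_mem[OF assms(1)]
    by (intro lies_over_fixed)
       (auto simp: embed_X_dual_def pcoords_def base_coords_def root_indices_def fixed_roots_def)
  ultimately show ?thesis
    unfolding ell_prod_def using assms(1) K(1) by (auto simp: embed_X_dual_def)
qed

end

theory Submission
  imports Defs "HOL-Complex_Analysis.Complex_Analysis"
begin

text \<open>On the component \<open>O\<^sub>K\<^sub>,\<^sub>L\<close> the interface has to be the value of the weight function of
  \<open>L\<inverse>\<close> at \<open>t = z\<^sub>K\<close>, and also the value of the dual weight function of \<open>K\<inverse>\<close> at \<open>t' = z'\<^sub>L\<close>.
  These two meromorphic functions coincide: by Fay's three-term identity the weight functions
  satisfy exchange relations for adjacent transpositions, in the Kaehler and in the
  equivariant parameters, the duality swaps the two sets of relations, and the initial values are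
  products by a dominance argument.  As one expression has poles only along divisors in
  \<open>(z, \<hbar>)\<close> and the other only along divisors in \<open>(z', \<hbar>)\<close>, the common value is entire.

  The values agree where components meet, because an exchange coefficient vanishes when two
  parameters coincide.  Finally the quadratic form that governs the quasi-periods of a weight function
  involves the Chern roots only through their sums on each level, and all fixed points lead to one
  and the same form; it defines the line bundle.\<close>

section \<open>The theta function\<close>

text \<open>The duality rests on a recursion. The exchange relation expresses the values for
  \<open>s \<circ> I\<close> by values for \<open>I\<close>, at the same and at a neighbouring fixed
  point, so the case \<open>I = id\<close> determines all of them. The dual weight function has the
  fixed point of \<open>X\<close> as its index and \<open>I\<close> as its point of evaluation. It
  therefore needs a relation of another kind, one that moves the point; after the swap of parameters
  it has the same coefficients.

  The obstacle in passing from values to a section is that components meet modulo the lattice: a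
  point may lie over several pairs \<open>(K, L)\<close> although the logarithms of its parameters
  are all different. The section is therefore evaluated at chosen lattice representatives of the
  parameters, where congruent ones are equal, and carried back by the multiplier of the bundle. For
  this the multiplier must be a function of two points and a cocycle. The quadratic form is an
  integral combination of squares and doubled products, so the cocycle identity can be checked on a
  single square.\<close>

locale nome =
  fixes q :: complex
  assumes q_nz: "q \<noteq> 0" and q_lt: "norm q < 1"
begin

lemma phi_convergent: "convergent_prod (\<lambda>s. 1 - q ^ s * x)"
proof -
  have "summable (\<lambda>s. norm q ^ s * norm x)"
    using q_lt by (intro summable_mult2 summable_geometric) auto
  then have "abs_convergent_prod (\<lambda>s. 1 - q ^ s * x)"
    by (intro summable_imp_abs_convergent_prod) (simp add: norm_mult norm_power)
  then show ?thesis by (rule abs_convergent_prod_imp_convergent_prod)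
qed

lemma phi_LIMSEQ: "(\<lambda>n. \<Prod>s<n. 1 - q ^ s * x) \<longlonglongrightarrow> phi q x"
  using convergent_prod_LIMSEQ[OF phi_convergent[of x]] unfolding phi_def
  by (subst (asm) LIMSEQ_lessThan_iff_atMost[symmetric]) auto

lemma phi_shift: "phi q x = (1 - x) * phi q (q * x)"
proof (rule LIMSEQ_unique)
  show "(\<lambda>n. \<Prod>s<Suc n. 1 - q ^ s * x) \<longlonglongrightarrow> phi q x"
    using phi_LIMSEQ[of x] by (rule LIMSEQ_Suc)
  have "(\<Prod>s<Suc n. 1 - q ^ s * x) = (1 - x) * (\<Prod>s<n. 1 - q ^ s * (q * x))" for n
    by (subst prod.lessThan_Suc_shift) (simp add: mult_ac)
  then show "(\<lambda>n. \<Prod>s<Suc n. 1 - q ^ s * x) \<longlonglongrightarrow> (1 - x) * phi q (q * x)"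
    using tendsto_mult[OF tendsto_const phi_LIMSEQ[of "q * x"]] by simp
qed

text \<open>A convergent product can vanish only through one of its factors; conversely, splitting
  off finitely many factors exposes the vanishing one.\<close>

lemma phi_eq_0_iff: "phi q x = 0 \<longleftrightarrow> (\<exists>s. q ^ s * x = 1)"
proof
  assume "phi q x = 0"
  then show "\<exists>s. q ^ s * x = 1"
    using prodinf_nonzero[OF phi_convergent[of x]] unfolding phi_def by force
next
  have split: "phi q x = (\<Prod>s<n. 1 - q ^ s * x) * phi q (q ^ n * x)" for n
  proof (induction n)
    case (Suc n)
    have "phi q (q ^ n * x) = (1 - q ^ n * x) * phi q (q ^ Suc n * x)"
      using phi_shift[of "q ^ n * x"] by (simp add: mult_ac)
    with Suc show ?case by simp
  qed simp
  assume "\<exists>s. q ^ s * x = 1"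
  then obtain s where "q ^ s * x = 1" by blast
  then show "phi q x = 0" using split[of "Suc s"] by simp
qed

lemma phi_holomorphic: "phi q holomorphic_on UNIV"
proof (rule holomorphic_uniform_sequence)
  show "(\<lambda>x. \<Prod>s<n. 1 - q ^ s * x) holomorphic_on UNIV" for n
    by (intro holomorphic_intros)
  fix z :: complex assume "z \<in> UNIV"
  have "uniform_limit (cball z 1) (\<lambda>n x. \<Prod>s<n. 1 - q ^ s * x) (phi q) sequentially"
  proof -
    have "uniformly_convergent_on (cball z 1) (\<lambda>N x. \<Prod>s<N. 1 + - (q ^ s * x))"
    proof (rule uniformly_convergent_on_prod)
      show "continuous_on (cball z 1) (\<lambda>x. - (q ^ n * x))" for n
        by (intro continuous_intros)
      have "norm (norm (- (q ^ n * x))) \<le> norm q ^ n * (norm z + 1)" if "x \<in> cball z 1" for n x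
      proof -
        have "norm x \<le> norm z + 1"
          using that norm_triangle_ineq2[of x z] by (simp add: dist_norm norm_minus_commute)
        then show ?thesis by (simp add: norm_mult norm_power mult_left_mono)
      qed
      moreover have "summable (\<lambda>n. norm q ^ n * (norm z + 1))"
        using q_lt by (intro summable_mult2 summable_geometric) auto
      ultimately show "uniformly_convergent_on (cball z 1) (\<lambda>N x. \<Sum>n<N. norm (- (q ^ n * x)))"
        by (intro Weierstrass_m_test') auto
    qed auto
    then have *: "uniformly_convergent_on (cball z 1) (\<lambda>N x. \<Prod>s<N. 1 - q ^ s * x)" by simp
    then obtain l where l: "uniform_limit (cball z 1) (\<lambda>N x. \<Prod>s<N. 1 - q ^ s * x) l sequentially"
      unfolding uniformly_convergent_on_def by blast
    have "l x = phi q x" if "x \<in> cball z 1" for x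
      using tendsto_uniform_limitI[OF l that] phi_LIMSEQ[of x] LIMSEQ_unique by blast
    with l show ?thesis
      by (subst (asm) uniform_limit_cong'[of _ _ _ l "phi q"]) auto
  qed
  then show "\<exists>d>0. cball z d \<subseteq> UNIV \<and>
      uniform_limit (cball z d) (\<lambda>n x. \<Prod>s<n. 1 - q ^ s * x) (phi q) sequentially"
    by (intro exI[of _ 1]) auto
qed auto

abbreviation "th \<equiv> theta q"

text \<open>The lattice is generated by \<open>\<tau>\<close> and \<open>2 * pi * \<i>\<close>, see
  \<open>log_lattice_iff\<close>. The two are independent over the reals because
  \<open>Re \<tau> < 0\<close>.\<close>

definition \<tau> :: complex where "\<tau> = Ln q"

lemma exp_tau: "exp \<tau> = q"
  using q_nz by (simp add: \<tau>_def)

lemma Re_tau: "Re \<tau> < 0"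
  using q_nz q_lt by (simp add: \<tau>_def)

lemma th_holomorphic: "th holomorphic_on UNIV"
proof -
  have *: "(\<lambda>u. phi q (f u)) holomorphic_on UNIV" if "f holomorphic_on UNIV" for f
    using holomorphic_on_compose[OF that, of "phi q"] phi_holomorphic
      holomorphic_on_subset[of "phi q" UNIV] by (auto simp: o_def)
  show ?thesis unfolding theta_def[abs_def] by (intro holomorphic_intros *) auto
qed

lemma th_holo [holomorphic_intros]: "f holomorphic_on A \<Longrightarrow> (\<lambda>u. th (f u)) holomorphic_on A"
  using holomorphic_on_compose[of f A th] th_holomorphic holomorphic_on_subset
  by (auto simp: o_def)

lemma th_continuous [continuous_intros]:
  "continuous_on A f \<Longrightarrow> continuous_on A (\<lambda>u. th (f u))"
  by (rule continuous_on_compose2[OF holomorphic_on_imp_continuous_on[OF th_holomorphic]]) auto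

lemma th_minus: "th (- u) = - th u"
  by (simp add: theta_def exp_minus field_simps)

lemma th_0 [simp]: "th 0 = 0"
  by (simp add: theta_def)

lemma th_diff_commute: "th (u - v) = - th (v - u)"
  using th_minus[of "v - u"] by simp

text \<open>The three factors of \<open>theta\<close> account for the exponents m = 0, m < 0 and m >
  0 in \<open>exp u = q powi m\<close>.\<close>

lemma th_eq_0_iff: "th u = 0 \<longleftrightarrow> u \<in> log_lattice q"
proof -
  have a: "exp (u / 2) - exp (- u / 2) = 0 \<longleftrightarrow> exp u = 1"
  proof -
    have "exp (u / 2) - exp (- u / 2) = exp (- u / 2) * (exp u - 1)"
      by (simp add: algebra_simps flip: exp_add)
    then show ?thesis by simp
  qed
  have b: "phi q (q * exp u) = 0 \<longleftrightarrow> (\<exists>s. exp u = q powi (- int (Suc s)))"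
    unfolding phi_eq_0_iff using q_nz
    by (simp add: power_int_minus field_simps power_int_def nat_add_distrib)
  have c: "phi q (q / exp u) = 0 \<longleftrightarrow> (\<exists>s. exp u = q powi (int (Suc s)))"
    unfolding phi_eq_0_iff using q_nz
    by (auto simp: field_simps power_int_def nat_add_distrib) (metis mult.commute)
  have "th u = 0 \<longleftrightarrow> exp u = 1 \<or> (\<exists>s. exp u = q powi (- int (Suc s))) \<or> (\<exists>s. exp u = q powi (int (Suc s)))"
    unfolding theta_def mult_eq_0_iff a b c by blast
  also have "\<dots> \<longleftrightarrow> (\<exists>m::int. exp u = q powi m)"
  proof
    assume "\<exists>m::int. exp u = q powi m"
    then obtain m where m: "exp u = q powi m" by blast
    consider "m = 0" | s where "m = int (Suc s)" | s where "m = - int (Suc s)"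
      by (metis int_cases3 not0_implies_Suc of_nat_0_less_iff less_numeral_extra(3))
    then show "exp u = 1 \<or> (\<exists>s. exp u = q powi (- int (Suc s))) \<or> (\<exists>s. exp u = q powi (int (Suc s)))"
      using m by cases (auto simp del: of_nat_Suc)
  next
    assume "exp u = 1 \<or> (\<exists>s. exp u = q powi (- int (Suc s))) \<or> (\<exists>s. exp u = q powi (int (Suc s)))"
    then show "\<exists>m::int. exp u = q powi m"
      by (auto intro: exI[of _ 0])
  qed
  finally show ?thesis by (simp add: log_lattice_def)
qed

lemma exp_int_mult: "exp (of_int m * \<tau>) = q powi m"
  using exp_power_int[of \<tau> m] by (simp add: exp_tau)

lemma log_lattice_iff: "w \<in> log_lattice q \<longleftrightarrow> (\<exists>m b. w = of_int m * \<tau> + 2 * pi * \<i> * of_int b)"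
proof
  assume "w \<in> log_lattice q"
  then obtain m where "exp w = exp (of_int m * \<tau>)"
    unfolding log_lattice_def exp_int_mult by blast
  then show "\<exists>m b. w = of_int m * \<tau> + 2 * pi * \<i> * of_int b"
    unfolding exp_eq by (auto simp: algebra_simps)
next
  assume "\<exists>m b. w = of_int m * \<tau> + 2 * pi * \<i> * of_int b"
  then obtain m b where "w = of_int m * \<tau> + 2 * pi * \<i> * of_int b" by blast
  then have "exp w = exp (of_int m * \<tau>)"
    unfolding exp_eq by (auto simp: algebra_simps)
  then show "w \<in> log_lattice q" unfolding log_lattice_def exp_int_mult by blast
qed

text \<open>The first product loses the factor \<open>1 - q * exp u\<close>, which the prefactor
  returns; the second gains \<open>1 - exp (- u)\<close>, which becomes the new prefactor.\<close>

lemma th_tau: "th (u + \<tau>) = - exp (- u - \<tau> / 2) * th u"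
proof -
  have e: "exp (u + \<tau>) = q * exp u" by (simp add: exp_add exp_tau)
  have 1: "q / exp (u + \<tau>) = exp (- u)"
    using q_nz by (simp add: e exp_minus field_simps)
  have 2: "phi q (exp (- u)) = (1 - exp (- u)) * phi q (q / exp u)"
    using phi_shift[of "exp (- u)"] by (simp add: exp_minus field_simps)
  have 3: "exp ((u + \<tau>) / 2) - exp (- (u + \<tau>) / 2) = - exp (- (u + \<tau>) / 2) * (1 - q * exp u)"
    by (simp add: algebra_simps flip: e exp_add) (simp add: field_simps)
  have 4: "exp (u / 2) - exp (- u / 2) = exp (u / 2) * (1 - exp (- u))"
    by (simp add: algebra_simps flip: exp_add)
  have 5: "exp (- (u + \<tau>) / 2) = exp (- u - \<tau> / 2) * exp (u / 2)"
    by (simp add: field_simps flip: exp_add)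
  have "th (u + \<tau>) = - exp (- (u + \<tau>) / 2) * ((1 - q * exp u) * phi q (q * (q * exp u)))
      * phi q (exp (- u))"
    unfolding theta_def 1 3 unfolding e by (simp add: mult_ac)
  also have "(1 - q * exp u) * phi q (q * (q * exp u)) = phi q (q * exp u)"
    using phi_shift[of "q * exp u"] by simp
  finally show ?thesis unfolding 2 5 theta_def 4 by (simp add: mult_ac)
qed

lemma th_2pi: "th (u + 2 * pi * \<i>) = - th u"
proof -
  have "exp ((u + 2 * pi * \<i>) / 2) = - exp (u / 2)"
    by (simp add: add_divide_distrib exp_add)
  moreover have "exp (- (u + 2 * pi * \<i>) / 2) = - exp (- u / 2)"
    by (simp add: diff_divide_distrib exp_diff)
  moreover have "exp (u + 2 * pi * \<i>) = exp u" by (simp add: exp_add)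
  ultimately show ?thesis unfolding theta_def by (simp add: algebra_simps)
qed

lemma exp_pi_int: "exp (\<i> * pi * of_int b) = (if even b then 1 else -1)"
proof (cases "even b")
  case True
  then obtain c where "b = 2 * c" by blast
  then show ?thesis using exp_integer_2pi[of "of_int c"] by (simp add: mult_ac)
next
  case False
  then obtain c where "b = 2 * c + 1" by (elim oddE)
  then show ?thesis using exp_integer_2pi[of "of_int c"]
    by (simp add: ring_distribs exp_add mult_ac)
qed

text \<open>The sign (-1)^(m + b) is written as an exponential, so that multipliers of products of
  theta functions are compared by adding exponents.\<close>

lemma th_quasi:
  "th (u + of_int m * \<tau> + 2 * pi * \<i> * of_int b) =
     exp (\<i> * pi * (of_int m + of_int b) - of_int m * u - (of_int m)\<^sup>2 * \<tau> / 2) * th u"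
proof -
  have 1: "th (u + 2 * pi * \<i> * of_int b) = exp (\<i> * pi * of_int b) * th u" for u b
  proof (induction b rule: int_induct[where k = 0])
    case (step1 i)
    have "th (u + 2 * pi * \<i> * of_int (i + 1)) = - th (u + 2 * pi * \<i> * of_int i)"
      using th_2pi[of "u + 2 * pi * \<i> * of_int i"] by (simp add: algebra_simps)
    with step1 show ?case unfolding exp_pi_int by simp
  next
    case (step2 i)
    have "th (u + 2 * pi * \<i> * of_int (i - 1)) = - th (u + 2 * pi * \<i> * of_int i)"
      using th_2pi[of "u + 2 * pi * \<i> * of_int (i - 1)"] by (simp add: algebra_simps)
    with step2 show ?case unfolding exp_pi_int by simp
  qed simp
  have 2: "th (u + of_int m * \<tau>) =
      exp (\<i> * pi * of_int m - of_int m * u - (of_int m)\<^sup>2 * \<tau> / 2) * th u" for u m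
  proof (induction m rule: int_induct[where k = 0])
    case (step1 m)
    have "th (u + of_int (m + 1) * \<tau>) = - exp (- (u + of_int m * \<tau>) - \<tau> / 2) * th (u + of_int m * \<tau>)"
      using th_tau[of "u + of_int m * \<tau>"] by (simp add: algebra_simps)
    also have "\<dots> = exp (\<i> * pi) * exp (- (u + of_int m * \<tau>) - \<tau> / 2)
        * (exp (\<i> * pi * of_int m - of_int m * u - (of_int m)\<^sup>2 * \<tau> / 2) * th u)"
      unfolding step1 by (simp add: mult.commute)
    also have "\<dots> = exp (\<i> * pi * of_int (m + 1) - of_int (m + 1) * u - (of_int (m + 1))\<^sup>2 * \<tau> / 2) * th u"
      unfolding mult.assoc[symmetric] exp_add[symmetric]
      by (intro arg_cong2[where f = "(*)"] arg_cong[where f = exp] refl)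
         (simp add: algebra_simps power2_eq_square add_divide_distrib)
    finally show ?case .
  next
    case (step2 m)
    have "th (u + of_int m * \<tau>) = - exp (- (u + of_int (m - 1) * \<tau>) - \<tau> / 2) * th (u + of_int (m - 1) * \<tau>)"
      using th_tau[of "u + of_int (m - 1) * \<tau>"] by (simp add: algebra_simps)
    then have "th (u + of_int (m - 1) * \<tau>) = - exp (u + of_int (m - 1) * \<tau> + \<tau> / 2) * th (u + of_int m * \<tau>)"
      by (simp add: mult.assoc[symmetric] flip: exp_add)
    also have "\<dots> = exp (- (\<i> * pi)) * exp (u + of_int (m - 1) * \<tau> + \<tau> / 2)
        * (exp (\<i> * pi * of_int m - of_int m * u - (of_int m)\<^sup>2 * \<tau> / 2) * th u)"
      unfolding step2 exp_minus by (simp add: mult.commute)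
    also have "\<dots> = exp (\<i> * pi * of_int (m - 1) - of_int (m - 1) * u - (of_int (m - 1))\<^sup>2 * \<tau> / 2) * th u"
      unfolding mult.assoc[symmetric] exp_add[symmetric]
      by (intro arg_cong2[where f = "(*)"] arg_cong[where f = exp] refl)
         (simp add: field_simps power2_eq_square)
    finally show ?case .
  qed simp
  show ?thesis unfolding 1 2 mult.assoc[symmetric] exp_add[symmetric]
    by (simp add: algebra_simps)
qed

text \<open>The exponential prefactor has slope 1 at the origin, so the derivative is the value
  \<open>phi q q * phi q q\<close> of the remaining factor. It is nonzero because no positive power
  of \<open>q\<close> equals 1.\<close>

lemma th_deriv_0: "deriv th 0 \<noteq> 0"
proof -
  define p where "p u = phi q (q * exp u) * phi q (q / exp u)" for u
  have *: "(\<lambda>u. phi q (f u)) holomorphic_on UNIV" if "f holomorphic_on UNIV" for f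
    using holomorphic_on_compose[OF that, of "phi q"] phi_holomorphic
      holomorphic_on_subset[of "phi q" UNIV] by (auto simp: o_def)
  have "p holomorphic_on UNIV" unfolding p_def[abs_def] by (intro holomorphic_intros *) (auto simp: q_nz)
  then have p: "(p has_field_derivative deriv p 0) (at 0)"
    using holomorphic_derivI by blast
  have "((\<lambda>u. (exp (u / 2) - exp (- u / 2)) * p u) has_field_derivative p 0) (at 0)"
    by (rule derivative_eq_intros p refl | simp)+
  moreover have "(\<lambda>u. (exp (u / 2) - exp (- u / 2)) * p u) = th"
    by (auto simp: theta_def p_def mult_ac)
  ultimately have "deriv th 0 = p 0" by (simp add: DERIV_imp_deriv)
  moreover have "phi q q \<noteq> 0"
  proof
    assume "phi q q = 0"
    then obtain s where "q ^ Suc s = 1" unfolding phi_eq_0_iff by (auto simp: mult.commute)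
    then have "norm q ^ Suc s = 1" by (metis norm_one norm_power)
    moreover have "norm q ^ Suc s < 1" using q_lt q_nz by (intro power_Suc_less_one) auto
    ultimately show False by simp
  qed
  ultimately show ?thesis by (simp add: p_def)
qed

text \<open>The nowhere vanishing multiplier of \<open>th_quasi\<close> carries the simple zero at
  the origin to every lattice point. Division by theta factors rests on this.\<close>

lemma th_deriv_nz: "w \<in> log_lattice q \<Longrightarrow> deriv th w \<noteq> 0"
proof -
  assume "w \<in> log_lattice q"
  then obtain m b where w: "w = of_int m * \<tau> + 2 * pi * \<i> * of_int b" unfolding log_lattice_iff by blast
  define c where "c u = exp (\<i> * pi * (of_int m + of_int b) - of_int m * u - (of_int m)\<^sup>2 * \<tau> / 2)" for u
  have "(th has_field_derivative deriv th 0) (at 0)"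
    using th_holomorphic holomorphic_derivI by blast
  moreover have "\<exists>d. (c has_field_derivative d) (at 0)"
    unfolding c_def[abs_def] by (rule exI) (rule derivative_eq_intros refl | simp)+
  ultimately obtain d where "(c has_field_derivative d) (at 0)"
    "((\<lambda>u. c u * th u) has_field_derivative c 0 * deriv th 0) (at 0)"
    using DERIV_mult'[of c _ 0 UNIV th "deriv th 0"] by force
  moreover have "c u * th u = th (u + w)" for u
    unfolding c_def w add.assoc[symmetric] th_quasi ..
  ultimately have "((\<lambda>u. th (u + w)) has_field_derivative c 0 * deriv th 0) (at 0)" by simp
  moreover have "(th has_field_derivative deriv th w) (at w)"
    using th_holomorphic holomorphic_derivI by blast
  then have "((\<lambda>u. th (u + w)) has_field_derivative deriv th w) (at 0)"
    using DERIV_shift[of th "deriv th w" 0 w] by simp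
  ultimately have "deriv th w = c 0 * deriv th 0" using DERIV_unique by blast
  then show ?thesis using th_deriv_0 by (simp add: c_def)
qed

end

text \<open>Used to cancel a theta factor from an identity between entire functions: a single point
  where the factor is nonzero suffices.\<close>

lemma entire_mult_eq_0:
  fixes f g :: "complex \<Rightarrow> complex"
  assumes "f holomorphic_on UNIV" "g holomorphic_on UNIV" "\<And>x. f x * g x = 0" "g a \<noteq> 0"
  shows "f x = 0"
proof -
  have "isCont g a"
    using assms(2) holomorphic_on_imp_continuous_on continuous_on_eq_continuous_at open_UNIV by blast
  then obtain e where "e > 0" "\<And>x. dist x a < e \<Longrightarrow> g x \<noteq> 0"
    using continuous_at_avoid[of a g 0] assms(4) by (auto simp: dist_commute)
  then have "f y = 0" if "y \<in> ball a e" for y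
    using assms(3)[of y] that by (auto simp: dist_commute)
  then show ?thesis
    using analytic_continuation_open[of "ball a e" UNIV f "\<lambda>_. 0" x] \<open>e > 0\<close> assms(1)
    by (auto intro: holomorphic_intros)
qed

text \<open>At a zero \<open>a\<close> of \<open>g\<close> both functions are divided by
  \<open>x - a\<close>. The new denominator is nonzero at \<open>a\<close> since the zero is simple,
  and the value there is the one of l'Hopital's rule.\<close>

lemma quotient_simple_zeros_holomorphic:
  fixes f g :: "complex \<Rightarrow> complex"
  assumes f: "f holomorphic_on UNIV" and g: "g holomorphic_on UNIV"
    and zero: "\<And>x. g x = 0 \<Longrightarrow> f x = 0 \<and> deriv g x \<noteq> 0"
  shows "(\<lambda>x. if g x = 0 then deriv f x / deriv g x else f x / g x) holomorphic_on UNIV"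
    (is "?h holomorphic_on UNIV")
proof -
  have "?h field_differentiable at a" for a
  proof (cases "g a = 0")
    case False
    have "isCont g a"
      using g holomorphic_on_imp_continuous_on continuous_on_eq_continuous_at open_UNIV by blast
    then obtain e where e: "e > 0" "\<And>x. dist x a < e \<Longrightarrow> g x \<noteq> 0"
      using continuous_at_avoid[of a g 0] False by (auto simp: dist_commute)
    have "(\<lambda>x. f x / g x) holomorphic_on ball a e"
      using e(2) by (intro holomorphic_intros holomorphic_on_subset[OF f] holomorphic_on_subset[OF g])
        (auto simp: dist_commute)
    also have "?this \<longleftrightarrow> ?h holomorphic_on ball a e"
      using e(2) by (intro holomorphic_cong) (auto simp: dist_commute)
    finally show ?thesis using e(1) by (simp add: holomorphic_on_imp_differentiable_at)
  next
    case True
    define F where "F x = (if x = a then deriv f a else (f x - f a) / (x - a))" for x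
    define G where "G x = (if x = a then deriv g a else (g x - g a) / (x - a))" for x
    have F: "F holomorphic_on UNIV" and G: "G holomorphic_on UNIV"
      unfolding F_def G_def using f g by (auto intro!: pole_lemma)
    have "isCont G a"
      using G holomorphic_on_imp_continuous_on continuous_on_eq_continuous_at open_UNIV by blast
    moreover have "G a \<noteq> 0" using zero[OF True] by (simp add: G_def)
    ultimately obtain e where e: "e > 0" "\<And>x. dist x a < e \<Longrightarrow> G x \<noteq> 0"
      using continuous_at_avoid[of a G 0] by (auto simp: dist_commute)
    have "(\<lambda>x. F x / G x) holomorphic_on ball a e"
      using e(2) by (intro holomorphic_intros holomorphic_on_subset[OF F] holomorphic_on_subset[OF G])
        (auto simp: dist_commute)
    also have "?this \<longleftrightarrow> ?h holomorphic_on ball a e"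
    proof (rule holomorphic_cong)
      fix x assume "x \<in> ball a e"
      then have "G x \<noteq> 0" using e(2) by (auto simp: dist_commute)
      then show "F x / G x = ?h x"
        using True zero[OF True] by (auto simp: F_def G_def split: if_splits)
    qed simp
    finally show ?thesis using e(1) by (simp add: holomorphic_on_imp_differentiable_at)
  qed
  then show ?thesis by (simp add: holomorphic_on_def field_differentiable_at_within)
qed

section \<open>Liouville's theorem on the torus and Fay's three-term identity\<close>

context nome
begin

lemma lattice_reduce: "\<exists>s\<in>{0..1}. \<exists>r\<in>{0..1}. \<exists>m b.
   u = of_real s * \<tau> + 2 * pi * \<i> * of_real r + of_int m * \<tau> + 2 * pi * \<i> * of_int b"
proof -
  define s where "s = Re u / Re \<tau>"
  define r where "r = Im (u - of_real s * \<tau>) / (2 * pi)"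
  have "u = of_real s * \<tau> + 2 * pi * \<i> * of_real r"
    using Re_tau by (simp add: complex_eq_iff s_def r_def)
  then have "u = of_real (frac s) * \<tau> + 2 * pi * \<i> * of_real (frac r)
      + of_int \<lfloor>s\<rfloor> * \<tau> + 2 * pi * \<i> * of_int \<lfloor>r\<rfloor>"
    by (simp add: frac_def algebra_simps)
  then show ?thesis
    using frac_ge_0 frac_lt_1 by (metis atLeastAtMost_iff less_eq_real_def)
qed

text \<open>The compact period parallelogram already yields all values, so \<open>f\<close> is
  bounded and Liouville's theorem applies.\<close>

lemma elliptic_constant:
  assumes f: "f holomorphic_on UNIV"
    and per: "\<And>u. f (u + \<tau>) = f u" "\<And>u. f (u + 2 * pi * \<i>) = f u"
  shows "f u = f v"
proof -
  have per1: "f (u + of_int m * \<tau>) = f u" for u m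
  proof (induction m rule: int_induct[where k = 0])
    case (step1 i)
    then show ?case using per(1)[of "u + of_int i * \<tau>"] by (simp add: algebra_simps)
  next
    case (step2 i)
    then show ?case using per(1)[of "u + of_int (i - 1) * \<tau>"] by (simp add: algebra_simps)
  qed simp
  have per2: "f (u + 2 * pi * \<i> * of_int m) = f u" for u m
  proof (induction m rule: int_induct[where k = 0])
    case (step1 i)
    then show ?case using per(2)[of "u + 2 * pi * \<i> * of_int i"] by (simp add: algebra_simps)
  next
    case (step2 i)
    then show ?case using per(2)[of "u + 2 * pi * \<i> * of_int (i - 1)"] by (simp add: algebra_simps)
  qed simp
  define K where "K = (\<lambda>(s, r). of_real s * \<tau> + 2 * pi * \<i> * of_real r) ` ({0..1::real} \<times> {0..1::real})"
  have "compact K" unfolding K_def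
    by (intro compact_continuous_image compact_Times) (auto simp: case_prod_unfold intro!: continuous_intros)
  then have "bounded (f ` K)"
    by (intro compact_imp_bounded compact_continuous_image)
       (meson UNIV_I f holomorphic_on_imp_continuous_on continuous_on_subset subset_UNIV)
  moreover have "range f \<subseteq> f ` K"
  proof safe
    fix u
    obtain s r m b where s: "s \<in> {0..1}" "r \<in> {0..1}"
      "u = of_real s * \<tau> + 2 * pi * \<i> * of_real r + of_int m * \<tau> + 2 * pi * \<i> * of_int b"
      using lattice_reduce[of u] by blast
    then have "f u = f (of_real s * \<tau> + 2 * pi * \<i> * of_real r)"
      by (simp only: per1 per2)
    with s show "f u \<in> f ` K" unfolding K_def by (auto intro!: imageI)
  qed
  ultimately have "bounded (range f)" using bounded_subset by blast
  then show ?thesis using Liouville_theorem[OF f] unfolding constant_on_def by (metis UNIV_I)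
qed

text \<open>Supplies the points at which a theta factor to be cancelled does not vanish.\<close>

lemma th_half_period: "th (pi * \<i>) \<noteq> 0"
proof
  assume "th (pi * \<i>) = 0"
  then obtain m b where "pi * \<i> = of_int m * \<tau> + 2 * pi * \<i> * of_int b"
    unfolding th_eq_0_iff log_lattice_iff by blast
  then have "of_int m * Re \<tau> = 0" "pi = of_int m * Im \<tau> + 2 * pi * of_int b"
    by (auto simp: complex_eq_iff)
  then have "pi * (2 * of_int b - 1) = 0" using Re_tau by (simp add: algebra_simps)
  then have "2 * real_of_int b = 1" by simp
  then have "2 * b = 1" by linarith
  then show False by presburger
qed

text \<open>As functions of \<open>x\<close> the left side and
  \<open>th (x + y) * th (x - y)\<close> have the same multipliers, and the zeros of the latter are
  zeros of the former. The quotient is entire and elliptic, hence constant, and its value is read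
  off at \<open>x = w\<close>.\<close>

lemma th_fay:
  "th (x + z) * th (x - z) * th (y + w) * th (y - w)
     - th (x + w) * th (x - w) * th (y + z) * th (y - z)
   = th (x + y) * th (x - y) * th (z + w) * th (z - w)"
proof -
  \<comment> \<open>\<open>th (2 * y) \<noteq> 0\<close> keeps the zeros \<open>y\<close> and
    \<open>- y\<close> apart modulo the lattice, so that they are simple; the other two conditions
    make the denominator nonzero at \<open>x = w\<close>.\<close>
  have generic: "th (x + z) * th (x - z) * th (y + w) * th (y - w)
      - th (x + w) * th (x - w) * th (y + z) * th (y - z)
    = th (x + y) * th (x - y) * th (z + w) * th (z - w)"
    if gen: "th (2 * y) \<noteq> 0" "th (y + w) \<noteq> 0" "th (y - w) \<noteq> 0" for x y
  proof -
    define N where "N x = th (x + z) * th (x - z) * th (y + w) * th (y - w)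
      - th (x + w) * th (x - w) * th (y + z) * th (y - z)" for x
    define D where "D x = th (x + y) * th (x - y)" for x
    have holo: "N holomorphic_on UNIV" "D holomorphic_on UNIV"
      unfolding N_def[abs_def] D_def[abs_def] by (intro holomorphic_intros)+
    define c where "c m b x = exp (2 * (\<i> * pi * (of_int m + of_int b)) - 2 * of_int m * x - (of_int m)\<^sup>2 * \<tau>)"
      for m b :: int and x
    have pair: "th (x + (of_int m * \<tau> + 2 * pi * \<i> * of_int b) + a)
        * th (x + (of_int m * \<tau> + 2 * pi * \<i> * of_int b) - a)
        = c m b x * (th (x + a) * th (x - a))" for x a m b
    proof -
      have "th (x + (of_int m * \<tau> + 2 * pi * \<i> * of_int b) + a)
          = exp (\<i> * pi * (of_int m + of_int b) - of_int m * (x + a) - (of_int m)\<^sup>2 * \<tau> / 2) * th (x + a)"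
        using th_quasi[of "x + a" m b] by (simp add: algebra_simps)
      moreover have "th (x + (of_int m * \<tau> + 2 * pi * \<i> * of_int b) - a)
          = exp (\<i> * pi * (of_int m + of_int b) - of_int m * (x - a) - (of_int m)\<^sup>2 * \<tau> / 2) * th (x - a)"
        using th_quasi[of "x - a" m b] by (simp add: algebra_simps)
      moreover have "c m b x = exp (\<i> * pi * (of_int m + of_int b) - of_int m * (x + a) - (of_int m)\<^sup>2 * \<tau> / 2)
          * exp (\<i> * pi * (of_int m + of_int b) - of_int m * (x - a) - (of_int m)\<^sup>2 * \<tau> / 2)"
        unfolding c_def exp_add[symmetric] by (rule arg_cong[where f = exp]) (simp add: algebra_simps)
      ultimately show ?thesis by (simp add: mult_ac)
    qed
    have N_quasi: "N (x + (of_int m * \<tau> + 2 * pi * \<i> * of_int b)) = c m b x * N x" for x m b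
      unfolding N_def pair by (simp add: algebra_simps)
    have D_quasi: "D (x + (of_int m * \<tau> + 2 * pi * \<i> * of_int b)) = c m b x * D x" for x m b
      unfolding D_def pair by simp
    have N_zero: "N x = 0" if "x - y \<in> log_lattice q \<or> x + y \<in> log_lattice q" for x
    proof -
      have "N y = 0" by (simp add: N_def)
      moreover have "N (- y) = N y"
      proof -
        have "th (- y + a) = - th (y - a)" "th (- y - a) = - th (y + a)" for a
          using th_minus[of "y - a"] th_minus[of "y + a"] by simp_all
        then show ?thesis unfolding N_def by (simp only: mult_minus_left mult_minus_right minus_minus) (simp add: mult_ac)
      qed
      ultimately have *: "N y = 0" "N (- y) = 0" by auto
      from that show ?thesis
      proof
        assume "x - y \<in> log_lattice q"
        then obtain m b where "x - y = of_int m * \<tau> + 2 * pi * \<i> * of_int b"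
          unfolding log_lattice_iff by blast
        then have "x = y + (of_int m * \<tau> + 2 * pi * \<i> * of_int b)" by (simp add: algebra_simps)
        then show ?thesis using N_quasi * by simp
      next
        assume "x + y \<in> log_lattice q"
        then obtain m b where "x + y = of_int m * \<tau> + 2 * pi * \<i> * of_int b"
          unfolding log_lattice_iff by blast
        then have "x = - y + (of_int m * \<tau> + 2 * pi * \<i> * of_int b)" by (simp add: algebra_simps)
        then show ?thesis by (simp only: N_quasi * mult_zero_right)
      qed
    qed
    define h where "h x = (if D x = 0 then deriv N x / deriv D x else N x / D x)" for x
    have zero: "N x = 0 \<and> deriv D x \<noteq> 0" if "D x = 0" for x
    proof -
      have "x - y \<in> log_lattice q \<or> x + y \<in> log_lattice q"
        using that by (auto simp: D_def th_eq_0_iff)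
      moreover have "(th has_field_derivative deriv th u) (at u)" for u
        using th_holomorphic holomorphic_derivI by blast
      then have "((\<lambda>x. th (x + y)) has_field_derivative deriv th (x + y)) (at x)"
        "((\<lambda>x. th (x - y)) has_field_derivative deriv th (x - y)) (at x)"
        using DERIV_shift[of th _ x y] DERIV_shift[of th _ x "- y"] by auto
      then have "(D has_field_derivative deriv th (x + y) * th (x - y) + deriv th (x - y) * th (x + y)) (at x)"
        unfolding D_def[abs_def] by (rule DERIV_mult)
      then have "deriv D x = deriv th (x + y) * th (x - y) + deriv th (x - y) * th (x + y)"
        by (rule DERIV_imp_deriv)
      moreover have "\<not> (th (x + y) = 0 \<and> th (x - y) = 0)"
      proof
        assume "th (x + y) = 0 \<and> th (x - y) = 0"
        then obtain m b m' b' where "x + y = of_int m * \<tau> + 2 * pi * \<i> * of_int b"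
          "x - y = of_int m' * \<tau> + 2 * pi * \<i> * of_int b'"
          unfolding th_eq_0_iff log_lattice_iff by metis
        then have "2 * y = of_int (m - m') * \<tau> + 2 * pi * \<i> * of_int (b - b')"
          by (simp add: algebra_simps)
        then have "th (2 * y) = 0" unfolding th_eq_0_iff log_lattice_iff by blast
        with gen show False by simp
      qed
      ultimately show ?thesis using N_zero that th_deriv_nz
        by (auto simp: D_def simp flip: th_eq_0_iff)
    qed
    have h: "h holomorphic_on UNIV"
      unfolding h_def by (rule quotient_simple_zeros_holomorphic[OF holo zero])
    have hD: "h x * D x = N x" for x using zero[of x] by (simp add: h_def)
    have h_quasi: "h (x + (of_int m * \<tau> + 2 * pi * \<i> * of_int b)) = h x" for x m b
    proof -
      have "(h (x + (of_int m * \<tau> + 2 * pi * \<i> * of_int b)) - h x) * D x = 0" for x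
      proof -
        have "c m b x * (h (x + (of_int m * \<tau> + 2 * pi * \<i> * of_int b)) * D x) = c m b x * (h x * D x)"
          using hD[of "x + (of_int m * \<tau> + 2 * pi * \<i> * of_int b)"] hD[of x]
          unfolding D_quasi N_quasi by (simp add: mult_ac)
        then show ?thesis by (simp add: c_def algebra_simps)
      qed
      moreover have "(\<lambda>x. h (x + (of_int m * \<tau> + 2 * pi * \<i> * of_int b)) - h x) holomorphic_on UNIV"
        using holomorphic_on_compose[OF _ holomorphic_on_subset[OF h subset_UNIV],
            of "\<lambda>x. x + (of_int m * \<tau> + 2 * pi * \<i> * of_int b)" UNIV]
        by (auto simp: o_def intro!: holomorphic_on_diff h) (simp add: holomorphic_intros)
      moreover have "D w \<noteq> 0"
        using gen th_diff_commute[of w y] by (simp add: D_def add.commute)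
      ultimately have "h (x + (of_int m * \<tau> + 2 * pi * \<i> * of_int b)) - h x = 0"
        using entire_mult_eq_0[where g = D and a = w, OF _ holo(2)] by blast
      then show ?thesis by simp
    qed
    have "h x = h w"
      by (rule elliptic_constant[OF h]) (use h_quasi[of _ 1 0] h_quasi[of _ 0 1] in simp_all)
    moreover have "h w = th (z + w) * th (z - w)"
    proof -
      have "h w * D w = th (z + w) * th (z - w) * D w"
        unfolding hD using th_diff_commute[of z w] th_diff_commute[of y w]
        by (simp add: N_def D_def algebra_simps)
      moreover have "D w \<noteq> 0"
        using gen th_diff_commute[of w y] by (simp add: D_def add.commute)
      ultimately show ?thesis by simp
    qed
    ultimately show ?thesis using hD[of x] by (simp add: N_def D_def mult_ac)
  qed
  \<comment> \<open>The conditions on \<open>y\<close> are removed by multiplying with the three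
    theta factors and cancelling them one by one as entire functions of \<open>y\<close>.\<close>
  define H where "H y = th (x + z) * th (x - z) * th (y + w) * th (y - w)
     - th (x + w) * th (x - w) * th (y + z) * th (y - z)
   - th (x + y) * th (x - y) * th (z + w) * th (z - w)" for y
  have H: "H holomorphic_on UNIV" unfolding H_def[abs_def] by (intro holomorphic_intros)
  have 0: "H y * th (2 * y) * th (y + w) * th (y - w) = 0" for y
    using generic[of y x] by (auto simp: H_def)
  have 1: "H y * th (2 * y) * th (y + w) = 0" for y
    by (rule entire_mult_eq_0[where f = "\<lambda>y. H y * th (2 * y) * th (y + w)" and g = "\<lambda>y. th (y - w)" and a = "pi * \<i> + w"])
       (use 0 th_half_period in \<open>auto intro!: holomorphic_intros H\<close>)
  have 2: "H y * th (2 * y) = 0" for y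
    by (rule entire_mult_eq_0[where f = "\<lambda>y. H y * th (2 * y)" and g = "\<lambda>y. th (y + w)" and a = "pi * \<i> - w"])
       (use 1 th_half_period in \<open>auto intro!: holomorphic_intros H\<close>)
  have "H y = 0"
    by (rule entire_mult_eq_0[where f = H and g = "\<lambda>y. th (2 * y)" and a = "pi * \<i> / 2"])
       (use 2 th_half_period in \<open>auto intro!: holomorphic_intros H\<close>)
  then show ?thesis by (simp add: H_def)
qed

end

section \<open>Weight functions indexed by positions\<close>

context nome
begin

text \<open>The roots of level \<open>m\<close> are indexed by the positions \<open>1, \<dots>, m\<close> of \<open>I\<close> and not by the sorted
  values \<open>i\<^sup>(\<^sup>m\<^sup>)\<^sub>a\<close>, which differ by a permutation that the symmetrisation absorbs.  The weight
  functions then depend on \<open>I\<close> only through comparisons of its values.\<close>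

definition pos_psi ::
  "(nat \<Rightarrow> nat) \<Rightarrow> complex \<Rightarrow> (nat \<Rightarrow> complex) \<Rightarrow> nat \<Rightarrow> nat \<Rightarrow> nat \<Rightarrow> complex \<Rightarrow> complex"
where
  "pos_psi I h \<mu> m j l u =
    (if I l < I j then th (h + u)
     else if l = j then th (u + (if I j < I (Suc m) then h else 0) + \<mu> (Suc m) - \<mu> j)
     else th u)"

definition pos_den :: "(nat \<Rightarrow> nat) \<Rightarrow> complex \<Rightarrow> nat \<Rightarrow> (nat \<Rightarrow> complex) \<Rightarrow> complex" where
  "pos_den I h m v =
    (\<Prod>(i, j) | i \<in> {1..m} \<and> j \<in> {1..m} \<and> I i < I j. th (h + v i - v j) * th (v j - v i))"

definition pos_num ::
  "(nat \<Rightarrow> nat) \<Rightarrow> complex \<Rightarrow> (nat \<Rightarrow> complex) \<Rightarrow> nat \<Rightarrow> (nat \<Rightarrow> complex) \<Rightarrow> (nat \<Rightarrow> complex) \<Rightarrow> complex"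
where
  "pos_num I h \<mu> m v w = (\<Prod>(j, l) \<in> {1..m} \<times> {1..Suc m}. pos_psi I h \<mu> m j l (w l - v j))"

definition pos_G ::
  "(nat \<Rightarrow> nat) \<Rightarrow> complex \<Rightarrow> (nat \<Rightarrow> complex) \<Rightarrow> nat \<Rightarrow> (nat \<Rightarrow> complex) \<Rightarrow> (nat \<Rightarrow> complex) \<Rightarrow> complex"
where
  "pos_G I h \<mu> m v w = pos_num I h \<mu> m v w / pos_den I h m v"

text \<open>The argument \<open>w\<close> holds the variables of level \<open>m\<close>. They are
  kept apart from \<open>t\<close> because the next step evaluates the inner function at the
  permuted roots \<open>t m \<circ> \<pi>\<close>.\<close>

fun pos_W ::
  "(nat \<Rightarrow> nat) \<Rightarrow> complex \<Rightarrow> (nat \<Rightarrow> complex) \<Rightarrow> (nat \<Rightarrow> nat \<Rightarrow> complex) \<Rightarrow> nat \<Rightarrow> (nat \<Rightarrow> complex) \<Rightarrow> complex"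
where
  "pos_W I h \<mu> t 0 w = 1"
| "pos_W I h \<mu> t (Suc m) w =
    (\<Sum>\<pi> | \<pi> permutes {1..m}. pos_W I h \<mu> t m (t m \<circ> \<pi>) * pos_G I h \<mu> m (t m \<circ> \<pi>) w)"

lemma finite_pairs: "finite {(i, j). i \<in> {1..m} \<and> j \<in> {1..m::nat} \<and> P i j}"
  by (rule finite_subset[of _ "{1..m} \<times> {1..m}"]) auto

lemma pos_G_cong:
  assumes "\<And>i j. i \<in> {1..Suc m} \<Longrightarrow> j \<in> {1..Suc m} \<Longrightarrow> I i < I j \<longleftrightarrow> I' i < I' j"
    and "\<And>j. j \<in> {1..Suc m} \<Longrightarrow> w j = w' j" "\<And>j. j \<in> {1..m} \<Longrightarrow> v j = v' j"
    and "\<And>j. j \<in> {1..Suc m} \<Longrightarrow> \<mu> j = \<mu>' j"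
  shows "pos_G I h \<mu> m v w = pos_G I' h \<mu>' m v' w'"
proof -
  have "pos_num I h \<mu> m v w = pos_num I' h \<mu>' m v' w'"
    unfolding pos_num_def pos_psi_def using assms by (intro prod.cong refl) auto
  moreover have "pos_den I h m v = pos_den I' h m v'"
    unfolding pos_den_def using assms(1,3) by (intro prod.cong) auto
  ultimately show ?thesis by (simp add: pos_G_def)
qed

lemma pos_W_cong:
  assumes "\<And>i j. i \<in> {1..m} \<Longrightarrow> j \<in> {1..m} \<Longrightarrow> I i < I j \<longleftrightarrow> I' i < I' j"
    and "\<And>j. j \<in> {1..m} \<Longrightarrow> w j = w' j" "\<And>k j. k < m \<Longrightarrow> j \<in> {1..k} \<Longrightarrow> t k j = t' k j"
    and "\<And>j. j \<in> {1..m} \<Longrightarrow> \<mu> j = \<mu>' j"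
  shows "pos_W I h \<mu> t m w = pos_W I' h \<mu>' t' m w'"
  using assms
proof (induction m arbitrary: w w')
  case (Suc m)
  have "pos_W I h \<mu> t m (t m \<circ> \<pi>) * pos_G I h \<mu> m (t m \<circ> \<pi>) w
      = pos_W I' h \<mu>' t' m (t' m \<circ> \<pi>) * pos_G I' h \<mu>' m (t' m \<circ> \<pi>) w'"
    if \<pi>: "\<pi> permutes {1..m}" for \<pi>
  proof -
    have "(t m \<circ> \<pi>) j = (t' m \<circ> \<pi>) j" if "j \<in> {1..m}" for j
      using permutes_in_image[OF \<pi>] that Suc.prems(3)[of m "\<pi> j"] by auto
    then show ?thesis
      using Suc.prems by (intro arg_cong2[where f = "(*)"] Suc.IH pos_G_cong) auto
  qed
  then show ?case by simp
qed simp

text \<open>Only levels below \<open>m\<close> enter denominators; the variables of level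
  \<open>m\<close> occur in numerators and stay free.\<close>

definition regular_roots :: "complex \<Rightarrow> (nat \<Rightarrow> nat \<Rightarrow> complex) \<Rightarrow> nat \<Rightarrow> bool" where
  "regular_roots h t m \<longleftrightarrow> (\<forall>k<m. \<forall>i\<in>{1..k}. \<forall>j\<in>{1..k}. i \<noteq> j \<longrightarrow>
     th (h + t k i - t k j) \<noteq> 0 \<and> th (t k i - t k j) \<noteq> 0)"

text \<open>The arguments are given by equations. In an application \<open>x\<close> and
  \<open>z\<close> are the half sum and half difference of \<open>p1\<close> and \<open>p2\<close>,
  and \<open>y\<close> and \<open>w\<close> those of \<open>p3\<close> and
  \<open>p4\<close>.\<close>

lemma th_fay4:
  assumes "p1 = x + z" "p2 = x - z" "p3 = y + w" "p4 = y - w"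
    "p5 = x + w" "p6 = x - w" "p7 = y + z" "p8 = y - z"
    "p9 = x + y" "p10 = x - y" "p11 = z + w" "p12 = z - w"
  shows "th p1 * th p2 * th p3 * th p4 - th p5 * th p6 * th p7 * th p8
    = th p9 * th p10 * th p11 * th p12"
  unfolding assms by (rule th_fay)

text \<open>The exchange relation seen by one lower root \<open>v\<close> when the larger of the two
  neighbouring values sits in the last position: a single instance of Fay's identity.\<close>

lemma exchange_local_last:
  "th (h + M) * th (b - a) * (th (b - v + M) * th (h + a - v))
   = th h * th (b - a + M) * (th (a - v + h + M) * th (b - v))
     - th (h - b + a) * th M * (th (b - v + h + M) * th (a - v))"
proof -
  have "th (a - v + h + M) * th h * th (b - a + M) * th (b - v)
      - th (h + M) * th (h + a - v) * th (b - v + M) * th (b - a)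
      = th (b - v + h + M) * th (h - b + a) * th M * th (a - v)"
    by (rule th_fay4[where x = "(a - v + h + M + h) / 2" and z = "(a - v + M) / 2"
          and y = "(b - a + M + (b - v)) / 2" and w = "(M - a + v) / 2"])
       (simp_all add: field_simps)
  then show ?thesis by (simp add: algebra_simps)
qed

text \<open>The counterpart in which the smaller value sits in the last position.\<close>

lemma exchange_local_first:
  "th (h + M) * th (b - a) * (th (a - v + h - M) * th (b - v))
   = th h * th (b - a + M) * (th (b - v - M) * th (h + a - v))
     - th (h - b + a) * th M * (th (a - v - M) * th (h + b - v))"
proof -
  have "th (h + a - v) * th h * th (b - a + M) * th (b - v - M)
      - th (h + M) * th (a - v + h - M) * th (b - v) * th (b - a)
      = th (h + b - v) * th (h - b + a) * th M * th (a - v - M)"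
    by (rule th_fay4[where x = "(h + a - v + h) / 2" and z = "(a - v) / 2"
          and y = "(b - a + M + (b - v - M)) / 2" and w = "(2 * M - a + v) / 2"])
       (simp_all add: field_simps)
  then show ?thesis by (simp add: algebra_simps)
qed

text \<open>Here both positions lie below the last. Two instances of Fay's identity, one with and
  one without Kaehler parameters, share the factor \<open>th (z' - z - w' + w)\<close> on the right;
  cross multiplication eliminates it.\<close>

lemma exchange_local_pair:
  fixes M1 M2 z z' w w' :: complex
  defines "M \<equiv> M1 - M2"
  shows "th (z' - z) * (th h * th (w' - w + M) *
        (th (z - w + M2) * th (z' - w) * th (h + z - w') * th (z' - w' + M1))
      - th M * th (h + w - w') *
        (th (z - w' + M2) * th (z' - w') * th (h + z - w) * th (z' - w + M1)))
    = th (w' - w) * (th h * th (z' - z + M) *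
        (th (z - w + M1) * th (z' - w) * th (h + z - w') * th (z' - w' + M2))
      - th (h - z' + z) * th M *
        (th (z' - w + M1) * th (z - w) * th (h + z' - w') * th (z - w' + M2)))"
proof -
  have 1: "th (z' - w' + M1) * th (z - w + M2) * th (z' - z) * th (w' - w + M)
      - th (z' - w' + M2) * th (z - w + M1) * th (z' - z + M) * th (w' - w)
      = th (z' - w + M1) * th (z - w' + M2) * th (z' - z - w' + w) * th M"
    by (rule th_fay4[where x = "(z' - w' + M1 + (z - w + M2)) / 2" and z = "(z' - w' + M1 - (z - w + M2)) / 2"
          and y = "(z' - z + (w' - w + M)) / 2" and w = "(z' - z - (w' - w + M)) / 2"])
       (simp_all add: field_simps M_def)
  have "th (h + z - w) * th (h + w - w') * th (z' - z) * th (w' - z')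
      - th (h + z' - w') * th (h - z' + z) * th (w' - w) * th (w - z)
      = th h * th (h + z - w') * th (z' - w) * th (z - w + w' - z')"
    by (rule th_fay4[where x = "(h + z - w + (h + w - w')) / 2" and z = "(h + z - w - (h + w - w')) / 2"
          and y = "(z' - z + (w' - z')) / 2" and w = "(z' - z - (w' - z')) / 2"])
       (simp_all add: field_simps)
  moreover have "th (w' - z') = - th (z' - w')" "th (w - z) = - th (z - w)"
    "th (z - w + w' - z') = - th (z' - z - w' + w)"
    using th_diff_commute[of w' z'] th_diff_commute[of w z] th_minus[of "z' - z - w' + w"]
    by (simp_all add: algebra_simps)
  ultimately have 2: "th (h + z - w) * th (h + w - w') * th (z' - z) * th (z' - w')
      - th (h + z' - w') * th (h - z' + z) * th (w' - w) * th (z - w)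
      = th h * th (h + z - w') * th (z' - w) * th (z' - z - w' + w)"
    by (simp add: algebra_simps)
  have "th h * th (z' - w) * th (h + z - w') *
      (th (z' - w' + M1) * th (z - w + M2) * th (z' - z) * th (w' - w + M)
      - th (z' - w' + M2) * th (z - w + M1) * th (z' - z + M) * th (w' - w))
    = th M * th (z - w' + M2) * th (z' - w + M1) *
      (th (h + z - w) * th (h + w - w') * th (z' - z) * th (z' - w')
      - th (h + z' - w') * th (h - z' + z) * th (w' - w) * th (z - w))"
    unfolding 1 2 by (simp add: mult_ac)
  then show ?thesis by (simp add: algebra_simps)
qed

end

section \<open>The exchange relation\<close>

context nome
begin

text \<open>Relabelling the positions in \<open>I\<close>, \<open>v\<close> and \<open>w\<close>
  simultaneously affects only the assignment of the parameters \<open>\<mu>\<close> to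
  positions.\<close>

lemma pos_G_transpose:
  assumes ab: "a \<in> {1..m}" "b \<in> {1..m}"
  defines "\<sigma> \<equiv> Transposition.transpose a b"
  shows "pos_G (I \<circ> \<sigma>) h \<mu> m (v \<circ> \<sigma>) (w \<circ> \<sigma>) = pos_G I h (\<mu> \<circ> \<sigma>) m v w"
proof -
  have inv: "\<sigma> (\<sigma> i) = i" for i by (simp add: \<sigma>_def)
  have m: "\<sigma> (Suc m) = Suc m" using ab by (auto simp: \<sigma>_def Transposition.transpose_def)
  have in1: "\<sigma> i \<in> {1..m} \<longleftrightarrow> i \<in> {1..m}" for i
    using ab by (auto simp: \<sigma>_def Transposition.transpose_def)
  have in2: "\<sigma> i \<in> {1..Suc m} \<longleftrightarrow> i \<in> {1..Suc m}" for i
    using ab by (auto simp: \<sigma>_def Transposition.transpose_def)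
  have inj: "\<sigma> i = \<sigma> j \<longleftrightarrow> i = j" for i j using inv by metis
  have "pos_num (I \<circ> \<sigma>) h \<mu> m (v \<circ> \<sigma>) (w \<circ> \<sigma>) = pos_num I h (\<mu> \<circ> \<sigma>) m v w"
    unfolding pos_num_def
    by (rule prod.reindex_bij_witness[where i = "map_prod \<sigma> \<sigma>" and j = "map_prod \<sigma> \<sigma>"])
       (auto simp: inv pos_psi_def inj m in1 in2 simp del: atLeastAtMost_iff One_nat_def)
  moreover have "pos_den (I \<circ> \<sigma>) h m (v \<circ> \<sigma>) = pos_den I h m v"
    unfolding pos_den_def
    by (rule prod.reindex_bij_witness[where i = "map_prod \<sigma> \<sigma>" and j = "map_prod \<sigma> \<sigma>"])
       (auto simp: inv in1 simp del: atLeastAtMost_iff One_nat_def)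
  ultimately show ?thesis by (simp add: pos_G_def)
qed

text \<open>The factors of \<open>pos_G\<close> with both positions in \<open>{a, b}\<close>, for
  \<open>I a < I b\<close>: \<open>w\<close>, \<open>w'\<close> are the roots of the lower level at
  \<open>a\<close>, \<open>b\<close>, and \<open>z\<close>, \<open>z'\<close> those of the upper
  level.\<close>

definition pair_weight ::
  "complex \<Rightarrow> complex \<Rightarrow> complex \<Rightarrow> complex \<Rightarrow> complex \<Rightarrow> complex \<Rightarrow> complex \<Rightarrow> complex"
where
  "pair_weight h M1 M2 w w' z z' =
    th (z - w + M1) * th (z' - w) * th (h + z - w') * th (z' - w' + M2) / (th (h + w - w') * th (w' - w))"

lemma pair_weight_exchange:
  assumes "th (w' - w) \<noteq> 0" "th (h + w - w') \<noteq> 0" "th (h + w' - w) \<noteq> 0"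
  shows "th (z' - z) * (th h * th (w' - w + (M1 - M2)) / th (w' - w) * pair_weight h M2 M1 w w' z z'
      - th (h - w + w') * th (M1 - M2) / th (w - w') * pair_weight h M2 M1 w' w z z')
    = th h * th (z' - z + (M1 - M2)) * pair_weight h M1 M2 w w' z z'
      - th (h - z' + z) * th (M1 - M2) * pair_weight h M1 M2 w w' z' z"
proof -
  define A where "A M1 M2 w w' z z' = th (z - w + M1) * th (z' - w) * th (h + z - w') * th (z' - w' + M2)"
    for M1 M2 w w' z z'
  define d where "d = th (w' - w)"
  define e where "e = th (h + w - w')"
  define f where "f = th (h + w' - w)"
  have nz: "d \<noteq> 0" "e \<noteq> 0" "f \<noteq> 0" using assms by (auto simp: d_def e_def f_def)
  have d': "th (w - w') = - d" using th_diff_commute[of w w'] by (simp add: d_def)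
  have f': "th (h - w + w') = f" by (simp add: f_def algebra_simps)
  have pair: "th (z' - z) * (th h * th (w' - w + (M1 - M2)) * A M2 M1 w w' z z'
        - th (M1 - M2) * e * A M2 M1 w' w z z')
      = d * (th h * th (z' - z + (M1 - M2)) * A M1 M2 w w' z z'
        - th (h - z' + z) * th (M1 - M2) * A M1 M2 w w' z' z)"
    using exchange_local_pair[of z' z h w' w M1 M2] by (simp add: A_def d_def e_def algebra_simps)
  have "(th (z' - z) * (th h * th (w' - w + (M1 - M2)) / d * (A M2 M1 w w' z z' / (e * d))
      - f * th (M1 - M2) / (- d) * (A M2 M1 w' w z z' / (f * (- d))))) * (d * d * e)
    = th (z' - z) * (th h * th (w' - w + (M1 - M2)) * A M2 M1 w w' z z'
        - th (M1 - M2) * e * A M2 M1 w' w z z')"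
    using nz by (simp add: field_simps)
  also have "\<dots> = (th h * th (z' - z + (M1 - M2)) * (A M1 M2 w w' z z' / (e * d))
      - th (h - z' + z) * th (M1 - M2) * (A M1 M2 w w' z' z / (e * d))) * (d * d * e)"
    unfolding pair using nz by (simp add: field_simps)
  finally show ?thesis using nz unfolding pair_weight_def d' f'
    by (simp add: A_def flip: d_def e_def f_def)
qed

text \<open>No value lies strictly between \<open>I a\<close> and \<open>I b\<close>, so every other
  position compares with both in the same way. The remaining factors do not notice the swap, and one
  constant \<open>R\<close> serves all eight combinations.\<close>

lemma pos_G_pair:
  fixes h :: complex and I :: "nat \<Rightarrow> nat" and \<mu> v w :: "nat \<Rightarrow> complex"
  assumes ab: "a \<in> {1..m}" "b \<in> {1..m}" and lt: "I a < I b" and inj: "inj_on I {1..Suc m}"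
    and adj: "\<And>i. i \<in> {1..Suc m} \<Longrightarrow> \<not> (I a < I i \<and> I i < I b)"
  defines "\<sigma> \<equiv> Transposition.transpose a b"
  defines "\<delta> \<equiv> (if I a < I (Suc m) then h else 0)"
  shows "\<exists>R. (\<forall>\<mu>' v' w'. \<mu>' \<in> {\<mu>, \<mu> \<circ> \<sigma>} \<longrightarrow> v' \<in> {v, v \<circ> \<sigma>} \<longrightarrow> w' \<in> {w, w \<circ> \<sigma>} \<longrightarrow>
     pos_G I h \<mu>' m v' w' = R * pair_weight h (\<delta> + \<mu>' (Suc m) - \<mu>' a) (\<delta> + \<mu>' (Suc m) - \<mu>' b)
        (v' a) (v' b) (w' a) (w' b))"
proof -
  have inv: "\<sigma> (\<sigma> i) = i" for i by (simp add: \<sigma>_def)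
  have m: "\<sigma> (Suc m) = Suc m" using ab by (auto simp: \<sigma>_def Transposition.transpose_def)
  have in1: "\<sigma> i \<in> {1..m} \<longleftrightarrow> i \<in> {1..m}" for i
    using ab by (auto simp: \<sigma>_def Transposition.transpose_def)
  have in2: "\<sigma> i \<in> {1..Suc m} \<longleftrightarrow> i \<in> {1..Suc m}" for i
    using ab by (auto simp: \<sigma>_def Transposition.transpose_def)
  have neq: "a \<noteq> b" using lt by auto
  have fixo: "\<sigma> i = i" if "i \<noteq> a" "i \<noteq> b" for i
    using that by (simp add: \<sigma>_def)
  have sa: "\<sigma> a = b" "\<sigma> b = a" by (simp_all add: \<sigma>_def)
  have ord: "(I i < I a \<longleftrightarrow> I i < I b) \<and> (I a < I i \<longleftrightarrow> I b < I i)"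
    if "i \<in> {1..Suc m}" "i \<noteq> a" "i \<noteq> b" for i
  proof -
    have "I i \<noteq> I a" "I i \<noteq> I b" using inj that ab by (auto simp: inj_on_def)
    then show ?thesis using adj[OF that(1)] lt by linarith
  qed
  define S where "S = {1..m} \<times> {1..Suc m} - {a, b} \<times> {a, b}"
  define rest where "rest \<mu> v w = (\<Prod>(j, l) \<in> S. pos_psi I h \<mu> m j l (w l - v j))" for \<mu> v w
  define T where "T = {(i, j). i \<in> {1..m} \<and> j \<in> {1..m} \<and> I i < I j} - {(a, b)}"
  define rden where "rden v = (\<Prod>(i, j) \<in> T. th (h + v i - v j) * th (v j - v i))" for v
  have num: "pos_num I h \<mu> m v w = rest \<mu> v w *
      (th (w a - v a + (\<delta> + \<mu> (Suc m) - \<mu> a)) * th (w b - v a) *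
        th (h + w a - v b) * th (w b - v b + (\<delta> + \<mu> (Suc m) - \<mu> b)))" for \<mu> v w
  proof -
    have sub: "{a, b} \<times> {a, b} \<subseteq> {1..m} \<times> {1..Suc m}" using ab by auto
    have "pos_num I h \<mu> m v w = rest \<mu> v w * (\<Prod>(j, l) \<in> {a, b} \<times> {a, b}. pos_psi I h \<mu> m j l (w l - v j))"
      unfolding pos_num_def rest_def S_def by (rule prod.subset_diff[OF sub]) simp
    also have "{a, b} \<times> {a, b} = {(a, a), (a, b), (b, a), (b, b)}" by auto
    also have "(\<Prod>(j, l) \<in> {(a, a), (a, b), (b, a), (b, b)}. pos_psi I h \<mu> m j l (w l - v j))
      = pos_psi I h \<mu> m a a (w a - v a) * pos_psi I h \<mu> m a b (w b - v a)
        * pos_psi I h \<mu> m b a (w a - v b) * pos_psi I h \<mu> m b b (w b - v b)"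
      using neq by (simp add: mult_ac)
    also have "\<dots> = th (w a - v a + (\<delta> + \<mu> (Suc m) - \<mu> a)) * th (w b - v a) *
        th (h + w a - v b) * th (w b - v b + (\<delta> + \<mu> (Suc m) - \<mu> b))"
      using lt neq ord[of "Suc m"] ab unfolding pos_psi_def \<delta>_def
      by (auto simp: algebra_simps)
    finally show ?thesis .
  qed
  have den: "pos_den I h m v = rden v * (th (h + v a - v b) * th (v b - v a))" for v
  proof -
    have "{(a, b)} \<subseteq> {(i, j). i \<in> {1..m} \<and> j \<in> {1..m} \<and> I i < I j}" using ab lt by auto
    from prod.subset_diff[OF this finite_pairs, of "\<lambda>(i, j). th (h + v i - v j) * th (v j - v i)"]
    show ?thesis unfolding pos_den_def rden_def T_def by simp
  qed
  have rest_\<mu>: "rest (\<mu> \<circ> \<sigma>) v w = rest \<mu> v w" for \<mu> v w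
    unfolding rest_def
  proof (intro prod.cong refl)
    fix x assume x: "x \<in> S"
    obtain j l where jl: "x = (j, l)" by force
    have "pos_psi I h (\<mu> \<circ> \<sigma>) m j l u = pos_psi I h \<mu> m j l u" for u
      using x ab jl by (cases "l = j") (auto simp: S_def pos_psi_def m fixo)
    then show "(case x of (j, l) \<Rightarrow> pos_psi I h (\<mu> \<circ> \<sigma>) m j l (w l - v j))
        = (case x of (j, l) \<Rightarrow> pos_psi I h \<mu> m j l (w l - v j))"
      by (simp add: jl)
  qed
  have psi_\<sigma>: "pos_psi I h \<mu> m (\<sigma> j) l u = pos_psi I h \<mu> m j l u
      \<and> pos_psi I h \<mu> m j (\<sigma> l) u = pos_psi I h \<mu> m j l u" if "(j, l) \<in> S" for j l u \<mu>
  proof -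
    have jl: "j \<in> {1..m}" "l \<in> {1..Suc m}" "\<not> (j \<in> {a, b} \<and> l \<in> {a, b})" using that by (auto simp: S_def)
    consider "j \<in> {a, b}" "l \<notin> {a, b}" | "j \<notin> {a, b}" "l \<in> {a, b}" | "j \<notin> {a, b}" "l \<notin> {a, b}" using jl by blast
    then show ?thesis
    proof cases
      case 1 then show ?thesis using ord[of l] jl by (auto simp: pos_psi_def sa fixo)
    next
      case 2
      then have "j \<noteq> a" "j \<noteq> b" by auto
      with 2 show ?thesis using ord[of j] jl by (auto simp: pos_psi_def sa fixo)
    next
      case 3 then show ?thesis by (simp add: fixo)
    qed
  qed
  have ab\<sigma>: "\<sigma> i \<in> {a, b} \<longleftrightarrow> i \<in> {a, b}" for i
    using sa fixo inv by (metis insert_iff singletonD)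
  have S_iff: "(j, l) \<in> S \<longleftrightarrow> j \<in> {1..m} \<and> l \<in> {1..Suc m} \<and> \<not> (j \<in> {a, b} \<and> l \<in> {a, b})" for j l
    unfolding S_def by blast
  have S\<sigma>: "(\<sigma> j, l) \<in> S \<longleftrightarrow> (j, l) \<in> S" "(j, \<sigma> l) \<in> S \<longleftrightarrow> (j, l) \<in> S" for j l
    unfolding S_iff in1 in2 ab\<sigma> by (rule refl)+
  have rest_v: "rest \<mu> (v \<circ> \<sigma>) w = rest \<mu> v w" for \<mu> v w
    unfolding rest_def
    by (rule prod.reindex_bij_witness[where i = "map_prod \<sigma> id" and j = "map_prod \<sigma> id"])
       (auto simp: inv S\<sigma> psi_\<sigma>)
  have rest_w: "rest \<mu> v (w \<circ> \<sigma>) = rest \<mu> v w" for \<mu> v w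
    unfolding rest_def
    by (rule prod.reindex_bij_witness[where i = "map_prod id \<sigma>" and j = "map_prod id \<sigma>"])
       (auto simp: inv S\<sigma> psi_\<sigma>)
  have T\<sigma>: "(\<sigma> i, \<sigma> j) \<in> T" if "(i, j) \<in> T" for i j
  proof -
    have ij: "i \<in> {1..m}" "j \<in> {1..m}" "I i < I j" "(i, j) \<noteq> (a, b)" using that by (auto simp: T_def)
    have "I (\<sigma> i) < I (\<sigma> j)"
    proof (cases "i \<in> {a, b}")
      case True
      then have "j \<notin> {a, b}" using ij lt by auto
      then show ?thesis using True ij ord[of j] by (auto simp: sa fixo)
    next
      case False
      then show ?thesis using ij ord[of i] by (cases "j \<in> {a, b}") (auto simp: sa fixo)
    qed
    moreover have "(\<sigma> i, \<sigma> j) \<noteq> (a, b)" using inv sa ij lt by (metis less_not_sym prod.inject)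
    ultimately show ?thesis using in1 ij by (auto simp: T_def simp del: atLeastAtMost_iff One_nat_def)
  qed
  have rden_v: "rden (v \<circ> \<sigma>) = rden v" for v
    unfolding rden_def
    by (rule prod.reindex_bij_witness[where i = "map_prod \<sigma> \<sigma>" and j = "map_prod \<sigma> \<sigma>"])
       (auto simp: inv T\<sigma>)
  show ?thesis
  proof (intro exI[of _ "rest \<mu> v w / rden v"] allI impI)
    fix \<mu>' v' w' assume A: "\<mu>' \<in> {\<mu>, \<mu> \<circ> \<sigma>}" "v' \<in> {v, v \<circ> \<sigma>}" "w' \<in> {w, w \<circ> \<sigma>}"
    have "rest \<mu>' v' w' = rest \<mu> v w" using A rest_\<mu> rest_v rest_w by auto
    moreover have "rden v' = rden v" using A rden_v by auto
    ultimately show "pos_G I h \<mu>' m v' w' = rest \<mu> v w / rden v * pair_weight h (\<delta> + \<mu>' (Suc m) - \<mu>' a) (\<delta> + \<mu>' (Suc m) - \<mu>' b)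
        (v' a) (v' b) (w' a) (w' b)"
      by (simp add: pos_G_def num den pair_weight_def)
  qed
qed

text \<open>Induction on the level. If both positions lie below the last, the induction hypothesis
  writes the inner function of the swapped index through that of \<open>I\<close>. Reindexing one
  half of the sum by the transposition brings both halves to the same inner value, and
  \<open>pair_weight_exchange\<close> compares the coefficients. Otherwise the inner functions
  coincide and the relation concerns the top factor alone.\<close>

lemma exchange:
  fixes h :: complex
  assumes "regular_roots h t m" "inj_on I {1..m}" "a \<in> {1..m}" "b \<in> {1..m}" "I a < I b"
    and "\<And>i. i \<in> {1..m} \<Longrightarrow> \<not> (I a < I i \<and> I i < I b)"
  shows "th (h + (\<mu> b - \<mu> a)) * th (w b - w a) *
      pos_W (I \<circ> Transposition.transpose a b) h \<mu> t m (w \<circ> Transposition.transpose a b)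
    = th h * th (w b - w a + (\<mu> b - \<mu> a)) * pos_W I h \<mu> t m w
      - th (h - w b + w a) * th (\<mu> b - \<mu> a) * pos_W I h \<mu> t m (w \<circ> Transposition.transpose a b)"
  using assms
proof (induction m arbitrary: w)
  case 0 then show ?case by simp
next
  case (Suc m)
  define \<sigma> where "\<sigma> = Transposition.transpose a b"
  define M where "M = \<mu> b - \<mu> a"
  have inj: "inj_on I {1..m}" by (rule inj_on_subset[OF Suc.prems(2)]) auto
  have neq: "a \<noteq> b" using Suc.prems(5) by auto
  have sa: "\<sigma> a = b" "\<sigma> b = a" by (simp_all add: \<sigma>_def)
  have inv: "\<sigma> (\<sigma> i) = i" for i by (simp add: \<sigma>_def)
  have fixo: "\<sigma> i = i" if "i \<noteq> a" "i \<noteq> b" for i using that by (simp add: \<sigma>_def)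
  have ord: "(I i < I a \<longleftrightarrow> I i < I b) \<and> (I a < I i \<longleftrightarrow> I b < I i)"
    if "i \<in> {1..Suc m}" "i \<noteq> a" "i \<noteq> b" for i
  proof -
    have "I i \<noteq> I a" "I i \<noteq> I b" using Suc.prems(2-4) that by (auto simp: inj_on_def)
    then show ?thesis using Suc.prems(6)[OF that(1)] Suc.prems(5) by linarith
  qed
  have reg: "regular_roots h t m" using Suc.prems(1) by (auto simp: regular_roots_def)
  have reg_m: "th (h + t m i - t m j) \<noteq> 0 \<and> th (t m i - t m j) \<noteq> 0"
    if "i \<in> {1..m}" "j \<in> {1..m}" "i \<noteq> j" for i j
    using Suc.prems(1) that by (auto simp: regular_roots_def)
  show ?case
  proof (cases "a \<in> {1..m} \<and> b \<in> {1..m}")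
    case True
    then have ab: "a \<in> {1..m}" "b \<in> {1..m}" by auto
    have \<sigma>_perm: "\<sigma> permutes {1..m}" unfolding \<sigma>_def using ab by (rule permutes_swap_id)
    define P where "P v = th h * th (v a - v b + M) / th (v a - v b) * pos_W I h \<mu> t m (v \<circ> \<sigma>)" for v
    define Q where "Q v = th (h - v a + v b) * th M / th (v a - v b) * pos_W I h \<mu> t m v" for v
    \<comment> \<open>The relation has \<open>w \<circ> \<sigma>\<close> in the swapped term, hence
      the induction hypothesis is taken at \<open>v \<circ> \<sigma>\<close> to obtain that term at
      \<open>v\<close>.\<close>
    have IH: "th (h + M) * pos_W (I \<circ> \<sigma>) h \<mu> t m v = P v - Q v" if "th (v a - v b) \<noteq> 0" for v
    proof -
      have v: "v \<circ> \<sigma> \<circ> \<sigma> = v" using inv by auto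
      have "th (h + M) * th ((v \<circ> \<sigma>) b - (v \<circ> \<sigma>) a) * pos_W (I \<circ> \<sigma>) h \<mu> t m (v \<circ> \<sigma> \<circ> \<sigma>)
        = th h * th ((v \<circ> \<sigma>) b - (v \<circ> \<sigma>) a + M) * pos_W I h \<mu> t m (v \<circ> \<sigma>)
          - th (h - (v \<circ> \<sigma>) b + (v \<circ> \<sigma>) a) * th M * pos_W I h \<mu> t m (v \<circ> \<sigma> \<circ> \<sigma>)"
        unfolding M_def \<sigma>_def
        by (rule Suc.IH[OF reg inj ab Suc.prems(5)]) (use Suc.prems(6) in auto)
      then have "th (h + M) * th (v a - v b) * pos_W (I \<circ> \<sigma>) h \<mu> t m v
        = th h * th (v a - v b + M) * pos_W I h \<mu> t m (v \<circ> \<sigma>) - th (h - v a + v b) * th M * pos_W I h \<mu> t m v"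
        unfolding v by (simp only: o_apply sa)
      then show ?thesis using that unfolding P_def Q_def by (simp add: field_simps)
    qed
    have nz: "th ((t m \<circ> \<pi>) b - (t m \<circ> \<pi>) a) \<noteq> 0" "th ((t m \<circ> \<pi>) a - (t m \<circ> \<pi>) b) \<noteq> 0"
      "th (h + (t m \<circ> \<pi>) b - (t m \<circ> \<pi>) a) \<noteq> 0" "th (h + (t m \<circ> \<pi>) a - (t m \<circ> \<pi>) b) \<noteq> 0"
      if "\<pi> permutes {1..m}" for \<pi>
    proof -
      have "\<pi> a \<noteq> \<pi> b" using neq permutes_inj[OF that] by (auto simp: inj_def)
      then show "th ((t m \<circ> \<pi>) b - (t m \<circ> \<pi>) a) \<noteq> 0" "th ((t m \<circ> \<pi>) a - (t m \<circ> \<pi>) b) \<noteq> 0"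
      "th (h + (t m \<circ> \<pi>) b - (t m \<circ> \<pi>) a) \<noteq> 0" "th (h + (t m \<circ> \<pi>) a - (t m \<circ> \<pi>) b) \<noteq> 0"
        using reg_m permutes_in_image[OF that] ab by auto
    qed
    define f where "f \<pi> = (P (t m \<circ> \<pi>) - Q (t m \<circ> \<pi>)) * pos_G (I \<circ> \<sigma>) h \<mu> m (t m \<circ> \<pi>) (w \<circ> \<sigma>)" for \<pi>
    have "th (h + M) * pos_W (I \<circ> \<sigma>) h \<mu> t (Suc m) (w \<circ> \<sigma>)
        = (\<Sum>\<pi> | \<pi> permutes {1..m}. P (t m \<circ> \<pi>) * pos_G (I \<circ> \<sigma>) h \<mu> m (t m \<circ> \<pi>) (w \<circ> \<sigma>))
        - (\<Sum>\<pi> | \<pi> permutes {1..m}. Q (t m \<circ> \<pi>) * pos_G (I \<circ> \<sigma>) h \<mu> m (t m \<circ> \<pi>) (w \<circ> \<sigma>))"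
      unfolding pos_W.simps sum_distrib_left sum_subtractf[symmetric]
    proof (intro sum.cong refl)
      fix \<pi> assume "\<pi> \<in> {\<pi>. \<pi> permutes {1..m}}"
      then have \<pi>: "\<pi> permutes {1..m}" by blast
      show "th (h + M) * (pos_W (I \<circ> \<sigma>) h \<mu> t m (t m \<circ> \<pi>) * pos_G (I \<circ> \<sigma>) h \<mu> m (t m \<circ> \<pi>) (w \<circ> \<sigma>))
        = P (t m \<circ> \<pi>) * pos_G (I \<circ> \<sigma>) h \<mu> m (t m \<circ> \<pi>) (w \<circ> \<sigma>)
        - Q (t m \<circ> \<pi>) * pos_G (I \<circ> \<sigma>) h \<mu> m (t m \<circ> \<pi>) (w \<circ> \<sigma>)"
        unfolding mult.assoc[symmetric] IH[OF nz(2)[OF \<pi>]] by (rule left_diff_distrib)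
    qed
    also have "(\<Sum>\<pi> | \<pi> permutes {1..m}. P (t m \<circ> \<pi>) * pos_G (I \<circ> \<sigma>) h \<mu> m (t m \<circ> \<pi>) (w \<circ> \<sigma>))
      = (\<Sum>\<pi> | \<pi> permutes {1..m}. P (t m \<circ> (\<pi> \<circ> \<sigma>)) * pos_G (I \<circ> \<sigma>) h \<mu> m (t m \<circ> (\<pi> \<circ> \<sigma>)) (w \<circ> \<sigma>))"
      by (rule sum_permutations_compose_right[OF \<sigma>_perm])
    finally have lhs: "th (h + M) * pos_W (I \<circ> \<sigma>) h \<mu> t (Suc m) (w \<circ> \<sigma>)
      = (\<Sum>\<pi> | \<pi> permutes {1..m}. P (t m \<circ> (\<pi> \<circ> \<sigma>)) * pos_G (I \<circ> \<sigma>) h \<mu> m (t m \<circ> (\<pi> \<circ> \<sigma>)) (w \<circ> \<sigma>)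
          - Q (t m \<circ> \<pi>) * pos_G (I \<circ> \<sigma>) h \<mu> m (t m \<circ> \<pi>) (w \<circ> \<sigma>))"
      by (simp only: sum_subtractf)
    have coeff: "th (w b - w a) * (P (v \<circ> \<sigma>) * pos_G (I \<circ> \<sigma>) h \<mu> m (v \<circ> \<sigma>) (w \<circ> \<sigma>)
          - Q v * pos_G (I \<circ> \<sigma>) h \<mu> m v (w \<circ> \<sigma>))
        = th h * th (w b - w a + M) * (pos_W I h \<mu> t m v * pos_G I h \<mu> m v w)
          - th (h - w b + w a) * th M * (pos_W I h \<mu> t m v * pos_G I h \<mu> m v (w \<circ> \<sigma>))"
      if nz: "th (v b - v a) \<noteq> 0" "th (h + v a - v b) \<noteq> 0" "th (h + v b - v a) \<noteq> 0" for v
    proof -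
      define \<delta> where "\<delta> = (if I a < I (Suc m) then h else 0)"
      obtain R where R: "\<And>\<mu>' v' w'. \<mu>' \<in> {\<mu>, \<mu> \<circ> \<sigma>} \<Longrightarrow> v' \<in> {v, v \<circ> \<sigma>} \<Longrightarrow> w' \<in> {w, w \<circ> \<sigma>} \<Longrightarrow>
         pos_G I h \<mu>' m v' w' = R * pair_weight h (\<delta> + \<mu>' (Suc m) - \<mu>' a) (\<delta> + \<mu>' (Suc m) - \<mu>' b)
        (v' a) (v' b) (w' a) (w' b)"
        using pos_G_pair[OF ab Suc.prems(5,2,6)] unfolding \<sigma>_def \<delta>_def by blast
      define M1 where "M1 = \<delta> + \<mu> (Suc m) - \<mu> a"
      define M2 where "M2 = \<delta> + \<mu> (Suc m) - \<mu> b"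
      have M: "M = M1 - M2" by (simp add: M_def M1_def M2_def)
      have [simp]: "\<sigma> (Suc m) = Suc m" using ab by (intro fixo) auto
      have w\<sigma>: "w \<circ> \<sigma> \<circ> \<sigma> = w" using inv by auto
      have g1: "pos_G (I \<circ> \<sigma>) h \<mu> m (v \<circ> \<sigma>) (w \<circ> \<sigma>) = R * pair_weight h M2 M1 (v a) (v b) (w a) (w b)"
        using pos_G_transpose[OF ab, of I h \<mu> v w] R[of "\<mu> \<circ> \<sigma>" v w]
        by (simp add: \<sigma>_def[symmetric] M1_def M2_def sa)
      have "v \<circ> \<sigma> \<circ> \<sigma> = v" using inv by auto
      then have g2: "pos_G (I \<circ> \<sigma>) h \<mu> m v (w \<circ> \<sigma>) = R * pair_weight h M2 M1 (v b) (v a) (w a) (w b)"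
        using pos_G_transpose[OF ab, of I h \<mu> "v \<circ> \<sigma>" w] R[of "\<mu> \<circ> \<sigma>" "v \<circ> \<sigma>" w]
        by (simp add: \<sigma>_def[symmetric] M1_def M2_def sa)
      have g3: "pos_G I h \<mu> m v w = R * pair_weight h M1 M2 (v a) (v b) (w a) (w b)"
        using R[of \<mu> v w] by (simp add: M1_def M2_def)
      have g4: "pos_G I h \<mu> m v (w \<circ> \<sigma>) = R * pair_weight h M1 M2 (v a) (v b) (w b) (w a)"
        using R[of \<mu> v "w \<circ> \<sigma>"] by (simp add: M1_def M2_def sa)
      have "P (v \<circ> \<sigma>) = th h * th (v b - v a + M) / th (v b - v a) * pos_W I h \<mu> t m v"
        unfolding P_def \<open>v \<circ> \<sigma> \<circ> \<sigma> = v\<close> by (simp add: sa)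
      then have "th (w b - w a) * (P (v \<circ> \<sigma>) * pos_G (I \<circ> \<sigma>) h \<mu> m (v \<circ> \<sigma>) (w \<circ> \<sigma>)
          - Q v * pos_G (I \<circ> \<sigma>) h \<mu> m v (w \<circ> \<sigma>))
        = R * pos_W I h \<mu> t m v * (th (w b - w a) *
           (th h * th (v b - v a + M) / th (v b - v a) * pair_weight h M2 M1 (v a) (v b) (w a) (w b)
      - th (h - v a + v b) * th M / th (v a - v b) * pair_weight h M2 M1 (v b) (v a) (w a) (w b)))"
        unfolding Q_def g1 g2 by (simp add: algebra_simps)
      also note pair_weight_exchange[OF nz, of "w b" "w a" M1 M2, folded M]
      finally show ?thesis unfolding g3 g4 by (rule trans) (simp add: algebra_simps)
    qed
    have "th (h + M) * th (w b - w a) * pos_W (I \<circ> \<sigma>) h \<mu> t (Suc m) (w \<circ> \<sigma>)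
      = th (w b - w a) * (th (h + M) * pos_W (I \<circ> \<sigma>) h \<mu> t (Suc m) (w \<circ> \<sigma>))"
      by (simp only: mult_ac)
    also have "\<dots> = (\<Sum>\<pi> | \<pi> permutes {1..m}.
       th h * th (w b - w a + M) * (pos_W I h \<mu> t m (t m \<circ> \<pi>) * pos_G I h \<mu> m (t m \<circ> \<pi>) w)
          - th (h - w b + w a) * th M * (pos_W I h \<mu> t m (t m \<circ> \<pi>) * pos_G I h \<mu> m (t m \<circ> \<pi>) (w \<circ> \<sigma>)))"
      unfolding lhs sum_distrib_left
    proof (intro sum.cong refl)
      fix \<pi> assume "\<pi> \<in> {\<pi>. \<pi> permutes {1..m}}"
      then show "th (w b - w a) * (P (t m \<circ> (\<pi> \<circ> \<sigma>)) * pos_G (I \<circ> \<sigma>) h \<mu> m (t m \<circ> (\<pi> \<circ> \<sigma>)) (w \<circ> \<sigma>)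
          - Q (t m \<circ> \<pi>) * pos_G (I \<circ> \<sigma>) h \<mu> m (t m \<circ> \<pi>) (w \<circ> \<sigma>))
       = th h * th (w b - w a + M) * (pos_W I h \<mu> t m (t m \<circ> \<pi>) * pos_G I h \<mu> m (t m \<circ> \<pi>) w)
          - th (h - w b + w a) * th M * (pos_W I h \<mu> t m (t m \<circ> \<pi>) * pos_G I h \<mu> m (t m \<circ> \<pi>) (w \<circ> \<sigma>))"
        using coeff[of "t m \<circ> \<pi>"] nz[of \<pi>] unfolding o_assoc by blast
    qed
    finally show ?thesis
      by (simp only: pos_W.simps sum_subtractf sum_distrib_left \<sigma>_def M_def)
  next
    case False
    have ab': "a \<in> {1..Suc m}" "b \<in> {1..Suc m}" using Suc.prems by auto
    \<comment> \<open>Exactly one of \<open>a\<close> and \<open>b\<close> is the last position;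
      \<open>c\<close> is the other one.\<close>
    define c where "c = (if a = Suc m then b else a)"
    have c: "c \<in> {1..m}" "c \<in> {a, b}" using False ab' neq by (auto simp: c_def)
    have only: "j = c" if "j \<in> {1..m}" "j \<in> {a, b}" for j
      using that False neq ab' by (auto simp: c_def)
    have last: "{a, b} = {c, Suc m}" using False ab' neq by (auto simp: c_def)
    have in2: "\<sigma> i \<in> {1..Suc m} \<longleftrightarrow> i \<in> {1..Suc m}" for i
      using ab' by (auto simp: \<sigma>_def Transposition.transpose_def)
    \<comment> \<open>Of the pair only \<open>c\<close> remains below the last position, and giving
      it the neighbouring value changes no comparison.\<close>
    have W_eq: "pos_W (I \<circ> \<sigma>) h \<mu> t m v = pos_W I h \<mu> t m v" for v
    proof (rule pos_W_cong)
      fix i j assume ij: "i \<in> {1..m}" "j \<in> {1..m}"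
      show "(I \<circ> \<sigma>) i < (I \<circ> \<sigma>) j \<longleftrightarrow> I i < I j"
      proof (cases "i \<in> {a, b}")
        case True
        show ?thesis
        proof (cases "j \<in> {a, b}")
          case True
          with \<open>i \<in> {a, b}\<close> ij only have "i = j" by metis
          then show ?thesis by simp
        next
          case False
          then show ?thesis using True ij ord[of j] by (auto simp: sa fixo)
        qed
      next
        case i: False
        show ?thesis
        proof (cases "j \<in> {a, b}")
          case True
          then show ?thesis using i ij ord[of i] by (auto simp: sa fixo)
        qed (use i fixo in auto)
      qed
    qed auto
    define S where "S = {1..m} \<times> {1..Suc m} - {(c, a), (c, b)}"
    define rest where "rest I w v = (\<Prod>(j, l) \<in> S. pos_psi I h \<mu> m j l (w l - v j))" for I w v
    have num: "pos_num I h \<mu> m v w = rest I w v * (pos_psi I h \<mu> m c a (w a - v c) * pos_psi I h \<mu> m c b (w b - v c))"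
      for I v w
    proof -
      have sub: "{(c, a), (c, b)} \<subseteq> {1..m} \<times> {1..Suc m}" using c ab' by auto
      show ?thesis unfolding pos_num_def rest_def S_def using neq
        by (subst prod.subset_diff[OF sub]) auto
    qed
    have S_iff: "(j, l) \<in> S \<longleftrightarrow> j \<in> {1..m} \<and> l \<in> {1..Suc m} \<and> \<not> (j = c \<and> l \<in> {a, b})" for j l
      unfolding S_def by blast
    have ab\<sigma>: "\<sigma> i \<in> {a, b} \<longleftrightarrow> i \<in> {a, b}" for i
      using sa fixo inv by (metis insert_iff singletonD)
    have S\<sigma>: "(j, \<sigma> l) \<in> S \<longleftrightarrow> (j, l) \<in> S" for j l
      unfolding S_iff in2 ab\<sigma> by (rule refl)
    have psi: "pos_psi (I \<circ> \<sigma>) h \<mu> m j l u = pos_psi I h \<mu> m j l u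
        \<and> pos_psi I h \<mu> m j (\<sigma> l) u = pos_psi I h \<mu> m j l u" if "(j, l) \<in> S" for j l u
    proof -
      have jl: "j \<in> {1..m}" "l \<in> {1..Suc m}" "\<not> (j = c \<and> l \<in> {a, b})" using that by (auto simp: S_iff)
      show ?thesis
      proof (cases "j = c")
        case True
        then have l: "l \<noteq> a" "l \<noteq> b" using jl by auto
        have "l \<noteq> Suc m" "l \<noteq> c" using l last by blast+
        then show ?thesis using True c ord[OF jl(2) l] by (auto simp: pos_psi_def sa fixo l)
      next
        case False
        then have j: "j \<notin> {a, b}" using only jl by blast
        then have j': "j \<noteq> a" "j \<noteq> b" by auto
        have "j \<in> {1..Suc m}" using jl by auto
        note o = ord[OF this j']
        have lt\<sigma>: "I (\<sigma> l) < I j \<longleftrightarrow> I l < I j" "I j < I (\<sigma> l) \<longleftrightarrow> I j < I l" for l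
        proof -
          consider "l = a" | "l = b" | "l \<noteq> a" "l \<noteq> b" by blast
          then show "I (\<sigma> l) < I j \<longleftrightarrow> I l < I j" "I j < I (\<sigma> l) \<longleftrightarrow> I j < I l"
            by (cases; use o in \<open>simp add: sa fixo\<close>)+
        qed
        have "\<sigma> j = j" "\<sigma> l = j \<longleftrightarrow> l = j" using fixo[OF j'] inv by metis+
        then show ?thesis unfolding pos_psi_def o_apply by (simp only: lt\<sigma>)
      qed
    qed
    have rest1: "rest (I \<circ> \<sigma>) w v = rest I w v" for w v
      unfolding rest_def by (intro prod.cong) (auto simp: psi)
    have rest2: "rest I (w \<circ> \<sigma>) v = rest I w v" for w v
      unfolding rest_def
      by (rule prod.reindex_bij_witness[where i = "map_prod id \<sigma>" and j = "map_prod id \<sigma>"])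
         (auto simp: inv S\<sigma> psi)
    have den: "pos_den (I \<circ> \<sigma>) h m v = pos_den I h m v" for v
    proof -
      have "(I \<circ> \<sigma>) i < (I \<circ> \<sigma>) j \<longleftrightarrow> I i < I j" if ij: "i \<in> {1..m}" "j \<in> {1..m}" for i j
      proof (cases "i \<in> {a, b}")
        case True
        show ?thesis
        proof (cases "j \<in> {a, b}")
          case True
          with \<open>i \<in> {a, b}\<close> ij only have "i = j" by metis
          then show ?thesis by simp
        next
          case False
          then show ?thesis using True ij ord[of j] by (auto simp: sa fixo)
        qed
      next
        case i: False
        show ?thesis
        proof (cases "j \<in> {a, b}")
          case True
          then show ?thesis using i ij ord[of i] by (auto simp: sa fixo)
        qed (use i fixo in auto)
      qed
      then show ?thesis unfolding pos_den_def by (intro prod.cong) auto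
    qed
    have local: "th (h + M) * th (w b - w a) *
        (pos_psi (I \<circ> \<sigma>) h \<mu> m c a (w b - x) * pos_psi (I \<circ> \<sigma>) h \<mu> m c b (w a - x))
      = th h * th (w b - w a + M) * (pos_psi I h \<mu> m c a (w a - x) * pos_psi I h \<mu> m c b (w b - x))
      - th (h - w b + w a) * th M * (pos_psi I h \<mu> m c a (w b - x) * pos_psi I h \<mu> m c b (w a - x))" for x
    proof (cases "a = Suc m")
      case True
      then have c': "c = b" by (simp add: c_def)
      show ?thesis
        using exchange_local_first[of h M "w b" "w a" x] Suc.prems(5) neq unfolding c' pos_psi_def
        by (simp add: sa True[symmetric] M_def algebra_simps)
    next
      case False
      then have c': "c = a" "Suc m = b" using last by (auto simp: c_def)
      show ?thesis
        using exchange_local_last[of h M "w b" "w a" x] Suc.prems(5) neq unfolding c' pos_psi_def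
        by (simp add: sa M_def algebra_simps)
    qed
    have G: "th (h + M) * th (w b - w a) * pos_G (I \<circ> \<sigma>) h \<mu> m v (w \<circ> \<sigma>)
      = th h * th (w b - w a + M) * pos_G I h \<mu> m v w
        - th (h - w b + w a) * th M * pos_G I h \<mu> m v (w \<circ> \<sigma>)" for v
    proof -
      have "th (h + M) * th (w b - w a) * pos_G (I \<circ> \<sigma>) h \<mu> m v (w \<circ> \<sigma>)
        = rest I w v / pos_den I h m v * (th (h + M) * th (w b - w a) *
        (pos_psi (I \<circ> \<sigma>) h \<mu> m c a (w b - v c) * pos_psi (I \<circ> \<sigma>) h \<mu> m c b (w a - v c)))"
        unfolding pos_G_def num den rest1 rest2 by (simp add: sa mult_ac)
      also note local
      finally show ?thesis
        unfolding pos_G_def num den rest1 rest2 by (simp add: sa algebra_simps diff_divide_distrib)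
    qed
    have "th (h + M) * th (w b - w a) * pos_W (I \<circ> \<sigma>) h \<mu> t (Suc m) (w \<circ> \<sigma>)
      = (\<Sum>\<pi> | \<pi> permutes {1..m}. pos_W I h \<mu> t m (t m \<circ> \<pi>) *
          (th (h + M) * th (w b - w a) * pos_G (I \<circ> \<sigma>) h \<mu> m (t m \<circ> \<pi>) (w \<circ> \<sigma>)))"
      unfolding pos_W.simps W_eq sum_distrib_left by (simp add: mult_ac)
    also have "\<dots> = th h * th (w b - w a + M) * pos_W I h \<mu> t (Suc m) w
        - th (h - w b + w a) * th M * pos_W I h \<mu> t (Suc m) (w \<circ> \<sigma>)"
      unfolding G pos_W.simps sum_distrib_left sum_subtractf[symmetric]
      by (intro sum.cong refl) (simp add: algebra_simps)
    finally show ?thesis unfolding \<sigma>_def M_def .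
  qed
qed

end

section \<open>Values at the fixed points and their duality\<close>

text \<open>Multiplication is from the left, hence acts on values, as the exchange relation for
  neighbouring values does. A general transposition arises from one of shorter range by conjugation
  with an adjacent one.\<close>

lemma permutes_adjacent_induct [consumes 1, case_names id adjacent]:
  assumes "p permutes {1..n::nat}" and "P id"
    and step: "\<And>k p. k \<in> {1..<n} \<Longrightarrow> p permutes {1..n} \<Longrightarrow> P p \<Longrightarrow> P (Transposition.transpose k (Suc k) \<circ> p)"
  shows "P p"
proof -
  have less: "P (Transposition.transpose a b \<circ> p)"
    if "p permutes {1..n}" "P p" "a \<in> {1..n}" "b \<in> {1..n}" "a < b" for a b p
    using that
  proof (induction "b - a" arbitrary: b p)
    case (Suc d)
    show ?case
    proof (cases "b = Suc a")
      case True
      then show ?thesis using Suc.prems by (auto intro: step)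
    next
      case False
      define c where "c = b - 1"
      have c: "b = Suc c" "a < c" "c \<in> {1..<n}" "c \<in> {1..n}" "d = c - a"
        using Suc.prems(3-5) Suc.hyps(2) False by (auto simp: c_def)
      let ?s = "Transposition.transpose c (Suc c)"
      have perm: "Transposition.transpose i j permutes {1..n}" if "i \<in> {1..n}" "j \<in> {1..n}" for i j
        using that by (rule permutes_swap_id)
      have "?s permutes {1..n}" using c Suc.prems by (intro perm) auto
      then have 1: "?s \<circ> p permutes {1..n}" "P (?s \<circ> p)"
        using Suc.prems c step by (auto intro: permutes_compose)
      have 2: "P (Transposition.transpose a c \<circ> (?s \<circ> p))"
        using Suc.hyps(1)[OF c(5) 1 Suc.prems(3) c(4,2)] .
      have 3: "Transposition.transpose a c \<circ> (?s \<circ> p) permutes {1..n}"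
        using 1(1) perm[OF Suc.prems(3) c(4)] by (rule permutes_compose)
      have 4: "P (?s \<circ> (Transposition.transpose a c \<circ> (?s \<circ> p)))"
        by (rule step[OF c(3) 3 2])
      have "?s \<circ> (Transposition.transpose a c \<circ> (?s \<circ> p)) = Transposition.transpose a b \<circ> p"
        using c(1,2) by (auto simp: fun_eq_iff Transposition.transpose_def)
      with 4 show ?thesis by simp
    qed
  qed auto
  from assms(1) finite_atLeastAtMost show ?thesis
  proof (induction p rule: permutes_induct)
    case (swap a b p)
    show ?case
    proof (cases "a < b")
      case True then show ?thesis using swap less by blast
    next
      case False
      then have "b < a" using swap by auto
      then show ?thesis
        unfolding transpose_commute[of a b] using swap less[of p b a] by blast
    qed
  qed (rule assms(2))
qed

text \<open>Consecutive members of the flag of initial images differ by one value, which is the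
  value of the permutation there.\<close>

lemma permutes_eq_of_initial_images:
  assumes "p permutes {1..n::nat}" "r permutes {1..n}"
    and "\<And>m. m < n \<Longrightarrow> p ` {1..m} = r ` {1..m}"
  shows "p = r"
proof
  fix i
  have img: "p ` {1..m} = r ` {1..m}" if "m \<le> n" for m
    using that assms permutes_image[OF assms(1)] permutes_image[OF assms(2)] by (cases "m = n") auto
  show "p i = r i"
  proof (cases "i \<in> {1..n}")
    case True
    define m where "m = i - 1"
    have m: "i = Suc m" "m < n" using True by (auto simp: m_def)
    have split: "{1..Suc m} = insert (Suc m) {1..m}" by auto
    have "f (Suc m) \<notin> f ` {1..m}" if "inj f" for f :: "nat \<Rightarrow> nat"
      using inj_image_mem_iff[OF that, of "Suc m" "{1..m}"] by simp
    then have "p (Suc m) \<notin> p ` {1..m}" "r (Suc m) \<notin> r ` {1..m}"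
      using permutes_inj assms(1,2) by blast+
    moreover have "insert (p (Suc m)) (p ` {1..m}) = insert (r (Suc m)) (r ` {1..m})"
      using img[of "Suc m"] m unfolding split by auto
    moreover have "p ` {1..m} = r ` {1..m}" using img m by simp
    ultimately have "p (Suc m) = r (Suc m)" by blast
    then show ?thesis using m by simp
  next
    case False
    then show ?thesis using assms(1,2) by (simp add: permutes_not_in)
  qed
qed

lemma pairs_Suc: "{(i, j). i \<in> {1..Suc m} \<and> j \<in> {1..Suc m} \<and> i < j}
    = {(i, j). i \<in> {1..m} \<and> j \<in> {1..m} \<and> i < j} \<union> (\<lambda>i. (i, Suc m)) ` {1..m}"
  by (auto simp: le_Suc_eq)

lemma prod_pairs_Suc:
  "(\<Prod>(i, j) | i \<in> {1..Suc m} \<and> j \<in> {1..Suc m} \<and> i < j. f i j)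
    = (\<Prod>(i, j) | i \<in> {1..m} \<and> j \<in> {1..m} \<and> i < j. f i j) * (\<Prod>i\<in>{1..m}. f i (Suc m))"
proof -
  have "inj_on (\<lambda>i. (i, Suc m)) {1..m}" by (auto simp: inj_on_def)
  moreover have "finite {(i, j). i \<in> {1..m} \<and> j \<in> {1..m} \<and> i < j}"
    by (rule finite_subset[of _ "{1..m} \<times> {1..m}"]) auto
  ultimately show ?thesis
    unfolding pairs_Suc by (subst prod.union_disjoint) (auto simp: prod.reindex)
qed

text \<open>An adjacent transposition permutes the pairs \<open>i < j\<close> other than
  \<open>(k, Suc k)\<close>. The exceptional factors are put on opposite sides, so that no possibly
  vanishing theta is divided by.\<close>

lemma prod_pairs_transpose:
  fixes f :: "nat \<Rightarrow> nat \<Rightarrow> complex"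
  assumes "k \<in> {1..<n}"
  defines "s \<equiv> Transposition.transpose k (Suc k)"
  shows "(\<Prod>(i, j) | i \<in> {1..n} \<and> j \<in> {1..n} \<and> i < j. f (s i) (s j)) * f k (Suc k)
    = (\<Prod>(i, j) | i \<in> {1..n} \<and> j \<in> {1..n} \<and> i < j. f i j) * f (Suc k) k"
proof -
  let ?A = "{(i, j). i \<in> {1..n} \<and> j \<in> {1..n} \<and> i < j}"
  have fin: "finite ?A" by (rule finite_subset[of _ "{1..n} \<times> {1..n}"]) auto
  have sub: "{(k, Suc k)} \<subseteq> ?A" using assms by auto
  have inv: "s (s i) = i" for i by (simp add: s_def)
  have "s i < s j" if "i < j" "(i, j) \<noteq> (k, Suc k)" for i j
    using that by (auto simp: s_def Transposition.transpose_def)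
  moreover have "s i \<in> {1..n} \<longleftrightarrow> i \<in> {1..n}" for i
    using assms by (auto simp: s_def Transposition.transpose_def)
  moreover have "(s i, s j) \<noteq> (k, Suc k)" if "i < j" for i j
    using that by (auto simp: s_def Transposition.transpose_def split: if_splits)
  ultimately have map: "(s i, s j) \<in> ?A - {(k, Suc k)}" if "(i, j) \<in> ?A - {(k, Suc k)}" for i j
    using that by blast
  define B where "B = ?A - {(k, Suc k)}"
  have "(\<Prod>(i, j) \<in> B. f (s i) (s j)) = (\<Prod>(i, j) \<in> B. f i j)"
    by (rule prod.reindex_bij_witness[where i = "map_prod s s" and j = "map_prod s s"])
       (auto simp: inv map[folded B_def])
  moreover have "s k = Suc k" "s (Suc k) = k" by (simp_all add: s_def)
  ultimately show ?thesis
    using prod.subset_diff[OF sub fin, of "\<lambda>(i, j). f (s i) (s j)"]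
      prod.subset_diff[OF sub fin, of "\<lambda>(i, j). f i j"] unfolding B_def by simp
qed

section \<open>Values of weight functions at fixed points\<close>

context nome
begin

definition generic :: "nat \<Rightarrow> complex \<Rightarrow> (nat \<Rightarrow> complex) \<Rightarrow> bool" where
  "generic n h y \<longleftrightarrow> (\<forall>i\<in>{1..n}. \<forall>j\<in>{1..n}. i \<noteq> j \<longrightarrow> th (y i - y j) \<noteq> 0 \<and> th (h + y i - y j) \<noteq> 0)"

lemma genericD: "generic n h y \<Longrightarrow> i \<in> {1..n} \<Longrightarrow> j \<in> {1..n} \<Longrightarrow> i \<noteq> j \<Longrightarrow> th (y i - y j) \<noteq> 0"
    "generic n h y \<Longrightarrow> i \<in> {1..n} \<Longrightarrow> j \<in> {1..n} \<Longrightarrow> i \<noteq> j \<Longrightarrow> th (h + y i - y j) \<noteq> 0"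
  by (auto simp: generic_def)

lemma generic_permute: "generic n h y \<Longrightarrow> p permutes {1..n} \<Longrightarrow> generic n h (y \<circ> p)"
  unfolding generic_def using permutes_in_image[of p "{1..n}"] permutes_inj[of p "{1..n}"]
  by (metis (no_types, lifting) injD o_apply)

lemma generic_minus:
  assumes "generic n h y"
  shows "generic n h (\<lambda>i. - y i)"
  unfolding generic_def
proof (intro ballI impI)
  fix i j assume "i \<in> {1..n}" "j \<in> {1..n}" "i \<noteq> j"
  moreover have e: "- y i - - y j = y j - y i" "h + - y i - - y j = h + y j - y i" by simp_all
  ultimately show "th (- y i - - y j) \<noteq> 0 \<and> th (h + - y i - - y j) \<noteq> 0"
    unfolding e using genericD[OF assms, of j i] by blast
qed

text \<open>The weight function of \<open>J\<close> at the fixed point \<open>N\<close>. The roots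
  are \<open>y \<circ> N\<close> on every level, whereas the top variables are
  \<open>y \<circ> J\<close> because they are indexed by the positions of \<open>J\<close>.\<close>

definition fixed_W ::
  "nat \<Rightarrow> complex \<Rightarrow> (nat \<Rightarrow> nat) \<Rightarrow> (nat \<Rightarrow> nat) \<Rightarrow> (nat \<Rightarrow> complex) \<Rightarrow> (nat \<Rightarrow> complex) \<Rightarrow> complex"
where
  "fixed_W n h J N y \<nu> = pos_W J h \<nu> (\<lambda>_. y \<circ> N) n (y \<circ> J)"

lemma generic_regular: "generic n h y \<Longrightarrow> N permutes {1..n} \<Longrightarrow> regular_roots h (\<lambda>_. y \<circ> N) n"
  using generic_permute[of n h y N] unfolding generic_def regular_roots_def by auto

text \<open>Exchanging the positions of the values \<open>k\<close> and \<open>Suc k\<close> is left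
  multiplication by \<open>s\<close>; the parameters attached to these values are found through
  \<open>inv J\<close>.\<close>

lemma exchange_values:
  fixes \<nu> y :: "nat \<Rightarrow> complex"
  assumes J: "J permutes {1..n}" and k: "k \<in> {1..<n}" and reg: "regular_roots h t n"
  defines "s \<equiv> Transposition.transpose k (Suc k)"
  defines "M \<equiv> \<nu> (inv J (Suc k)) - \<nu> (inv J k)"
  shows "th (h + M) * th (y (Suc k) - y k) * pos_W (s \<circ> J) h \<nu> t n (y \<circ> (s \<circ> J))
    = th h * th (y (Suc k) - y k + M) * pos_W J h \<nu> t n (y \<circ> J)
      - th (h - y (Suc k) + y k) * th M * pos_W J h \<nu> t n (y \<circ> s \<circ> J)"
proof -
  define a b where "a = inv J k" and "b = inv J (Suc k)"
  have Ja: "J a = k" "J b = Suc k" unfolding a_def b_def using permutes_inverses(1)[OF J] by auto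
  have ab: "a \<in> {1..n}" "b \<in> {1..n}"
    using k permutes_in_image[OF J, of a] permutes_in_image[OF J, of b] Ja by auto
  have sJ: "J \<circ> Transposition.transpose a b = s \<circ> J"
  proof
    fix i
    show "(J \<circ> Transposition.transpose a b) i = (s \<circ> J) i"
    proof -
      consider "i = a" | "i = b" | "i \<noteq> a" "i \<noteq> b" by blast
      then show ?thesis
      proof cases
        case 3
        then have "J i \<noteq> k" "J i \<noteq> Suc k" using Ja permutes_inj[OF J] by (metis injD)+
        with 3 show ?thesis by (simp add: s_def)
      qed (simp_all add: s_def Ja)
    qed
  qed
  have "th (h + (\<nu> b - \<nu> a)) * th ((y \<circ> J) b - (y \<circ> J) a) *
      pos_W (J \<circ> Transposition.transpose a b) h \<nu> t n ((y \<circ> J) \<circ> Transposition.transpose a b)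
    = th h * th ((y \<circ> J) b - (y \<circ> J) a + (\<nu> b - \<nu> a)) * pos_W J h \<nu> t n (y \<circ> J)
      - th (h - (y \<circ> J) b + (y \<circ> J) a) * th (\<nu> b - \<nu> a) * pos_W J h \<nu> t n ((y \<circ> J) \<circ> Transposition.transpose a b)"
    by (rule exchange[OF reg permutes_inj_on[OF J] ab]) (auto simp: Ja)
  moreover have "(y \<circ> J) \<circ> Transposition.transpose a b = y \<circ> (s \<circ> J)"
    unfolding sJ[symmetric] by (simp only: o_assoc)
  ultimately show ?thesis
    unfolding M_def a_def[symmetric] b_def[symmetric] sJ by (simp only: o_apply Ja o_assoc)
qed

text \<open>Swapping the top variables amounts to swapping \<open>y\<close> and moving the point, as
  \<open>(y \<circ> s) \<circ> (s \<circ> N) = y \<circ> N\<close>. So the last term is again a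
  value at a fixed point.\<close>

lemma fixed_W_exchange:
  fixes \<nu> y :: "nat \<Rightarrow> complex"
  assumes J: "J permutes {1..n}" and N: "N permutes {1..n}" and k: "k \<in> {1..<n}" and gen: "generic n h y"
  defines "s \<equiv> Transposition.transpose k (Suc k)"
  defines "M \<equiv> \<nu> (inv J (Suc k)) - \<nu> (inv J k)"
  shows "th (h + M) * th (y (Suc k) - y k) * fixed_W n h (s \<circ> J) N y \<nu>
    = th h * th (y (Suc k) - y k + M) * fixed_W n h J N y \<nu>
      - th (h - y (Suc k) + y k) * th M * fixed_W n h J (s \<circ> N) (y \<circ> s) \<nu>"
proof -
  have "y \<circ> s \<circ> (s \<circ> N) = y \<circ> N" by (auto simp: s_def)
  then show ?thesis
    unfolding fixed_W_def M_def s_def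
    by (simp only:) (rule exchange_values[OF J k generic_regular[OF gen N]])
qed

definition diag_factor ::
  "complex \<Rightarrow> (nat \<Rightarrow> nat) \<Rightarrow> (nat \<Rightarrow> complex) \<Rightarrow> (nat \<Rightarrow> complex) \<Rightarrow> nat \<Rightarrow> nat \<Rightarrow> complex"
where
  "diag_factor h J y \<nu> i j =
    (if J i < J j then th (h + \<nu> j - \<nu> i) * th (y (J j) - y (J i))
     else th (\<nu> j - \<nu> i) * th (h + y (J j) - y (J i)))"

text \<open>The numerator factors of \<open>(i, j)\<close> and \<open>(j, i)\<close> with both
  positions at most \<open>m\<close> multiply to a factor of the denominator. What is left are the
  pairs with the last position and those with equal positions.\<close>

lemma pos_G_diagonal:
  assumes J: "J permutes {1..n}" and m: "Suc m \<le> n" and gen: "generic n h y"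
  shows "pos_G J h \<nu> m (y \<circ> J) (y \<circ> J) = (\<Prod>i\<in>{1..m}. diag_factor h J y \<nu> i (Suc m))"
proof -
  define f where "f = (\<lambda>(j, l). pos_psi J h \<nu> m j l (y (J l) - y (J j)))"
  define P where "P = {(i, j). i \<in> {1..m} \<and> j \<in> {1..m} \<and> J i < J j}"
  have finP: "finite P" unfolding P_def by (rule finite_pairs)
  have injJ: "J i = J j \<longleftrightarrow> i = j" for i j using permutes_inj[OF J] by (auto simp: inj_def)
  have split: "{1..m} \<times> {1..Suc m} = (\<lambda>j. (j, Suc m)) ` {1..m} \<union> (\<lambda>j. (j, j)) ` {1..m} \<union> P \<union> prod.swap ` P"
    (is "_ = ?A \<union> ?B \<union> P \<union> ?C")
  proof
    show "{1..m} \<times> {1..Suc m} \<subseteq> ?A \<union> ?B \<union> P \<union> ?C"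
    proof safe
      fix j l assume *: "j \<in> {1..m}" "l \<in> {1..Suc m}" "(j, l) \<notin> prod.swap ` P" "(j, l) \<notin> P" "(j, l) \<notin> ?B"
      then have "l \<noteq> j" by auto
      then have "J l \<noteq> J j" by (simp add: injJ)
      have "\<not> l \<le> m"
      proof
        assume "l \<le> m"
        then have "(j, l) \<in> P \<or> (l, j) \<in> P" using * \<open>J l \<noteq> J j\<close> by (auto simp: P_def)
        then show False using * by (metis image_eqI swap_simp)
      qed
      then have "l = Suc m" using * by auto
      then show "(j, l) \<in> ?A" using * by auto
    qed
  qed (auto simp: P_def)
  have disj: "?A \<inter> ?B = {}" "(?A \<union> ?B) \<inter> P = {}" "(?A \<union> ?B \<union> P) \<inter> ?C = {}"
    by (auto simp: P_def)
  have "pos_num J h \<nu> m (y \<circ> J) (y \<circ> J) = prod f ({1..m} \<times> {1..Suc m})"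
    unfolding pos_num_def f_def by simp
  also have "\<dots> = prod f ?A * prod f ?B * prod f P * prod f ?C"
    unfolding split using finP disj by (simp add: prod.union_disjoint)
  also have "prod f ?A = (\<Prod>j\<in>{1..m}. f (j, Suc m))" by (simp add: prod.reindex inj_on_def)
  also have "prod f ?B = (\<Prod>j\<in>{1..m}. f (j, j))" by (simp add: prod.reindex inj_on_def)
  also have "prod f ?C = (\<Prod>x\<in>P. f (prod.swap x))" by (subst prod.reindex) (auto simp: inj_on_def)
  finally have "pos_num J h \<nu> m (y \<circ> J) (y \<circ> J)
      = (\<Prod>j\<in>{1..m}. f (j, Suc m) * f (j, j)) * (\<Prod>x\<in>P. f x * f (prod.swap x))"
    by (simp only: prod.distrib mult.assoc)
  also have "(\<Prod>x\<in>P. f x * f (prod.swap x)) = pos_den J h m (y \<circ> J)"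
    unfolding pos_den_def P_def[symmetric]
    by (intro prod.cong refl) (auto simp: P_def f_def pos_psi_def mult.commute algebra_simps)
  also have "(\<Prod>j\<in>{1..m}. f (j, Suc m) * f (j, j)) = (\<Prod>i\<in>{1..m}. diag_factor h J y \<nu> i (Suc m))"
  proof (intro prod.cong refl)
    fix j assume "j \<in> {1..m}"
    then have "J (Suc m) \<noteq> J j" unfolding injJ by auto
    then show "f (j, Suc m) * f (j, j) = diag_factor h J y \<nu> j (Suc m)"
      using \<open>j \<in> {1..m}\<close> by (auto simp: f_def pos_psi_def diag_factor_def algebra_simps)
  qed
  finally have num: "pos_num J h \<nu> m (y \<circ> J) (y \<circ> J)
    = (\<Prod>i\<in>{1..m}. diag_factor h J y \<nu> i (Suc m)) * pos_den J h m (y \<circ> J)" .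
  have "pos_den J h m (y \<circ> J) \<noteq> 0"
  proof -
    have "th (h + (y \<circ> J) i - (y \<circ> J) j) * th ((y \<circ> J) j - (y \<circ> J) i) \<noteq> 0" if "(i, j) \<in> P" for i j
    proof -
      have "i \<in> {1..n}" "j \<in> {1..n}" "J i < J j" using that m by (auto simp: P_def)
      then have "J i \<in> {1..n}" "J j \<in> {1..n}" "J i \<noteq> J j"
        unfolding permutes_in_image[OF J] by simp_all
      then show ?thesis using genericD(1)[OF gen, of "J j" "J i"] genericD(2)[OF gen, of "J i" "J j"]
        by (simp del: atLeastAtMost_iff)
    qed
    then have "\<forall>x\<in>P. (case x of (i, j) \<Rightarrow> th (h + (y \<circ> J) i - (y \<circ> J) j) * th ((y \<circ> J) j - (y \<circ> J) i)) \<noteq> 0"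
      by fast
    then show ?thesis unfolding pos_den_def P_def[symmetric] prod_zero_iff[OF finP] by blast
  qed
  then show ?thesis unfolding pos_G_def num by (rule nonzero_mult_div_cancel_right)
qed

text \<open>A lower root that equals a top variable of larger value produces the factor
  \<open>th 0\<close>.\<close>

lemma pos_G_nonzero_le:
  assumes "pos_G J h \<nu> m v (y \<circ> J) \<noteq> 0" and "j \<in> {1..m}" "l \<in> {1..Suc m}" "v j = y (J l)"
  shows "J l \<le> J j"
proof (rule ccontr)
  assume "\<not> J l \<le> J j"
  then have "pos_psi J h \<nu> m j l ((y \<circ> J) l - v j) = 0"
    using assms(4) by (auto simp: pos_psi_def)
  then have "pos_num J h \<nu> m v (y \<circ> J) = 0"
    unfolding pos_num_def using assms(2,3) by (intro prod_zero bexI[of _ "(j, l)"]) auto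
  with assms(1) show False by (simp add: pos_G_def)
qed

text \<open>In a nonzero term of the symmetrisation every root \<open>y (N (\<pi> j))\<close> sits at a position whose
  value is at least \<open>N (\<pi> j)\<close>; the dominance hypothesis turns these inequalities into equalities.\<close>

lemma pos_W_dominant:
  assumes J: "J permutes {1..n}" and N: "N permutes {1..n}" and gen: "generic n h y"
    and dom: "\<And>k. k < n \<Longrightarrow> (\<Sum>j\<in>{1..k}. J j) \<le> (\<Sum>j\<in>{1..k}. N j)"
    and "m \<le> n" "N ` {1..m} = J ` {1..m}"
  shows "pos_W J h \<nu> (\<lambda>_. y \<circ> N) m (y \<circ> J) =
    (if \<forall>k<m. N ` {1..k} = J ` {1..k}
     then \<Prod>(i, j) | i \<in> {1..m} \<and> j \<in> {1..m} \<and> i < j. diag_factor h J y \<nu> i j else 0)"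
  using assms(5,6)
proof (induction m)
  case (Suc m)
  let ?G = "\<lambda>\<pi>. pos_G J h \<nu> m (y \<circ> N \<circ> \<pi>) (y \<circ> J)"
  have injN: "N i = N j \<longleftrightarrow> i = j" for i j using permutes_inj[OF N] by (auto simp: inj_def)
  have key: "\<forall>j\<in>{1..m}. N (\<pi> j) = J j" if \<pi>: "\<pi> permutes {1..m}" and nz: "?G \<pi> \<noteq> 0" for \<pi>
  proof -
    have le: "N (\<pi> j) \<le> J j" if j: "j \<in> {1..m}" for j
    proof -
      have "\<pi> j \<in> {1..m}" using permutes_in_image[OF \<pi>] j by blast
      then have "N (\<pi> j) \<in> N ` {1..Suc m}" by auto
      then obtain l where l: "l \<in> {1..Suc m}" "N (\<pi> j) = J l" unfolding Suc.prems(2) by auto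
      with pos_G_nonzero_le[OF nz j l(1)] show ?thesis by simp
    qed
    have "(\<Sum>j\<in>{1..m}. N (\<pi> j)) = (\<Sum>j\<in>{1..m}. N j)"
      using sum.permute[OF \<pi>, of N] by (simp add: o_def)
    also have "\<dots> \<ge> (\<Sum>j\<in>{1..m}. J j)" using dom[of m] Suc.prems(1) by simp
    finally have "(\<Sum>j\<in>{1..m}. N (\<pi> j)) = (\<Sum>j\<in>{1..m}. J j)"
      using sum_mono[of "{1..m}" "\<lambda>j. N (\<pi> j)" J] le by simp
    from sum_mono_inv[OF this le] show ?thesis by blast
  qed
  show ?case
  proof (cases "N ` {1..m} = J ` {1..m}")
    case False
    have "?G \<pi> = 0" if \<pi>: "\<pi> permutes {1..m}" for \<pi>
    proof (rule ccontr)
      assume "?G \<pi> \<noteq> 0"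
      from key[OF \<pi> this] have "J ` {1..m} = (\<lambda>j. N (\<pi> j)) ` {1..m}" by (intro image_cong) auto
      then have "J ` {1..m} = N ` \<pi> ` {1..m}" by (simp add: image_image)
      with permutes_image[OF \<pi>] False show False by simp
    qed
    then have "pos_W J h \<nu> (\<lambda>_. y \<circ> N) (Suc m) (y \<circ> J) = 0"
      unfolding pos_W.simps by (intro sum.neutral) simp
    moreover have "\<not> (\<forall>k<Suc m. N ` {1..k} = J ` {1..k})" using False by blast
    ultimately show ?thesis by (simp only: if_False)
  next
    case True
    \<comment> \<open>The only permutation that survives: it moves the root with index
      \<open>J j\<close> to position \<open>j\<close>.\<close>
    define \<pi>0 where "\<pi>0 i = (if i \<in> {1..m} then inv N (J i) else i)" for i
    have N\<pi>0: "N (\<pi>0 j) = J j" if "j \<in> {1..m}" for j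
      using that permutes_inverses(1)[OF N] by (simp add: \<pi>0_def)
    have \<pi>0: "\<pi>0 permutes {1..m}"
    proof (rule bij_imp_permutes)
      have "inj_on \<pi>0 {1..m}"
        using N\<pi>0 permutes_inj[OF J] by (metis (no_types, lifting) injD inj_onI)
      moreover have "\<pi>0 ` {1..m} \<subseteq> {1..m}"
      proof safe
        fix j assume j: "j \<in> {1..m}"
        then obtain i where i: "i \<in> {1..m}" "J j = N i" using True by (metis imageE imageI)
        then have "\<pi>0 j = i" using N\<pi>0[OF j] injN by metis
        with i show "\<pi>0 j \<in> {1..m}" by simp
      qed
      ultimately show "bij_betw \<pi>0 {1..m} {1..m}"
        by (simp add: bij_betw_def endo_inj_surj)
    qed (simp only: \<pi>0_def if_False)
    have unique: "\<pi> = \<pi>0" if \<pi>: "\<pi> permutes {1..m}" and "?G \<pi> \<noteq> 0" for \<pi>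
    proof
      fix i show "\<pi> i = \<pi>0 i"
        using key[OF that] N\<pi>0 injN permutes_not_in[OF \<pi>, of i] permutes_not_in[OF \<pi>0, of i]
        by (cases "i \<in> {1..m}") metis+
    qed
    have "pos_W J h \<nu> (\<lambda>_. y \<circ> N) (Suc m) (y \<circ> J)
        = (\<Sum>\<pi> | \<pi> permutes {1..m}. if \<pi> = \<pi>0 then pos_W J h \<nu> (\<lambda>_. y \<circ> N) m (y \<circ> N \<circ> \<pi>0) * ?G \<pi>0 else 0)"
      unfolding pos_W.simps using unique by (intro sum.cong refl) auto
    also have "\<dots> = pos_W J h \<nu> (\<lambda>_. y \<circ> N) m (y \<circ> N \<circ> \<pi>0) * ?G \<pi>0"
      using \<pi>0 by (simp add: finite_permutations)
    also have "pos_W J h \<nu> (\<lambda>_. y \<circ> N) m (y \<circ> N \<circ> \<pi>0) = pos_W J h \<nu> (\<lambda>_. y \<circ> N) m (y \<circ> J)"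
      using N\<pi>0 by (intro pos_W_cong) auto
    also have "?G \<pi>0 = pos_G J h \<nu> m (y \<circ> J) (y \<circ> J)"
      using N\<pi>0 by (intro pos_G_cong) auto
    also have "\<dots> = (\<Prod>i\<in>{1..m}. diag_factor h J y \<nu> i (Suc m))"
      by (rule pos_G_diagonal[OF J Suc.prems(1) gen])
    also have "pos_W J h \<nu> (\<lambda>_. y \<circ> N) m (y \<circ> J) = (if \<forall>k<m. N ` {1..k} = J ` {1..k}
       then \<Prod>(i, j) | i \<in> {1..m} \<and> j \<in> {1..m} \<and> i < j. diag_factor h J y \<nu> i j else 0)"
      using Suc.prems(1) by (intro Suc.IH True) simp
    finally have step: "pos_W J h \<nu> (\<lambda>_. y \<circ> N) (Suc m) (y \<circ> J) = (if \<forall>k<m. N ` {1..k} = J ` {1..k}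
       then \<Prod>(i, j) | i \<in> {1..m} \<and> j \<in> {1..m} \<and> i < j. diag_factor h J y \<nu> i j else 0)
       * (\<Prod>i\<in>{1..m}. diag_factor h J y \<nu> i (Suc m))" .
    have all: "(\<forall>k<Suc m. N ` {1..k} = J ` {1..k}) \<longleftrightarrow> (\<forall>k<m. N ` {1..k} = J ` {1..k})"
      unfolding All_less_Suc by (simp only: True simp_thms)
    have if_mult: "(if b then u else 0) * v = (if b then u * v else 0)" for b and u v :: complex by simp
    show ?thesis unfolding step prod_pairs_Suc all by (rule if_mult)
  qed
qed simp

lemma fixed_W_dominant:
  assumes J: "J permutes {1..n}" and N: "N permutes {1..n}" and gen: "generic n h y"
    and dom: "\<And>k. k < n \<Longrightarrow> (\<Sum>j\<in>{1..k}. J j) \<le> (\<Sum>j\<in>{1..k}. N j)"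
  shows "fixed_W n h J N y \<nu> =
    (if N = J then \<Prod>(i, j) | i \<in> {1..n} \<and> j \<in> {1..n} \<and> i < j. diag_factor h J y \<nu> i j else 0)"
proof -
  have "N ` {1..n} = J ` {1..n}" using permutes_image[OF J] permutes_image[OF N] by simp
  moreover have "(\<forall>k<n. N ` {1..k} = J ` {1..k}) \<longleftrightarrow> N = J"
    using permutes_eq_of_initial_images[OF N J] by auto
  ultimately show ?thesis
    using pos_W_dominant[OF J N gen dom, of n \<nu>] unfolding fixed_W_def by auto
qed

text \<open>The identity has the smallest initial sums, since \<open>m\<close> distinct positive
  integers add up to at least 1 + ... + m. Hence it is dominated by every point.\<close>

lemma fixed_W_id:
  assumes N: "N permutes {1..n}" and gen: "generic n h y"
  shows "fixed_W n h id N y \<nu> = (if N = id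
    then \<Prod>(i, j) | i \<in> {1..n} \<and> j \<in> {1..n} \<and> i < j. th (h + \<nu> j - \<nu> i) * th (y j - y i) else 0)"
proof -
  have le: "\<Sum>{1..card A} \<le> \<Sum>A" if "finite A" "0 \<notin> A" for A :: "nat set"
    using that
  proof (induction "card A" arbitrary: A)
    case (Suc c)
    then have ne: "A \<noteq> {}" by auto
    let ?A = "A - {Max A}"
    have Max: "Max A \<in> A" using Suc ne by (intro Max_in) auto
    have cA: "card ?A = c" using Suc Max by simp
    have "A \<subseteq> {1..Max A}" using Suc by (auto simp: Suc_le_eq intro: gr0I)
    then have "card A \<le> Max A" using card_mono[of "{1..Max A}" A] by simp
    moreover have "\<Sum>{1..card ?A} \<le> \<Sum>?A" using Suc cA by (intro Suc.hyps) auto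
    moreover have "\<Sum>A = Max A + \<Sum>?A" using Suc Max by (simp add: sum.remove)
    moreover have "\<Sum>{1..Suc c} = Suc c + \<Sum>{1..c}" by simp
    ultimately show ?case using cA Suc(2) by simp
  qed simp
  have dom: "(\<Sum>j\<in>{1..m}. id j) \<le> (\<Sum>j\<in>{1..m}. N j)" if "m < n" for m
  proof -
    have "0 \<notin> N ` {1..m}"
    proof
      assume "0 \<in> N ` {1..m}"
      then obtain j where "j \<in> {1..m}" "N j = 0" by auto
      then show False using permutes_in_image[OF N, of j] \<open>m < n\<close> by auto
    qed
    then have "\<Sum>{1..card (N ` {1..m})} \<le> \<Sum> (N ` {1..m})" by (intro le) auto
    moreover have "(\<Sum>j\<in>{1..m}. N j) = \<Sum> (N ` {1..m})"
      using permutes_inj_on[OF N] by (simp add: sum.reindex)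
    moreover have "card (N ` {1..m}) = m"
      using permutes_inj_on[OF N] by (simp add: card_image)
    ultimately show ?thesis by simp
  qed
  note * = fixed_W_dominant[where J = id, OF permutes_id N gen dom, of \<nu>]
  have "(\<Prod>(i, j) | i \<in> {1..n} \<and> j \<in> {1..n} \<and> i < j. diag_factor h id y \<nu> i j)
      = (\<Prod>(i, j) | i \<in> {1..n} \<and> j \<in> {1..n} \<and> i < j. th (h + \<nu> j - \<nu> i) * th (y j - y i))"
    by (intro prod.cong refl) (auto simp: diag_factor_def)
  with * show ?thesis by simp
qed

text \<open>Follows from the exchange relation in \<open>J\<close> because the coefficients of either relation are
  invariant under the other one.\<close>

lemma fixed_W_exchange_point:
  fixes h :: complex
  assumes J: "J permutes {1..n}" and N: "N permutes {1..n}" and k: "k \<in> {1..<n}"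
    and gen: "generic n h y" and gen\<nu>: "generic n h \<nu>"
  defines "s \<equiv> Transposition.transpose k (Suc k)"
  shows "th (h + (y (N (Suc k)) - y (N k))) * th (\<nu> k - \<nu> (Suc k)) * fixed_W n h J (N \<circ> s) y \<nu>
    = th h * th (\<nu> k - \<nu> (Suc k) + (y (N (Suc k)) - y (N k))) * fixed_W n h J N y \<nu>
      - th (h - \<nu> k + \<nu> (Suc k)) * th (y (N (Suc k)) - y (N k)) * fixed_W n h (J \<circ> s) N y (\<nu> \<circ> s)"
  using J N gen
proof (induction J arbitrary: N y rule: permutes_adjacent_induct)
  case id
  have s: "s permutes {1..n}" unfolding s_def using k by (intro permutes_swap_id) auto
  have sk: "s k = Suc k" "s (Suc k) = k" by (simp_all add: s_def)
  have ss: "s \<circ> s = id" by (simp add: s_def)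
  have kn: "k \<in> {1..n}" "Suc k \<in> {1..n}" using k by auto
  define M where "M = \<nu> k - \<nu> (Suc k)"
  define D where "D y \<nu> = (\<Prod>(i, j) | i \<in> {1..n} \<and> j \<in> {1..n} \<and> i < j. th (h + \<nu> j - \<nu> i) * th (y j - y i))"
    for y \<nu> :: "nat \<Rightarrow> complex"
  have W_id: "fixed_W n h id N y \<nu> = (if N = id then D y \<nu> else 0)"
    if N: "N permutes {1..n}" and y: "generic n h y" for N y \<nu>
    unfolding D_def by (rule fixed_W_id[OF N y])
  have D_\<nu>: "D y (\<nu> \<circ> s) * th (h - M) = D y \<nu> * th (h + M)" for y
    using prod_pairs_transpose[OF k, of "\<lambda>i j. th (h + \<nu> j - \<nu> i)", folded s_def]
    unfolding D_def M_def by (simp add: case_prod_unfold prod.distrib algebra_simps)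
  have D_y: "D (y \<circ> s) \<nu>' = - D y \<nu>'" if "generic n h y" for y \<nu>'
  proof -
    have "D (y \<circ> s) \<nu>' * th (y (Suc k) - y k) = D y \<nu>' * th (y k - y (Suc k))"
      using prod_pairs_transpose[OF k, of "\<lambda>i j. th (y j - y i)", folded s_def]
      unfolding D_def by (simp add: case_prod_unfold prod.distrib algebra_simps)
    then have "D (y \<circ> s) \<nu>' * th (y (Suc k) - y k) = - D y \<nu>' * th (y (Suc k) - y k)"
      using th_diff_commute[of "y k" "y (Suc k)"] by simp
    moreover have "th (y (Suc k) - y k) \<noteq> 0" using genericD(1)[OF that, of "Suc k" k] kn by simp
    ultimately show ?thesis by (metis mult_right_cancel)
  qed
  have hM: "th (h + M) \<noteq> 0" "th (h - M) \<noteq> 0"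
    using genericD(2)[OF gen\<nu>, of k "Suc k"] genericD(2)[OF gen\<nu>, of "Suc k" k] kn
    unfolding M_def by (simp_all add: algebra_simps)
  define Y where "Y = y (Suc k) - y k"
  have Y: "th Y \<noteq> 0" unfolding Y_def using genericD(1)[OF id(2), of "Suc k" k] kn by simp
  \<comment> \<open>The values for the index \<open>s\<close> come from the known ones for
    \<open>id\<close> by \<open>fixed_W_exchange\<close>; the claim is then checked for
    \<open>N = id\<close>, for \<open>N = s\<close> and for all other \<open>N\<close>.\<close>
  have exch: "th (h + M) * th Y * fixed_W n h (id \<circ> s) N y (\<nu> \<circ> s)
    = th h * th (Y + M) * fixed_W n h id N y (\<nu> \<circ> s)
      - th (h - Y) * th M * fixed_W n h id (s \<circ> N) (y \<circ> s) (\<nu> \<circ> s)"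
    using fixed_W_exchange[OF permutes_id id(1) k id(2), of "\<nu> \<circ> s"]
    by (simp add: M_def Y_def s_def[symmetric] sk algebra_simps)
  have sN: "s \<circ> N permutes {1..n}" using id(1) s by (rule permutes_compose)
  have Ns: "N \<circ> s permutes {1..n}" using s id(1) by (rule permutes_compose)
  consider "N = id" | "N = s" | "N \<noteq> id" "N \<noteq> s" by blast
  then show ?case
  proof cases
    case 1
    have sid: "s \<noteq> id" using sk by (metis id_apply n_not_Suc_n)
    have "th (h + M) * th Y * fixed_W n h (id \<circ> s) N y (\<nu> \<circ> s) = th h * th (Y + M) * D y (\<nu> \<circ> s)"
      unfolding exch unfolding W_id[OF id(1,2)] W_id[OF sN generic_permute[OF id(2) s]] using 1 sid by simp
    then have "th (h + M) * (th Y * fixed_W n h (id \<circ> s) N y (\<nu> \<circ> s) * th (h - M))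
        = th h * th (Y + M) * (D y (\<nu> \<circ> s) * th (h - M))" by (simp add: mult_ac)
    also have "\<dots> = th (h + M) * (th h * th (Y + M) * D y \<nu>)" unfolding D_\<nu> by (simp add: mult_ac)
    finally have "th Y * fixed_W n h (id \<circ> s) N y (\<nu> \<circ> s) * th (h - M) = th h * th (Y + M) * D y \<nu>"
      using hM by simp
    then have F: "th (h - M) * th Y * fixed_W n h (id \<circ> s) N y (\<nu> \<circ> s) = th h * th (Y + M) * D y \<nu>"
      by (simp only: mult_ac)
    have NY: "y (N (Suc k)) - y (N k) = Y" "\<nu> k - \<nu> (Suc k) + Y = Y + M" "h - \<nu> k + \<nu> (Suc k) = h - M"
      using 1 by (simp_all add: Y_def M_def)
    have Nid: "(N = id) = True" "(N \<circ> s = id) = False" using 1 sid by auto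
    show ?thesis
      unfolding NY W_id[OF id(1,2)] W_id[OF Ns id(2)] F unfolding NY Nid if_True if_False F by simp
  next
    case 2
    have sid: "s \<noteq> id" using sk by (metis id_apply n_not_Suc_n)
    have NY: "y (N (Suc k)) - y (N k) = - Y" using 2 by (simp add: sk Y_def)
    have "th (h + M) * th Y * fixed_W n h (id \<circ> s) N y (\<nu> \<circ> s) = th (h - Y) * th M * D y (\<nu> \<circ> s)"
      unfolding exch unfolding W_id[OF id(1,2)] W_id[OF sN generic_permute[OF id(2) s]] D_y[OF id(2)]
      using 2 sid ss by simp
    then have "th (h + M) * (th Y * fixed_W n h (id \<circ> s) N y (\<nu> \<circ> s) * th (h - M))
        = th (h - Y) * th M * (D y (\<nu> \<circ> s) * th (h - M))" by (simp add: mult_ac)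
    also have "\<dots> = th (h + M) * (th (h - Y) * th M * D y \<nu>)" unfolding D_\<nu> by (simp add: mult_ac)
    finally have "th Y * fixed_W n h (id \<circ> s) N y (\<nu> \<circ> s) * th (h - M) = th (h - Y) * th M * D y \<nu>"
      using hM by simp
    then have F: "th (h - M) * th Y * fixed_W n h (id \<circ> s) N y (\<nu> \<circ> s) = th (h - Y) * th M * D y \<nu>"
      by (simp only: mult_ac)
    have e: "h + - Y = h - Y" "\<nu> k - \<nu> (Suc k) = M" "h - \<nu> k + \<nu> (Suc k) = h - M" by (simp_all add: M_def)
    have Nid: "(N = id) = False" "(N \<circ> s = id) = True" using 2 sid ss by auto
    show ?thesis
      unfolding NY e W_id[OF id(1,2)] W_id[OF Ns id(2)] Nid if_True if_False th_minus
        mult_minus_right mult_minus_left F by simp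
  next
    case 3
    have "s \<circ> N \<noteq> id"
    proof
      assume "s \<circ> N = id"
      then have "s \<circ> s \<circ> N = s" by (simp add: comp_assoc)
      with ss 3 show False by simp
    qed
    moreover have "N \<circ> s \<noteq> id"
    proof
      assume "N \<circ> s = id"
      then have "N \<circ> (s \<circ> s) = s" by (simp add: o_assoc)
      with ss 3 show False by simp
    qed
    ultimately have "th (h + M) * th Y * fixed_W n h (id \<circ> s) N y (\<nu> \<circ> s) = 0"
      unfolding exch unfolding W_id[OF id(1,2)] W_id[OF sN generic_permute[OF id(2) s]] using 3 by simp
    then have F: "fixed_W n h (id \<circ> s) N y (\<nu> \<circ> s) = 0" using hM Y by simp
    have Nid: "(N = id) = False" "(N \<circ> s = id) = False" using 3 \<open>N \<circ> s \<noteq> id\<close> by auto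
    show ?thesis unfolding W_id[OF id(1,2)] W_id[OF Ns id(2)] Nid if_False F by simp
  qed
next
  case (adjacent j J N y)
  define r where "r = Transposition.transpose j (Suc j)"
  have s: "s permutes {1..n}" unfolding s_def using k by (intro permutes_swap_id) auto
  have r: "r permutes {1..n}" unfolding r_def using adjacent(1) by (intro permutes_swap_id) auto
  have rr: "r (r i) = i" and ss: "s (s i) = i" for i by (simp_all add: r_def s_def)
  have inv: "inv (J \<circ> s) i = s (inv J i)" for i
  proof -
    have "(J \<circ> s) (s (inv J i)) = i" using permutes_inverses(1)[OF adjacent(2)] by (simp add: ss)
    then show ?thesis using permutes_inj[OF permutes_compose[OF s adjacent(2)]] by (metis inv_f_f)
  qed
  define M where "M = \<nu> (inv J (Suc j)) - \<nu> (inv J j)"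
  have M': "(\<nu> \<circ> s) (inv (J \<circ> s) (Suc j)) - (\<nu> \<circ> s) (inv (J \<circ> s) j) = M"
    by (simp add: M_def inv ss)
  define A where "A = th (h + M) * th (y (Suc j) - y j)"
  define B where "B = th h * th (y (Suc j) - y j + M)"
  define C where "C = th (h - y (Suc j) + y j) * th M"
  have sN: "N \<circ> s permutes {1..n}" using s adjacent(4) by (rule permutes_compose)
  have Js: "J \<circ> s permutes {1..n}" using s adjacent(2) by (rule permutes_compose)
  have rN: "r \<circ> N permutes {1..n}" using adjacent(4) r by (rule permutes_compose)
  have gr: "generic n h (y \<circ> r)" using adjacent(5) r by (rule generic_permute)
  have nz: "A \<noteq> 0"
  proof -
    have "inv J (Suc j) \<in> {1..n}" "inv J j \<in> {1..n}" "inv J (Suc j) \<noteq> inv J j"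
      using permutes_in_image[OF permutes_inv[OF adjacent(2)]] adjacent(1)
        inj_eq[OF permutes_inj[OF permutes_inv[OF adjacent(2)]]] by auto
    then have "th (h + \<nu> (inv J (Suc j)) - \<nu> (inv J j)) \<noteq> 0" by (rule genericD(2)[OF gen\<nu>])
    moreover have "th (y (Suc j) - y j) \<noteq> 0" using genericD(1)[OF adjacent(5), of "Suc j" j] adjacent(1) by auto
    ultimately show ?thesis by (simp add: A_def M_def algebra_simps)
  qed
  have e1: "A * fixed_W n h (r \<circ> J) N y \<nu>
      = B * fixed_W n h J N y \<nu> - C * fixed_W n h J (r \<circ> N) (y \<circ> r) \<nu>"
    unfolding A_def B_def C_def M_def r_def
    by (rule fixed_W_exchange[OF adjacent(2,4,1,5)])
  have e2: "A * fixed_W n h (r \<circ> J) (N \<circ> s) y \<nu>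
      = B * fixed_W n h J (N \<circ> s) y \<nu> - C * fixed_W n h J (r \<circ> (N \<circ> s)) (y \<circ> r) \<nu>"
    unfolding A_def B_def C_def M_def r_def
    by (rule fixed_W_exchange[OF adjacent(2) sN adjacent(1,5)])
  have e3: "A * fixed_W n h (r \<circ> (J \<circ> s)) N y (\<nu> \<circ> s)
      = B * fixed_W n h (J \<circ> s) N y (\<nu> \<circ> s) - C * fixed_W n h (J \<circ> s) (r \<circ> N) (y \<circ> r) (\<nu> \<circ> s)"
    unfolding A_def B_def C_def M'[symmetric] r_def
    by (rule fixed_W_exchange[OF Js adjacent(4,1,5)])
  define d where "d = y (N (Suc k)) - y (N k)"
  define X where "X = th (h + d) * th (\<nu> k - \<nu> (Suc k))"
  define Y where "Y = th h * th (\<nu> k - \<nu> (Suc k) + d)"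
  define Z where "Z = th (h - \<nu> k + \<nu> (Suc k)) * th d"
  have i1: "X * fixed_W n h J (N \<circ> s) y \<nu> = Y * fixed_W n h J N y \<nu> - Z * fixed_W n h (J \<circ> s) N y (\<nu> \<circ> s)"
    unfolding X_def Y_def Z_def d_def by (rule adjacent.IH[OF adjacent(4,5)])
  have i2: "X * fixed_W n h J (r \<circ> (N \<circ> s)) (y \<circ> r) \<nu>
      = Y * fixed_W n h J (r \<circ> N) (y \<circ> r) \<nu> - Z * fixed_W n h (J \<circ> s) (r \<circ> N) (y \<circ> r) (\<nu> \<circ> s)"
  proof -
    have yr: "(y \<circ> r) ((r \<circ> N) i) = y (N i)" for i by (simp add: rr)
    show ?thesis using adjacent.IH[OF rN gr]
      unfolding X_def Y_def Z_def d_def yr comp_assoc .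
  qed
  \<comment> \<open>Either order of applying the two relations leads to the same four values.
    Genericity makes \<open>A\<close> nonzero, so it can be cancelled.\<close>
  have "A * (X * fixed_W n h (r \<circ> J) (N \<circ> s) y \<nu>)
      = B * (X * fixed_W n h J (N \<circ> s) y \<nu>) - C * (X * fixed_W n h J (r \<circ> (N \<circ> s)) (y \<circ> r) \<nu>)"
    using arg_cong[OF e2, of "\<lambda>u. X * u"] by (simp only: right_diff_distrib mult_ac)
  also have "\<dots> = Y * (B * fixed_W n h J N y \<nu> - C * fixed_W n h J (r \<circ> N) (y \<circ> r) \<nu>)
      - Z * (B * fixed_W n h (J \<circ> s) N y (\<nu> \<circ> s) - C * fixed_W n h (J \<circ> s) (r \<circ> N) (y \<circ> r) (\<nu> \<circ> s))"
    unfolding i1 i2 by (simp only: algebra_simps)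
  also have "\<dots> = A * (Y * fixed_W n h (r \<circ> J) N y \<nu> - Z * fixed_W n h (r \<circ> (J \<circ> s)) N y (\<nu> \<circ> s))"
    unfolding e1[symmetric] e3[symmetric] by (simp only: algebra_simps)
  finally have "X * fixed_W n h (r \<circ> J) (N \<circ> s) y \<nu>
      = Y * fixed_W n h (r \<circ> J) N y \<nu> - Z * fixed_W n h (r \<circ> (J \<circ> s)) N y (\<nu> \<circ> s)"
    using nz by simp
  then show ?case unfolding X_def Y_def Z_def d_def r_def by (simp only: o_assoc)
qed

lemma permutes_longest: "longest_perm n permutes {1..n}"
proof (rule bij_imp_permutes)
  show "bij_betw (longest_perm n) {1..n} {1..n}"
    by (rule bij_betwI[where g = "longest_perm n"]) (auto simp: longest_perm_def)
qed (auto simp: longest_perm_def)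

lemma longest_involution: "longest_perm n (longest_perm n i) = i"
  by (auto simp: longest_perm_def)

text \<open>The longest permutation has the largest initial sums, so as a point it dominates every
  \<open>J\<close>.\<close>

lemma fixed_W_longest:
  assumes J: "J permutes {1..n}" and gen: "generic n h y"
  shows "fixed_W n h J (longest_perm n) y \<nu> =
    (if longest_perm n = J then \<Prod>(i, j) | i \<in> {1..n} \<and> j \<in> {1..n} \<and> i < j. diag_factor h J y \<nu> i j else 0)"
proof (rule fixed_W_dominant[OF J permutes_longest gen])
  fix k assume "k < n"
  have le: "\<Sum>A \<le> (\<Sum>j\<in>{1..card A}. n + 1 - j)" if "A \<subseteq> {1..n}" for A :: "nat set"
    using that
  proof (induction "card A" arbitrary: A)
    case (Suc c)
    then have fin: "finite A" and ne: "A \<noteq> {}" using finite_subset by auto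
    let ?A = "A - {Min A}"
    have Min: "Min A \<in> A" using fin ne by (rule Min_in)
    have cA: "card ?A = c" using Suc Min fin by simp
    have "A \<subseteq> {Min A..n}" using Suc fin by auto
    then have "card A \<le> n + 1 - Min A" using card_mono[of "{Min A..n}" A] by simp
    then have "Min A \<le> n + 1 - Suc c" using Suc(2) by simp
    moreover have "\<Sum>?A \<le> (\<Sum>j\<in>{1..card ?A}. n + 1 - j)" using Suc cA by (intro Suc.hyps) auto
    moreover have "\<Sum>A = Min A + \<Sum>?A" using fin Min by (simp add: sum.remove)
    ultimately have "\<Sum>A \<le> (n + 1 - Suc c) + (\<Sum>j\<in>{1..c}. n + 1 - j)" unfolding cA by simp
    also have "\<dots> = (\<Sum>j\<in>{1..Suc c}. n + 1 - j)" by simp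
    finally show ?case unfolding Suc(2) .
  next
    case 0
    then have "finite A" using finite_subset[of A "{1..n}"] by simp
    with 0 show ?case by simp
  qed
  have "(\<Sum>j\<in>{1..k}. J j) = \<Sum> (J ` {1..k})"
    using permutes_inj_on[OF J] by (simp add: sum.reindex)
  also have "\<dots> \<le> (\<Sum>j\<in>{1..card (J ` {1..k})}. n + 1 - j)"
  proof (rule le)
    have "J ` {1..k} \<subseteq> J ` {1..n}" using \<open>k < n\<close> by (intro image_mono) auto
    then show "J ` {1..k} \<subseteq> {1..n}" unfolding permutes_image[OF J] .
  qed
  also have "card (J ` {1..k}) = k" using permutes_inj_on[OF J] by (simp add: card_image)
  also have "(\<Sum>j\<in>{1..k}. n + 1 - j) = (\<Sum>j\<in>{1..k}. longest_perm n j)"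
    using \<open>k < n\<close> by (intro sum.cong) (auto simp: longest_perm_def)
  finally show "(\<Sum>j\<in>{1..k}. J j) \<le> (\<Sum>j\<in>{1..k}. longest_perm n j)" .
qed

lemma card_increasing_pairs: "card {(i, j). i \<in> {1..n} \<and> j \<in> {1..n} \<and> i < j} = n * (n - 1) div 2"
proof (induction n)
  case (Suc n)
  have fin: "finite {(i, j). i \<in> {1..n} \<and> j \<in> {1..n} \<and> i < j}"
    by (rule finite_subset[of _ "{1..n} \<times> {1..n}"]) auto
  have "card ((\<lambda>i. (i, Suc n)) ` {1..n}) = n" by (subst card_image) (auto simp: inj_on_def)
  then have "card {(i, j). i \<in> {1..Suc n} \<and> j \<in> {1..Suc n} \<and> i < j} = n * (n - 1) div 2 + n"
    unfolding pairs_Suc Suc.IH[symmetric] by (subst card_Un_disjoint) (use fin in auto)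
  also have "\<dots> = Suc n * (Suc n - 1) div 2" by (cases n) (auto simp: algebra_simps)
  finally show ?case .
qed simp

text \<open>Both sides obey one recursion in \<open>I\<close>: \<open>fixed_W_exchange\<close> on
  the left and \<open>fixed_W_exchange_point\<close> on the right, with equal coefficients. For
  \<open>I = id\<close> both vanish unless \<open>K = id\<close>, and then each of the
  \<open>n * (n - 1) div 2\<close> pairs contributes a sign because \<open>th\<close> is
  odd.\<close>

theorem fixed_W_duality:
  assumes I: "I permutes {1..n}" and K: "K permutes {1..n}"
    and gen: "generic n h z" and gen\<mu>: "generic n h \<mu>"
  shows "fixed_W n h I K z \<mu> = (-1) ^ (n * (n - 1) div 2) *
    fixed_W n h (longest_perm n \<circ> inv K) (longest_perm n \<circ> inv I) (\<mu> \<circ> longest_perm n) (\<lambda>i. - z i)"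
  using I K gen
proof (induction I arbitrary: K z rule: permutes_adjacent_induct)
  case id
  let ?w = "longest_perm n"
  have gen\<mu>': "generic n h (\<mu> \<circ> ?w)" using gen\<mu> permutes_longest by (rule generic_permute)
  have J: "?w \<circ> inv K permutes {1..n}"
    using permutes_inv[OF id(1)] permutes_longest by (rule permutes_compose)
  have eq: "?w = ?w \<circ> inv K \<longleftrightarrow> K = id"
  proof
    assume *: "?w = ?w \<circ> inv K"
    have "inv K i = i" for i using fun_cong[OF *, of i] longest_involution by (metis o_apply)
    then have "K i = i" for i using permutes_inverses(1)[OF id(1), of i] by simp
    then show "K = id" by auto
  qed simp
  show ?case
  proof (cases "K = id")
    case False
    then have "fixed_W n h (?w \<circ> inv K) ?w (\<mu> \<circ> ?w) (\<lambda>i. - z i) = 0"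
      unfolding fixed_W_longest[OF J gen\<mu>'] eq by (simp only: if_False)
    moreover have "fixed_W n h id K z \<mu> = 0" unfolding fixed_W_id[OF id] using False by (simp only: if_False)
    ultimately show ?thesis by (simp only: inv_id comp_id mult_zero_right)
  next
    case True
    have "(\<Prod>(i, j) | i \<in> {1..n} \<and> j \<in> {1..n} \<and> i < j. th (h + \<mu> j - \<mu> i) * th (z j - z i))
      = (\<Prod>(i, j) | i \<in> {1..n} \<and> j \<in> {1..n} \<and> i < j. -1 * diag_factor h ?w (\<mu> \<circ> ?w) (\<lambda>i. - z i) i j)"
    proof (intro prod.cong refl, clarify)
      fix i j assume "i \<in> {1..n}" "j \<in> {1..n}" "i < j"
      then have "\<not> ?w i < ?w j" by (auto simp: longest_perm_def)
      then show "th (h + \<mu> j - \<mu> i) * th (z j - z i) = - 1 * diag_factor h ?w (\<mu> \<circ> ?w) (\<lambda>i. - z i) i j"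
        using th_diff_commute[of "z j" "z i"] by (simp add: diag_factor_def longest_involution)
    qed
    also have "\<dots> = (-1) ^ (n * (n - 1) div 2)
        * (\<Prod>(i, j) | i \<in> {1..n} \<and> j \<in> {1..n} \<and> i < j. diag_factor h ?w (\<mu> \<circ> ?w) (\<lambda>i. - z i) i j)"
      unfolding case_prod_unfold prod.distrib prod_constant
      using card_increasing_pairs[of n] by (simp add: case_prod_unfold)
    finally show ?thesis
      unfolding True inv_id comp_id fixed_W_id[OF permutes_id id(2)]
      unfolding fixed_W_longest[OF permutes_longest gen\<mu>'] by (simp only: if_True simp_thms)
  qed
next
  case (adjacent k I K z)
  let ?w = "longest_perm n"
  define s where "s = Transposition.transpose k (Suc k)"
  have s: "s permutes {1..n}" unfolding s_def using adjacent(1) by (intro permutes_swap_id) auto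
  have ss: "s (s i) = i" for i by (simp add: s_def)
  have gen\<mu>': "generic n h (\<mu> \<circ> ?w)" using gen\<mu> permutes_longest by (rule generic_permute)
  define J where "J = ?w \<circ> inv K"
  define N where "N = ?w \<circ> inv I"
  have J: "J permutes {1..n}" unfolding J_def
    using permutes_inv[OF adjacent(4)] permutes_longest by (rule permutes_compose)
  have N: "N permutes {1..n}" unfolding N_def
    using permutes_inv[OF adjacent(2)] permutes_longest by (rule permutes_compose)
  have invs: "inv (s \<circ> L) = inv L \<circ> s" if "L permutes {1..n}" for L
  proof
    fix i
    have "(s \<circ> L) (inv L (s i)) = i" using permutes_inverses(1)[OF that] by (simp add: ss)
    then show "inv (s \<circ> L) i = (inv L \<circ> s) i"
      using permutes_inj[OF permutes_compose[OF that s]] by (metis inv_f_f o_apply)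
  qed
  define M where "M = \<mu> (inv I (Suc k)) - \<mu> (inv I k)"
  define Y where "Y = z (Suc k) - z k"
  define \<epsilon> :: complex where "\<epsilon> = (-1) ^ (n * (n - 1) div 2)"
  have wN: "(\<mu> \<circ> ?w) (N i) = \<mu> (inv I i)" for i by (simp add: N_def longest_involution)
  have nz: "th (h + M) * th Y \<noteq> 0"
  proof -
    have "inv I (Suc k) \<in> {1..n}" "inv I k \<in> {1..n}" "inv I (Suc k) \<noteq> inv I k"
      using permutes_in_image[OF permutes_inv[OF adjacent(2)]] adjacent(1)
        inj_eq[OF permutes_inj[OF permutes_inv[OF adjacent(2)]]] by auto
    then have "th (h + \<mu> (inv I (Suc k)) - \<mu> (inv I k)) \<noteq> 0" by (rule genericD(2)[OF gen\<mu>])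
    moreover have "th (z (Suc k) - z k) \<noteq> 0" using genericD(1)[OF adjacent(5), of "Suc k" k] adjacent(1) by auto
    ultimately show ?thesis unfolding M_def Y_def add_diff_eq by simp
  qed
  have e1: "th (h + M) * th Y * fixed_W n h (s \<circ> I) K z \<mu>
    = th h * th (Y + M) * fixed_W n h I K z \<mu>
      - th (h - z (Suc k) + z k) * th M * fixed_W n h I (s \<circ> K) (z \<circ> s) \<mu>"
    unfolding M_def Y_def s_def by (rule fixed_W_exchange[OF adjacent(2,4,1,5)])
  have i1: "fixed_W n h I K z \<mu> = \<epsilon> * fixed_W n h J N (\<mu> \<circ> ?w) (\<lambda>i. - z i)"
    unfolding \<epsilon>_def J_def N_def by (rule adjacent.IH[OF adjacent(4,5)])
  have i2: "fixed_W n h I (s \<circ> K) (z \<circ> s) \<mu> = \<epsilon> * fixed_W n h (J \<circ> s) N (\<mu> \<circ> ?w) ((\<lambda>i. - z i) \<circ> s)"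
  proof -
    have "fixed_W n h I (s \<circ> K) (z \<circ> s) \<mu>
        = \<epsilon> * fixed_W n h (?w \<circ> inv (s \<circ> K)) N (\<mu> \<circ> ?w) (\<lambda>i. - (z \<circ> s) i)"
      unfolding \<epsilon>_def N_def
      by (rule adjacent.IH[OF permutes_compose[OF adjacent(4) s] generic_permute[OF adjacent(5) s]])
    moreover have "(\<lambda>i. - (z \<circ> s) i) = (\<lambda>i. - z i) \<circ> s" by auto
    ultimately show ?thesis unfolding invs[OF adjacent(4)] J_def by (simp only: o_assoc)
  qed
  have bs: "th (h + M) * th Y * fixed_W n h J (N \<circ> s) (\<mu> \<circ> ?w) (\<lambda>i. - z i)
    = th h * th (Y + M) * fixed_W n h J N (\<mu> \<circ> ?w) (\<lambda>i. - z i)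
      - th (h - z (Suc k) + z k) * th M * fixed_W n h (J \<circ> s) N (\<mu> \<circ> ?w) ((\<lambda>i. - z i) \<circ> s)"
  proof -
    have e: "- z k - - z (Suc k) = Y" "h - - z k + - z (Suc k) = h - z (Suc k) + z k" by (simp_all add: Y_def)
    show ?thesis
      using fixed_W_exchange_point[OF J N adjacent(1) gen\<mu>' generic_minus[OF adjacent(5)]]
      unfolding s_def[symmetric] wN M_def[symmetric] e .
  qed
  have "th (h + M) * th Y * fixed_W n h (s \<circ> I) K z \<mu>
      = \<epsilon> * (th (h + M) * th Y * fixed_W n h J (N \<circ> s) (\<mu> \<circ> ?w) (\<lambda>i. - z i))"
    unfolding e1 i1 i2 bs by (simp only: right_diff_distrib mult_ac)
  then have "th (h + M) * th Y * fixed_W n h (s \<circ> I) K z \<mu>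
      = th (h + M) * th Y * (\<epsilon> * fixed_W n h J (N \<circ> s) (\<mu> \<circ> ?w) (\<lambda>i. - z i))"
    by (simp only: mult_ac)
  then have "fixed_W n h (s \<circ> I) K z \<mu> = \<epsilon> * fixed_W n h J (N \<circ> s) (\<mu> \<circ> ?w) (\<lambda>i. - z i)"
    using nz by (metis mult_left_cancel)
  then show ?case
    unfolding s_def[symmetric] invs[OF adjacent(2)] \<epsilon>_def J_def N_def by (simp only: o_assoc)
qed

text \<open>The two values are moved next to each other by the exchange relation, where the coefficient
  \<open>th (\<mu> b - \<mu> a)\<close> vanishes.\<close>

lemma pos_W_eq_transposed:
  assumes I: "I permutes {1..n}" and ab: "a \<in> {1..n}" "b \<in> {1..n}" "I a < I b"
    and \<mu>: "\<mu> a = \<mu> b" and reg: "regular_roots h t n" and h: "th h \<noteq> 0"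
    and h\<mu>: "\<And>i j. i \<in> {1..n} \<Longrightarrow> j \<in> {1..n} \<Longrightarrow> th (h + (\<mu> i - \<mu> j)) \<noteq> 0"
    and z: "\<And>i j. i \<in> {1..n} \<Longrightarrow> j \<in> {1..n} \<Longrightarrow> i \<noteq> j \<Longrightarrow> th (z i - z j) \<noteq> 0"
  shows "pos_W I h \<mu> t n (z \<circ> I) =
    pos_W (I \<circ> Transposition.transpose a b) h \<mu> t n (z \<circ> (I \<circ> Transposition.transpose a b))"
  using I ab(3) z
proof (induction "I b - I a" arbitrary: I z)
  case 0 then show ?case by simp
next
  case (Suc d)
  note I = Suc.prems(1)
  have inj: "I i = I j \<longleftrightarrow> i = j" for i j using permutes_inj[OF I] by (auto simp: inj_def)
  have Iin: "I a \<in> {1..n}" "I b \<in> {1..n}" using permutes_in_image[OF I] ab by auto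
  show ?case
  proof (cases "I b = Suc (I a)")
    case True
    define k where "k = I a"
    have k: "k \<in> {1..<n}" using Iin True by (auto simp: k_def)
    have invs: "inv I k = a" "inv I (Suc k) = b"
      using permutes_inverses(2)[OF I] True by (simp_all add: k_def flip: True)
    define s where "s = Transposition.transpose k (Suc k)"
    have sI: "s \<circ> I = I \<circ> Transposition.transpose a b"
    proof
      fix i
      consider "i = a" | "i = b" | "i \<noteq> a" "i \<noteq> b" by blast
      then show "(s \<circ> I) i = (I \<circ> Transposition.transpose a b) i"
      proof cases
        case 3
        then have "I i \<noteq> k" "I i \<noteq> Suc k" using inj[of i a] inj[of i b] True by (auto simp: k_def)
        with 3 show ?thesis by (simp add: s_def)
      qed (use True in \<open>simp_all add: s_def k_def\<close>)
    qed
    have "th (h + 0) * th (z (Suc k) - z k) * pos_W (s \<circ> I) h \<mu> t n (z \<circ> (s \<circ> I))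
      = th h * th (z (Suc k) - z k + 0) * pos_W I h \<mu> t n (z \<circ> I)
      - th (h - z (Suc k) + z k) * th 0 * pos_W I h \<mu> t n (z \<circ> s \<circ> I)"
      using exchange_values[OF I k reg, of \<mu> z] unfolding s_def[symmetric] invs \<mu> diff_self .
    then have "th h * th (z (Suc k) - z k) * pos_W (s \<circ> I) h \<mu> t n (z \<circ> (s \<circ> I))
      = th h * th (z (Suc k) - z k) * pos_W I h \<mu> t n (z \<circ> I)"
      by (simp only: add_0_right th_0 mult_zero_right mult_zero_left diff_0_right)
    moreover have "th (z (Suc k) - z k) \<noteq> 0" using Suc.prems(3)[of "Suc k" k] k by auto
    ultimately show ?thesis unfolding sI using h by (metis mult_eq_0_iff mult_left_cancel)
  next
    case False
    define k where "k = I b - 1"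
    have k: "k \<in> {1..<n}" "Suc k = I b" "I a < k" using Iin Suc.prems(2) False by (auto simp: k_def)
    define s where "s = Transposition.transpose k (Suc k)"
    define r where "r = Transposition.transpose a b"
    have s: "s permutes {1..n}" unfolding s_def using k by (intro permutes_swap_id) auto
    have r: "r permutes {1..n}" unfolding r_def using ab by (intro permutes_swap_id) auto
    have rr: "r (r i) = i" for i by (simp add: r_def)
    have ss: "s \<circ> s = id" by (simp add: s_def)
    define I' where "I' = s \<circ> I"
    have I': "I' permutes {1..n}" unfolding I'_def using I s by (rule permutes_compose)
    have I'r: "I' \<circ> r permutes {1..n}" using r I' by (rule permutes_compose)
    have sI': "s \<circ> I' = I" "s \<circ> (I' \<circ> r) = I \<circ> r" unfolding I'_def o_assoc ss by auto
    have I'b: "I' b = k" "I' a = I a" using k by (simp_all add: I'_def s_def flip: k(2))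
    have d: "d = I' b - I' a" "I' a < I' b" using Suc.hyps(2) k I'b by auto
    have IH: "pos_W I' h \<mu> t n (z' \<circ> I') = pos_W (I' \<circ> r) h \<mu> t n (z' \<circ> (I' \<circ> r))"
      if "\<And>i j. i \<in> {1..n} \<Longrightarrow> j \<in> {1..n} \<Longrightarrow> i \<noteq> j \<Longrightarrow> th (z' i - z' j) \<noteq> 0" for z'
      unfolding r_def by (rule Suc.hyps(1)[OF d(1) I' d(2) that])
    have z': "th ((z \<circ> s) i - (z \<circ> s) j) \<noteq> 0" if "i \<in> {1..n}" "j \<in> {1..n}" "i \<noteq> j" for i j
      using Suc.prems(3)[of "s i" "s j"] permutes_in_image[OF s] inj_eq[OF permutes_inj[OF s]] that by simp
    have \<mu>r: "\<mu> (r i) = \<mu> i" for i using \<mu> by (simp add: r_def Transposition.transpose_def)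
    have inv: "inv (I' \<circ> r) i = r (inv I' i)" for i
    proof -
      have "(I' \<circ> r) (r (inv I' i)) = i" using permutes_inverses(1)[OF I'] by (simp add: rr)
      then show ?thesis using permutes_inj[OF I'r] by (metis inv_f_f)
    qed
    define M where "M = \<mu> (inv I' (Suc k)) - \<mu> (inv I' k)"
    have M': "\<mu> (inv (I' \<circ> r) (Suc k)) - \<mu> (inv (I' \<circ> r) k) = M"
      unfolding M_def inv \<mu>r by simp
    have "th (h + M) * th (z (Suc k) - z k) * pos_W I h \<mu> t n (z \<circ> I)
      = th h * th (z (Suc k) - z k + M) * pos_W I' h \<mu> t n (z \<circ> I')
      - th (h - z (Suc k) + z k) * th M * pos_W I' h \<mu> t n (z \<circ> s \<circ> I')"
      using exchange_values[OF I' k(1) reg, of \<mu> z] unfolding s_def[symmetric] M_def[symmetric] sI' .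
    also have "pos_W I' h \<mu> t n (z \<circ> I') = pos_W (I' \<circ> r) h \<mu> t n (z \<circ> (I' \<circ> r))"
      by (rule IH[OF Suc.prems(3)])
    also have "pos_W I' h \<mu> t n (z \<circ> s \<circ> I') = pos_W (I' \<circ> r) h \<mu> t n (z \<circ> s \<circ> (I' \<circ> r))"
      by (rule IH[OF z'])
    also have "th h * th (z (Suc k) - z k + M) * pos_W (I' \<circ> r) h \<mu> t n (z \<circ> (I' \<circ> r))
      - th (h - z (Suc k) + z k) * th M * pos_W (I' \<circ> r) h \<mu> t n (z \<circ> s \<circ> (I' \<circ> r))
      = th (h + M) * th (z (Suc k) - z k) * pos_W (I \<circ> r) h \<mu> t n (z \<circ> (I \<circ> r))"
      using exchange_values[OF I'r k(1) reg, of \<mu> z] unfolding s_def[symmetric] M' sI' by (rule sym)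
    finally have *: "th (h + M) * th (z (Suc k) - z k) * pos_W I h \<mu> t n (z \<circ> I)
      = th (h + M) * th (z (Suc k) - z k) * pos_W (I \<circ> r) h \<mu> t n (z \<circ> (I \<circ> r))" .
    have "th (h + M) \<noteq> 0" unfolding M_def
      using permutes_in_image[OF permutes_inv[OF I']] k by (intro h\<mu>) auto
    moreover have "th (z (Suc k) - z k) \<noteq> 0" using Suc.prems(3)[of "Suc k" k] k by auto
    ultimately show ?thesis unfolding r_def[symmetric] using * by (metis mult_eq_0_iff mult_left_cancel)
  qed
qed

text \<open>A permutation that preserves \<open>\<mu>\<close> is a product of transpositions of
  equal entries. One of them is split off at a time, by induction on the number of moved
  points.\<close>

lemma pos_W_eq_of_equal_parameters:
  assumes I: "I permutes {1..n}" and g: "g permutes {1..n}" and \<mu>g: "\<And>i. \<mu> (g i) = \<mu> i"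
    and reg: "regular_roots h t n" and h: "th h \<noteq> 0"
    and h\<mu>: "\<And>i j. i \<in> {1..n} \<Longrightarrow> j \<in> {1..n} \<Longrightarrow> th (h + (\<mu> i - \<mu> j)) \<noteq> 0"
    and z: "\<And>i j. i \<in> {1..n} \<Longrightarrow> j \<in> {1..n} \<Longrightarrow> i \<noteq> j \<Longrightarrow> th (z i - z j) \<noteq> 0"
  shows "pos_W (I \<circ> g) h \<mu> t n (z \<circ> (I \<circ> g)) = pos_W I h \<mu> t n (z \<circ> I)"
  using g \<mu>g
proof (induction "card {i. g i \<noteq> i}" arbitrary: g rule: less_induct)
  case (less g)
  have fin: "finite {i. g i \<noteq> i}"
    by (rule finite_subset[of _ "{1..n}"]) (use permutes_not_in[OF less.prems(1)] in blast)+
  show ?case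
  proof (cases "\<exists>a. g a \<noteq> a")
    case False
    then have "g = id" by auto
    then show ?thesis by (simp only: comp_id)
  next
    case True
    then obtain a where a: "g a \<noteq> a" by blast
    define b where "b = g a"
    have a_in: "a \<in> {1..n}" using permutes_not_in[OF less.prems(1)] a by blast
    have b_in: "b \<in> {1..n}" unfolding b_def using permutes_in_image[OF less.prems(1)] a_in by blast
    define r where "r = Transposition.transpose a b"
    have r: "r permutes {1..n}" unfolding r_def using a_in b_in by (rule permutes_swap_id)
    \<comment> \<open>Composition with the transposition of \<open>a\<close> and \<open>g a\<close>
      makes \<open>a\<close> a fixed point and creates no new moved point.\<close>
    define g' where "g' = r \<circ> g"
    have g': "g' permutes {1..n}" unfolding g'_def using less.prems(1) r by (rule permutes_compose)
    have \<mu>ab: "\<mu> a = \<mu> b" using less.prems(2)[of a] by (simp add: b_def)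
    then have \<mu>r: "\<mu> (r i) = \<mu> i" for i by (simp add: r_def Transposition.transpose_def)
    have g'a: "g' a = a" by (simp add: g'_def r_def b_def)
    have sub: "{i. g' i \<noteq> i} \<subset> {i. g i \<noteq> i}"
    proof
      show "{i. g' i \<noteq> i} \<subseteq> {i. g i \<noteq> i}"
      proof clarify
        fix i assume "g' i \<noteq> i" "g i = i"
        then have "r i \<noteq> i" by (simp add: g'_def)
        then have "i = a \<or> i = b" by (auto simp: r_def Transposition.transpose_def split: if_splits)
        then have "g a = a" using \<open>g i = i\<close> b_def permutes_inj[OF less.prems(1)] by (metis injD)
        with a show False by simp
      qed
      show "{i. g' i \<noteq> i} \<noteq> {i. g i \<noteq> i}" using g'a a by blast
    qed
    have IH: "pos_W (I \<circ> g') h \<mu> t n (z \<circ> (I \<circ> g')) = pos_W I h \<mu> t n (z \<circ> I)"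
      using psubset_card_mono[OF fin sub] by (rule less.hyps[OF _ g']) (simp add: g'_def \<mu>r less.prems(2))
    \<comment> \<open>The same transposition, now as a factor on the right, exchanges the positions
      \<open>a'\<close> and \<open>b'\<close>; this is the form that
      \<open>pos_W_eq_transposed\<close> treats.\<close>
    define a' where "a' = inv g' a"
    define b' where "b' = inv g' b"
    have ab': "g' a' = a" "g' b' = b" unfolding a'_def b'_def using permutes_inverses(1)[OF g'] by auto
    have g_eq: "g = g' \<circ> Transposition.transpose a' b'"
    proof
      fix i
      have inj: "g' i = g' j \<longleftrightarrow> i = j" for i j using permutes_inj[OF g'] by (auto simp: inj_def)
      have "g i = r (g' i)" by (simp add: g'_def r_def)
      also have "\<dots> = (g' \<circ> Transposition.transpose a' b') i"
      proof -
        consider "i = a'" | "i = b'" | "i \<noteq> a'" "i \<noteq> b'" by blast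
        then show ?thesis
        proof cases
          case 3
          then have "g' i \<noteq> a" "g' i \<noteq> b" using inj[of i a'] inj[of i b'] ab' by auto
          with 3 show ?thesis by (simp add: r_def)
        qed (simp_all add: ab' r_def)
      qed
      finally show "g i = (g' \<circ> Transposition.transpose a' b') i" .
    qed
    have in': "a' \<in> {1..n}" "b' \<in> {1..n}"
      unfolding a'_def b'_def using permutes_in_image[OF permutes_inv[OF g']] a_in b_in by auto
    have "\<mu> (g' i) = \<mu> i" for i by (simp add: g'_def \<mu>r less.prems(2))
    then have \<mu>': "\<mu> a' = \<mu> b'" using ab' \<mu>ab by metis
    have Ig': "I \<circ> g' permutes {1..n}" using g' I by (rule permutes_compose)
    have "a' \<noteq> b'" using ab' a b_def by auto
    then have "(I \<circ> g') a' \<noteq> (I \<circ> g') b'" using permutes_inj[OF Ig'] by (metis injD)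
    then consider "(I \<circ> g') a' < (I \<circ> g') b'" | "(I \<circ> g') b' < (I \<circ> g') a'" by linarith
    then have "pos_W (I \<circ> g') h \<mu> t n (z \<circ> (I \<circ> g')) =
      pos_W (I \<circ> g' \<circ> Transposition.transpose a' b') h \<mu> t n (z \<circ> (I \<circ> g' \<circ> Transposition.transpose a' b'))"
    proof cases
      case 1
      show ?thesis by (rule pos_W_eq_transposed[OF Ig' in' 1 \<mu>' reg h h\<mu> z])
    next
      case 2
      show ?thesis unfolding transpose_commute[of a']
        by (rule pos_W_eq_transposed[OF Ig' in'(2,1) 2 \<mu>'[symmetric] reg h h\<mu> z])
    qed
    then show ?thesis unfolding g_eq using IH by (simp only: o_assoc)
  qed
qed

end

section \<open>Entire functions of several variables\<close>

text \<open>By Osgood's lemma a continuous function that is holomorphic in each variable is holomorphic;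
  taking this as the definition of an entire function keeps everything in the product topology.\<close>

definition sep_entire :: "(('c \<Rightarrow> complex) \<Rightarrow> complex) \<Rightarrow> bool" where
  "sep_entire f \<longleftrightarrow> continuous_on UNIV f \<and> (\<forall>p c. (\<lambda>w. f (p(c := w))) holomorphic_on UNIV)"

lemma sep_entire_slice: "sep_entire f \<Longrightarrow> (\<lambda>w. f (p(c := w))) holomorphic_on UNIV"
  by (simp add: sep_entire_def)

lemma sep_entire_continuous: "sep_entire f \<Longrightarrow> continuous_on UNIV f"
  by (simp add: sep_entire_def)

lemma sep_entire_const [intro]: "sep_entire (\<lambda>_. k)"
  by (auto simp: sep_entire_def)

lemma sep_entire_coord [intro]: "sep_entire (\<lambda>p. p c)"
proof -
  have "(\<lambda>w. (p(d := w)) c) holomorphic_on UNIV" for p :: "'a \<Rightarrow> complex" and d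
    by (cases "d = c") (auto intro: holomorphic_intros)
  then show ?thesis by (simp only: sep_entire_def continuous_on_product_coordinates) simp
qed

lemma sep_entire_add [intro]: "sep_entire f \<Longrightarrow> sep_entire g \<Longrightarrow> sep_entire (\<lambda>p. f p + g p)"
  by (auto simp: sep_entire_def intro!: continuous_intros holomorphic_intros)

lemma sep_entire_diff [intro]: "sep_entire f \<Longrightarrow> sep_entire g \<Longrightarrow> sep_entire (\<lambda>p. f p - g p)"
  by (auto simp: sep_entire_def intro!: continuous_intros holomorphic_intros)

lemma sep_entire_minus [intro]: "sep_entire f \<Longrightarrow> sep_entire (\<lambda>p. - f p)"
  by (auto simp: sep_entire_def intro!: continuous_intros holomorphic_intros)

lemma sep_entire_mult [intro]: "sep_entire f \<Longrightarrow> sep_entire g \<Longrightarrow> sep_entire (\<lambda>p. f p * g p)"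
  by (auto simp: sep_entire_def intro!: continuous_intros holomorphic_intros)

lemma sep_entire_sum [intro]: "(\<And>i. i \<in> A \<Longrightarrow> sep_entire (f i)) \<Longrightarrow> sep_entire (\<lambda>p. \<Sum>i\<in>A. f i p)"
  by (induction A rule: infinite_finite_induct) auto

lemma sep_entire_prod [intro]: "(\<And>i. i \<in> A \<Longrightarrow> sep_entire (f i)) \<Longrightarrow> sep_entire (\<lambda>p. \<Prod>i\<in>A. f i p)"
  by (induction A rule: infinite_finite_induct) auto

lemma sep_entire_compose:
  assumes "g holomorphic_on UNIV" "sep_entire f"
  shows "sep_entire (\<lambda>p. g (f p))"
  unfolding sep_entire_def
proof (intro conjI allI)
  show "continuous_on UNIV (\<lambda>p. g (f p))"
    by (rule continuous_on_compose2[OF holomorphic_on_imp_continuous_on[OF assms(1)]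
          sep_entire_continuous[OF assms(2)]]) auto
  show "(\<lambda>w. g (f (p(c := w)))) holomorphic_on UNIV" for p c
    using holomorphic_on_compose[OF sep_entire_slice[OF assms(2), of p c]
        holomorphic_on_subset[OF assms(1)]] by (auto simp: o_def)
qed

section \<open>Cauchy integrals with parameters\<close>

definition unit_loop :: "real \<Rightarrow> complex" where
  "unit_loop x = exp (2 * of_real pi * \<i> * of_real x)"

lemma unit_loop_nz [simp]: "unit_loop x \<noteq> 0" "norm (unit_loop x) = 1"
proof -
  have "unit_loop x = cis (2 * pi * x)" by (simp add: unit_loop_def cis_conv_exp mult_ac)
  then show "norm (unit_loop x) = 1" by simp
qed (simp add: unit_loop_def)

lemma unit_loop_continuous [continuous_intros]:
  "continuous_on A f \<Longrightarrow> continuous_on A (\<lambda>x. unit_loop (f x))"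
  unfolding unit_loop_def by (intro continuous_intros)

text \<open>The contour integral becomes an integral over the fixed interval \<open>{0..1}\<close>,
  so that parameters can vary under the integral sign.\<close>

lemma Cauchy_value_integral:
  assumes f: "f holomorphic_on S" "open S" "cball z r \<subseteq> S" and w: "norm (w - z) < r"
  shows "f w = integral {0..1} (\<lambda>x. f (z + r * unit_loop x) * (r * unit_loop x) / (z + r * unit_loop x - w))"
proof -
  have "((\<lambda>u. f u/(u-w)) has_contour_integral (2 * of_real pi * \<i> * f w)) (circlepath z r)"
    using f w ball_subset_cball[of z r] by (intro Cauchy_integral_circlepath)
      (auto intro: holomorphic_on_imp_continuous_on holomorphic_on_subset simp del: ball_subset_cball)
  then have "2 * of_real pi * \<i> * f w = contour_integral (circlepath z r) (\<lambda>u. f u/(u-w))"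
    by (rule contour_integral_unique[symmetric])
  also have "\<dots> = integral {0..1} (\<lambda>x. (2 * of_real pi * \<i>) *
      (f (z + r * unit_loop x) * (r * unit_loop x) / (z + r * unit_loop x - w)))"
    unfolding contour_integral_integral vector_derivative_circlepath
    unfolding circlepath unit_loop_def
    by (intro integral_cong) (simp add: mult_ac)
  finally show ?thesis unfolding integral_mult_right by simp
qed

lemma Cauchy_deriv_integral:
  assumes f: "f holomorphic_on S" "open S" "cball z r \<subseteq> S" and r: "r > 0"
  shows "deriv f z = integral {0..1} (\<lambda>x. f (z + r * unit_loop x) / (r * unit_loop x))"
proof -
  have "(f has_field_derivative (1 / (2 * of_real pi * \<i>) *
      contour_integral (circlepath z r) (\<lambda>u. f u / (u - z)^2))) (at z)"
    using f r ball_subset_cball[of z r] by (intro Cauchy_derivative_integral_circlepath(2))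
      (auto intro: holomorphic_on_imp_continuous_on holomorphic_on_subset simp del: ball_subset_cball)
  then have "deriv f z = 1 / (2 * of_real pi * \<i>) *
      contour_integral (circlepath z r) (\<lambda>u. f u / (u - z)^2)" by (rule DERIV_imp_deriv)
  also have "contour_integral (circlepath z r) (\<lambda>u. f u / (u - z)^2) =
    integral {0..1} (\<lambda>x. (2 * of_real pi * \<i>) * (f (z + r * unit_loop x) / (r * unit_loop x)))"
    unfolding contour_integral_integral vector_derivative_circlepath
    unfolding circlepath unit_loop_def
    using r by (intro integral_cong) (simp add: power2_eq_square field_simps)
  finally show ?thesis unfolding integral_mult_right by simp
qed

text \<open>Differentiation under the integral asks for a derivative in \<open>w\<close> that is
  jointly continuous. It is one, being a Cauchy integral of \<open>F\<close> over a circle about the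
  moving centre \<open>w\<close>; halving the radius keeps these circles inside
  \<open>S\<close>.\<close>

lemma holomorphic_parameter_integral:
  fixes F :: "complex \<Rightarrow> real \<Rightarrow> complex"
  assumes S: "open S" and cont: "continuous_on (S \<times> {0..1}) (\<lambda>(w, x). F w x)"
    and holo: "\<And>x. x \<in> {0..1} \<Longrightarrow> (\<lambda>w. F w x) holomorphic_on S"
  shows "(\<lambda>w. integral {0..1} (F w)) holomorphic_on S"
proof -
  have "(\<lambda>w. integral {0..1} (F w)) field_differentiable (at w0)" if "w0 \<in> S" for w0
  proof -
    obtain R where R: "R > 0" "cball w0 R \<subseteq> S" using S \<open>w0 \<in> S\<close> open_contains_cball by blast
    define r where "r = R / 2"
    have r: "r > 0" using R by (simp add: r_def)
    have ball: "cball w r \<subseteq> S" if "w \<in> ball w0 r" for w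
    proof -
      have "cball w r \<subseteq> cball w0 R"
      proof
        fix u assume "u \<in> cball w r"
        then show "u \<in> cball w0 R" using that dist_triangle[of w0 u w] by (simp add: r_def)
      qed
      with R show ?thesis by blast
    qed
    have "(\<lambda>w. integral (cbox 0 1) (F w)) holomorphic_on ball w0 r"
    proof (rule leibniz_rule_holomorphic)
      fix w and x :: real assume w: "w \<in> ball w0 r" and x: "x \<in> cbox 0 1"
      have "((\<lambda>w. F w x) has_field_derivative deriv (\<lambda>w. F w x) w) (at w)"
      proof (rule holomorphic_derivI[OF holo S])
        show "w \<in> S" using ball[OF w] r by auto
      qed (use x in simp)
      then show "((\<lambda>w. F w x) has_field_derivative deriv (\<lambda>w. F w x) w) (at w within ball w0 r)"
        by (rule has_field_derivative_at_within)
    next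
      fix w assume w: "w \<in> ball w0 r"
      have "w \<in> S" using ball[OF w] r by auto
      then have "continuous_on (cbox 0 1) (F w)"
        by (intro continuous_on_compose2[OF cont, of _ "\<lambda>x. (w, x)", simplified]) (auto intro!: continuous_intros)
      then show "F w integrable_on cbox 0 1" by (rule integrable_continuous)
    next
      have "deriv (\<lambda>w. F w x) w = integral (cbox 0 1) (\<lambda>y. F (w + r * unit_loop y) x / (r * unit_loop y))"
        if "w \<in> ball w0 r" "x \<in> {0..1}" for w x
        using Cauchy_deriv_integral[OF holo[OF that(2)] S ball[OF that(1)] r] by simp
      moreover have "continuous_on (ball w0 r \<times> cbox (0::real) 1)
          (\<lambda>p. integral (cbox 0 1) (\<lambda>y. F (fst p + r * unit_loop y) (snd p) / (r * unit_loop y)))"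
      proof (rule integral_continuous_on_param)
        have "continuous_on ((ball w0 r \<times> cbox (0::real) 1) \<times> cbox (0::real) 1)
            (\<lambda>u. case (fst (fst u) + r * unit_loop (snd u), snd (fst u)) of (w, x) \<Rightarrow> F w x)"
        proof (rule continuous_on_compose2[OF cont])
          show "(\<lambda>u. (fst (fst u) + r * unit_loop (snd u), snd (fst u))) ` ((ball w0 r \<times> cbox (0::real) 1) \<times> cbox (0::real) 1)
              \<subseteq> S \<times> {0..1}"
          proof (rule image_subsetI)
            fix u assume u: "u \<in> (ball w0 r \<times> cbox (0::real) 1) \<times> cbox (0::real) 1"
            then have "fst (fst u) \<in> ball w0 r" by auto
            moreover have "fst (fst u) + r * unit_loop (snd u) \<in> cball (fst (fst u)) r"
              using r by (simp add: dist_norm norm_mult)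
            ultimately have "fst (fst u) + r * unit_loop (snd u) \<in> S" using ball by blast
            then show "(fst (fst u) + complex_of_real r * unit_loop (snd u), snd (fst u)) \<in> S \<times> {0..1}"
              using u by auto
          qed
        qed (intro continuous_intros)
        then show "continuous_on ((ball w0 r \<times> cbox (0::real) 1) \<times> cbox (0::real) 1)
            (\<lambda>(p, y). F (fst p + complex_of_real r * unit_loop y) (snd p) / (complex_of_real r * unit_loop y))"
          using r unfolding case_prod_unfold fst_conv snd_conv
          by (intro continuous_on_divide continuous_on_mult continuous_on_const unit_loop_continuous
              continuous_on_snd continuous_on_id ballI) auto
      qed
      ultimately show "continuous_on (ball w0 r \<times> cbox 0 1) (\<lambda>(w, x). deriv (\<lambda>w. F w x) w)"
        by (subst continuous_on_cong[OF refl, where g = "\<lambda>p. integral (cbox 0 1) (\<lambda>y. F (fst p + r * unit_loop y) (snd p) / (r * unit_loop y))"])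
           auto
    qed auto
    then show ?thesis using r by (simp add: holomorphic_on_imp_differentiable_at)
  qed
  then show ?thesis by (simp add: holomorphic_on_def field_differentiable_at_within)
qed

lemma update_continuous:
  fixes f :: "'a::topological_space \<Rightarrow> 'c \<Rightarrow> complex"
  assumes "continuous_on S f" "continuous_on S g"
  shows "continuous_on S (\<lambda>x. (f x)(c := g x))"
proof (rule continuous_on_coordinatewise_then_product)
  fix i
  have "continuous_on S (\<lambda>x. f x i)"
    using continuous_on_compose2[OF continuous_on_product_coordinates assms(1), of i] by simp
  then show "continuous_on S (\<lambda>x. ((f x)(c := g x)) i)"
    using assms(2) by (cases "i = c") auto
qed

lemma coord_continuous:
  fixes f :: "'a::topological_space \<Rightarrow> 'c \<Rightarrow> complex"
  shows "continuous_on S f \<Longrightarrow> continuous_on S (\<lambda>x. f x c)"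
  using continuous_on_compose2[OF continuous_on_product_coordinates, of S f c] by simp

definition part_deriv :: "'c \<Rightarrow> (('c \<Rightarrow> complex) \<Rightarrow> complex) \<Rightarrow> ('c \<Rightarrow> complex) \<Rightarrow> complex" where
  "part_deriv c f p = deriv (\<lambda>w. f (p(c := w))) (p c)"

text \<open>Cauchy's formula on the unit circle about \<open>p c\<close> expresses the derivative by
  values of \<open>f\<close>, and these are continuous in all coordinates together.\<close>

lemma part_deriv_continuous:
  assumes "sep_entire f"
  shows "continuous_on UNIV (part_deriv c f)"
proof -
  have "part_deriv c f p = integral (cbox 0 1) (\<lambda>x. f (p(c := p c + unit_loop x)) / unit_loop x)" for p
    unfolding part_deriv_def
    using Cauchy_deriv_integral[OF sep_entire_slice[OF assms] open_UNIV, of "p c" 1 p c] by simp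
  moreover have "continuous_on UNIV (\<lambda>p. integral (cbox 0 1) (\<lambda>x. f (p(c := p c + unit_loop x)) / unit_loop x))"
  proof (rule integral_continuous_on_param)
    have "continuous_on (UNIV \<times> cbox (0::real) 1) (\<lambda>u. f ((fst u)(c := fst u c + unit_loop (snd u))))"
      by (rule continuous_on_compose2[OF sep_entire_continuous[OF assms]])
         (intro update_continuous continuous_on_add unit_loop_continuous continuous_on_fst continuous_on_snd
            continuous_on_id coord_continuous, simp)
    then show "continuous_on (UNIV \<times> cbox (0::real) 1) (\<lambda>(p, x). f (p(c := p c + unit_loop x)) / unit_loop x)"
      unfolding case_prod_unfold
      by (intro continuous_on_divide unit_loop_continuous continuous_on_snd continuous_on_id ballI unit_loop_nz)
  qed
  ultimately show ?thesis by presburger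
qed

text \<open>Links \<open>polydisc\<close> to the product topology: coordinates outside
  \<open>A\<close> are held fixed, so finitely many radii matter and their minimum is
  positive.\<close>

lemma open_product_contains_polydisc:
  fixes U :: "('c \<Rightarrow> complex) set"
  assumes "open U" "x \<in> U" "finite A"
  shows "\<exists>\<delta>>0. \<forall>y. (\<forall>c\<in>A. dist (y c) (x c) < \<delta>) \<longrightarrow> (\<forall>c. c \<notin> A \<longrightarrow> y c = x c) \<longrightarrow> y \<in> U"
proof -
  obtain X where X: "x \<in> (\<Pi>\<^sub>E i\<in>UNIV. X i)" "\<And>i. open (X i)" "(\<Pi>\<^sub>E i\<in>UNIV. X i) \<subseteq> U"
    using product_topology_open_contains_basis[OF assms(1)[unfolded open_fun_def] assms(2)] by auto
  have "\<exists>d>0. \<forall>w. dist w (x c) < d \<longrightarrow> w \<in> X c" for c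
    using X(1) X(2)[of c] unfolding open_dist by (auto simp: PiE_iff)
  then obtain d where d: "\<And>c. d c > 0" "\<And>c w. dist w (x c) < d c \<Longrightarrow> w \<in> X c" by metis
  define \<delta> where "\<delta> = Min (insert 1 (d ` A))"
  have "\<delta> > 0" using assms(3) d(1) by (simp add: \<delta>_def)
  moreover have "\<delta> \<le> d c" if "c \<in> A" for c using assms(3) that by (simp add: \<delta>_def)
  moreover have "y \<in> U" if "\<forall>c\<in>A. dist (y c) (x c) < \<delta>" "\<forall>c. c \<notin> A \<longrightarrow> y c = x c" for y
  proof -
    have "y c \<in> X c" for c
    proof (cases "c \<in> A")
      case True
      then show ?thesis using that(1) \<open>\<And>c. c \<in> A \<Longrightarrow> \<delta> \<le> d c\<close> by (intro d(2)) (meson less_le_trans)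
    next
      case False
      then show ?thesis using that(2) d(1)[of c] by (intro d(2)) simp
    qed
    with X(3) show ?thesis by (auto simp: PiE_iff)
  qed
  ultimately show ?thesis by blast
qed

text \<open>The coordinates are changed one at a time. Each change is compared with its linear
  approximation by the mean value inequality, and continuity of the partial derivatives keeps the
  error below \<open>\<epsilon>\<close>.\<close>

lemma sep_entire_differentiable:
  assumes f: "sep_entire f" and A: "finite A" and x: "x \<in> A \<rightarrow>\<^sub>E UNIV"
  shows "complex_differentiable_at A f x"
  unfolding complex_differentiable_at_def
proof (rule exI[of _ "\<lambda>c. part_deriv c f x"], intro allI impI)
  fix \<epsilon> :: real assume "\<epsilon> > 0"
  define U where "U = (\<Inter>c\<in>A. part_deriv c f -` ball (part_deriv c f x) \<epsilon>)"
  have "open (part_deriv c f -` ball (part_deriv c f x) \<epsilon>)" for c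
    using continuous_on_open_vimage[OF open_UNIV, of "part_deriv c f"] part_deriv_continuous[OF f] by simp
  then have "open U" unfolding U_def using A by (intro open_INT) auto
  moreover have "x \<in> U" using \<open>\<epsilon> > 0\<close> by (simp add: U_def)
  ultimately obtain \<delta> where \<delta>: "\<delta> > 0"
    "\<And>y. (\<And>c. c \<in> A \<Longrightarrow> dist (y c) (x c) < \<delta>) \<Longrightarrow> (\<And>c. c \<notin> A \<Longrightarrow> y c = x c) \<Longrightarrow> y \<in> U"
    using open_product_contains_polydisc[OF _ _ A, of U x] by blast
  have "cmod (f y - f x - (\<Sum>c\<in>A. part_deriv c f x * (y c - x c))) \<le> \<epsilon> * (\<Sum>c\<in>A. cmod (y c - x c))"
    if y: "y \<in> polydisc A x \<delta>" for y
  proof -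
    \<comment> \<open>\<open>m B\<close> has the new coordinates in \<open>B\<close> and the old
      ones elsewhere.\<close>
    define m where "m B = (\<lambda>c. if c \<in> B then y c else x c)" for B
    have "cmod (f (m B) - f x - (\<Sum>c\<in>B. part_deriv c f x * (y c - x c))) \<le> \<epsilon> * (\<Sum>c\<in>B. cmod (y c - x c))"
      if "finite B" "B \<subseteq> A" for B
      using that
    proof (induction B rule: finite_induct)
      case (insert c B)
      define g where "g w = f ((m B)(c := w))" for w
      define g' where "g' w = part_deriv c f ((m B)(c := w))" for w
      have der: "(g has_field_derivative g' w) (at w)" for w
        using holomorphic_derivI[OF sep_entire_slice[OF f, of "m B" c], of w]
        by (simp add: g_def[abs_def] g'_def part_deriv_def)
      have "cmod ((\<lambda>w. g w - part_deriv c f x * w) (y c) - (\<lambda>w. g w - part_deriv c f x * w) (x c)) \<le> \<epsilon> * cmod (y c - x c)"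
      proof (rule field_differentiable_bound[of "ball (x c) \<delta>" _ "\<lambda>w. g' w - part_deriv c f x"])
        show "((\<lambda>w. g w - part_deriv c f x * w) has_field_derivative g' w - part_deriv c f x) (at w within ball (x c) \<delta>)" for w
          by (rule has_field_derivative_at_within) (auto intro!: derivative_eq_intros der)
        fix w assume w: "w \<in> ball (x c) \<delta>"
        have "(m B)(c := w) \<in> U"
          using w y insert.prems by (intro \<delta>(2)) (auto simp: m_def polydisc_def dist_commute \<delta>(1))
        then show "cmod (g' w - part_deriv c f x) \<le> \<epsilon>"
          using insert.prems by (auto simp: U_def g'_def dist_norm norm_minus_commute less_imp_le)
      qed (use y insert.prems \<delta>(1) in \<open>auto simp: polydisc_def dist_commute\<close>)
      moreover have "g (y c) = f (m (insert c B))" "g (x c) = f (m B)"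
        using insert.hyps by (auto simp: g_def m_def intro!: arg_cong[where f = f])
      ultimately have "cmod (f (m (insert c B)) - f (m B) - part_deriv c f x * (y c - x c)) \<le> \<epsilon> * cmod (y c - x c)"
        by (simp add: algebra_simps)
      moreover have "cmod (f (m B) - f x - (\<Sum>c\<in>B. part_deriv c f x * (y c - x c))) \<le> \<epsilon> * (\<Sum>c\<in>B. cmod (y c - x c))"
        using insert by simp
      ultimately have "cmod ((f (m (insert c B)) - f (m B) - part_deriv c f x * (y c - x c))
          + (f (m B) - f x - (\<Sum>c\<in>B. part_deriv c f x * (y c - x c))))
          \<le> \<epsilon> * cmod (y c - x c) + \<epsilon> * (\<Sum>c\<in>B. cmod (y c - x c))"
        by (rule norm_triangle_mono)
      then show ?case using insert.hyps by (simp add: algebra_simps)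
    qed (simp add: m_def)
    from this[OF A order_refl] have "cmod (f (m A) - f x - (\<Sum>c\<in>A. part_deriv c f x * (y c - x c))) \<le> \<epsilon> * (\<Sum>c\<in>A. cmod (y c - x c))" .
    moreover have "m A = y"
      using x y by (auto simp: m_def polydisc_def PiE_iff extensional_def fun_eq_iff)
    ultimately show ?thesis by simp
  qed
  then show "\<exists>\<delta>>0. \<forall>y\<in>polydisc A x \<delta>.
      cmod (f y - f x - (\<Sum>c\<in>A. part_deriv c f x * (y c - x c))) \<le> \<epsilon> * (\<Sum>c\<in>A. cmod (y c - x c))"
    using \<delta>(1) by blast
qed

lemma sep_entire_holomorphic_along:
  assumes "sep_entire f" "finite A" "X \<subseteq> A \<rightarrow>\<^sub>E UNIV"
  shows "holomorphic_along A X f"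
  unfolding holomorphic_along_def
proof
  fix x assume "x \<in> X"
  have "\<forall>y\<in>polydisc A x 1. complex_differentiable_at A f y"
    using assms by (auto simp: polydisc_def intro: sep_entire_differentiable)
  then show "\<exists>r>0. \<exists>g. (\<forall>y\<in>polydisc A x r. complex_differentiable_at A g y) \<and>
                      (\<forall>y\<in>X \<inter> polydisc A x r. f y = g y)"
    by (intro exI[of _ 1] exI[of _ f]) auto
qed

section \<open>Division by a theta factor\<close>

context nome
begin

lemma th_isolated_zero: "\<exists>r>0. \<forall>w\<in>ball a r - {a}. th w \<noteq> 0"
proof (cases "th a = 0")
  case True
  obtain r where "0 < r" "ball a r \<subseteq> UNIV" "\<And>w. w \<in> ball a r - {a} \<Longrightarrow> th w \<noteq> 0"
    by (rule isolated_zeros[OF th_holomorphic open_UNIV connected_UNIV UNIV_I True UNIV_I th_half_period], rule that)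
  then show ?thesis by blast
next
  case False
  have "isCont th a"
    using th_holomorphic holomorphic_on_imp_continuous_on continuous_on_eq_continuous_at open_UNIV by blast
  then obtain e where "e > 0" "\<And>x. dist a x < e \<Longrightarrow> th x \<noteq> 0"
    using continuous_at_avoid[of a th 0] False by auto
  then show ?thesis by (intro exI[of _ e]) auto
qed

text \<open>On each line in direction \<open>c\<close> the quotient extends across the zeros, which
  are simple because \<open>l\<close> has slope 1 there. Joint continuity and holomorphy in the
  other variables follow from Cauchy's formula on a circle in direction \<open>c\<close> that avoids
  the zeros of the denominator and can be kept fixed near a given point.\<close>

lemma th_division:
  assumes f: "sep_entire f" and l: "sep_entire l"
    and shift: "\<And>p w. l (p(c := w)) = l p + (w - p c)"
    and zero: "\<And>p. th (l p) = 0 \<Longrightarrow> f p = 0"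
  shows "\<exists>g. sep_entire g \<and> (\<forall>p. f p = th (l p) * g p)"
proof -
  define g where "g p = (if th (l p) = 0 then part_deriv c f p / part_deriv c (\<lambda>p. th (l p)) p
      else f p / th (l p))" for p
  have slice: "(\<lambda>w. g (p(c := w))) holomorphic_on UNIV" for p
  proof -
    have th_slice: "(\<lambda>w. th (l (p(c := w)))) holomorphic_on UNIV"
      unfolding shift by (intro holomorphic_intros)
    have "deriv (\<lambda>w. th (l (p(c := w)))) u = deriv th (l p + (u - p c))" for u
    proof -
      have "(th has_field_derivative deriv th v) (at v)" for v
        using th_holomorphic holomorphic_derivI by blast
      then have "((\<lambda>w. th (w + (l p - p c))) has_field_derivative deriv th (u + (l p - p c))) (at u)"
        unfolding DERIV_shift[symmetric] .
      then have "deriv (\<lambda>w. th (w + (l p - p c))) u = deriv th (u + (l p - p c))" by (rule DERIV_imp_deriv)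
      then show ?thesis unfolding shift by (simp add: algebra_simps)
    qed
    then have "(\<lambda>w. if th (l (p(c := w))) = 0 then deriv (\<lambda>w. f (p(c := w))) w / deriv (\<lambda>w. th (l (p(c := w)))) w
        else f (p(c := w)) / th (l (p(c := w)))) holomorphic_on UNIV"
      using zero th_deriv_nz
      by (intro quotient_simple_zeros_holomorphic sep_entire_slice[OF f] th_slice)
         (auto simp: shift th_eq_0_iff)
    also have "(\<lambda>w. if th (l (p(c := w))) = 0 then deriv (\<lambda>w. f (p(c := w))) w / deriv (\<lambda>w. th (l (p(c := w)))) w
        else f (p(c := w)) / th (l (p(c := w)))) = (\<lambda>w. g (p(c := w)))"
      by (auto simp: g_def part_deriv_def)
    finally show ?thesis .
  qed
  have local: "\<exists>U. open U \<and> p0 \<in> U \<and> continuous_on U g \<and>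
      (\<forall>p\<in>U. \<forall>d. (\<lambda>w. g (p(d := w))) field_differentiable at (p d))" for p0
  proof -
    obtain r where r: "r > 0" "\<And>w. w \<in> ball (l p0) r \<Longrightarrow> w \<noteq> l p0 \<Longrightarrow> th w \<noteq> 0"
      using th_isolated_zero[of "l p0"] by blast
    \<comment> \<open>\<open>off\<close> is the change of the part of \<open>l\<close> that does not
      depend on the coordinate \<open>c\<close>. With radius \<open>r / 2\<close> and
      \<open>off\<close> below \<open>r / 4\<close>, the values of \<open>l\<close> on the circle
      keep a distance between \<open>r / 4\<close> and \<open>3 * r / 4\<close> from
      \<open>l p0\<close>, where \<open>th\<close> has no zero.\<close>
    define \<rho> where "\<rho> = r / 2"
    have \<rho>: "\<rho> > 0" using r by (simp add: \<rho>_def)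
    define P where "P p x = p(c := p0 c + \<rho> * unit_loop x)" for p x
    define off where "off p = l p - p c - (l p0 - p0 c)" for p
    define U where "U = {p. cmod (off p) < r / 4 \<and> cmod (p c - p0 c) < \<rho>}"
    have lP: "l (P p x) = l p0 + (off p + \<rho> * unit_loop x)" for p x
      unfolding P_def shift off_def by simp
    have cont_l: "continuous_on UNIV l" by (rule sep_entire_continuous[OF l])
    have "continuous_on UNIV (\<lambda>p. cmod (off p))" "continuous_on UNIV (\<lambda>p. cmod (p c - p0 c))"
      unfolding off_def by (intro continuous_on_norm continuous_on_diff cont_l continuous_on_const
          continuous_on_product_coordinates)+
    then have "open U" unfolding U_def
      by (intro open_Collect_conj open_Collect_less) (auto intro: continuous_on_const)
    have "p0 \<in> U" using r \<rho> by (simp add: U_def off_def)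
    have nz: "th (l (P p x)) \<noteq> 0" if "p \<in> U" for p x
    proof (rule r(2))
      have o: "cmod (off p) < r / 4" using that by (simp add: U_def)
      have u: "cmod (\<rho> * unit_loop x) = r / 2" using r by (simp add: norm_mult \<rho>_def)
      have "cmod (off p + \<rho> * unit_loop x) < r"
        using norm_triangle_ineq[of "off p" "\<rho> * unit_loop x"] o u r by linarith
      then show "l (P p x) \<in> ball (l p0) r" unfolding lP by (metis dist_self dist_add_cancel add_0_right norm_minus_cancel dist_0_norm mem_ball)
      have "off p + \<rho> * unit_loop x \<noteq> 0"
        using norm_diff_ineq[of "\<rho> * unit_loop x" "off p"] o u r by (auto simp: add.commute)
      then show "l (P p x) \<noteq> l p0" unfolding lP by simp
    qed
    have den: "p0 c + \<rho> * unit_loop x - p c \<noteq> 0" if "p \<in> U" for p x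
    proof
      assume "p0 c + \<rho> * unit_loop x - p c = 0"
      then have "p c - p0 c = \<rho> * unit_loop x" by (simp add: algebra_simps)
      then have "cmod (p c - p0 c) = \<rho>" using \<rho> by (simp add: norm_mult)
      with that show False by (simp add: U_def)
    qed
    define F where "F p x = f (P p x) / th (l (P p x)) * (\<rho> * unit_loop x) / (p0 c + \<rho> * unit_loop x - p c)" for p x
    have gF: "g p = integral {0..1} (F p)" if "p \<in> U" for p
    proof -
      have "cmod (p c - p0 c) < \<rho>" using that by (simp add: U_def)
      from Cauchy_value_integral[OF slice open_UNIV subset_UNIV this, of p]
      have "g p = integral {0..1} (\<lambda>x. g (P p x) * (\<rho> * unit_loop x) / (p0 c + \<rho> * unit_loop x - p c))"
        by (simp add: P_def)
      also have "\<dots> = integral {0..1} (F p)"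
        unfolding F_def using nz[OF that] by (intro integral_cong) (simp add: g_def)
      finally show ?thesis .
    qed
    have F_cont: "continuous_on (U \<times> {0..1}) (\<lambda>(p, x). F p x)"
    proof -
      have P: "continuous_on (U \<times> {0..1}) (\<lambda>u. P (fst u) (snd u))"
        unfolding P_def by (intro update_continuous continuous_on_add continuous_on_mult unit_loop_continuous
            continuous_on_fst continuous_on_snd continuous_on_id continuous_on_const)
      have fP: "continuous_on (U \<times> {0..1}) (\<lambda>u. f (P (fst u) (snd u)))"
        by (rule continuous_on_compose2[OF sep_entire_continuous[OF f] P]) auto
      have lP: "continuous_on (U \<times> {0..1}) (\<lambda>u. th (l (P (fst u) (snd u))))"
        by (rule th_continuous[OF continuous_on_compose2[OF cont_l P]]) auto
      show ?thesis unfolding F_def case_prod_unfold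
        using nz den
        by (intro continuous_on_divide continuous_on_mult fP lP continuous_on_add continuous_on_diff
            unit_loop_continuous continuous_on_fst continuous_on_snd continuous_on_id continuous_on_const
            coord_continuous) auto
    qed
    have "continuous_on U (\<lambda>p. integral (cbox 0 1) (F p))"
      by (rule integral_continuous_on_param) (use F_cont in simp)
    then have g_cont: "continuous_on U g"
      using gF by (subst continuous_on_cong[OF refl, where g = "\<lambda>p. integral (cbox 0 1) (F p)"]) auto
    have "(\<lambda>w. g (p(d := w))) field_differentiable at (p d)" if p: "p \<in> U" for p d
    proof (cases "d = c")
      case True
      then show ?thesis using slice[of p] by (simp add: holomorphic_on_imp_differentiable_at)
    next
      case False
      define W where "W = (\<lambda>w. p(d := w)) -` U"
      have upd: "continuous_on UNIV (\<lambda>w. p(d := w))"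
        by (intro update_continuous continuous_on_const continuous_on_id)
      have "open W" unfolding W_def using continuous_on_open_vimage[OF open_UNIV, of "\<lambda>w. p(d := w)"] upd \<open>open U\<close> by simp
      have "p d \<in> W" using p by (simp add: W_def)
      have "(\<lambda>w. integral {0..1} (F (p(d := w)))) holomorphic_on W"
      proof (rule holomorphic_parameter_integral[OF \<open>open W\<close>])
        have "continuous_on (W \<times> {0..1}) (\<lambda>u. case (p(d := fst u), snd u) of (p, x) \<Rightarrow> F p x)"
          by (rule continuous_on_compose2[OF F_cont])
             (auto simp: W_def intro!: continuous_on_Pair update_continuous continuous_on_fst continuous_on_snd
                continuous_on_id continuous_on_const)
        then show "continuous_on (W \<times> {0..1}) (\<lambda>(w, x). F (p(d := w)) x)"
          by (simp add: case_prod_unfold)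
        fix x :: real
        have Pd: "P (p(d := w)) x = (P p x)(d := w)" for w
          using False by (auto simp: P_def)
        have "(\<lambda>w. f ((P p x)(d := w)) / th (l ((P p x)(d := w))) * (\<rho> * unit_loop x) / (p0 c + \<rho> * unit_loop x - p c)) holomorphic_on W"
          using nz[of "p(d := w)" x for w] den[OF p]
          by (intro holomorphic_intros holomorphic_on_subset[OF sep_entire_slice[OF f]]
              holomorphic_on_subset[OF sep_entire_slice[OF l]]) (auto simp: W_def Pd)
        then show "(\<lambda>w. F (p(d := w)) x) holomorphic_on W"
          using False unfolding F_def Pd by simp
      qed
      then have "(\<lambda>w. g (p(d := w))) holomorphic_on W"
        by (rule holomorphic_transform) (simp add: W_def gF)
      then show ?thesis using \<open>open W\<close> \<open>p d \<in> W\<close> by (simp add: holomorphic_on_imp_differentiable_at)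
    qed
    with \<open>open U\<close> \<open>p0 \<in> U\<close> g_cont show ?thesis by blast
  qed
  have "sep_entire g"
    unfolding sep_entire_def
  proof (intro conjI allI)
    have "continuous_on (\<Union>{U. open U \<and> continuous_on U g}) g"
      by (rule continuous_on_open_Union) auto
    moreover have "\<Union>{U. open U \<and> continuous_on U g} = UNIV" using local by blast
    ultimately show "continuous_on UNIV g" by simp
    fix p d
    have "(\<lambda>w. g (p(d := w))) field_differentiable at w" for w
    proof -
      have "(\<lambda>v. g ((p(d := w))(d := v))) field_differentiable at ((p(d := w)) d)"
        using local[of "p(d := w)"] by blast
      then show ?thesis by simp
    qed
    then show "(\<lambda>w. g (p(d := w))) holomorphic_on UNIV"
      by (simp add: holomorphic_on_def)
  qed
  moreover have "f p = th (l p) * g p" for p using zero[of p] by (simp add: g_def)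
  ultimately show ?thesis by blast
qed

end

section \<open>Gluing along complementary theta divisors\<close>

context nome
begin

definition shifted :: "('c \<Rightarrow> complex) \<Rightarrow> complex \<Rightarrow> ('c \<Rightarrow> complex) \<Rightarrow> 'c \<Rightarrow> complex" where
  "shifted p s u = (\<lambda>c. p c + s * u c)"

text \<open>A linear form with coefficient 1 at some coordinate, along which
  \<open>th_division\<close> can divide.\<close>

definition theta_form :: "(('c \<Rightarrow> complex) \<Rightarrow> complex) \<Rightarrow> bool" where
  "theta_form l \<longleftrightarrow> sep_entire l \<and> (\<forall>p s u. l (shifted p s u) = l p + s * l u) \<and>
     (\<exists>c. \<forall>p w. l (p(c := w)) = l p + (w - p c))"

text \<open>No form of \<open>\<Lambda>\<close> is constant on the line through \<open>p\<close> in
  direction \<open>u\<close>. The excluded parameters \<open>s\<close> therefore do not accumulate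
  at 0, and continuity gives the value at \<open>p\<close>.\<close>

lemma vanish_of_generic:
  assumes D: "continuous_on UNIV D" and fin: "finite \<Lambda>"
    and \<Lambda>: "\<And>l. l \<in> \<Lambda> \<Longrightarrow> theta_form l \<and> l u \<noteq> 0"
    and gen: "\<And>s. (\<And>l. l \<in> \<Lambda> \<Longrightarrow> th (l (shifted p s u)) \<noteq> 0) \<Longrightarrow> D (shifted p s u) = 0"
  shows "D p = (0 :: complex)"
proof -
  have "eventually (\<lambda>s. th (l (shifted p s u)) \<noteq> 0) (at 0)" if "l \<in> \<Lambda>" for l
  proof -
    have l: "l (shifted p s u) = l p + s * l u" "l u \<noteq> 0" for s
      using \<Lambda>[OF that] by (auto simp: theta_form_def)
    obtain r where r: "r > 0" "\<And>w. w \<in> ball (l p) r - {l p} \<Longrightarrow> th w \<noteq> 0"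
      using th_isolated_zero[of "l p"] by blast
    have "th (l (shifted p s u)) \<noteq> 0" if "s \<noteq> 0" "dist s 0 < r / cmod (l u)" for s
    proof (rule r(2))
      have "cmod (s * l u) < r" using that l(2) by (simp add: norm_mult field_simps)
      moreover have "dist (l p) (l p + s * l u) = cmod (s * l u)" by (simp add: dist_norm)
      ultimately show "l (shifted p s u) \<in> ball (l p) r - {l p}" using that l by simp
    qed
    then show ?thesis unfolding eventually_at using r(1) l(2)
      by (intro exI[of _ "r / cmod (l u)"]) auto
  qed
  then have "eventually (\<lambda>s. \<forall>l\<in>\<Lambda>. th (l (shifted p s u)) \<noteq> 0) (at 0)"
    by (intro eventually_ball_finite fin) auto
  then have ev: "eventually (\<lambda>s. D (shifted p s u) = 0) (at 0)"
    by (rule eventually_mono) (use gen in blast)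
  have "continuous_on UNIV (\<lambda>s. shifted p s u)"
    unfolding shifted_def by (intro continuous_on_coordinatewise_then_product continuous_intros)
  then have "continuous_on UNIV (\<lambda>s. D (shifted p s u))"
    by (rule continuous_on_compose2[OF D]) auto
  then have "isCont (\<lambda>s. D (shifted p s u)) 0"
    using continuous_on_eq_continuous_at open_UNIV by blast
  then have "((\<lambda>s. D (shifted p s u)) \<longlongrightarrow> D (shifted p 0 u)) (at 0)"
    by (simp add: isCont_def)
  moreover have "((\<lambda>s. D (shifted p s u)) \<longlongrightarrow> 0) (at 0)"
    using tendsto_eventually[OF ev] .
  ultimately have "D (shifted p 0 u) = 0" using tendsto_unique[OF at_neq_bot] by blast
  then show ?thesis by (simp add: shifted_def)
qed

text \<open>A list rather than a set, because a denominator may contain a theta factor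
  repeatedly.\<close>

definition th_list :: "(('c \<Rightarrow> complex) \<Rightarrow> complex) list \<Rightarrow> ('c \<Rightarrow> complex) \<Rightarrow> complex" where
  "th_list ls p = (\<Prod>l\<leftarrow>ls. th (l p))"

lemma th_list_simps [simp]: "th_list [] p = 1" "th_list (l # ls) p = th (l p) * th_list ls p"
  "th_list (ls @ ls') p = th_list ls p * th_list ls' p"
  by (simp_all add: th_list_def)

lemma th_list_sep_entire:
  "(\<And>l. l \<in> set ls \<Longrightarrow> theta_form l) \<Longrightarrow> sep_entire (th_list ls)"
proof (induction ls)
  case (Cons l ls)
  have "sep_entire (\<lambda>p. th (l p) * th_list ls p)"
    using Cons by (intro sep_entire_mult sep_entire_compose[OF th_holomorphic]) (auto simp: theta_form_def)
  moreover have "th_list (l # ls) = (\<lambda>p. th (l p) * th_list ls p)" by (simp add: fun_eq_iff)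
  ultimately show ?case by simp
next
  case Nil
  have "th_list [] = (\<lambda>_. 1)" by (simp add: fun_eq_iff)
  then show ?case by (simp add: sep_entire_const)
qed

lemma th_list_nz: "(\<And>l. l \<in> set ls \<Longrightarrow> th (l p) \<noteq> 0) \<Longrightarrow> th_list ls p \<noteq> 0"
  by (induction ls) auto

text \<open>Poles occur along the divisors of \<open>\<Lambda>\<close> only. The equation is
  demanded off these divisors, because a quotient with vanishing denominator has the default value
  0.\<close>

definition th_mero :: "(('c \<Rightarrow> complex) \<Rightarrow> complex) set \<Rightarrow> (('c \<Rightarrow> complex) \<Rightarrow> complex) \<Rightarrow> bool" where
  "th_mero \<Lambda> F \<longleftrightarrow> (\<exists>G ls. sep_entire G \<and> set ls \<subseteq> \<Lambda> \<and>
     (\<forall>p. (\<forall>l\<in>\<Lambda>. th (l p) \<noteq> 0) \<longrightarrow> F p * th_list ls p = G p))"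

lemma th_meroI:
  assumes "sep_entire G" "set ls \<subseteq> \<Lambda>"
    and "\<And>p. (\<And>l. l \<in> \<Lambda> \<Longrightarrow> th (l p) \<noteq> 0) \<Longrightarrow> F p * th_list ls p = G p"
  shows "th_mero \<Lambda> F"
  unfolding th_mero_def
proof (rule exI[of _ G], rule exI[of _ ls], intro conjI allI impI)
  fix p assume "\<forall>l\<in>\<Lambda>. th (l p) \<noteq> 0"
  then show "F p * th_list ls p = G p" by (intro assms(3)) simp
qed (rule assms(1,2))+

lemma th_mero_entire: "sep_entire F \<Longrightarrow> th_mero \<Lambda> F"
  by (rule th_meroI[of F "[]"]) auto

lemma th_mero_mult:
  assumes "th_mero \<Lambda> F" "th_mero \<Lambda> F'"
  shows "th_mero \<Lambda> (\<lambda>p. F p * F' p)"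
proof -
  obtain G ls where entire1: "sep_entire G" "set ls \<subseteq> \<Lambda>"
    and eq1: "\<forall>p. (\<forall>l\<in>\<Lambda>. th (l p) \<noteq> 0) \<longrightarrow> F p * th_list ls p = G p"
    using assms(1) unfolding th_mero_def by (elim exE conjE)
  note 1 = entire1 eq1[rule_format]
  obtain G' ls' where entire2: "sep_entire G'" "set ls' \<subseteq> \<Lambda>"
    and eq2: "\<forall>p. (\<forall>l\<in>\<Lambda>. th (l p) \<noteq> 0) \<longrightarrow> F' p * th_list ls' p = G' p"
    using assms(2) unfolding th_mero_def by (elim exE conjE)
  note 2 = entire2 eq2[rule_format]
  note * = 1(1,2) 2(1,2) 1(3) 2(3)
  show ?thesis
  proof (rule th_meroI[of "\<lambda>p. G p * G' p" "ls @ ls'"])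
    fix p assume "\<And>l. l \<in> \<Lambda> \<Longrightarrow> th (l p) \<noteq> 0"
    then show "F p * F' p * th_list (ls @ ls') p = G p * G' p"
      using *(5,6)[of p, symmetric] by (simp add: mult_ac)
  qed (use * in auto)
qed

lemma th_mero_add:
  assumes \<Lambda>: "\<And>l. l \<in> \<Lambda> \<Longrightarrow> theta_form l" and "th_mero \<Lambda> F" "th_mero \<Lambda> F'"
  shows "th_mero \<Lambda> (\<lambda>p. F p + F' p)"
proof -
  obtain G ls where entire1: "sep_entire G" "set ls \<subseteq> \<Lambda>"
    and eq1: "\<forall>p. (\<forall>l\<in>\<Lambda>. th (l p) \<noteq> 0) \<longrightarrow> F p * th_list ls p = G p"
    using assms(2) unfolding th_mero_def by (elim exE conjE)
  note 1 = entire1 eq1[rule_format]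
  obtain G' ls' where entire2: "sep_entire G'" "set ls' \<subseteq> \<Lambda>"
    and eq2: "\<forall>p. (\<forall>l\<in>\<Lambda>. th (l p) \<noteq> 0) \<longrightarrow> F' p * th_list ls' p = G' p"
    using assms(3) unfolding th_mero_def by (elim exE conjE)
  note 2 = entire2 eq2[rule_format]
  note * = 1(1,2) 2(1,2) 1(3) 2(3)
  show ?thesis
  proof (rule th_meroI[of "\<lambda>p. G p * th_list ls' p + G' p * th_list ls p" "ls @ ls'"])
    show "sep_entire (\<lambda>p. G p * th_list ls' p + G' p * th_list ls p)"
      using * \<Lambda> by (intro sep_entire_add sep_entire_mult th_list_sep_entire) auto
    fix p assume "\<And>l. l \<in> \<Lambda> \<Longrightarrow> th (l p) \<noteq> 0"
    then show "(F p + F' p) * th_list (ls @ ls') p = G p * th_list ls' p + G' p * th_list ls p"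
      using *(5,6)[of p, symmetric] by (simp add: algebra_simps)
  qed (use * in auto)
qed

lemma th_mero_sum:
  assumes \<Lambda>: "\<And>l. l \<in> \<Lambda> \<Longrightarrow> theta_form l" and "\<And>i. i \<in> A \<Longrightarrow> th_mero \<Lambda> (F i)"
  shows "th_mero \<Lambda> (\<lambda>p. \<Sum>i\<in>A. F i p)"
  using assms(2)
proof (induction A rule: infinite_finite_induct)
  case (insert i A)
  have "th_mero \<Lambda> (\<lambda>p. F i p + (\<Sum>i\<in>A. F i p))"
    using insert by (intro th_mero_add[OF \<Lambda>]) auto
  then show ?case using insert.hyps by simp
qed (auto intro: th_mero_entire)

lemma th_mero_inverse:
  assumes "l \<in> \<Lambda>"
  shows "th_mero \<Lambda> (\<lambda>p. inverse (th (l p)))"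
  by (rule th_meroI[of "\<lambda>_. 1" "[l]"]) (use assms in auto)

lemma th_mero_prod:
  assumes "\<And>i. i \<in> A \<Longrightarrow> th_mero \<Lambda> (F i)"
  shows "th_mero \<Lambda> (\<lambda>p. \<Prod>i\<in>A. F i p)"
  using assms
proof (induction A rule: infinite_finite_induct)
  case (insert i A)
  have "th_mero \<Lambda> (\<lambda>p. F i p * (\<Prod>i\<in>A. F i p))"
    using insert by (intro th_mero_mult) auto
  then show ?case using insert.hyps by simp
qed (auto intro: th_mero_entire)

lemma th_mero_pos_W:
  fixes t :: "('c \<Rightarrow> complex) \<Rightarrow> nat \<Rightarrow> nat \<Rightarrow> complex"
  assumes \<Lambda>: "\<And>l. l \<in> \<Lambda> \<Longrightarrow> theta_form l"
    and "sep_entire h" "\<And>j. sep_entire (\<lambda>p. \<mu> p j)" "\<And>k j. sep_entire (\<lambda>p. t p k j)"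
    and "\<And>k i j. k < m \<Longrightarrow> i \<in> {1..k} \<Longrightarrow> j \<in> {1..k} \<Longrightarrow> i \<noteq> j \<Longrightarrow>
      (\<lambda>p. h p + t p k i - t p k j) \<in> \<Lambda> \<and> (\<lambda>p. t p k i - t p k j) \<in> \<Lambda>"
    and "\<And>j. sep_entire (\<lambda>p. w p j)"
  shows "th_mero \<Lambda> (\<lambda>p. pos_W I (h p) (\<mu> p) (t p) m (w p))"
  using assms(5,6)
proof (induction m arbitrary: w)
  case (Suc m)
  have th: "sep_entire (\<lambda>p. th (f p))" if "sep_entire f" for f :: "('c \<Rightarrow> complex) \<Rightarrow> complex"
    by (rule sep_entire_compose[OF th_holomorphic that])
  have "th_mero \<Lambda> (\<lambda>p. pos_W I (h p) (\<mu> p) (t p) m (t p m \<circ> \<pi>) * pos_G I (h p) (\<mu> p) m (t p m \<circ> \<pi>) (w p))"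
    if \<pi>: "\<pi> permutes {1..m}" for \<pi>
  proof (rule th_mero_mult)
    show "th_mero \<Lambda> (\<lambda>p. pos_W I (h p) (\<mu> p) (t p) m (t p m \<circ> \<pi>))"
      using assms(4) Suc.prems by (intro Suc.IH) auto
    have num: "sep_entire (\<lambda>p. pos_num I (h p) (\<mu> p) m (t p m \<circ> \<pi>) (w p))"
    proof -
      have "sep_entire (\<lambda>p. pos_psi I (h p) (\<mu> p) m j l (w p l - (t p m \<circ> \<pi>) j))" for j l
        unfolding pos_psi_def o_apply
        by (cases "I l < I j"; cases "l = j"; cases "I j < I (Suc m)")
           (simp_all only: if_True if_False simp_thms,
             (intro th sep_entire_add sep_entire_diff sep_entire_const assms Suc.prems)+)
      then show ?thesis unfolding pos_num_def case_prod_unfold by (intro sep_entire_prod)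
    qed
    let ?P = "{(i, j). i \<in> {1..m} \<and> j \<in> {1..m} \<and> I i < I j}"
    have "th_mero \<Lambda> (\<lambda>p. \<Prod>x\<in>?P. inverse (th (h p + t p m (\<pi> (fst x)) - t p m (\<pi> (snd x))))
          * inverse (th (t p m (\<pi> (snd x)) - t p m (\<pi> (fst x)))))"
    proof (rule th_mero_prod)
      fix x assume "x \<in> ?P"
      then have x: "fst x \<in> {1..m}" "snd x \<in> {1..m}" "fst x \<noteq> snd x" by auto
      have \<pi>x: "\<pi> (fst x) \<in> {1..m}" "\<pi> (snd x) \<in> {1..m}" "\<pi> (fst x) \<noteq> \<pi> (snd x)"
        using x permutes_in_image[OF \<pi>] inj_eq[OF permutes_inj[OF \<pi>]] by (simp_all del: atLeastAtMost_iff)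
      show "th_mero \<Lambda> (\<lambda>p. inverse (th (h p + t p m (\<pi> (fst x)) - t p m (\<pi> (snd x))))
          * inverse (th (t p m (\<pi> (snd x)) - t p m (\<pi> (fst x)))))"
        using Suc.prems(1)[OF lessI \<pi>x] Suc.prems(1)[OF lessI \<pi>x(2,1) \<pi>x(3)[symmetric]]
        by (intro th_mero_mult th_mero_inverse[of "\<lambda>p. h p + t p m (\<pi> (fst x)) - t p m (\<pi> (snd x))"]
            th_mero_inverse[of "\<lambda>p. t p m (\<pi> (snd x)) - t p m (\<pi> (fst x))"]) auto
    qed
    moreover have "inverse (pos_den I (h p) m (t p m \<circ> \<pi>)) =
      (\<Prod>x\<in>?P. inverse (th (h p + t p m (\<pi> (fst x)) - t p m (\<pi> (snd x))))
          * inverse (th (t p m (\<pi> (snd x)) - t p m (\<pi> (fst x)))))" for p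
      unfolding pos_den_def case_prod_unfold o_apply inverse_mult_distrib[symmetric]
      using prod_inversef[of "\<lambda>x. th (h p + t p m (\<pi> (fst x)) - t p m (\<pi> (snd x)))
          * th (t p m (\<pi> (snd x)) - t p m (\<pi> (fst x)))"] by (simp only: o_def case_prod_unfold)
    ultimately have den: "th_mero \<Lambda> (\<lambda>p. inverse (pos_den I (h p) m (t p m \<circ> \<pi>)))" by simp
    show "th_mero \<Lambda> (\<lambda>p. pos_G I (h p) (\<mu> p) m (t p m \<circ> \<pi>) (w p))"
      unfolding pos_G_def divide_inverse by (rule th_mero_mult[OF th_mero_entire[OF num] den])
  qed
  then show ?case unfolding pos_W.simps by (intro th_mero_sum[OF \<Lambda>]) auto
qed (auto intro: th_mero_entire)

text \<open>A function with poles only along the divisors of \<open>\<Lambda>1\<close> and, in another presentation, only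
  along those of \<open>\<Lambda>2\<close>, has poles only in codimension two, hence none.  The direction \<open>v\<close> moves a
  point within the divisors of \<open>\<Lambda>1\<close> off the divisors of \<open>\<Lambda>2\<close>.\<close>

lemma th_mero_glue:
  assumes F1: "th_mero \<Lambda>1 F1" and F2: "th_mero \<Lambda>2 F2"
    and \<Lambda>: "finite \<Lambda>" "\<Lambda>1 \<subseteq> \<Lambda>" "\<Lambda>2 \<subseteq> \<Lambda>" "\<And>l. l \<in> \<Lambda> \<Longrightarrow> theta_form l \<and> l u \<noteq> 0"
    and eq: "\<And>p. (\<And>l. l \<in> \<Lambda> \<Longrightarrow> th (l p) \<noteq> 0) \<Longrightarrow> F1 p = F2 p"
    and v: "\<And>l. l \<in> \<Lambda>1 \<Longrightarrow> l v = 0" "\<And>l. l \<in> \<Lambda>2 \<Longrightarrow> l v \<noteq> 0"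
  shows "\<exists>f. sep_entire f \<and> (\<forall>p. (\<forall>l\<in>\<Lambda>1. th (l p) \<noteq> 0) \<longrightarrow> f p = F1 p)
    \<and> (\<forall>p. (\<forall>l\<in>\<Lambda>2. th (l p) \<noteq> 0) \<longrightarrow> f p = F2 p)"
proof -
  obtain G1 ls1 where entire1: "sep_entire G1" "set ls1 \<subseteq> \<Lambda>1"
    and eq1: "\<forall>p. (\<forall>l\<in>\<Lambda>1. th (l p) \<noteq> 0) \<longrightarrow> F1 p * th_list ls1 p = G1 p"
    using F1 unfolding th_mero_def by (elim exE conjE)
  note 1 = entire1 eq1[rule_format]
  obtain G2 ls2 where entire2: "sep_entire G2" "set ls2 \<subseteq> \<Lambda>2"
    and eq2: "\<forall>p. (\<forall>l\<in>\<Lambda>2. th (l p) \<noteq> 0) \<longrightarrow> F2 p * th_list ls2 p = G2 p"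
    using F2 unfolding th_mero_def by (elim exE conjE)
  note 2 = entire2 eq2[rule_format]
  have ent: "sep_entire (th_list ls)" if "set ls \<subseteq> \<Lambda>" for ls
    using that \<Lambda>(4) by (intro th_list_sep_entire) auto
  have ent12: "sep_entire (th_list ls1)" "sep_entire (th_list ls2)"
    by (rule ent, use 1(2) 2(2) \<Lambda>(2,3) in blast)+
  have dense: "f p = g p"
    if "sep_entire f" "sep_entire g" "\<And>p. (\<And>l. l \<in> \<Lambda> \<Longrightarrow> th (l p) \<noteq> 0) \<Longrightarrow> f p = g p" for f g p
  proof -
    have "f p - g p = 0"
    proof (rule vanish_of_generic[where D = "\<lambda>p. f p - g p" and u = u, OF _ \<Lambda>(1)])
      show "continuous_on UNIV (\<lambda>p. f p - g p)"
        using that by (intro continuous_on_diff sep_entire_continuous)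
    qed (use that(3) \<Lambda>(4) in auto)
    then show ?thesis by simp
  qed
  have main: "G1 p * th_list ls2 p = G2 p * th_list ls1 p" for p
  proof (rule dense[of "\<lambda>p. G1 p * th_list ls2 p" "\<lambda>p. G2 p * th_list ls1 p"])
    fix p assume p: "\<And>l. l \<in> \<Lambda> \<Longrightarrow> th (l p) \<noteq> 0"
    then have "F1 p * th_list ls1 p = G1 p" "F2 p * th_list ls2 p = G2 p" "F1 p = F2 p"
      using 1(3)[of p] 2(3)[of p] eq[of p] \<Lambda> by blast+
    then show "G1 p * th_list ls2 p = G2 p * th_list ls1 p" by (metis mult.commute mult.left_commute)
  qed (intro sep_entire_mult 1 2 ent12)+
  \<comment> \<open>The factors of \<open>ls\<close> are removed from \<open>G\<close> one by one.
    Each removal is legitimate because \<open>G * th_list ls2\<close> vanishes on the divisor of the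
    factor, while \<open>th_list ls2\<close> does not vanish identically along \<open>v\<close>
    there.\<close>
  have divide: "\<exists>f. sep_entire f \<and> (\<forall>p. G p = f p * th_list ls p)"
    if "sep_entire G" "set ls \<subseteq> \<Lambda>1" "\<And>p. G p * th_list ls2 p = G2 p * th_list ls p" for G ls
    using that
  proof (induction ls arbitrary: G)
    case (Cons l ls)
    have l: "l \<in> \<Lambda>1" "theta_form l" using Cons.prems \<Lambda> by auto
    then obtain c where c: "\<And>p w. l (p(c := w)) = l p + (w - p c)" unfolding theta_form_def by blast
    have lin: "l (shifted p s u) = l p + s * l u" for p s u using l by (simp add: theta_form_def)
    have "\<exists>g. sep_entire g \<and> (\<forall>p. G p = th (l p) * g p)"
    proof (rule th_division[OF Cons.prems(1) _ c])
      show "sep_entire l" using l by (simp add: theta_form_def)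
      fix p assume p: "th (l p) = 0"
      show "G p = 0"
      proof (rule vanish_of_generic[OF sep_entire_continuous[OF Cons.prems(1)], where \<Lambda> = "set ls2" and u = v])
        fix s assume s: "\<And>l. l \<in> set ls2 \<Longrightarrow> th (l (shifted p s v)) \<noteq> 0"
        have "l (shifted p s v) = l p" unfolding lin using v(1)[OF l(1)] by simp
        then have "G (shifted p s v) * th_list ls2 (shifted p s v) = 0" using Cons.prems(3) p by simp
        then show "G (shifted p s v) = 0" using th_list_nz[of ls2 "shifted p s v"] s by auto
      qed (use v(2) 2(2) \<Lambda> in auto)
    qed
    then obtain g where g: "sep_entire g" "\<And>p. G p = th (l p) * g p" by blast
    have "g p * th_list ls2 p = G2 p * th_list ls p" for p
    proof (rule dense[of "\<lambda>p. g p * th_list ls2 p" "\<lambda>p. G2 p * th_list ls p"])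
      fix p assume p: "\<And>l. l \<in> \<Lambda> \<Longrightarrow> th (l p) \<noteq> 0"
      have "th (l p) * (g p * th_list ls2 p) = th (l p) * (G2 p * th_list ls p)"
        using Cons.prems(3)[of p] g(2)[of p] by (simp add: mult_ac)
      moreover have "th (l p) \<noteq> 0" using p l \<Lambda> by auto
      ultimately show "g p * th_list ls2 p = G2 p * th_list ls p" by simp
    qed (intro sep_entire_mult g(1) 2(1) ent12 ent subset_trans[OF _ \<Lambda>(2)]; use Cons.prems(2) in simp)+
    then obtain f where "sep_entire f" "\<And>p. g p = f p * th_list ls p"
      using Cons.IH[OF g(1)] Cons.prems(2) by auto
    then show ?case using g(2) by (intro exI[of _ f]) (simp add: mult_ac)
  qed auto
  obtain f where f: "sep_entire f" "\<And>p. G1 p = f p * th_list ls1 p"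
    using divide[OF 1(1,2) main] by blast
  have f2: "f p * th_list ls2 p = G2 p" for p
  proof (rule dense[of "\<lambda>p. f p * th_list ls2 p" G2])
    fix p assume p: "\<And>l. l \<in> \<Lambda> \<Longrightarrow> th (l p) \<noteq> 0"
    have "th_list ls1 p * (f p * th_list ls2 p) = th_list ls1 p * G2 p"
      using main[of p] f(2)[of p] by (simp add: mult_ac)
    moreover have "th_list ls1 p \<noteq> 0" using p 1 \<Lambda> by (intro th_list_nz) auto
    ultimately show "f p * th_list ls2 p = G2 p" by simp
  qed (intro sep_entire_mult f 2 ent12)+
  have "f p = F1 p" if p: "\<forall>l\<in>\<Lambda>1. th (l p) \<noteq> 0" for p
  proof -
    have "th_list ls1 p \<noteq> 0" using p 1 by (intro th_list_nz) auto
    moreover have "F1 p * th_list ls1 p = f p * th_list ls1 p" using 1(3)[of p] f(2)[of p] p by simp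
    ultimately show ?thesis by simp
  qed
  moreover have "f p = F2 p" if p: "\<forall>l\<in>\<Lambda>2. th (l p) \<noteq> 0" for p
  proof -
    have "th_list ls2 p \<noteq> 0" using p 2 by (intro th_list_nz) auto
    moreover have "F2 p * th_list ls2 p = f p * th_list ls2 p" using 2(3)[of p] f2[of p] p by simp
    ultimately show ?thesis by simp
  qed
  ultimately show ?thesis using f(1) by blast
qed

section \<open>The restrictions of the duality interface\<close>

text \<open>The arguments of the theta factors in the denominators at the fixed point
  \<open>K\<close>, where \<open>E\<close> selects the left or the right parameters.\<close>

definition diff_forms :: "(nat \<Rightarrow> pcoord) \<Rightarrow> (nat \<Rightarrow> nat) \<Rightarrow> nat \<Rightarrow> ((pcoord \<Rightarrow> complex) \<Rightarrow> complex) set" where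
  "diff_forms E K m = (\<Union>i\<in>{1..m}. \<Union>j\<in>{1..m} - {i}.
     {(\<lambda>p. p HbarP + p (E (K i)) - p (E (K j))), (\<lambda>p. p (E (K i)) - p (E (K j)))})"

lemma diff_forms_ball:
  "(\<forall>l\<in>diff_forms E K m. P l) \<longleftrightarrow> (\<forall>i\<in>{1..m}. \<forall>j\<in>{1..m}. i \<noteq> j \<longrightarrow>
     P (\<lambda>p. p HbarP + p (E (K i)) - p (E (K j))) \<and> P (\<lambda>p. p (E (K i)) - p (E (K j))))"
  unfolding diff_forms_def by auto

lemma finite_diff_forms: "finite (diff_forms E K m)"
  by (simp add: diff_forms_def)

lemma diff_formsI:
  assumes "i \<in> {1..m}" "j \<in> {1..m}" "i \<noteq> j"
  shows "(\<lambda>p. p HbarP + p (E (K i)) - p (E (K j))) \<in> diff_forms E K m"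
    "(\<lambda>p. p (E (K i)) - p (E (K j))) \<in> diff_forms E K m"
  using assms unfolding diff_forms_def by blast+

lemma diff_forms_mono:
  assumes K: "K permutes {1..n}" and "m \<le> n"
  shows "diff_forms E K m \<subseteq> diff_forms E id n"
proof -
  have "\<forall>l\<in>diff_forms E K m. l \<in> diff_forms E id n"
    unfolding diff_forms_ball
  proof (intro ballI impI conjI)
    fix i j assume "i \<in> {1..m}" "j \<in> {1..m}" "i \<noteq> j"
    then have *: "K i \<in> {1..n}" "K j \<in> {1..n}" "K i \<noteq> K j"
      using \<open>m \<le> n\<close> permutes_in_image[OF K] inj_eq[OF permutes_inj[OF K]] by auto
    show "(\<lambda>p. p HbarP + p (E (K i)) - p (E (K j))) \<in> diff_forms E id n"
      "(\<lambda>p. p (E (K i)) - p (E (K j))) \<in> diff_forms E id n"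
      using diff_formsI[OF *, of E id] by simp_all
  qed
  then show ?thesis by blast
qed

lemma theta_form_diff:
  assumes E: "inj E" "\<And>i. E i \<noteq> HbarP" and K: "K permutes {1..n}" and l: "l \<in> diff_forms E K m"
  shows "theta_form l"
proof -
  have "\<forall>l\<in>diff_forms E K m. theta_form l"
    unfolding diff_forms_ball
  proof (intro ballI impI conjI)
    fix i j :: nat assume "i \<noteq> j"
    then have ne: "E (K j) \<noteq> E (K i)" "E (K i) \<noteq> HbarP"
      using E permutes_inj[OF K] by (auto simp: inj_def)
    show "theta_form (\<lambda>p. p HbarP + p (E (K i)) - p (E (K j)))"
      unfolding theta_form_def
      by (intro conjI allI sep_entire_diff sep_entire_add sep_entire_coord exI[of _ "E (K i)"])
         (use ne in \<open>auto simp: shifted_def algebra_simps\<close>)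
    show "theta_form (\<lambda>p. p (E (K i)) - p (E (K j)))"
      unfolding theta_form_def
      by (intro conjI allI sep_entire_diff sep_entire_add sep_entire_coord exI[of _ "E (K i)"])
         (use ne in \<open>auto simp: shifted_def algebra_simps\<close>)
  qed
  with l show ?thesis by blast
qed

lemma generic_forms:
  "generic n (p HbarP) (\<lambda>i. p (E i)) \<longleftrightarrow> (\<forall>l\<in>diff_forms E id n. th (l p) \<noteq> 0)"
  unfolding diff_forms_ball generic_def by auto

text \<open>All levels carry the same roots, so the conditions are nested and those of level
  \<open>n - 1\<close> comprise the others.\<close>

lemma regular_forms:
  assumes "n \<ge> 1"
  shows "regular_roots (p HbarP) (\<lambda>_. (\<lambda>i. p (E i)) \<circ> K) n \<longleftrightarrow> (\<forall>l\<in>diff_forms E K (n - 1). th (l p) \<noteq> 0)"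
  unfolding diff_forms_ball regular_roots_def
proof (intro iffI ballI allI impI; (elim allE[of _ "n - 1"])?)
qed (use assms in auto)

text \<open>Distinct integers separate the parameters, and the value 1/2 at \<open>HbarP\<close>
  keeps the forms that contain it away from 0.\<close>

definition generic_direction :: "pcoord \<Rightarrow> complex" where
  "generic_direction c = (case c of EquiL i \<Rightarrow> of_nat i | EquiR i \<Rightarrow> of_nat i | HbarP \<Rightarrow> 1 / 2 | _ \<Rightarrow> 0)"

text \<open>Fixes \<open>HbarP\<close> and the left parameters, so that all left forms are constant
  along it, whereas the distinct integers make every right form vary.\<close>

definition right_direction :: "pcoord \<Rightarrow> complex" where
  "right_direction c = (case c of EquiR i \<Rightarrow> of_nat i | _ \<Rightarrow> 0)"

lemma half_plus_diff_nz: "1 / 2 + of_nat i - of_nat j \<noteq> (0 :: complex)"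
proof
  assume "1 / 2 + of_nat i - of_nat j = (0 :: complex)"
  then have "1 + 2 * of_nat i = (2 * of_nat j :: complex)" by (simp add: field_simps)
  then have "of_nat (1 + 2 * i) = (of_nat (2 * j) :: complex)" by simp
  then have "1 + 2 * i = 2 * j" by (simp only: of_nat_eq_iff)
  then show False by presburger
qed

lemma generic_direction_nz:
  assumes "l \<in> diff_forms EquiL id n \<union> diff_forms EquiR id n"
  shows "l generic_direction \<noteq> 0"
proof -
  have "\<forall>l\<in>diff_forms EquiL id n. l generic_direction \<noteq> 0" "\<forall>l\<in>diff_forms EquiR id n. l generic_direction \<noteq> 0"
    unfolding diff_forms_ball using half_plus_diff_nz by (auto simp: generic_direction_def)
  with assms show ?thesis by blast
qed

text \<open>The duality theorem gives equality at generic points. One expression has its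
  denominators in the left parameters and the other in the right ones, which is the situation of
  \<open>th_mero_glue\<close>.\<close>

lemma interface_exists:
  assumes K: "K permutes {1..n}" and L: "L permutes {1..n}" and n: "n \<ge> 1"
  shows "\<exists>f. sep_entire f \<and>
    (\<forall>p. regular_roots (p HbarP) (\<lambda>_. (\<lambda>i. p (EquiL i)) \<circ> K) n \<longrightarrow>
       f p = pos_W (inv L) (p HbarP) (\<lambda>i. p (EquiR i)) (\<lambda>_. (\<lambda>i. p (EquiL i)) \<circ> K) n ((\<lambda>i. p (EquiL i)) \<circ> inv L)) \<and>
    (\<forall>p. regular_roots (p HbarP) (\<lambda>_. (\<lambda>i. p (EquiR i)) \<circ> L) n \<longrightarrow>
       f p = (-1) ^ (n * (n - 1) div 2) * pos_W (longest_perm n \<circ> inv K) (p HbarP) (\<lambda>i. - p (EquiL i))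
         (\<lambda>_. (\<lambda>i. p (EquiR i)) \<circ> L) n ((\<lambda>i. p (EquiR i)) \<circ> inv K))"
  unfolding regular_forms[OF n]
proof (rule th_mero_glue[where \<Lambda> = "diff_forms EquiL id n \<union> diff_forms EquiR id n"])
  have tf: "theta_form l" if "l \<in> diff_forms EquiL M m \<union> diff_forms EquiR M m" "M permutes {1..n}" for l M m
    using that theta_form_diff[of EquiL M n l m] theta_form_diff[of EquiR M n l m] by (auto simp: inj_def)
  have mem: "(\<lambda>p. p HbarP + ((\<lambda>i. p (E i)) \<circ> M) i - ((\<lambda>i. p (E i)) \<circ> M) j) \<in> diff_forms E M (n - 1)
      \<and> (\<lambda>p. ((\<lambda>i. p (E i)) \<circ> M) i - ((\<lambda>i. p (E i)) \<circ> M) j) \<in> diff_forms E M (n - 1)"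
    if "k < n" "i \<in> {1..k}" "j \<in> {1..k}" "i \<noteq> j" for E :: "nat \<Rightarrow> pcoord" and M k i j
    using diff_formsI[of i "n - 1" j E M] that unfolding o_apply by auto
  show "th_mero (diff_forms EquiL K (n - 1)) (\<lambda>p. pos_W (inv L) (p HbarP) (\<lambda>i. p (EquiR i))
      (\<lambda>_. (\<lambda>i. p (EquiL i)) \<circ> K) n ((\<lambda>i. p (EquiL i)) \<circ> inv L))"
    by (rule th_mero_pos_W[OF _ _ _ _ mem]) (use tf K in \<open>auto intro: sep_entire_coord\<close>)
  have "th_mero (diff_forms EquiR L (n - 1)) (\<lambda>p. pos_W (longest_perm n \<circ> inv K) (p HbarP) (\<lambda>i. - p (EquiL i))
         (\<lambda>_. (\<lambda>i. p (EquiR i)) \<circ> L) n ((\<lambda>i. p (EquiR i)) \<circ> inv K))"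
    by (rule th_mero_pos_W[OF _ _ _ _ mem]) (use tf L in \<open>auto intro: sep_entire_coord sep_entire_minus\<close>)
  then show "th_mero (diff_forms EquiR L (n - 1)) (\<lambda>p. (-1) ^ (n * (n - 1) div 2) *
      pos_W (longest_perm n \<circ> inv K) (p HbarP) (\<lambda>i. - p (EquiL i))
         (\<lambda>_. (\<lambda>i. p (EquiR i)) \<circ> L) n ((\<lambda>i. p (EquiR i)) \<circ> inv K))"
    by (intro th_mero_mult th_mero_entire[OF sep_entire_const])
  show "finite (diff_forms EquiL id n \<union> diff_forms EquiR id n)" by (simp add: finite_diff_forms)
  show "diff_forms EquiL K (n - 1) \<subseteq> diff_forms EquiL id n \<union> diff_forms EquiR id n"
    using diff_forms_mono[OF K, of "n - 1" EquiL] by auto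
  show "diff_forms EquiR L (n - 1) \<subseteq> diff_forms EquiL id n \<union> diff_forms EquiR id n"
    using diff_forms_mono[OF L, of "n - 1" EquiR] by auto
  show "theta_form l \<and> l generic_direction \<noteq> 0"
    if "l \<in> diff_forms EquiL id n \<union> diff_forms EquiR id n" for l
    using generic_direction_nz[OF that] tf[OF that permutes_id] by blast
  have "\<forall>l\<in>diff_forms EquiL K (n - 1). l right_direction = 0"
    unfolding diff_forms_ball by (simp add: right_direction_def)
  then show "l right_direction = 0" if "l \<in> diff_forms EquiL K (n - 1)" for l using that by blast
  have "\<forall>l\<in>diff_forms EquiR L (n - 1). l right_direction \<noteq> 0"
    unfolding diff_forms_ball using inj_eq[OF permutes_inj[OF L]] by (simp add: right_direction_def)
  then show "l right_direction \<noteq> 0" if "l \<in> diff_forms EquiR L (n - 1)" for l using that by blast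
  fix p assume gen: "\<And>l. l \<in> diff_forms EquiL id n \<union> diff_forms EquiR id n \<Longrightarrow> th (l p) \<noteq> 0"
  define z where "z i = p (EquiL i)" for i
  define \<mu> where "\<mu> i = p (EquiR i)" for i
  have g: "generic n (p HbarP) z" "generic n (p HbarP) \<mu>"
    using gen generic_forms[of n p EquiL] generic_forms[of n p EquiR] unfolding z_def \<mu>_def by blast+
  have ww: "f \<circ> longest_perm n \<circ> (longest_perm n \<circ> g) = f \<circ> g" for f :: "nat \<Rightarrow> complex" and g
    by (auto simp: longest_involution)
  show "pos_W (inv L) (p HbarP) (\<lambda>i. p (EquiR i)) (\<lambda>_. (\<lambda>i. p (EquiL i)) \<circ> K) n ((\<lambda>i. p (EquiL i)) \<circ> inv L)
    = (-1) ^ (n * (n - 1) div 2) * pos_W (longest_perm n \<circ> inv K) (p HbarP) (\<lambda>i. - p (EquiL i))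
         (\<lambda>_. (\<lambda>i. p (EquiR i)) \<circ> L) n ((\<lambda>i. p (EquiR i)) \<circ> inv K)"
    using fixed_W_duality[OF permutes_inv[OF L] K g]
    unfolding fixed_W_def ww permutes_inv_inv[OF L] unfolding z_def \<mu>_def .
qed

end

section \<open>Quasi-periodicity\<close>

definition int_vec :: "('c \<Rightarrow> complex) \<Rightarrow> bool" where
  "int_vec m \<longleftrightarrow> (\<forall>c. m c \<in> \<int>)"

definition int_linear :: "(('c \<Rightarrow> complex) \<Rightarrow> complex) \<Rightarrow> bool" where
  "int_linear l \<longleftrightarrow> (\<forall>x y. l (\<lambda>c. x c + y c) = l x + l y) \<and> (\<forall>s x. l (\<lambda>c. s * x c) = s * l x)
     \<and> (\<forall>m. int_vec m \<longrightarrow> l m \<in> \<int>)"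

lemma int_linearD:
  assumes "int_linear l"
  shows "l (\<lambda>c. x c + y c) = l x + l y" "l (\<lambda>c. s * x c) = s * l x" "int_vec m \<Longrightarrow> l m \<in> \<int>"
  using assms by (auto simp: int_linear_def)

lemma int_linear_coord: "int_linear (\<lambda>x. x c)"
  by (simp add: int_linear_def int_vec_def)

lemma int_linear_zero: "int_linear (\<lambda>_. 0)"
  by (simp add: int_linear_def)

lemma int_linear_add: "int_linear l \<Longrightarrow> int_linear l' \<Longrightarrow> int_linear (\<lambda>x. l x + l' x)"
  by (auto simp: int_linear_def algebra_simps)

lemma int_linear_minus: "int_linear l \<Longrightarrow> int_linear (\<lambda>x. - l x)"
  by (auto simp: int_linear_def algebra_simps)

lemma int_linear_diff: "int_linear l \<Longrightarrow> int_linear l' \<Longrightarrow> int_linear (\<lambda>x. l x - l' x)"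
  by (auto simp: int_linear_def algebra_simps)

lemma int_linear_sum: "(\<And>i. i \<in> A \<Longrightarrow> int_linear (l i)) \<Longrightarrow> int_linear (\<lambda>x. \<Sum>i\<in>A. l i x)"
  by (induction A rule: infinite_finite_induct) (auto intro: int_linear_zero int_linear_add)

lemma int_linear_scale: "a \<in> \<int> \<Longrightarrow> int_linear l \<Longrightarrow> int_linear (\<lambda>x. a * l x)"
  by (auto simp: int_linear_def algebra_simps)

text \<open>An integer and its square have the same parity. The locale is instantiated at an
  arbitrary admissible nome, here 1/2.\<close>

lemma exp_pi_square:
  assumes "a \<in> \<int>"
  shows "exp (\<i> * pi * a\<^sup>2) = exp (\<i> * pi * a)"
proof -
  from assms obtain k :: int where a: "a = of_int k" by (elim Ints_cases)
  show ?thesis using nome.exp_pi_int[of "1/2" "k\<^sup>2"] nome.exp_pi_int[of "1/2" k]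
    by (simp add: nome_def a)
qed

context nome
begin

definition translate :: "('c \<Rightarrow> complex) \<Rightarrow> ('c \<Rightarrow> complex) \<Rightarrow> ('c \<Rightarrow> complex) \<Rightarrow> 'c \<Rightarrow> complex" where
  "translate m b x = (\<lambda>c. x c + (m c * \<tau> + 2 * pi * \<i> * b c))"

text \<open>For a quadratic form \<open>Q\<close> with polar form \<open>B\<close> the multiplier is
  \<open>\<plusminus> exp (- B m x - Q m \<tau> / 2)\<close>, which is the one of \<open>\<Prod> th (l x) ^ k\<close> for \<open>Q = \<Sum> k l\<^sup>2\<close>.\<close>

definition mult_exp ::
  "(('c \<Rightarrow> complex) \<Rightarrow> complex) \<Rightarrow> ('c \<Rightarrow> complex) \<Rightarrow> ('c \<Rightarrow> complex) \<Rightarrow> ('c \<Rightarrow> complex) \<Rightarrow> complex"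
where
  "mult_exp Q m b x = exp (\<i> * pi * (Q m + Q b) - (Q (\<lambda>c. m c + x c) - Q m - Q x) / 2 - Q m * \<tau> / 2)"

definition quasi :: "(('c \<Rightarrow> complex) \<Rightarrow> complex) \<Rightarrow> (('c \<Rightarrow> complex) \<Rightarrow> complex) \<Rightarrow> bool" where
  "quasi f Q \<longleftrightarrow> (\<forall>m b x. int_vec m \<longrightarrow> int_vec b \<longrightarrow> f (translate m b x) = mult_exp Q m b x * f x)"

lemma mult_exp_nz [simp]: "mult_exp Q m b x \<noteq> 0"
  by (simp add: mult_exp_def)

lemma mult_exp_add: "mult_exp (\<lambda>x. Q x + Q' x) m b x = mult_exp Q m b x * mult_exp Q' m b x"
  unfolding mult_exp_def exp_add[symmetric] by (rule arg_cong[where f = exp]) (simp add: field_simps)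

lemma mult_exp_minus: "mult_exp (\<lambda>x. - Q x) m b x = inverse (mult_exp Q m b x)"
  unfolding mult_exp_def exp_minus[symmetric] by (rule arg_cong[where f = exp]) (simp add: field_simps)

lemma int_linear_translate:
  assumes "int_linear l"
  shows "l (translate m b x) = l x + (l m * \<tau> + 2 * pi * \<i> * l b)"
proof -
  have "l (translate m b x) = l (\<lambda>c. x c + (\<lambda>c. (\<lambda>c. \<tau> * m c) c + (\<lambda>c. (2 * pi * \<i>) * b c) c) c)"
    unfolding translate_def by (simp only: mult.commute)
  also have "\<dots> = l x + (\<tau> * l m + (2 * pi * \<i>) * l b)" by (simp only: int_linearD(1,2)[OF assms])
  finally show ?thesis by (simp only: mult.commute)
qed

text \<open>The sign with exponent l m + l b is rewritten with the exponent (l m)^2 + (l b)^2. In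
  this shape the multiplier depends additively on the quadratic form, so products and quotients of
  theta functions add and subtract forms.\<close>

lemma quasi_th:
  assumes l: "int_linear l"
  shows "quasi (\<lambda>x. th (l x)) (\<lambda>x. (l x)\<^sup>2)"
  unfolding quasi_def
proof (intro allI impI)
  fix m b x :: "'a \<Rightarrow> complex" assume int: "int_vec m" "int_vec b"
  obtain i j :: int where ij: "l m = of_int i" "l b = of_int j"
    using int_linearD(3)[OF l] int by (metis Ints_cases)
  have "th (l (translate m b x)) = exp (\<i> * pi * (l m + l b) - l m * l x - (l m)\<^sup>2 * \<tau> / 2) * th (l x)"
    unfolding int_linear_translate[OF l] ij add.assoc[symmetric] by (rule th_quasi)
  also have "exp (\<i> * pi * (l m + l b) - l m * l x - (l m)\<^sup>2 * \<tau> / 2) = mult_exp (\<lambda>x. (l x)\<^sup>2) m b x"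
  proof -
    have "mult_exp (\<lambda>x. (l x)\<^sup>2) m b x
        = exp (\<i> * pi * (l m)\<^sup>2) * exp (\<i> * pi * (l b)\<^sup>2) * exp (- l m * l x - (l m)\<^sup>2 * \<tau> / 2)"
      unfolding mult_exp_def exp_add[symmetric] int_linearD(1)[OF l]
      by (rule arg_cong[where f = exp]) (simp add: field_simps power2_eq_square)
    also have "exp (\<i> * pi * (l m)\<^sup>2) = exp (\<i> * pi * l m)" by (rule exp_pi_square) (simp add: ij)
    also have "exp (\<i> * pi * (l b)\<^sup>2) = exp (\<i> * pi * l b)" by (rule exp_pi_square) (simp add: ij)
    finally show ?thesis
      unfolding exp_add[symmetric] by (simp add: algebra_simps)
  qed
  finally show "th (l (translate m b x)) = mult_exp (\<lambda>x. (l x)\<^sup>2) m b x * th (l x)" .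
qed

lemma quasi_mult: "quasi f Q \<Longrightarrow> quasi g Q' \<Longrightarrow> quasi (\<lambda>x. f x * g x) (\<lambda>x. Q x + Q' x)"
  unfolding quasi_def mult_exp_add by (simp add: mult_ac)

lemma quasi_inverse: "quasi f Q \<Longrightarrow> quasi (\<lambda>x. inverse (f x)) (\<lambda>x. - Q x)"
  unfolding quasi_def mult_exp_minus by simp

lemma quasi_one: "quasi (\<lambda>_. 1) (\<lambda>_. 0)"
  by (simp add: quasi_def mult_exp_def)

lemma quasi_prod:
  assumes "\<And>i. i \<in> A \<Longrightarrow> quasi (f i) (Q i)"
  shows "quasi (\<lambda>x. \<Prod>i\<in>A. f i x) (\<lambda>x. \<Sum>i\<in>A. Q i x)"
  using assms by (induction A rule: infinite_finite_induct) (auto intro: quasi_one quasi_mult)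

lemma quasi_sum:
  assumes "\<And>i. i \<in> A \<Longrightarrow> quasi (f i) Q"
  shows "quasi (\<lambda>x. \<Sum>i\<in>A. f i x) Q"
  using assms unfolding quasi_def by (simp add: sum_distrib_left)

section \<open>Quadratic forms of the weight functions\<close>

definition above :: "(nat \<Rightarrow> nat) \<Rightarrow> nat \<Rightarrow> nat \<Rightarrow> complex" where
  "above I m l = of_nat (card {j \<in> {1..m}. I l < I j})"

text \<open>The part of the form that sees the individual variables of level \<open>m\<close>; it
  telescopes between consecutive levels.\<close>

definition top_form :: "(nat \<Rightarrow> nat) \<Rightarrow> complex \<Rightarrow> (nat \<Rightarrow> complex) \<Rightarrow> nat \<Rightarrow> (nat \<Rightarrow> complex) \<Rightarrow> complex" where
  "top_form I h \<mu> m w = (of_nat m - 1) * (\<Sum>l\<in>{1..m}. (w l)\<^sup>2) + 2 * h * (\<Sum>l\<in>{1..m}. w l * above I m l)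
     + 2 * (\<Sum>l\<in>{1..m}. w l * (\<mu> m - \<mu> l))"

definition const_form :: "(nat \<Rightarrow> nat) \<Rightarrow> complex \<Rightarrow> (nat \<Rightarrow> complex) \<Rightarrow> nat \<Rightarrow> complex" where
  "const_form I h \<mu> m = (\<Sum>j\<in>{1..m}. (\<mu> (Suc m) - \<mu> j)\<^sup>2)
     + 2 * h * (\<Sum>j\<in>{1..m}. if I j < I (Suc m) then \<mu> (Suc m) - \<mu> j else 0) + h\<^sup>2 * of_nat m"

text \<open>The contribution of one level that remains after the telescoping. Roots enter only
  through \<open>s\<close> and \<open>s'\<close>, the sums over the levels \<open>m\<close> and
  \<open>Suc m\<close>.\<close>

definition level_form :: "(nat \<Rightarrow> nat) \<Rightarrow> complex \<Rightarrow> (nat \<Rightarrow> complex) \<Rightarrow> nat \<Rightarrow> complex \<Rightarrow> complex \<Rightarrow> complex" where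
  "level_form I h \<mu> m s s' = 2 * s\<^sup>2 - 2 * s * s' + 2 * s * (\<mu> m - \<mu> (Suc m) - h) + const_form I h \<mu> m"

lemma sum_square_differences:
  fixes v :: "nat \<Rightarrow> complex"
  assumes "finite A" "finite B"
  shows "(\<Sum>j\<in>A. \<Sum>l\<in>B. (w l - v j)\<^sup>2) = of_nat (card A) * (\<Sum>l\<in>B. (w l)\<^sup>2)
    + of_nat (card B) * (\<Sum>j\<in>A. (v j)\<^sup>2) - 2 * (\<Sum>j\<in>A. v j) * (\<Sum>l\<in>B. w l)"
proof -
  have "(\<Sum>j\<in>A. \<Sum>l\<in>B. (w l - v j)\<^sup>2) = (\<Sum>j\<in>A. (\<Sum>l\<in>B. (w l)\<^sup>2) + of_nat (card B) * (v j)\<^sup>2 - 2 * v j * (\<Sum>l\<in>B. w l))"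
  proof (intro sum.cong refl)
    fix j
    have "(\<Sum>l\<in>B. (w l - v j)\<^sup>2) = (\<Sum>l\<in>B. (w l)\<^sup>2 + (v j)\<^sup>2 - (2 * v j) * w l)"
      by (intro sum.cong refl) (simp add: power2_diff mult_ac)
    then show "(\<Sum>l\<in>B. (w l - v j)\<^sup>2) = (\<Sum>l\<in>B. (w l)\<^sup>2) + of_nat (card B) * (v j)\<^sup>2 - 2 * v j * (\<Sum>l\<in>B. w l)"
      by (simp only: sum.distrib sum_subtractf sum_distrib_left[symmetric] sum_constant)
  qed
  also have "\<dots> = of_nat (card A) * (\<Sum>l\<in>B. (w l)\<^sup>2)
    + of_nat (card B) * (\<Sum>j\<in>A. (v j)\<^sup>2) - 2 * (\<Sum>j\<in>A. v j) * (\<Sum>l\<in>B. w l)"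
    by (simp add: sum.distrib sum_subtractf sum_distrib_left sum_distrib_right mult_ac)
  finally show ?thesis .
qed

lemma sum_ordered_pairs:
  fixes f :: "nat \<Rightarrow> nat \<Rightarrow> complex"
  shows "(\<Sum>(i, j) | i \<in> {1..m} \<and> j \<in> {1..m} \<and> I i < I j. f i j)
    = (\<Sum>j\<in>{1..m}. \<Sum>i\<in>{1..m}. if (I i :: nat) < I j then f i j else 0)"
proof -
  have "(\<Sum>(i, j) | i \<in> {1..m} \<and> j \<in> {1..m} \<and> I i < I j. f i j)
      = (\<Sum>(i, j) \<in> {1..m} \<times> {1..m}. if I i < I j then f i j else 0)"
    by (rule sum.mono_neutral_cong_left) (auto split: if_splits)
  also have "\<dots> = (\<Sum>i\<in>{1..m}. \<Sum>j\<in>{1..m}. if I i < I j then f i j else 0)"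
    by (simp add: sum.cartesian_product)
  also have "\<dots> = (\<Sum>j\<in>{1..m}. \<Sum>i\<in>{1..m}. if I i < I j then f i j else 0)"
    by (rule sum.swap)
  finally show ?thesis .
qed

text \<open>Adding the sum with \<open>i\<close> and \<open>j\<close> interchanged removes the order
  given by \<open>I\<close>. The factor 2 reflects the two theta factors that each pair contributes
  to the denominator.\<close>

lemma sum_pair_squares:
  fixes v :: "nat \<Rightarrow> complex"
  assumes inj: "inj_on I {1..m}"
  shows "2 * (\<Sum>j\<in>{1..m}. \<Sum>i\<in>{1..m}. if (I i :: nat) < I j then (v i - v j)\<^sup>2 else 0)
    = 2 * (of_nat m * (\<Sum>j\<in>{1..m}. (v j)\<^sup>2) - (\<Sum>j\<in>{1..m}. v j)\<^sup>2)"
proof -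
  let ?f = "\<lambda>i j. if I i < I j then (v i - v j)\<^sup>2 else 0"
  have "2 * (\<Sum>j\<in>{1..m}. \<Sum>i\<in>{1..m}. ?f i j) = (\<Sum>j\<in>{1..m}. \<Sum>i\<in>{1..m}. ?f i j) + (\<Sum>j\<in>{1..m}. \<Sum>i\<in>{1..m}. ?f j i)"
    using sum.swap[of "\<lambda>i j. ?f i j" "{1..m}" "{1..m}"] by (simp only: mult_2)
  also have "\<dots> = (\<Sum>j\<in>{1..m}. \<Sum>i\<in>{1..m}. ?f i j + ?f j i)" by (simp only: sum.distrib)
  also have "\<dots> = (\<Sum>j\<in>{1..m}. \<Sum>i\<in>{1..m}. (v i - v j)\<^sup>2)"
  proof (intro sum.cong refl)
    fix i j assume ij: "i \<in> {1..m}" "j \<in> {1..m}"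
    consider "I i < I j" | "I j < I i" | "i = j"
      using inj_on_eq_iff[OF inj ij(2,1)] by force
    then show "?f j i + ?f i j = (v j - v i)\<^sup>2"
    proof cases
      case 1
      then show ?thesis using power2_commute[of "v i" "v j"] by simp
    qed simp_all
  qed
  also have "\<dots> = 2 * (of_nat m * (\<Sum>j\<in>{1..m}. (v j)\<^sup>2) - (\<Sum>j\<in>{1..m}. v j)\<^sup>2)"
    by (subst sum_square_differences) (simp_all add: power2_eq_square algebra_simps)
  finally show ?thesis .
qed

text \<open>The left side is the form of \<open>pos_G\<close>, numerator minus denominator. The
  squares of the roots \<open>v\<close> occur m + 1 times in the numerator and 2 m times in the
  denominator; the balance 1 - m is made up by the preceding level, whence the coefficient
  \<open>of_nat m - 1\<close> in \<open>top_form\<close>.\<close>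

lemma step_form:
  assumes inj: "inj_on I {1..Suc m}"
  shows "(\<Sum>(j, l) \<in> {1..m} \<times> {1..Suc m}.
      (if I l < I j then h + (w l - v j)
       else if l = j then w l - v j + (if I j < I (Suc m) then h else 0) + \<mu> (Suc m) - \<mu> j
       else w l - v j)\<^sup>2)
    - (\<Sum>(i, j) | i \<in> {1..m} \<and> j \<in> {1..m} \<and> I i < I j. (h + v i - v j)\<^sup>2 + (v j - v i)\<^sup>2)
    = top_form I h \<mu> (Suc m) w - top_form I h \<mu> m v
      + level_form I h \<mu> m (\<Sum>j\<in>{1..m}. v j) (\<Sum>l\<in>{1..Suc m}. w l)"
proof -
  let ?A = "{1..m}" and ?B = "{1..Suc m}"
  have injm: "inj_on I ?A" by (rule inj_on_subset[OF inj]) auto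
  define e where "e j = (if I j < I (Suc m) then 1 else 0 :: complex)" for j
  define o' where "o' l j = (if I l < I j then 1 else 0 :: complex)" for l j
  define \<nu> where "\<nu> j = \<mu> (Suc m) - \<mu> j" for j
  define sv where "sv = (\<Sum>j\<in>?A. v j)"
  define sw where "sw = (\<Sum>l\<in>?B. w l)"
  define pv where "pv = (\<Sum>j\<in>?A. (v j)\<^sup>2)"
  define pw where "pw = (\<Sum>l\<in>?B. (w l)\<^sup>2)"
  have B: "?B = insert (Suc m) ?A" by auto
  have num: "(\<Sum>(j, l) \<in> ?A \<times> ?B.
      (if I l < I j then h + (w l - v j)
       else if l = j then w l - v j + (if I j < I (Suc m) then h else 0) + \<mu> (Suc m) - \<mu> j
       else w l - v j)\<^sup>2)
    = (\<Sum>j\<in>?A. \<Sum>l\<in>?B. (w l - v j)\<^sup>2) + (\<Sum>j\<in>?A. \<Sum>l\<in>?B. o' l j * (2 * h * (w l - v j) + h\<^sup>2))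
      + (\<Sum>j\<in>?A. 2 * (w j - v j) * (e j * h + \<nu> j) + (e j * h + \<nu> j)\<^sup>2)"
  proof -
    have "(\<Sum>l\<in>?B. (if I l < I j then h + (w l - v j)
       else if l = j then w l - v j + (if I j < I (Suc m) then h else 0) + \<mu> (Suc m) - \<mu> j
       else w l - v j)\<^sup>2)
      = (\<Sum>l\<in>?B. (w l - v j)\<^sup>2) + (\<Sum>l\<in>?B. o' l j * (2 * h * (w l - v j) + h\<^sup>2))
        + (2 * (w j - v j) * (e j * h + \<nu> j) + (e j * h + \<nu> j)\<^sup>2)" if j: "j \<in> ?A" for j
    proof -
      have "(\<Sum>l\<in>?B. (if I l < I j then h + (w l - v j)
       else if l = j then w l - v j + (if I j < I (Suc m) then h else 0) + \<mu> (Suc m) - \<mu> j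
       else w l - v j)\<^sup>2) = (\<Sum>l\<in>?B. (w l - v j)\<^sup>2 + o' l j * (2 * h * (w l - v j) + h\<^sup>2)
         + (if l = j then 2 * (w j - v j) * (e j * h + \<nu> j) + (e j * h + \<nu> j)\<^sup>2 else 0))"
        by (intro sum.cong refl)
           (auto simp: o'_def e_def \<nu>_def power2_eq_square algebra_simps)
      also have "\<dots> = (\<Sum>l\<in>?B. (w l - v j)\<^sup>2) + (\<Sum>l\<in>?B. o' l j * (2 * h * (w l - v j) + h\<^sup>2))
        + (\<Sum>l\<in>?B. if l = j then 2 * (w j - v j) * (e j * h + \<nu> j) + (e j * h + \<nu> j)\<^sup>2 else 0)"
        by (simp only: sum.distrib)
      also have "(\<Sum>l\<in>?B. if l = j then 2 * (w j - v j) * (e j * h + \<nu> j) + (e j * h + \<nu> j)\<^sup>2 else 0)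
          = 2 * (w j - v j) * (e j * h + \<nu> j) + (e j * h + \<nu> j)\<^sup>2"
        using j by (subst sum.delta) auto
      finally show ?thesis .
    qed
    then show ?thesis unfolding sum.cartesian_product[symmetric] by (simp only: sum.distrib cong: sum.cong)
  qed
  have sq: "(\<Sum>j\<in>?A. \<Sum>l\<in>?B. (w l - v j)\<^sup>2) = of_nat m * pw + (of_nat m + 1) * pv - 2 * sv * sw"
    by (subst sum_square_differences) (simp_all add: pv_def pw_def sv_def sw_def)
  have den: "(\<Sum>(i, j) | i \<in> ?A \<and> j \<in> ?A \<and> I i < I j. (h + v i - v j)\<^sup>2 + (v j - v i)\<^sup>2)
    = 2 * (of_nat m * pv - sv\<^sup>2) + (\<Sum>j\<in>?A. \<Sum>i\<in>?A. o' i j * (2 * h * (v i - v j) + h\<^sup>2))"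
  proof -
    have "(\<Sum>(i, j) | i \<in> ?A \<and> j \<in> ?A \<and> I i < I j. (h + v i - v j)\<^sup>2 + (v j - v i)\<^sup>2)
      = (\<Sum>j\<in>?A. \<Sum>i\<in>?A. 2 * (if I i < I j then (v i - v j)\<^sup>2 else 0) + o' i j * (2 * h * (v i - v j) + h\<^sup>2))"
      unfolding sum_ordered_pairs
      by (intro sum.cong refl) (simp add: o'_def power2_eq_square algebra_simps)
    also have "\<dots> = 2 * (\<Sum>j\<in>?A. \<Sum>i\<in>?A. if I i < I j then (v i - v j)\<^sup>2 else 0)
        + (\<Sum>j\<in>?A. \<Sum>i\<in>?A. o' i j * (2 * h * (v i - v j) + h\<^sup>2))"
      by (simp only: sum.distrib sum_distrib_left)
    finally show ?thesis unfolding sum_pair_squares[OF injm] pv_def sv_def .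
  qed
  have above_sum: "above I k l = (\<Sum>j\<in>{1..k}. o' l j)" for k l
    by (simp add: above_def o'_def sum.If_cases Collect_conj_eq Int_commute flip: of_nat_sum)
       (simp add: Int_def)
  have above_Suc: "above I (Suc m) l = above I m l + e l" if "l \<in> ?A" for l
    unfolding above_sum by (simp add: o'_def e_def)
  have o_top: "o' (Suc m) j = 1 - e j" if "j \<in> ?A" for j
  proof -
    have "I j \<noteq> I (Suc m)" using inj_on_eq_iff[OF inj, of j "Suc m"] that by auto
    then show ?thesis by (auto simp: o'_def e_def)
  qed
  have above_top: "above I (Suc m) (Suc m) = (\<Sum>j\<in>?A. 1 - e j)"
  proof -
    have "(\<Sum>j\<in>?B. o' (Suc m) j) = (\<Sum>j\<in>?A. o' (Suc m) j)" unfolding B by (simp add: o'_def)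
    also have "\<dots> = (\<Sum>j\<in>?A. 1 - e j)" by (intro sum.cong refl o_top)
    finally show ?thesis unfolding above_sum .
  qed
  \<comment> \<open>Numerator and denominator have the h-terms of the same pairs below the last
    position. Only the differences \<open>w l - v l\<close> and the pairs with the last position are
    left.\<close>
  have diff: "(\<Sum>j\<in>?A. \<Sum>l\<in>?B. o' l j * (2 * h * (w l - v j) + h\<^sup>2))
      - (\<Sum>j\<in>?A. \<Sum>i\<in>?A. o' i j * (2 * h * (v i - v j) + h\<^sup>2))
    = (\<Sum>l\<in>?A. 2 * h * (w l - v l) * above I m l) + (\<Sum>j\<in>?A. (1 - e j) * (2 * h * (w (Suc m) - v j) + h\<^sup>2))"
  proof -
    have "(\<Sum>j\<in>?A. \<Sum>l\<in>?B. o' l j * (2 * h * (w l - v j) + h\<^sup>2))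
      = (\<Sum>j\<in>?A. (1 - e j) * (2 * h * (w (Suc m) - v j) + h\<^sup>2))
        + (\<Sum>j\<in>?A. \<Sum>l\<in>?A. o' l j * (2 * h * (w l - v j) + h\<^sup>2))"
      unfolding B sum.distrib[symmetric] using o_top by (intro sum.cong refl) simp
    moreover have "(\<Sum>j\<in>?A. \<Sum>l\<in>?A. o' l j * (2 * h * (w l - v j) + h\<^sup>2))
      - (\<Sum>j\<in>?A. \<Sum>l\<in>?A. o' l j * (2 * h * (v l - v j) + h\<^sup>2))
      = (\<Sum>j\<in>?A. \<Sum>l\<in>?A. 2 * h * (w l - v l) * o' l j)"
      unfolding sum_subtractf[symmetric] by (intro sum.cong refl) (simp add: algebra_simps)
    moreover have "(\<Sum>j\<in>?A. \<Sum>l\<in>?A. 2 * h * (w l - v l) * o' l j) = (\<Sum>l\<in>?A. 2 * h * (w l - v l) * above I m l)"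
      unfolding above_sum sum_distrib_left by (rule sum.swap)
    ultimately show ?thesis by (simp add: algebra_simps)
  qed
  have ee: "e j * e j = e j" for j by (simp add: e_def)
  have rest: "(\<Sum>l\<in>?A. 2 * h * (w l - v l) * above I m l) + (\<Sum>j\<in>?A. (1 - e j) * (2 * h * (w (Suc m) - v j) + h\<^sup>2))
      + (\<Sum>j\<in>?A. 2 * (w j - v j) * (e j * h + \<nu> j) + (e j * h + \<nu> j)\<^sup>2)
    = 2 * h * (\<Sum>l\<in>?B. w l * above I (Suc m) l) - 2 * h * (\<Sum>l\<in>?A. v l * above I m l) - 2 * h * sv
      + 2 * (\<Sum>l\<in>?A. (w l - v l) * \<nu> l) + (\<Sum>j\<in>?A. (\<nu> j)\<^sup>2) + 2 * h * (\<Sum>j\<in>?A. e j * \<nu> j) + h\<^sup>2 * of_nat m"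
  proof -
    have wsum: "(\<Sum>l\<in>?B. w l * above I (Suc m) l) = (\<Sum>l\<in>?A. w l * (above I m l + e l) + w (Suc m) * (1 - e l))"
      unfolding B using above_Suc by (simp add: above_top sum.distrib sum_distrib_left)
    have hm: "h\<^sup>2 * of_nat m = (\<Sum>l\<in>?A. h\<^sup>2)" by simp
    have "2 * h * (\<Sum>l\<in>?B. w l * above I (Suc m) l) - 2 * h * (\<Sum>l\<in>?A. v l * above I m l) - 2 * h * sv
      + 2 * (\<Sum>l\<in>?A. (w l - v l) * \<nu> l) + (\<Sum>j\<in>?A. (\<nu> j)\<^sup>2) + 2 * h * (\<Sum>j\<in>?A. e j * \<nu> j) + h\<^sup>2 * of_nat m
      = (\<Sum>l\<in>?A. 2 * h * (w l * (above I m l + e l) + w (Suc m) * (1 - e l)) - 2 * h * (v l * above I m l) - 2 * h * v l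
          + 2 * ((w l - v l) * \<nu> l) + (\<nu> l)\<^sup>2 + 2 * h * (e l * \<nu> l) + h\<^sup>2)"
      unfolding wsum sv_def hm by (simp only: sum.distrib sum_subtractf sum_distrib_left distrib_left)
    also have "\<dots> = (\<Sum>l\<in>?A. 2 * h * (w l - v l) * above I m l + (1 - e l) * (2 * h * (w (Suc m) - v l) + h\<^sup>2)
          + (2 * (w l - v l) * (e l * h + \<nu> l) + (e l * h + \<nu> l)\<^sup>2))"
    proof (intro sum.cong refl)
      fix l
      have "(e l * h + \<nu> l)\<^sup>2 = (e l * e l) * h\<^sup>2 + 2 * h * (e l * \<nu> l) + (\<nu> l)\<^sup>2"
        by (simp add: power2_eq_square algebra_simps)
      then have sq: "(e l * h + \<nu> l)\<^sup>2 = e l * h\<^sup>2 + 2 * h * (e l * \<nu> l) + (\<nu> l)\<^sup>2" unfolding ee .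
      show "2 * h * (w l * (above I m l + e l) + w (Suc m) * (1 - e l)) - 2 * h * (v l * above I m l) - 2 * h * v l
          + 2 * ((w l - v l) * \<nu> l) + (\<nu> l)\<^sup>2 + 2 * h * (e l * \<nu> l) + h\<^sup>2
        = 2 * h * (w l - v l) * above I m l + (1 - e l) * (2 * h * (w (Suc m) - v l) + h\<^sup>2)
          + (2 * (w l - v l) * (e l * h + \<nu> l) + (e l * h + \<nu> l)\<^sup>2)"
        unfolding sq by (simp add: algebra_simps)
    qed
    also have "\<dots> = (\<Sum>l\<in>?A. 2 * h * (w l - v l) * above I m l) + (\<Sum>j\<in>?A. (1 - e j) * (2 * h * (w (Suc m) - v j) + h\<^sup>2))
      + (\<Sum>j\<in>?A. 2 * (w j - v j) * (e j * h + \<nu> j) + (e j * h + \<nu> j)\<^sup>2)"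
      by (simp only: sum.distrib)
    finally show ?thesis by simp
  qed
  have \<mu>: "2 * (\<Sum>l\<in>?A. (w l - v l) * \<nu> l)
    = 2 * (\<Sum>l\<in>?B. w l * (\<mu> (Suc m) - \<mu> l)) - 2 * (\<Sum>l\<in>?A. v l * (\<mu> m - \<mu> l)) + 2 * sv * (\<mu> m - \<mu> (Suc m))"
  proof -
    have "(\<Sum>l\<in>?B. w l * (\<mu> (Suc m) - \<mu> l)) = (\<Sum>l\<in>?A. w l * \<nu> l)"
      unfolding B by (simp add: \<nu>_def)
    then have "2 * (\<Sum>l\<in>?B. w l * (\<mu> (Suc m) - \<mu> l)) - 2 * (\<Sum>l\<in>?A. v l * (\<mu> m - \<mu> l)) + 2 * sv * (\<mu> m - \<mu> (Suc m))
      = (\<Sum>l\<in>?A. 2 * (w l * \<nu> l) - 2 * (v l * (\<mu> m - \<mu> l)) + 2 * v l * (\<mu> m - \<mu> (Suc m)))"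
      unfolding sv_def by (simp add: sum.distrib sum_subtractf sum_distrib_left sum_distrib_right)
    also have "\<dots> = (\<Sum>l\<in>?A. 2 * ((w l - v l) * \<nu> l))"
      by (intro sum.cong refl) (simp add: \<nu>_def algebra_simps)
    finally show ?thesis by (simp add: sum_distrib_left)
  qed
  have const: "const_form I h \<mu> m = (\<Sum>j\<in>?A. (\<nu> j)\<^sup>2) + 2 * h * (\<Sum>j\<in>?A. e j * \<nu> j) + h\<^sup>2 * of_nat m"
    unfolding const_form_def \<nu>_def e_def by (simp add: if_distrib[where f = "\<lambda>x. x * _"] cong: if_cong)
  have "of_nat m * pw + (of_nat m + 1) * pv - 2 * sv * sw - 2 * (of_nat m * pv - sv\<^sup>2)
      + ((\<Sum>l\<in>?A. 2 * h * (w l - v l) * above I m l) + (\<Sum>j\<in>?A. (1 - e j) * (2 * h * (w (Suc m) - v j) + h\<^sup>2))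
      + (\<Sum>j\<in>?A. 2 * (w j - v j) * (e j * h + \<nu> j) + (e j * h + \<nu> j)\<^sup>2))
    = top_form I h \<mu> (Suc m) w - top_form I h \<mu> m v + level_form I h \<mu> m sv sw"
    unfolding rest \<mu> top_form_def level_form_def const pw_def[symmetric] pv_def[symmetric]
    by (simp add: algebra_simps)
  then show ?thesis
    unfolding num den sq sv_def[symmetric] sw_def[symmetric] using diff by (simp add: algebra_simps)
qed

text \<open>The sum of the top variables is passed as \<open>s\<close>, since these are the argument
  \<open>w\<close> of \<open>pos_W\<close> and not a level of \<open>t\<close>.\<close>

definition rest_form ::
  "(nat \<Rightarrow> nat) \<Rightarrow> complex \<Rightarrow> (nat \<Rightarrow> complex) \<Rightarrow> (nat \<Rightarrow> nat \<Rightarrow> complex) \<Rightarrow> nat \<Rightarrow> complex \<Rightarrow> complex"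
where
  "rest_form I h \<mu> t m s = (\<Sum>k<m. level_form I h \<mu> k (\<Sum>j\<in>{1..k}. t k j)
     (if Suc k = m then s else \<Sum>j\<in>{1..Suc k}. t (Suc k) j))"

lemma rest_form_Suc:
  "rest_form I h \<mu> t (Suc m) s = rest_form I h \<mu> t m (\<Sum>j\<in>{1..m}. t m j)
     + level_form I h \<mu> m (\<Sum>j\<in>{1..m}. t m j) s"
proof -
  have "(if Suc k = Suc m then s else (\<Sum>j\<in>{1..Suc k}. t (Suc k) j))
      = (if Suc k = m then (\<Sum>j\<in>{1..m}. t m j) else (\<Sum>j\<in>{1..Suc k}. t (Suc k) j))" if "k < m" for k
    using that by auto
  then show ?thesis unfolding rest_form_def sum.lessThan_Suc
    by (intro arg_cong2[where f = "(+)"] sum.cong refl) (simp_all del: sum.cl_ivl_Suc)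
qed

text \<open>All summands of the symmetrisation must share one multiplier. They do:
  \<open>top_form\<close> of the permuted roots cancels in \<open>step_form\<close>, and everything
  else depends on their sum only.\<close>

lemma quasi_pos_W:
  fixes t :: "('c \<Rightarrow> complex) \<Rightarrow> nat \<Rightarrow> nat \<Rightarrow> complex"
  assumes "int_linear h" "\<And>j. int_linear (\<lambda>x. \<mu> x j)" "\<And>k j. int_linear (\<lambda>x. t x k j)"
    and "inj_on I {1..m}" and "\<And>j. int_linear (\<lambda>x. w x j)"
  shows "quasi (\<lambda>x. pos_W I (h x) (\<mu> x) (t x) m (w x))
    (\<lambda>x. top_form I (h x) (\<mu> x) m (w x) + rest_form I (h x) (\<mu> x) (t x) m (\<Sum>j\<in>{1..m}. w x j))"
  using assms(4,5)
proof (induction m arbitrary: w)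
  case 0
  show ?case by (simp add: top_form_def rest_form_def quasi_one)
next
  case (Suc m)
  have inj: "inj_on I {1..m}" by (rule inj_on_subset[OF Suc.prems(1)]) auto
  have "quasi (\<lambda>x. pos_W I (h x) (\<mu> x) (t x) m (t x m \<circ> \<pi>) * pos_G I (h x) (\<mu> x) m (t x m \<circ> \<pi>) (w x))
    (\<lambda>x. top_form I (h x) (\<mu> x) (Suc m) (w x) + rest_form I (h x) (\<mu> x) (t x) (Suc m) (\<Sum>j\<in>{1..Suc m}. w x j))"
    if \<pi>: "\<pi> permutes {1..m}" for \<pi>
  proof -
    define v where "v x = t x m \<circ> \<pi>" for x
    have v: "int_linear (\<lambda>x. v x j)" for j using assms(3) by (simp add: v_def)
    have sum_v: "(\<Sum>j\<in>{1..m}. v x j) = (\<Sum>j\<in>{1..m}. t x m j)" for x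
      unfolding v_def using sum.permute[OF \<pi>, of "t x m"] by simp
    have 1: "quasi (\<lambda>x. pos_W I (h x) (\<mu> x) (t x) m (v x))
        (\<lambda>x. top_form I (h x) (\<mu> x) m (v x) + rest_form I (h x) (\<mu> x) (t x) m (\<Sum>j\<in>{1..m}. v x j))"
      by (rule Suc.IH[OF inj v])
    define arg where "arg x = (\<lambda>(j, l). (if I l < I j then h x + (w x l - v x j)
       else if l = j then w x l - v x j + (if I j < I (Suc m) then h x else 0) + \<mu> x (Suc m) - \<mu> x j
       else w x l - v x j))" for x
    have arg: "int_linear (\<lambda>x. arg x y)" for y
    proof -
      obtain j l where y: "y = (j, l)" by force
      show ?thesis unfolding y arg_def prod.case
        by (cases "I l < I j"; cases "l = j"; cases "I j < I (Suc m)")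
           (simp_all only: if_True if_False simp_thms,
             (intro int_linear_add int_linear_diff int_linear_zero v assms Suc.prems)+)
    qed
    have 2: "quasi (\<lambda>x. pos_num I (h x) (\<mu> x) m (v x) (w x)) (\<lambda>x. \<Sum>y\<in>{1..m} \<times> {1..Suc m}. (arg x y)\<^sup>2)"
    proof -
      have "pos_num I (h x) (\<mu> x) m (v x) (w x) = (\<Prod>y\<in>{1..m} \<times> {1..Suc m}. th (arg x y))" for x
        unfolding pos_num_def by (intro prod.cong refl) (auto simp: pos_psi_def arg_def)
      then show ?thesis using quasi_prod[where A = "{1..m} \<times> {1..Suc m}", OF quasi_th[OF arg]] by simp
    qed
    have 3: "quasi (\<lambda>x. pos_den I (h x) m (v x))
      (\<lambda>x. \<Sum>y | fst y \<in> {1..m} \<and> snd y \<in> {1..m} \<and> I (fst y) < I (snd y).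
         (h x + v x (fst y) - v x (snd y))\<^sup>2 + (v x (snd y) - v x (fst y))\<^sup>2)"
      unfolding pos_den_def case_prod_unfold
      by (intro quasi_prod quasi_mult quasi_th int_linear_add int_linear_diff assms v)
    have 4: "quasi (\<lambda>x. pos_W I (h x) (\<mu> x) (t x) m (v x) * (pos_num I (h x) (\<mu> x) m (v x) (w x) * inverse (pos_den I (h x) m (v x))))
      (\<lambda>x. top_form I (h x) (\<mu> x) m (v x) + rest_form I (h x) (\<mu> x) (t x) m (\<Sum>j\<in>{1..m}. v x j)
        + ((\<Sum>y\<in>{1..m} \<times> {1..Suc m}. (arg x y)\<^sup>2) + - (\<Sum>y | fst y \<in> {1..m} \<and> snd y \<in> {1..m} \<and> I (fst y) < I (snd y).
         (h x + v x (fst y) - v x (snd y))\<^sup>2 + (v x (snd y) - v x (fst y))\<^sup>2)))"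
      by (rule quasi_mult[OF 1 quasi_mult[OF 2 quasi_inverse[OF 3]]])
    have 5: "(\<Sum>y\<in>{1..m} \<times> {1..Suc m}. (arg x y)\<^sup>2) - (\<Sum>y | fst y \<in> {1..m} \<and> snd y \<in> {1..m} \<and> I (fst y) < I (snd y).
         (h x + v x (fst y) - v x (snd y))\<^sup>2 + (v x (snd y) - v x (fst y))\<^sup>2)
      = top_form I (h x) (\<mu> x) (Suc m) (w x) - top_form I (h x) (\<mu> x) m (v x)
        + level_form I (h x) (\<mu> x) m (\<Sum>j\<in>{1..m}. v x j) (\<Sum>l\<in>{1..Suc m}. w x l)" for x
      using step_form[OF Suc.prems(1), of "h x" "w x" "v x" "\<mu> x"] unfolding arg_def case_prod_unfold .
    have alg: "a + r + (n + - d) = t' + (r + l)" if "n - d = t' - a + l" for a r n d t' l :: complex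
      using that by (simp add: algebra_simps)
    show ?thesis
      using 4 unfolding alg[OF 5] sum_v
      unfolding pos_G_def divide_inverse v_def[symmetric] rest_form_Suc .
  qed
  then show ?case unfolding pos_W.simps by (intro quasi_sum) simp
qed

end

section \<open>Comparison with the weight functions of the definition\<close>

text \<open>Lets the factor of the highest level leave the symmetrisations over the lower ones,
  which turns the nested sums into the recursion of \<open>pos_W\<close>.\<close>

lemma foldr_Sym_sum:
  assumes "\<And>k i t \<rho>. k \<in> set ks \<Longrightarrow> C i (t(k := \<rho>)) = C i t"
  shows "foldr Sym_level ks (\<lambda>t. \<Sum>i\<in>A. C i t * F i t) t = (\<Sum>i\<in>A. C i t * foldr Sym_level ks (F i) t)"
  using assms
proof (induction ks arbitrary: t)
  case (Cons k ks)
  have IH: "foldr Sym_level ks (\<lambda>t. \<Sum>i\<in>A. C i t * F i t) t = (\<Sum>i\<in>A. C i t * foldr Sym_level ks (F i) t)" for t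
    by (rule Cons.IH) (rule Cons.prems, simp)
  have C: "C i (t(k := \<rho>)) = C i t" for i t \<rho> by (rule Cons.prems) simp
  have "foldr Sym_level (k # ks) (\<lambda>t. \<Sum>i\<in>A. C i t * F i t) t
      = (\<Sum>\<pi> | \<pi> permutes {1..k}. \<Sum>i\<in>A. C i t * foldr Sym_level ks (F i) (t(k := t k \<circ> \<pi>)))"
    unfolding foldr.simps o_apply Sym_level_def[of k] IH C ..
  also have "\<dots> = (\<Sum>i\<in>A. C i t * foldr Sym_level (k # ks) (F i) t)"
    unfolding foldr.simps o_apply Sym_level_def[of k] sum_distrib_left by (rule sum.swap)
  finally show ?case .
qed simp

lemma foldr_Sym_update:
  assumes "m \<notin> set ks"
  shows "foldr Sym_level ks (\<lambda>t. F (t(m := f (t m)))) t = foldr Sym_level ks F (t(m := f (t m)))"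
  using assms
proof (induction ks arbitrary: t)
  case (Cons k ks)
  have IH: "foldr Sym_level ks (\<lambda>t. F (t(m := f (t m)))) t = foldr Sym_level ks F (t(m := f (t m)))" for t
    by (rule Cons.IH) (use Cons.prems in simp)
  have "m \<noteq> k" using Cons.prems by auto
  then show ?case unfolding foldr.simps o_apply Sym_level_def[of k] IH
    by (simp add: fun_upd_twist)
qed simp

lemma sorted_val_rank:
  assumes inj: "inj_on I {1..k}"
  shows "\<exists>e. e permutes {1..k} \<and> (\<forall>j\<in>{1..k}. sorted_val I k (e j) = I j)"
    and "\<And>a b. a \<in> {1..k} \<Longrightarrow> b \<in> {1..k} \<Longrightarrow> a < b \<Longrightarrow> sorted_val I k a < sorted_val I k b"
proof -
  define xs where "xs = sorted_list_of_set (I ` {1..k})"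
  have len: "length xs = k" using inj by (simp add: xs_def card_image)
  have dist: "distinct xs" and set: "set xs = I ` {1..k}" by (simp_all add: xs_def)
  have sv: "sorted_val I k a = xs ! (a - 1)" for a by (simp add: sorted_val_def xs_def)
  show less: "sorted_val I k a < sorted_val I k b" if "a \<in> {1..k}" "b \<in> {1..k}" "a < b" for a b
    using that len sorted_wrt_nth_less[of "(<)" xs "a - 1" "b - 1"] strict_sorted_list_of_set[of "I ` {1..k}"]
    unfolding sv xs_def[symmetric] by auto
  have inj_sv: "inj_on (sorted_val I k) {1..k}"
    by (rule linorder_inj_onI) (use less in force)+
  have img: "sorted_val I k ` {1..k} = I ` {1..k}"
  proof
    show "sorted_val I k ` {1..k} \<subseteq> I ` {1..k}"
      unfolding set[symmetric] sv using len by (auto intro!: nth_mem)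
    show "I ` {1..k} \<subseteq> sorted_val I k ` {1..k}"
    proof
      fix x assume "x \<in> I ` {1..k}"
      then obtain i where "i < k" "xs ! i = x" unfolding set[symmetric] in_set_conv_nth len by blast
      then show "x \<in> sorted_val I k ` {1..k}" unfolding sv by (intro image_eqI[of _ _ "Suc i"]) auto
    qed
  qed
  define e where "e j = (if j \<in> {1..k} then the_inv_into {1..k} (sorted_val I k) (I j) else j)" for j
  have e: "e j \<in> {1..k}" "sorted_val I k (e j) = I j" if "j \<in> {1..k}" for j
  proof -
    have Ij: "I j \<in> sorted_val I k ` {1..k}" unfolding img using that by (rule imageI)
    have ej: "e j = the_inv_into {1..k} (sorted_val I k) (I j)" using that by (simp only: e_def if_True)
    show "e j \<in> {1..k}" unfolding ej by (rule the_inv_into_into[OF inj_sv Ij order_refl])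
    show "sorted_val I k (e j) = I j" unfolding ej by (rule f_the_inv_into_f[OF inj_sv Ij])
  qed
  have "e permutes {1..k}"
  proof (rule bij_imp_permutes)
    have "inj_on e {1..k}" using e(2) inj by (metis inj_on_def)
    moreover have "e ` {1..k} \<subseteq> {1..k}" using e(1) by blast
    ultimately show "bij_betw e {1..k} {1..k}" by (simp add: bij_betw_def endo_inj_surj)
  qed (simp only: e_def if_False)
  with e show "\<exists>e. e permutes {1..k} \<and> (\<forall>j\<in>{1..k}. sorted_val I k (e j) = I j)" by blast
qed

context nome
begin

lemma pos_W_permute_roots:
  assumes "\<And>k. k < m \<Longrightarrow> \<rho> k permutes {1..k}"
  shows "pos_W I h \<mu> (\<lambda>k. t k \<circ> \<rho> k) m w = pos_W I h \<mu> t m w"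
  using assms
proof (induction m arbitrary: w)
  case (Suc m)
  have "\<rho> m permutes {1..m}" using Suc.prems by simp
  have IH: "pos_W I h \<mu> (\<lambda>k. t k \<circ> \<rho> k) m w = pos_W I h \<mu> t m w" for w
    by (rule Suc.IH) (use Suc.prems in simp)
  have "pos_W I h \<mu> (\<lambda>k. t k \<circ> \<rho> k) (Suc m) w
      = (\<Sum>\<pi> | \<pi> permutes {1..m}. pos_W I h \<mu> t m (t m \<circ> (\<rho> m \<circ> \<pi>)) * pos_G I h \<mu> m (t m \<circ> (\<rho> m \<circ> \<pi>)) w)"
    unfolding pos_W.simps IH comp_assoc ..
  also have "\<dots> = pos_W I h \<mu> t (Suc m) w"
    unfolding pos_W.simps by (rule setum_permutations_compose_left[OF \<open>\<rho> m permutes {1..m}\<close>, symmetric])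
  finally show ?case .
qed simp

text \<open>A reindexing by the rank permutations \<open>e\<close> and \<open>e'\<close>. The value
  in position \<open>Suc k\<close> differs from \<open>I j\<close> for \<open>j\<close> up to
  \<open>k\<close>, so the case of equality in \<open>p_ind\<close> does not arise.\<close>

lemma weight_level:
  assumes I: "I permutes {1..N}" and k: "Suc k \<le> N"
    and e: "e permutes {1..k}" "\<And>j. j \<in> {1..k} \<Longrightarrow> sorted_val I k (e j) = I j"
    and e': "e' permutes {1..Suc k}" "\<And>j. j \<in> {1..Suc k} \<Longrightarrow> sorted_val I (Suc k) (e' j) = I j"
  shows "(\<Prod>a\<in>{1..k}. \<Prod>c\<in>{1..Suc k}. psi q I h \<mu> k a c (w c - v a)) /
       (\<Prod>b\<in>{1..k}. \<Prod>a\<in>{1..<b}. th (h + v a - v b) * th (v b - v a))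
    = pos_G I h \<mu> k (v \<circ> e) (w \<circ> e')"
proof -
  have inj: "I i = I j \<longleftrightarrow> i = j" for i j using permutes_inj[OF I] by (auto simp: inj_def)
  have inj_on: "inj_on I A" for A using permutes_inj_on[OF I] .
  have "(\<Prod>a\<in>{1..k}. \<Prod>c\<in>{1..Suc k}. psi q I h \<mu> k a c (w c - v a))
      = (\<Prod>a\<in>{1..k}. \<Prod>c\<in>{1..Suc k}. psi q I h \<mu> k (e a) (e' c) (w (e' c) - v (e a)))"
    using prod.permute[OF e(1), of "\<lambda>a. \<Prod>c\<in>{1..Suc k}. psi q I h \<mu> k a c (w c - v a)"]
      prod.permute[OF e'(1), of "\<lambda>c. psi q I h \<mu> k (e a) c (w c - v (e a))" for a]
    unfolding o_def by simp
  also have "\<dots> = (\<Prod>a\<in>{1..k}. \<Prod>c\<in>{1..Suc k}. pos_psi I h \<mu> k a c ((w \<circ> e') c - (v \<circ> e) a))"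
  proof (intro prod.cong refl)
    fix j l assume j: "j \<in> {1..k}" and l: "l \<in> {1..Suc k}"
    have sv: "sorted_val I k (e j) = I j" "sorted_val I (k + 1) (e' l) = I l"
      using e(2)[OF j] e'(2)[OF l] by simp_all
    have ne: "I (Suc k) \<noteq> I j" unfolding inj using j by auto
    show "psi q I h \<mu> k (e j) (e' l) (w (e' l) - v (e j)) = pos_psi I h \<mu> k j l ((w \<circ> e') l - (v \<circ> e) j)"
      unfolding psi_def sv pos_psi_def Let_def p_ind_def inj permutes_inverses(2)[OF I] o_apply
      by (cases "I l < I j"; cases "l = j"; cases "I j < I (Suc k)"; use ne in simp)
  qed
  also have "\<dots> = pos_num I h \<mu> k (v \<circ> e) (w \<circ> e')"
    unfolding pos_num_def by (rule prod.cartesian_product)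
  finally have num: "(\<Prod>a\<in>{1..k}. \<Prod>c\<in>{1..Suc k}. psi q I h \<mu> k a c (w c - v a)) = pos_num I h \<mu> k (v \<circ> e) (w \<circ> e')" .
  have ord: "e i < e j \<longleftrightarrow> I i < I j" if ij: "i \<in> {1..k}" "j \<in> {1..k}" for i j
  proof -
    have eij: "e i \<in> {1..k}" "e j \<in> {1..k}" using permutes_in_image[OF e(1)] ij by blast+
    note less = sorted_val_rank(2)[OF inj_on]
    consider "e i < e j" | "e j < e i" | "e i = e j" by linarith
    then show ?thesis
    proof cases
      case 1
      then show ?thesis using less[OF eij 1] e(2) ij by simp
    next
      case 2
      then show ?thesis using less[OF eij(2,1) 2] e(2) ij by simp
    next
      case 3
      then show ?thesis using e(2)[OF ij(1)] e(2)[OF ij(2)] by simp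
    qed
  qed
  have "(\<Prod>b\<in>{1..k}. \<Prod>a\<in>{1..<b}. th (h + v a - v b) * th (v b - v a))
    = (\<Prod>(b, a)\<in>Sigma {1..k} (\<lambda>b. {1..<b}). th (h + v a - v b) * th (v b - v a))"
    by (rule prod.Sigma) auto
  also have "\<dots> = pos_den I h k (v \<circ> e)"
    unfolding pos_den_def
  proof (rule prod.reindex_bij_witness[where i = "\<lambda>(i, j). (e j, e i)" and j = "\<lambda>(b, a). (inv e a, inv e b)"])
    fix x assume x: "x \<in> Sigma {1..k} (\<lambda>b. {1..<b})"
    obtain b a where ba: "x = (b, a)" by force
    have in': "a \<in> {1..k}" "b \<in> {1..k}" "a < b" using x ba by auto
    have ein: "inv e a \<in> {1..k}" "inv e b \<in> {1..k}"
      using permutes_in_image[OF permutes_inv[OF e(1)]] in' by blast+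
    have "I (inv e a) < I (inv e b)"
      using ord[OF ein] in'(3) unfolding permutes_inverses(1)[OF e(1)] by blast
    then show "(case x of (b, a) \<Rightarrow> (inv e a, inv e b)) \<in> {(i, j). i \<in> {1..k} \<and> j \<in> {1..k} \<and> I i < I j}"
      using ein by (simp add: ba)
    show "(case case x of (b, a) \<Rightarrow> (inv e a, inv e b) of (i, j) \<Rightarrow> (e j, e i)) = x"
      by (simp add: ba permutes_inverses(1)[OF e(1)])
    show "(case case x of (b, a) \<Rightarrow> (inv e a, inv e b) of (i, j) \<Rightarrow>
        th (h + (v \<circ> e) i - (v \<circ> e) j) * th ((v \<circ> e) j - (v \<circ> e) i))
      = (case x of (b, a) \<Rightarrow> th (h + v a - v b) * th (v b - v a))"
      by (simp add: ba permutes_inverses(1)[OF e(1)])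
  next
    fix y assume y: "y \<in> {(i, j). i \<in> {1..k} \<and> j \<in> {1..k} \<and> I i < I j}"
    obtain i j where ij: "y = (i, j)" by force
    have in': "i \<in> {1..k}" "j \<in> {1..k}" "I i < I j" using y ij by auto
    have "e i \<in> {1..k}" "e j \<in> {1..k}" "e i < e j"
      using permutes_in_image[OF e(1)] in' ord by blast+
    then show "(case y of (i, j) \<Rightarrow> (e j, e i)) \<in> Sigma {1..k} (\<lambda>b. {1..<b})"
      by (simp add: ij)
    show "(case case y of (i, j) \<Rightarrow> (e j, e i) of (b, a) \<Rightarrow> (inv e a, inv e b)) = y"
      by (simp add: ij permutes_inverses(2)[OF e(1)])
  qed
  finally show ?thesis unfolding num pos_G_def by simp
qed

lemma weight_W_eq_pos_W:
  assumes I: "I permutes {1..n}"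
  shows "weight_W q n I t z h \<mu> = pos_W I h \<mu> t n (z \<circ> I)"
proof -
  have inj_on: "inj_on I A" for A using permutes_inj_on[OF I] .
  obtain e where e: "\<And>k. e k permutes {1..k}" "\<And>k j. j \<in> {1..k} \<Longrightarrow> sorted_val I k (e k j) = I j"
    using sorted_val_rank(1)[OF inj_on] by metis
  have main: "foldr Sym_level [1..<m] (weight_U q m I h \<mu>) t = pos_W I h \<mu> t m (t m \<circ> e m)" if "m \<le> n" for m t
    using that
  proof (induction m arbitrary: t)
    case 0 then show ?case by (simp add: weight_U_def)
  next
    case (Suc m)
    show ?case
    proof (cases "m = 0")
      case True
      then show ?thesis by (simp add: weight_U_def pos_G_def pos_num_def pos_den_def)
    next
      case False
      define G where "G \<pi> t = pos_G I h \<mu> m (t m \<circ> \<pi> \<circ> e m) (t (Suc m) \<circ> e (Suc m))"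
        for \<pi> and t :: "nat \<Rightarrow> nat \<Rightarrow> complex"
      have U: "weight_U q (Suc m) I h \<mu> t = weight_U q m I h \<mu> t * pos_G I h \<mu> m (t m \<circ> e m) (t (Suc m) \<circ> e (Suc m))" for t
      proof -
        have "1 \<le> m" using False by simp
        have lvl: "(\<Prod>a\<in>{1..m}. \<Prod>c\<in>{1..Suc m}. psi q I h \<mu> m a c (t (Suc m) c - t m a)) /
            (\<Prod>b\<in>{1..m}. \<Prod>a\<in>{1..<b}. th (h + t m a - t m b) * th (t m b - t m a))
          = pos_G I h \<mu> m (t m \<circ> e m) (t (Suc m) \<circ> e (Suc m))"
          by (rule weight_level[OF I Suc.prems e e])
        show ?thesis
          unfolding weight_U_def prod.atLeastLessThan_Suc[OF \<open>1 \<le> m\<close>] Suc_eq_plus1[symmetric] lvl ..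
      qed
      have Ucong: "weight_U q m I h \<mu> t = weight_U q m I h \<mu> t'" if "\<And>k. k \<le> m \<Longrightarrow> t k = t' k" for t t'
        unfolding weight_U_def using that by (intro prod.cong refl) auto
      have Sym: "Sym_level m (weight_U q (Suc m) I h \<mu>)
          = (\<lambda>t. \<Sum>\<pi> | \<pi> permutes {1..m}. G \<pi> t * weight_U q m I h \<mu> (t(m := t m \<circ> \<pi>)))"
        unfolding Sym_level_def U G_def by (simp add: mult.commute)
      have "foldr Sym_level [1..<Suc m] (weight_U q (Suc m) I h \<mu>) t
          = foldr Sym_level [1..<m] (\<lambda>t. \<Sum>\<pi> | \<pi> permutes {1..m}. G \<pi> t * weight_U q m I h \<mu> (t(m := t m \<circ> \<pi>))) t"
        using False by (simp add: Sym)
      also have "\<dots> = (\<Sum>\<pi> | \<pi> permutes {1..m}. G \<pi> t *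
          foldr Sym_level [1..<m] (\<lambda>t. weight_U q m I h \<mu> (t(m := t m \<circ> \<pi>))) t)"
        by (rule foldr_Sym_sum) (simp add: G_def)
      also have "\<dots> = (\<Sum>\<pi> | \<pi> permutes {1..m}. pos_W I h \<mu> t m (t m \<circ> (\<pi> \<circ> e m))
          * pos_G I h \<mu> m (t m \<circ> (\<pi> \<circ> e m)) (t (Suc m) \<circ> e (Suc m)))"
      proof (intro sum.cong refl)
        fix \<pi>
        have "foldr Sym_level [1..<m] (\<lambda>t. weight_U q m I h \<mu> (t(m := t m \<circ> \<pi>))) t
            = foldr Sym_level [1..<m] (weight_U q m I h \<mu>) (t(m := t m \<circ> \<pi>))"
          by (rule foldr_Sym_update[of m _ _ "\<lambda>u. u \<circ> \<pi>"]) simp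
        also have "\<dots> = pos_W I h \<mu> (t(m := t m \<circ> \<pi>)) m ((t(m := t m \<circ> \<pi>)) m \<circ> e m)"
          using Suc.prems by (intro Suc.IH) simp
        also have "\<dots> = pos_W I h \<mu> t m (t m \<circ> (\<pi> \<circ> e m))"
          by (rule pos_W_cong) auto
        finally show "G \<pi> t * foldr Sym_level [1..<m] (\<lambda>t. weight_U q m I h \<mu> (t(m := t m \<circ> \<pi>))) t
          = pos_W I h \<mu> t m (t m \<circ> (\<pi> \<circ> e m)) * pos_G I h \<mu> m (t m \<circ> (\<pi> \<circ> e m)) (t (Suc m) \<circ> e (Suc m))"
          by (simp only: G_def comp_assoc mult.commute)
      qed
      also have "\<dots> = pos_W I h \<mu> t (Suc m) (t (Suc m) \<circ> e (Suc m))"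
        unfolding pos_W.simps by (rule sum_permutations_compose_right[OF e(1), symmetric])
      finally show ?thesis .
    qed
  qed
  \<comment> \<open>On the top level the sorted values are 1, ..., n, so the rank of a position is
    its value.\<close>
  have en: "e n j = I j" if "j \<in> {1..n}" for j
  proof -
    have "sorted_val I n a = a" if "a \<in> {1..n}" for a
    proof -
      have "sorted_list_of_set {1..n} = [1..<Suc n]"
        by (metis atLeastLessThanSuc_atLeastAtMost sorted_list_of_set_range)
      then have sv: "sorted_val I n a = [1..<Suc n] ! (a - 1)"
        unfolding sorted_val_def permutes_image[OF I] by (rule arg_cong)
      show ?thesis unfolding sv by (subst nth_upt) (use that in auto)
    qed
    moreover have "e n j \<in> {1..n}" using permutes_in_image[OF e(1)[of n]] that by blast
    ultimately show ?thesis using e(2)[OF that] by simp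
  qed
  show ?thesis unfolding weight_W_def main[OF order_refl]
    by (rule pos_W_cong) (auto simp: en)
qed

end

section \<open>The quadratic form of the duality interface\<close>

text \<open>The last summand reads \<open>s n\<close>, which stands for the sum of all
  \<open>z i\<close>.\<close>

definition square_form :: "nat \<Rightarrow> (nat \<Rightarrow> complex) \<Rightarrow> (nat \<Rightarrow> complex) \<Rightarrow> complex" where
  "square_form n s z = of_nat (n - 1) * (\<Sum>i\<in>{1..n}. (z i)\<^sup>2) + (\<Sum>k\<in>{1..<n}. 2 * s k * s k - 2 * s k * s (Suc k))"

text \<open>\<open>s k\<close> and \<open>s' k\<close> stand for the sums of the Chern roots of level \<open>k\<close>.  The squares of
  the individual roots cancel, so the form depends on the roots through these sums only; this is
  why the multipliers below descend to symmetric powers without further conditions.\<close>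

definition interface_form ::
  "nat \<Rightarrow> (nat \<Rightarrow> complex) \<Rightarrow> (nat \<Rightarrow> complex) \<Rightarrow> (nat \<Rightarrow> complex) \<Rightarrow> (nat \<Rightarrow> complex) \<Rightarrow> complex \<Rightarrow> complex"
where
  "interface_form n s s' z z' h = square_form n s z + square_form n s' z'
     + (\<Sum>i\<in>{1..n}. 2 * z' i * (s i - s (i - 1))) - (\<Sum>i\<in>{1..n}. 2 * z i * (s' i - s' (i - 1)))
     - 2 * h * (\<Sum>k\<in>{1..<n}. s k + s' k)
     + 2 * h * (\<Sum>i\<in>{1..n}. of_nat (n - i) * z i) + 2 * h * (\<Sum>j\<in>{1..n}. of_nat (j - 1) * z' j)
     + of_nat (n * (n - 1) div 2) * (h * h)"

lemma sum_interval_Suc: "(\<Sum>i\<in>{1..Suc m}. f i) = (\<Sum>i\<in>{1..m}. f i) + (f (Suc m) :: complex)"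
  by simp

lemma increment_squares:
  fixes a :: "nat \<Rightarrow> complex"
  shows "(\<Sum>k<n. \<Sum>j\<in>{1..k}. (a (Suc k) - a j)\<^sup>2) = of_nat n * (\<Sum>i\<in>{1..n}. (a i)\<^sup>2) - (\<Sum>i\<in>{1..n}. a i)\<^sup>2"
proof (induction n)
  case (Suc n)
  have "(\<Sum>j\<in>{1..n}. (a (Suc n) - a j)\<^sup>2)
      = of_nat n * (a (Suc n))\<^sup>2 + (\<Sum>j\<in>{1..n}. (a j)\<^sup>2) - 2 * a (Suc n) * (\<Sum>j\<in>{1..n}. a j)"
  proof -
    have "(\<Sum>j\<in>{1..n}. (a (Suc n) - a j)\<^sup>2) = (\<Sum>j\<in>{1..n}. (a (Suc n))\<^sup>2 + (a j)\<^sup>2 - (2 * a (Suc n)) * a j)"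
      by (intro sum.cong refl) (simp add: power2_diff mult_ac)
    then show ?thesis by (simp only: sum.distrib sum_subtractf sum_distrib_left[symmetric] sum_constant) simp
  qed
  then show ?case unfolding sum.lessThan_Suc Suc.IH sum_interval_Suc
    by (simp add: power2_eq_square algebra_simps)
qed simp

text \<open>For initial sums, twice \<open>s k * s k - s k * s (Suc k)\<close> is the difference of
  the squares of \<open>s k\<close> and \<open>s (Suc k)\<close> plus the square of the increment,
  so the sum telescopes. The result does not depend on \<open>L\<close>.\<close>

lemma square_form_exact:
  assumes L: "L permutes {1..n}" and s: "\<And>k. k \<le> n \<Longrightarrow> s k = (\<Sum>l\<in>{1..k}. z (L l))"
  shows "square_form n s z = of_nat n * (\<Sum>i\<in>{1..n}. (z i)\<^sup>2) - (\<Sum>i\<in>{1..n}. z i)\<^sup>2"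
proof -
  have *: "(\<Sum>k\<in>{1..<m}. 2 * s k * s k - 2 * s k * s (Suc k)) = (\<Sum>l\<in>{1..m}. (z (L l))\<^sup>2) - (s m)\<^sup>2"
    if "m \<le> n" "m \<ge> 1" for m
    using that(2,1)
  proof (induction m rule: dec_induct)
    case base
    then show ?case using s[of 1] by simp
  next
    case (step m)
    have sm: "s (Suc m) = s m + z (L (Suc m))" using s[of m] s[of "Suc m"] step.prems by simp
    have "(\<Sum>k\<in>{1..<Suc m}. 2 * s k * s k - 2 * s k * s (Suc k))
        = (\<Sum>k\<in>{1..<m}. 2 * s k * s k - 2 * s k * s (Suc k)) + (2 * s m * s m - 2 * s m * s (Suc m))"
      by (rule prod.atLeastLessThan_Suc sum.atLeastLessThan_Suc) (use step in simp)
    also have "\<dots> = (\<Sum>l\<in>{1..m}. (z (L l))\<^sup>2) - (s m)\<^sup>2 + (2 * s m * s m - 2 * s m * s (Suc m))"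
      using step by simp
    finally show ?case unfolding sum_interval_Suc sm
      by (simp add: power2_eq_square algebra_simps)
  qed
  have sq: "(\<Sum>l\<in>{1..n}. (z (L l))\<^sup>2) = (\<Sum>i\<in>{1..n}. (z i)\<^sup>2)"
    using sum.permute[OF L, of "\<lambda>i. (z i)\<^sup>2"] by (simp add: o_def)
  have sn: "s n = (\<Sum>i\<in>{1..n}. z i)" unfolding s[OF order_refl] using sum.permute[OF L, of z] by (simp add: o_def)
  show ?thesis
  proof (cases "n \<ge> 1")
    case True
    then have "of_nat (n - 1) = (of_nat n - 1 :: complex)" by (simp add: of_nat_diff)
    then show ?thesis
      unfolding square_form_def *[OF order_refl True] sq sn by (simp only: left_diff_distrib mult_1_left) simp
  qed (simp add: square_form_def)
qed

lemma abel_sum: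
  fixes s \<mu> :: "nat \<Rightarrow> complex"
  assumes "n \<ge> 1" "s 0 = 0"
  shows "(\<Sum>i\<in>{1..n}. 2 * \<mu> i * (s i - s (i - 1))) = 2 * (\<Sum>k\<in>{1..<n}. s k * (\<mu> k - \<mu> (Suc k))) + 2 * \<mu> n * s n"
  using assms(1)
proof (induction n rule: dec_induct)
  case base then show ?case by (simp add: assms(2))
next
  case (step n)
  have last: "(\<Sum>k\<in>{1..<Suc n}. s k * (\<mu> k - \<mu> (Suc k))) = (\<Sum>k\<in>{1..<n}. s k * (\<mu> k - \<mu> (Suc k))) + s n * (\<mu> n - \<mu> (Suc n))"
    by (rule sum.atLeastLessThan_Suc) (use step in simp)
  show ?case unfolding sum_interval_Suc step.IH last diff_Suc_1 by (simp only: algebra_simps)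
qed

lemma sum_partial_sums:
  fixes a :: "nat \<Rightarrow> complex"
  assumes "n \<ge> 1"
  shows "(\<Sum>k\<in>{1..<n}. \<Sum>l\<in>{1..k}. a l) = (\<Sum>l\<in>{1..n}. of_nat (n - l) * a l)"
  using assms
proof (induction n rule: dec_induct)
  case base then show ?case by simp
next
  case (step n)
  have "(\<Sum>l\<in>{1..Suc n}. of_nat (Suc n - l) * a l) = (\<Sum>l\<in>{1..n}. of_nat (n - l) * a l + a l)"
  proof -
    have "of_nat (Suc n - l) * a l = of_nat (n - l) * a l + a l" if "l \<in> {1..n}" for l
      using that by (simp add: Suc_diff_le algebra_simps)
    then show ?thesis unfolding sum_interval_Suc by simp
  qed
  also have "\<dots> = (\<Sum>l\<in>{1..n}. of_nat (n - l) * a l) + (\<Sum>l\<in>{1..n}. a l)" by (rule sum.distrib)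
  finally show ?case using step by (simp add: sum.atLeastLessThan_Suc)
qed

lemma card_permuted:
  assumes I: "I permutes {1..n}"
  shows "card {j \<in> {1..n}. P (I j)} = card {v \<in> {1..n}. P v}"
proof -
  have "v \<in> I ` {j \<in> {1..n}. P (I j)}" if v: "v \<in> {1..n}" "P v" for v
  proof -
    obtain j where "j \<in> {1..n}" "v = I j" using v(1) permutes_image[OF I] by blast
    with v show ?thesis by (intro image_eqI[of _ _ j]) auto
  qed
  moreover have "I j \<in> {1..n}" if "j \<in> {1..n}" for j using permutes_in_image[OF I] that by blast
  ultimately have "I ` {j \<in> {1..n}. P (I j)} = {v \<in> {1..n}. P v}" by blast
  then show ?thesis using card_image[OF permutes_inj_on[OF I]] by metis
qed

text \<open>The coefficient of \<open>\<mu> k\<close> is the number of smaller values to the left of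
  position \<open>k\<close> minus the number of larger values to its right. Adding the smaller
  values to the right to both counts turns this into (I k - 1) - (n - k).\<close>

lemma inversion_sum:
  fixes \<mu> :: "nat \<Rightarrow> complex"
  assumes I: "I permutes {1..n}"
  shows "(\<Sum>k<n. \<Sum>j\<in>{1..k}. if I j < I (Suc k) then \<mu> (Suc k) - \<mu> j else 0)
    = (\<Sum>j\<in>{1..n}. (of_nat (I j) + of_nat j - 1 - of_nat n) * \<mu> j)"
proof -
  let ?A = "{1..n}"
  define c where "c j k = (if j < k \<and> I j < I k then 1 else 0 :: complex)" for j k
  have "(\<Sum>k<n. \<Sum>j\<in>{1..k}. if I j < I (Suc k) then \<mu> (Suc k) - \<mu> j else 0)
      = (\<Sum>k\<in>?A. \<Sum>j\<in>{1..<k}. if I j < I k then \<mu> k - \<mu> j else 0)"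
    by (rule sum.reindex_bij_witness[where i = "\<lambda>k. k - 1" and j = Suc])
       (auto simp: atLeastLessThanSuc_atLeastAtMost)
  also have "\<dots> = (\<Sum>k\<in>?A. \<Sum>j\<in>?A. c j k * (\<mu> k - \<mu> j))"
    by (intro sum.cong refl sum.mono_neutral_cong_left) (auto simp: c_def)
  also have "\<dots> = (\<Sum>k\<in>?A. \<Sum>j\<in>?A. c j k * \<mu> k) - (\<Sum>k\<in>?A. \<Sum>j\<in>?A. c j k * \<mu> j)"
    by (simp only: right_diff_distrib sum_subtractf)
  also have "(\<Sum>k\<in>?A. \<Sum>j\<in>?A. c j k * \<mu> j) = (\<Sum>k\<in>?A. \<Sum>j\<in>?A. c k j * \<mu> k)"
    by (rule sum.swap)
  also have "(\<Sum>k\<in>?A. \<Sum>j\<in>?A. c j k * \<mu> k) - (\<Sum>k\<in>?A. \<Sum>j\<in>?A. c k j * \<mu> k)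
      = (\<Sum>k\<in>?A. (\<Sum>j\<in>?A. c j k - c k j) * \<mu> k)"
    by (simp only: sum_subtractf sum_distrib_right left_diff_distrib)
  also have "\<dots> = (\<Sum>k\<in>?A. (of_nat (I k) + of_nat k - 1 - of_nat n) * \<mu> k)"
  proof (intro sum.cong refl arg_cong2[where f = "(*)"])
    fix k assume k: "k \<in> ?A"
    have Ik: "I k \<in> ?A" using permutes_in_image[OF I] k by blast
    have "(\<Sum>j\<in>?A. c j k - c k j) = (\<Sum>j\<in>?A. (if I j < I k then 1 else 0) - (if k < j then 1 else 0))"
    proof (intro sum.cong refl)
      fix j
      have "I j = I k \<longleftrightarrow> j = k" using permutes_inj[OF I] by (auto simp: inj_def)
      then show "c j k - c k j = (if I j < I k then 1 else 0) - (if k < j then 1 else 0)"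
        unfolding c_def by (cases "j < k"; cases "k < j"; cases "I j < I k"; cases "I k < I j") auto
    qed
    also have "\<dots> = of_nat (card {j \<in> ?A. I j < I k}) - of_nat (card {j \<in> ?A. k < j})"
      by (simp add: sum_subtractf sum.If_cases Int_def)
    also have "card {j \<in> ?A. I j < I k} = I k - 1"
    proof -
      have "{v \<in> ?A. v < I k} = {1..<I k}" using Ik by auto
      then show ?thesis unfolding card_permuted[OF I, of "\<lambda>v. v < I k"] by simp
    qed
    also have "card {j \<in> ?A. k < j} = n - k"
    proof -
      have "{j \<in> ?A. k < j} = {k<..n}" using k by auto
      then show ?thesis by simp
    qed
    finally show "(\<Sum>j\<in>?A. c j k - c k j) = of_nat (I k) + of_nat k - 1 - of_nat n"
      using k Ik by (simp add: of_nat_diff)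
  qed
  finally show ?thesis .
qed

lemma sum_naturals: "(\<Sum>k<n. of_nat k) = (of_nat (n * (n - 1) div 2) :: complex)"
proof -
  have "2 * (\<Sum>k<n. k) = n * (n - 1)" by (induction n) (auto simp: algebra_simps)
  then have "(\<Sum>k<n. k) = n * (n - 1) div 2" by simp
  moreover have "(\<Sum>k<n. of_nat k) = (of_nat (\<Sum>k<n. k) :: complex)" by simp
  ultimately show ?thesis by simp
qed

context nome
begin

text \<open>With \<open>s'\<close> the initial sums of the dual fixed point, their quadratic part is
  that of \<open>const_form\<close>, their pairing with \<open>z\<close> gives the mixed terms of
  \<open>top_form\<close>, and the terms linear in \<open>h\<close> match by
  \<open>inversion_sum\<close>. The \<open>s k\<close> with 0 < k < n stay free, as needed on all of
  \<open>X\<close>.\<close>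

lemma interface_form_primary:
  assumes L: "L permutes {1..n}" and n: "n \<ge> 1"
    and s: "s 0 = 0" "s n = (\<Sum>i\<in>{1..n}. z i)" and s': "\<And>k. k \<le> n \<Longrightarrow> s' k = (\<Sum>l\<in>{1..k}. \<mu> (L l))"
  defines "I \<equiv> inv L"
  shows "interface_form n s s' z \<mu> h
    = top_form I h \<mu> n (z \<circ> I) + (\<Sum>k<n. level_form I h \<mu> k (s k) (s (Suc k)))"
proof -
  let ?A = "{1..n}"
  have I: "I permutes ?A" unfolding I_def by (rule permutes_inv[OF L])
  have IL: "I (L i) = i" "L (I i) = i" for i unfolding I_def using permutes_inverses[OF L] by auto
  have perm: "(\<Sum>l\<in>?A. f (I l) l) = (\<Sum>i\<in>?A. f i (L i))" for f :: "nat \<Rightarrow> nat \<Rightarrow> complex"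
    using sum.permute[OF L, of "\<lambda>l. f (I l) l"] by (simp add: o_def IL)
  have above: "above I n l = of_nat (n - I l)" if "l \<in> ?A" for l
  proof -
    have "{v \<in> ?A. I l < v} = {I l<..n}" using permutes_in_image[OF I, of l] that by auto
    then show ?thesis unfolding above_def card_permuted[OF I, of "\<lambda>v. I l < v"] by simp
  qed
  have top: "top_form I h \<mu> n (z \<circ> I) = of_nat (n - 1) * (\<Sum>i\<in>?A. (z i)\<^sup>2)
      + 2 * h * (\<Sum>i\<in>?A. of_nat (n - i) * z i) + 2 * \<mu> n * s n - 2 * (\<Sum>i\<in>?A. z i * \<mu> (L i))"
  proof -
    have 1: "(\<Sum>l\<in>?A. ((z \<circ> I) l)\<^sup>2) = (\<Sum>i\<in>?A. (z i)\<^sup>2)" using perm[of "\<lambda>i l. (z i)\<^sup>2"] by simp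
    have 2: "(\<Sum>l\<in>?A. (z \<circ> I) l * above I n l) = (\<Sum>i\<in>?A. of_nat (n - i) * z i)"
      using perm[of "\<lambda>i l. z i * of_nat (n - i)"] above by (simp add: mult.commute)
    have 3: "(\<Sum>l\<in>?A. (z \<circ> I) l * (\<mu> n - \<mu> l)) = \<mu> n * s n - (\<Sum>i\<in>?A. z i * \<mu> (L i))"
      using perm[of "\<lambda>i l. z i * (\<mu> n - \<mu> l)"] unfolding s(2)
      by (simp add: right_diff_distrib sum_subtractf sum_distrib_left mult.commute)
    have 4: "of_nat n - 1 = (of_nat (n - 1) :: complex)" using n by (simp add: of_nat_diff)
    show ?thesis unfolding top_form_def 1 2 3 4
      by (simp only: right_diff_distrib mult.assoc add_diff_eq)
  qed
  have level: "(\<Sum>k<n. level_form I h \<mu> k (s k) (s (Suc k)))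
    = (\<Sum>k\<in>{1..<n}. 2 * s k * s k - 2 * s k * s (Suc k)) + 2 * (\<Sum>k\<in>{1..<n}. s k * (\<mu> k - \<mu> (Suc k)))
      - 2 * h * (\<Sum>k\<in>{1..<n}. s k) + (\<Sum>k<n. const_form I h \<mu> k)"
  proof -
    have "(\<Sum>k<n. level_form I h \<mu> k (s k) (s (Suc k)))
      = (\<Sum>k<n. (2 * s k * s k - 2 * s k * s (Suc k)) + 2 * (s k * (\<mu> k - \<mu> (Suc k))) - 2 * h * s k)
        + (\<Sum>k<n. const_form I h \<mu> k)"
      unfolding sum.distrib[symmetric]
      by (intro sum.cong refl) (simp add: level_form_def power2_eq_square algebra_simps)
    also have "(\<Sum>k<n. (2 * s k * s k - 2 * s k * s (Suc k)) + 2 * (s k * (\<mu> k - \<mu> (Suc k))) - 2 * h * s k)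
      = (\<Sum>k\<in>{1..<n}. (2 * s k * s k - 2 * s k * s (Suc k)) + 2 * (s k * (\<mu> k - \<mu> (Suc k))) - 2 * h * s k)"
    proof (rule sum.mono_neutral_right)
      show "\<forall>i\<in>{..<n} - {1..<n}. 2 * s i * s i - 2 * s i * s (Suc i) + 2 * (s i * (\<mu> i - \<mu> (Suc i))) - 2 * h * s i = 0"
      proof
        fix i assume "i \<in> {..<n} - {1..<n}"
        then have "i = 0" by auto
        then show "2 * s i * s i - 2 * s i * s (Suc i) + 2 * (s i * (\<mu> i - \<mu> (Suc i))) - 2 * h * s i = 0"
          by (simp add: s(1))
      qed
    qed auto
    finally show ?thesis by (simp only: sum.distrib sum_subtractf sum_distrib_left)
  qed
  have const: "(\<Sum>k<n. const_form I h \<mu> k) = square_form n s' \<mu>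
      + 2 * h * (\<Sum>j\<in>?A. (of_nat (I j) + of_nat j - 1 - of_nat n) * \<mu> j) + of_nat (n * (n - 1) div 2) * (h * h)"
  proof -
    have "(\<Sum>k<n. const_form I h \<mu> k) = (\<Sum>k<n. \<Sum>j\<in>{1..k}. (\<mu> (Suc k) - \<mu> j)\<^sup>2)
        + 2 * h * (\<Sum>k<n. \<Sum>j\<in>{1..k}. if I j < I (Suc k) then \<mu> (Suc k) - \<mu> j else 0) + h\<^sup>2 * (\<Sum>k<n. of_nat k)"
      unfolding const_form_def by (simp only: sum.distrib sum_distrib_left)
    moreover have "square_form n s' \<mu> = of_nat n * (\<Sum>i\<in>?A. (\<mu> i)\<^sup>2) - (\<Sum>i\<in>?A. \<mu> i)\<^sup>2"
      using s' by (intro square_form_exact[OF L]) blast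
    ultimately show ?thesis
      unfolding increment_squares inversion_sum[OF I] sum_naturals
      by (simp only: power2_eq_square mult_ac)
  qed
  have cross: "(\<Sum>i\<in>?A. 2 * z i * (s' i - s' (i - 1))) = 2 * (\<Sum>i\<in>?A. z i * \<mu> (L i))"
    unfolding sum_distrib_left
  proof (intro sum.cong refl)
    fix i assume i: "i \<in> ?A"
    then obtain m where m: "i = Suc m" by (cases i) auto
    then show "2 * z i * (s' i - s' (i - 1)) = 2 * (z i * \<mu> (L i))"
      using s'[of i] s'[of m] i by simp
  qed
  have partial: "(\<Sum>k\<in>{1..<n}. s' k) = (\<Sum>j\<in>?A. of_nat (n - I j) * \<mu> j)"
  proof -
    have "(\<Sum>k\<in>{1..<n}. s' k) = (\<Sum>k\<in>{1..<n}. \<Sum>l\<in>{1..k}. \<mu> (L l))" using s' by (intro sum.cong) auto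
    also have "\<dots> = (\<Sum>l\<in>?A. of_nat (n - l) * \<mu> (L l))" by (rule sum_partial_sums[OF n])
    also have "\<dots> = (\<Sum>j\<in>?A. of_nat (n - I j) * \<mu> j)"
      using perm[of "\<lambda>i l. of_nat (n - i) * \<mu> l"] by simp
    finally show ?thesis .
  qed
  have lin: "(\<Sum>j\<in>?A. (of_nat (I j) + of_nat j - 1 - of_nat n) * \<mu> j)
      = (\<Sum>j\<in>?A. of_nat (j - 1) * \<mu> j) - (\<Sum>k\<in>{1..<n}. s' k)"
    unfolding partial sum_subtractf[symmetric]
  proof (intro sum.cong refl)
    fix j assume j: "j \<in> ?A"
    then have "I j \<in> ?A" using permutes_in_image[OF I] by blast
    then show "(of_nat (I j) + of_nat j - 1 - of_nat n) * \<mu> j = of_nat (j - 1) * \<mu> j - of_nat (n - I j) * \<mu> j"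
      using j by (simp add: of_nat_diff algebra_simps)
  qed
  show ?thesis
    unfolding top level const lin interface_form_def cross abel_sum[where s = s and \<mu> = \<mu>, OF n s(1)]
    unfolding square_form_def[of n s] sum.distrib
    by (simp add: algebra_simps)
qed

lemma sum_reverse: "(\<Sum>i\<in>{1..n}. f (longest_perm n i)) = (\<Sum>i\<in>{1..n}. f i :: complex)"
  using sum.permute[OF permutes_longest, of f n] by (simp add: o_def)

text \<open>The primary case with the two varieties interchanged: \<open>K\<close> is composed with
  the longest permutation, \<open>\<mu>\<close> is reversed and \<open>z\<close> changes sign. It
  remains to see that this leaves \<open>interface_form\<close> unchanged when the
  \<open>s k\<close> are initial sums.\<close>

lemma interface_form_dual:
  assumes K: "K permutes {1..n}" and n: "n \<ge> 1"
    and s': "s' 0 = 0" "s' n = (\<Sum>i\<in>{1..n}. \<mu> i)" and s: "\<And>k. k \<le> n \<Longrightarrow> s k = (\<Sum>l\<in>{1..k}. z (K l))"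
  defines "J \<equiv> longest_perm n \<circ> inv K"
  shows "interface_form n s s' z \<mu> h
    = top_form J h (\<lambda>i. - z i) n (\<mu> \<circ> inv K) + (\<Sum>k<n. level_form J h (\<lambda>i. - z i) k (s' k) (s' (Suc k)))"
proof -
  let ?A = "{1..n}" and ?w = "longest_perm n"
  define r where "r k = (\<Sum>l\<in>{1..k}. - z (K (?w l)))" for k
  define y where "y = \<mu> \<circ> ?w"
  have Kw: "K \<circ> ?w permutes ?A" using permutes_longest K by (rule permutes_compose)
  have inv: "inv (K \<circ> ?w) = J"
  proof
    fix i
    have "(K \<circ> ?w) (J i) = i" by (simp add: J_def longest_involution permutes_inverses(1)[OF K])
    then show "inv (K \<circ> ?w) i = J i" using permutes_inj[OF Kw] by (metis inv_f_f)
  qed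
  have yJ: "y \<circ> J = \<mu> \<circ> inv K" by (auto simp: y_def J_def longest_involution)
  have sy: "s' n = (\<Sum>i\<in>?A. y i)" unfolding y_def o_apply sum_reverse by (rule s'(2))
  have r': "r k = (\<Sum>l\<in>{1..k}. - z ((K \<circ> ?w) l))" for k by (simp add: r_def)
  have "interface_form n s' r y (\<lambda>i. - z i) h
    = top_form J h (\<lambda>i. - z i) n (\<mu> \<circ> inv K) + (\<Sum>k<n. level_form J h (\<lambda>i. - z i) k (s' k) (s' (Suc k)))"
    using interface_form_primary[OF Kw n s'(1) sy, of r "\<lambda>i. - z i" h] r' unfolding inv yJ by blast
  moreover have "interface_form n s' r y (\<lambda>i. - z i) h = interface_form n s s' z \<mu> h"
  proof -
    have sq1: "square_form n s' y = square_form n s' \<mu>"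
      unfolding square_form_def y_def o_apply sum_reverse[of "\<lambda>i. (\<mu> i)\<^sup>2"] ..
    have "square_form n r (\<lambda>i. - z i) = of_nat n * (\<Sum>i\<in>?A. (- z i)\<^sup>2) - (\<Sum>i\<in>?A. - z i)\<^sup>2"
      using r' by (intro square_form_exact[OF Kw]) blast
    moreover have "square_form n s z = of_nat n * (\<Sum>i\<in>?A. (z i)\<^sup>2) - (\<Sum>i\<in>?A. z i)\<^sup>2"
      using s by (intro square_form_exact[OF K]) blast
    ultimately have sq2: "square_form n r (\<lambda>i. - z i) = square_form n s z"
      by (simp add: sum_negf)
    have step: "f i - f (i - 1) = a i" if "i \<in> ?A" "\<And>k. k \<le> n \<Longrightarrow> f k = (\<Sum>l\<in>{1..k}. a l)"
      for f a :: "nat \<Rightarrow> complex" and i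
    proof -
      have "i = Suc (i - 1)" "i \<le> n" using that(1) by auto
      then show ?thesis using that(2)[of i] that(2)[of "i - 1"] sum_interval_Suc[of a "i - 1"] by simp
    qed
    have c1: "(\<Sum>i\<in>?A. 2 * y i * (r i - r (i - 1))) = - (\<Sum>i\<in>?A. 2 * \<mu> i * (s i - s (i - 1)))"
    proof -
      have "(\<Sum>i\<in>?A. 2 * y i * (r i - r (i - 1))) = (\<Sum>i\<in>?A. (\<lambda>i. - (2 * \<mu> i * z (K i))) (?w i))"
        using step[of _ r "\<lambda>l. - z (K (?w l))"] by (intro sum.cong refl) (simp add: r_def y_def)
      also have "\<dots> = (\<Sum>i\<in>?A. - (2 * \<mu> i * z (K i)))" by (rule sum_reverse)
      also have "\<dots> = - (\<Sum>i\<in>?A. 2 * \<mu> i * (s i - s (i - 1)))"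
        unfolding sum_negf[symmetric] using step[of _ s "\<lambda>l. z (K l)", OF _ s] by (intro sum.cong refl) simp
      finally show ?thesis .
    qed
    have c2: "(\<Sum>i\<in>?A. 2 * - z i * (s' i - s' (i - 1))) = - (\<Sum>i\<in>?A. 2 * z i * (s' i - s' (i - 1)))"
      by (simp add: sum_negf)
    have h1: "(\<Sum>i\<in>?A. of_nat (n - i) * y i) = (\<Sum>j\<in>?A. of_nat (j - 1) * \<mu> j)"
    proof -
      have "(\<Sum>i\<in>?A. of_nat (n - i) * y i) = (\<Sum>i\<in>?A. (\<lambda>j. of_nat (j - 1) * \<mu> j) (?w i))"
        by (intro sum.cong refl) (auto simp: y_def longest_perm_def)
      also have "\<dots> = (\<Sum>j\<in>?A. of_nat (j - 1) * \<mu> j)" by (rule sum_reverse)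
      finally show ?thesis .
    qed
    \<comment> \<open>The weights n - l and l - 1 add up to n - 1, so the sums of the
      \<open>s k\<close> and of the \<open>r k\<close> differ by (n - 1) times the sum of the
      \<open>z i\<close>.\<close>
    have h2: "(\<Sum>k\<in>{1..<n}. r k) + (\<Sum>j\<in>?A. of_nat (j - 1) * z j) = (\<Sum>k\<in>{1..<n}. s k) - (\<Sum>i\<in>?A. of_nat (n - i) * z i)"
    proof -
      have "(\<Sum>k\<in>{1..<n}. r k) = (\<Sum>l\<in>?A. of_nat (n - l) * - z (K (?w l)))"
        unfolding r_def by (rule sum_partial_sums[OF n])
      also have "\<dots> = (\<Sum>l\<in>?A. (\<lambda>l. of_nat (l - 1) * - z (K l)) (?w l))"
        by (intro sum.cong refl) (auto simp: longest_perm_def)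
      also have "\<dots> = (\<Sum>l\<in>?A. of_nat (l - 1) * - z (K l))" by (rule sum_reverse)
      finally have 1: "(\<Sum>k\<in>{1..<n}. r k) = (\<Sum>l\<in>?A. of_nat (l - 1) * - z (K l))" .
      have "(\<Sum>k\<in>{1..<n}. s k) = (\<Sum>k\<in>{1..<n}. \<Sum>l\<in>{1..k}. z (K l))" using s by (intro sum.cong) auto
      also have "\<dots> = (\<Sum>l\<in>?A. of_nat (n - l) * z (K l))" by (rule sum_partial_sums[OF n])
      finally have 2: "(\<Sum>k\<in>{1..<n}. s k) = (\<Sum>l\<in>?A. of_nat (n - l) * z (K l))" .
      have nn: "of_nat (n - l) = (of_nat n - of_nat l :: complex)" "of_nat (l - 1) = (of_nat l - 1 :: complex)"
        if "l \<in> ?A" for l using that by (auto simp: of_nat_diff)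
      have "(\<Sum>k\<in>{1..<n}. s k) - (\<Sum>k\<in>{1..<n}. r k) = (\<Sum>l\<in>?A. (of_nat n - 1) * z (K l))"
        unfolding 1 2 sum_subtractf[symmetric] using nn by (intro sum.cong refl) (simp add: algebra_simps)
      also have "\<dots> = (\<Sum>l\<in>?A. (of_nat n - 1) * z l)"
        using sum.permute[OF K, of "\<lambda>l. (of_nat n - 1) * z l"] by (simp add: o_def)
      also have "\<dots> = (\<Sum>j\<in>?A. of_nat (j - 1) * z j) + (\<Sum>i\<in>?A. of_nat (n - i) * z i)"
        unfolding sum.distrib[symmetric] using nn by (intro sum.cong refl) (simp add: algebra_simps)
      finally show ?thesis by (simp add: algebra_simps)
    qed
    have h3: "(\<Sum>j\<in>?A. of_nat (j - 1) * - z j) = - (\<Sum>j\<in>?A. of_nat (j - 1) * z j)"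
      by (simp add: sum_negf)
    have "2 * h * (\<Sum>k\<in>{1..<n}. r k) + 2 * h * (\<Sum>j\<in>?A. of_nat (j - 1) * z j)
        = 2 * h * (\<Sum>k\<in>{1..<n}. s k) - 2 * h * (\<Sum>i\<in>?A. of_nat (n - i) * z i)"
      using h2 unfolding distrib_left[symmetric] right_diff_distrib[symmetric] by simp
    then show ?thesis
      unfolding interface_form_def sq1 sq2 c1 c2 h1 h3 sum.distrib by (simp add: algebra_simps)
  qed
  ultimately show ?thesis by simp
qed

end

section \<open>The line bundle\<close>

definition int_map :: "(('c \<Rightarrow> complex) \<Rightarrow> 'd \<Rightarrow> complex) \<Rightarrow> bool" where
  "int_map T \<longleftrightarrow> (\<forall>c. int_linear (\<lambda>x. T x c))"

lemma int_map_int_vec: "int_map T \<Longrightarrow> int_vec m \<Longrightarrow> int_vec (T m)"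
  unfolding int_map_def int_vec_def[of "T m"] using int_linearD(3) by blast

context nome
begin

lemma int_map_translate: "int_map T \<Longrightarrow> T (translate m b x) = translate (T m) (T b) (T x)"
  unfolding int_map_def using int_linear_translate[of "\<lambda>x. T x c" m b x for c]
  by (auto simp: translate_def[of "T m"] fun_eq_iff)

lemma mult_exp_int_map:
  assumes "int_map T"
  shows "mult_exp (\<lambda>x. Q (T x)) m b x = mult_exp Q (T m) (T b) (T x)"
proof -
  have "T (\<lambda>c. m c + x c) = (\<lambda>c. T m c + T x c)"
    using int_linearD(1)[of "\<lambda>x. T x c" for c] assms unfolding int_map_def by blast
  then show ?thesis by (simp add: mult_exp_def)
qed

lemma mult_exp_square:
  assumes l: "int_linear l" and int: "int_vec m" "int_vec b"
  shows "mult_exp (\<lambda>x. (l x)\<^sup>2) m b x = exp (\<i> * pi * (l m + l b) - l m * l x - (l m)\<^sup>2 * \<tau> / 2)"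
proof -
  have "mult_exp (\<lambda>x. (l x)\<^sup>2) m b x
      = exp (\<i> * pi * (l m)\<^sup>2) * exp (\<i> * pi * (l b)\<^sup>2) * exp (- l m * l x - (l m)\<^sup>2 * \<tau> / 2)"
    unfolding mult_exp_def exp_add[symmetric] int_linearD(1)[OF l]
    by (rule arg_cong[where f = exp]) (simp add: field_simps power2_eq_square)
  also have "exp (\<i> * pi * (l m)\<^sup>2) = exp (\<i> * pi * l m)"
    by (rule exp_pi_square) (rule int_linearD(3)[OF l int(1)])
  also have "exp (\<i> * pi * (l b)\<^sup>2) = exp (\<i> * pi * l b)"
    by (rule exp_pi_square) (rule int_linearD(3)[OF l int(2)])
  finally show ?thesis
    unfolding exp_add[symmetric] by (simp add: algebra_simps)
qed

definition cocyclic :: "(('c \<Rightarrow> complex) \<Rightarrow> complex) \<Rightarrow> bool" where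
  "cocyclic Q \<longleftrightarrow> (\<forall>m b m' b' x. int_vec m \<longrightarrow> int_vec b \<longrightarrow> int_vec m' \<longrightarrow> int_vec b' \<longrightarrow>
     mult_exp Q (\<lambda>c. m c + m' c) (\<lambda>c. b c + b' c) x = mult_exp Q m b x * mult_exp Q m' b' (translate m b x))"

lemma int_vec_add: "int_vec m \<Longrightarrow> int_vec m' \<Longrightarrow> int_vec (\<lambda>c. m c + m' c)"
  by (simp add: int_vec_def)

text \<open>The second multiplier is taken at the translated point, which adds 2 pi i times the
  integer - l m' * l b to the exponent; its exponential is 1.\<close>

lemma cocyclic_square:
  assumes l: "int_linear l"
  shows "cocyclic (\<lambda>x. (l x)\<^sup>2)"
  unfolding cocyclic_def
proof (intro allI impI)
  fix m b m' b' x :: "'a \<Rightarrow> complex"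
  assume int: "int_vec m" "int_vec b" "int_vec m'" "int_vec b'"
  obtain i j :: int where ij: "l m' = of_int i" "l b = of_int j"
    using int_linearD(3)[OF l] int by (metis Ints_cases)
  have period: "exp (2 * pi * \<i> * of_int (- i * j)) = 1"
    using exp_plus_2pin[of 0 "- i * j"] by (simp add: mult_ac)
  have "mult_exp (\<lambda>x. (l x)\<^sup>2) m b x * mult_exp (\<lambda>x. (l x)\<^sup>2) m' b' (translate m b x)
      = exp (\<i> * pi * (l m + l m' + (l b + l b')) - (l m + l m') * l x - (l m + l m')\<^sup>2 * \<tau> / 2) * exp (2 * pi * \<i> * of_int (- i * j))"
    unfolding mult_exp_square[OF l int(1,2)] mult_exp_square[OF l int(3,4)] int_linear_translate[OF l]
      exp_add[symmetric]
    by (rule arg_cong[where f = exp]) (simp add: ij field_simps power2_eq_square)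
  also have "\<dots> = mult_exp (\<lambda>x. (l x)\<^sup>2) (\<lambda>c. m c + m' c) (\<lambda>c. b c + b' c) x"
    unfolding mult_exp_square[OF l int_vec_add[OF int(1,3)] int_vec_add[OF int(2,4)]] int_linearD(1)[OF l] period
    by simp
  finally show "mult_exp (\<lambda>x. (l x)\<^sup>2) (\<lambda>c. m c + m' c) (\<lambda>c. b c + b' c) x
      = mult_exp (\<lambda>x. (l x)\<^sup>2) m b x * mult_exp (\<lambda>x. (l x)\<^sup>2) m' b' (translate m b x)" ..
qed

lemma cocyclic_add: "cocyclic Q \<Longrightarrow> cocyclic Q' \<Longrightarrow> cocyclic (\<lambda>x. Q x + Q' x)"
  unfolding cocyclic_def mult_exp_add by (simp add: mult_ac)

lemma cocyclic_minus: "cocyclic Q \<Longrightarrow> cocyclic (\<lambda>x. - Q x)"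
  unfolding cocyclic_def mult_exp_minus by simp

lemma cocyclic_diff: "cocyclic Q \<Longrightarrow> cocyclic Q' \<Longrightarrow> cocyclic (\<lambda>x. Q x - Q' x)"
  using cocyclic_add[of Q "\<lambda>x. - Q' x"] cocyclic_minus[of Q'] by simp

lemma cocyclic_sum: "(\<And>i. i \<in> A \<Longrightarrow> cocyclic (Q i)) \<Longrightarrow> cocyclic (\<lambda>x. \<Sum>i\<in>A. Q i x)"
proof (induction A rule: infinite_finite_induct)
  case (insert i A)
  then show ?case using cocyclic_add[of "Q i" "\<lambda>x. \<Sum>i\<in>A. Q i x"] by simp
qed (simp_all add: cocyclic_def mult_exp_def)

lemma cocyclic_of_nat: "cocyclic Q \<Longrightarrow> cocyclic (\<lambda>x. of_nat k * Q x)"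
  using cocyclic_sum[of "{..<k}" "\<lambda>_. Q"] by simp

text \<open>By polarisation a doubled product is an integral combination of squares. The mixed terms
  of \<open>interface_form\<close> all carry this factor 2.\<close>

lemma cocyclic_polar:
  assumes "int_linear l" "int_linear l'"
  shows "cocyclic (\<lambda>x. 2 * l x * l' x)"
proof -
  have "cocyclic (\<lambda>x. (l x + l' x)\<^sup>2 - (l x)\<^sup>2 - (l' x)\<^sup>2)"
    by (intro cocyclic_diff cocyclic_square int_linear_add assms)
  moreover have "(l x + l' x)\<^sup>2 - (l x)\<^sup>2 - (l' x)\<^sup>2 = 2 * l x * l' x" for x
    by (simp add: power2_eq_square algebra_simps)
  ultimately show ?thesis by simp
qed

lemma cocyclic_interface_form:
  assumes "\<And>k. int_linear (\<lambda>x. s x k)" "\<And>k. int_linear (\<lambda>x. s' x k)"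
    "\<And>k. int_linear (\<lambda>x. z x k)" "\<And>k. int_linear (\<lambda>x. z' x k)" "int_linear h"
  shows "cocyclic (\<lambda>x. interface_form n (s x) (s' x) (z x) (z' x) (h x))"
proof -
  have hh: "cocyclic (\<lambda>x. h x * h x)" using cocyclic_square[OF assms(5)] by (simp add: power2_eq_square)
  show ?thesis
    unfolding interface_form_def square_form_def
    by (intro cocyclic_add cocyclic_diff cocyclic_sum cocyclic_of_nat cocyclic_polar cocyclic_square hh
        int_linear_add int_linear_diff int_linear_sum int_linear_scale assms Ints_of_nat)
qed

section \<open>Congruence modulo the lattice and transition multipliers\<close>

definition lattice_cong :: "('c \<Rightarrow> complex) \<Rightarrow> ('c \<Rightarrow> complex) \<Rightarrow> bool" where
  "lattice_cong X Y \<longleftrightarrow> (\<forall>c. Y c - X c \<in> log_lattice q)"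

lemma log_lattice_add: "u \<in> log_lattice q \<Longrightarrow> v \<in> log_lattice q \<Longrightarrow> u + v \<in> log_lattice q"
proof -
  assume "u \<in> log_lattice q" "v \<in> log_lattice q"
  then obtain m b m' b' :: int where "u = of_int m * \<tau> + 2 * pi * \<i> * of_int b" "v = of_int m' * \<tau> + 2 * pi * \<i> * of_int b'"
    unfolding log_lattice_iff by blast
  then have "u + v = of_int (m + m') * \<tau> + 2 * pi * \<i> * of_int (b + b')" by (simp add: algebra_simps)
  then show "u + v \<in> log_lattice q" unfolding log_lattice_iff by blast
qed

lemma log_lattice_minus: "u \<in> log_lattice q \<Longrightarrow> - u \<in> log_lattice q"
proof -
  assume "u \<in> log_lattice q"
  then obtain m b :: int where "u = of_int m * \<tau> + 2 * pi * \<i> * of_int b"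
    unfolding log_lattice_iff by blast
  then have "- u = of_int (- m) * \<tau> + 2 * pi * \<i> * of_int (- b)" by (simp add: algebra_simps)
  then show "- u \<in> log_lattice q" unfolding log_lattice_iff by blast
qed

lemma log_lattice_diff: "u \<in> log_lattice q \<Longrightarrow> v \<in> log_lattice q \<Longrightarrow> u - v \<in> log_lattice q"
  using log_lattice_add[of u "- v"] log_lattice_minus[of v] by simp

lemma log_lattice_sum: "(\<And>i. i \<in> A \<Longrightarrow> f i \<in> log_lattice q) \<Longrightarrow> (\<Sum>i\<in>A. f i) \<in> log_lattice q"
  by (induction A rule: infinite_finite_induct) (auto intro: zero_in_log_lattice log_lattice_add)

lemma lattice_cong_translate:
  "lattice_cong X Y \<longleftrightarrow> (\<exists>m b. int_vec m \<and> int_vec b \<and> Y = translate m b X)"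
proof
  assume "lattice_cong X Y"
  then have "\<exists>m b :: int. Y c - X c = of_int m * \<tau> + 2 * pi * \<i> * of_int b" for c
    by (simp add: lattice_cong_def log_lattice_iff)
  then obtain m b :: "'a \<Rightarrow> int" where "\<And>c. Y c - X c = of_int (m c) * \<tau> + 2 * pi * \<i> * of_int (b c)"
    by metis
  then have "Y = translate (\<lambda>c. of_int (m c)) (\<lambda>c. of_int (b c)) X"
    unfolding translate_def by (auto simp: fun_eq_iff algebra_simps)
  moreover have "int_vec (\<lambda>c. of_int (m c))" "int_vec (\<lambda>c. of_int (b c))" by (simp_all add: int_vec_def)
  ultimately show "\<exists>m b. int_vec m \<and> int_vec b \<and> Y = translate m b X" by blast
next
  assume "\<exists>m b. int_vec m \<and> int_vec b \<and> Y = translate m b X"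
  then obtain m b where *: "int_vec m" "int_vec b" "Y = translate m b X" by blast
  show "lattice_cong X Y"
    unfolding lattice_cong_def
  proof
    fix c
    obtain i j :: int where "m c = of_int i" "b c = of_int j" using * by (metis Ints_cases int_vec_def)
    then have "Y c - X c = of_int i * \<tau> + 2 * pi * \<i> * of_int j" by (simp add: * translate_def)
    then show "Y c - X c \<in> log_lattice q" unfolding log_lattice_iff by blast
  qed
qed

lemma lattice_cong_sym: "lattice_cong X Y \<Longrightarrow> lattice_cong Y X"
  unfolding lattice_cong_def using log_lattice_minus by (metis minus_diff_eq)

lemma lattice_cong_trans: "lattice_cong X Y \<Longrightarrow> lattice_cong Y Z \<Longrightarrow> lattice_cong X Z"
  unfolding lattice_cong_def using log_lattice_add by (metis add.commute diff_add_cancel add_diff_eq)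

text \<open>The vector \<open>X\<close> holds sums of roots and not roots. They are read at index 0,
  \<open>root_sums\<close> having stored the same sum at every index.\<close>

definition total_form :: "nat \<Rightarrow> (pcoord \<Rightarrow> complex) \<Rightarrow> complex" where
  "total_form n X = interface_form n (\<lambda>k. X (RootL k 0)) (\<lambda>k. X (RootR k 0))
     (\<lambda>i. X (EquiL i)) (\<lambda>i. X (EquiR i)) (X HbarP)"

lemma cocyclic_total_form: "cocyclic (total_form n)"
  unfolding total_form_def by (intro cocyclic_interface_form int_linear_coord)

text \<open>Recovers the coefficient of \<open>\<tau>\<close> of a lattice element from its real
  part, as the other generator is purely imaginary.\<close>

definition tau_degree :: "complex \<Rightarrow> complex" where
  "tau_degree w = of_real (Re w / Re \<tau>)"

definition period_degree :: "complex \<Rightarrow> complex" where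
  "period_degree w = (w - tau_degree w * \<tau>) / (2 * pi * \<i>)"

lemma degrees:
  "m \<in> \<int> \<Longrightarrow> b \<in> \<int> \<Longrightarrow> tau_degree (m * \<tau> + 2 * pi * \<i> * b) = m"
  "m \<in> \<int> \<Longrightarrow> b \<in> \<int> \<Longrightarrow> period_degree (m * \<tau> + 2 * pi * \<i> * b) = b"
proof -
  assume int: "m \<in> \<int>" "b \<in> \<int>"
  then obtain i j :: int where ij: "m = of_int i" "b = of_int j" by (metis Ints_cases)
  have "Re (m * \<tau> + 2 * pi * \<i> * b) = of_int i * Re \<tau>" by (simp add: ij)
  then show 1: "tau_degree (m * \<tau> + 2 * pi * \<i> * b) = m"
    using Re_tau by (simp add: tau_degree_def ij)
  show "period_degree (m * \<tau> + 2 * pi * \<i> * b) = b"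
    unfolding period_degree_def 1 by simp
qed

text \<open>The multiplier as a function of two congruent points, without mention of the translation
  that relates them, as \<open>line_bundle\<close> requires.\<close>

definition transition :: "nat \<Rightarrow> (pcoord \<Rightarrow> complex) \<Rightarrow> (pcoord \<Rightarrow> complex) \<Rightarrow> complex" where
  "transition n X Y = mult_exp (total_form n) (\<lambda>c. tau_degree (Y c - X c)) (\<lambda>c. period_degree (Y c - X c)) X"

lemma transition_nz: "transition n X Y \<noteq> 0"
  by (simp add: transition_def)

lemma transition_translate:
  assumes "int_vec m" "int_vec b"
  shows "transition n X (translate m b X) = mult_exp (total_form n) m b X"
proof -
  have int: "m c \<in> \<int>" "b c \<in> \<int>" for c using assms by (auto simp: int_vec_def)
  have "translate m b X c - X c = m c * \<tau> + 2 * pi * \<i> * b c" for c by (simp add: translate_def)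
  then show ?thesis unfolding transition_def by (simp only: degrees[OF int])
qed

lemma transition_refl: "transition n X X = 1"
proof -
  have int: "int_vec (\<lambda>_. 0)" by (simp add: int_vec_def)
  have "total_form n (\<lambda>_. 0) = 0" by (simp add: total_form_def interface_form_def square_form_def)
  then show ?thesis
    using transition_translate[OF int int, of n X] by (simp add: translate_def mult_exp_def)
qed

lemma transition_trans:
  assumes "lattice_cong X Y" "lattice_cong Y Z"
  shows "transition n X Z = transition n X Y * transition n Y Z"
proof -
  obtain m b m' b' where *: "int_vec m" "int_vec b" "Y = translate m b X"
    "int_vec m'" "int_vec b'" "Z = translate m' b' Y"
    using assms unfolding lattice_cong_translate by blast
  have "Z = translate (\<lambda>c. m c + m' c) (\<lambda>c. b c + b' c) X"
    unfolding * by (simp add: translate_def algebra_simps)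
  then have "transition n X Z = mult_exp (total_form n) (\<lambda>c. m c + m' c) (\<lambda>c. b c + b' c) X"
    using * by (simp add: transition_translate int_vec_add)
  also have "\<dots> = mult_exp (total_form n) m b X * mult_exp (total_form n) m' b' (translate m b X)"
    using cocyclic_total_form[of n] * unfolding cocyclic_def by blast
  finally show ?thesis using * by (simp add: transition_translate)
qed


text \<open>The multipliers depend on the Chern roots only through their sums on each level, stored
  at \<open>RootL k a\<close> and \<open>RootR k a\<close> for every \<open>a\<close>.\<close>

definition root_sums :: "nat \<Rightarrow> (pcoord \<Rightarrow> complex) \<Rightarrow> pcoord \<Rightarrow> complex" where
  "root_sums n x c = (case c of
       RootL k a \<Rightarrow> if k < n then \<Sum>a\<in>{1..k}. x (RootL k a) else \<Sum>i\<in>{1..n}. x (EquiL i)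
     | RootR k a \<Rightarrow> if k < n then \<Sum>a\<in>{1..k}. x (RootR k a) else \<Sum>i\<in>{1..n}. x (EquiR i)
     | _ \<Rightarrow> if c \<in> base_coords n then x c else 0)"

text \<open>The root sums at the fixed point \<open>(K, L)\<close> as an integral linear map of the
  parameters. From \<open>k = n\<close> on the entry is the total sum, which
  \<open>interface_form\<close> reads at \<open>k = n\<close>.\<close>

definition fixed_sums :: "nat \<Rightarrow> (nat \<Rightarrow> nat) \<Rightarrow> (nat \<Rightarrow> nat) \<Rightarrow> (pcoord \<Rightarrow> complex) \<Rightarrow> pcoord \<Rightarrow> complex" where
  "fixed_sums n K L p c = (case c of
       RootL k a \<Rightarrow> if k < n then \<Sum>l\<in>{1..k}. p (EquiL (K l)) else \<Sum>i\<in>{1..n}. p (EquiL i)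
     | RootR k a \<Rightarrow> if k < n then \<Sum>l\<in>{1..k}. p (EquiR (L l)) else \<Sum>i\<in>{1..n}. p (EquiR i)
     | _ \<Rightarrow> if c \<in> base_coords n then p c else 0)"

lemma int_linear_if: "int_linear l \<Longrightarrow> int_linear l' \<Longrightarrow> int_linear (\<lambda>x. if P then l x else l' x)"
  by (cases P) simp_all

lemma sep_entire_if: "sep_entire f \<Longrightarrow> sep_entire g \<Longrightarrow> sep_entire (\<lambda>x. if P then f x else g x)"
  by (cases P) simp_all

lemma int_map_fixed_sums: "int_map (fixed_sums n K L)"
  unfolding int_map_def
proof
  fix c show "int_linear (\<lambda>x. fixed_sums n K L x c)"
    by (cases c) (auto simp: fixed_sums_def intro!: int_linear_if int_linear_sum int_linear_coord int_linear_zero)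
qed

lemma sum_fixed_roots:
  assumes K: "K permutes {1..n}"
  shows "(\<Sum>a\<in>{1..k}. fixed_roots K z k a) = (\<Sum>l\<in>{1..k}. z (K l) :: complex)"
proof -
  obtain e where e: "e permutes {1..k}" "\<And>j. j \<in> {1..k} \<Longrightarrow> sorted_val K k (e j) = K j"
    using sorted_val_rank(1)[OF permutes_inj_on[OF K]] by metis
  have "(\<Sum>a\<in>{1..k}. fixed_roots K z k a) = (\<Sum>l\<in>{1..k}. fixed_roots K z k (e l))"
    using sum.permute[OF e(1), of "fixed_roots K z k"] by (simp add: o_def)
  also have "\<dots> = (\<Sum>l\<in>{1..k}. z (K l))" using e(2) by (intro sum.cong refl) (simp add: fixed_roots_def)
  finally show ?thesis .
qed

lemma pcoords_mem:
  "RootL k a \<in> pcoords n \<longleftrightarrow> 1 \<le> a \<and> a \<le> k \<and> k \<le> n - 1"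
  "RootR k a \<in> pcoords n \<longleftrightarrow> 1 \<le> a \<and> a \<le> k \<and> k \<le> n - 1"
  "EquiL i \<in> pcoords n \<longleftrightarrow> i \<in> {1..n}" "EquiR i \<in> pcoords n \<longleftrightarrow> i \<in> {1..n}" "HbarP \<in> pcoords n"
  "EquiL i \<in> base_coords n \<longleftrightarrow> i \<in> {1..n}" "EquiR i \<in> base_coords n \<longleftrightarrow> i \<in> {1..n}" "HbarP \<in> base_coords n"
  by (auto simp: pcoords_def base_coords_def root_indices_def)

lemma finite_coords: "finite (pcoords n)" "finite (base_coords n)"
proof -
  have "root_indices n \<subseteq> {..n} \<times> {..n}" by (auto simp: root_indices_def)
  then have "finite (root_indices n)" by (rule finite_subset) simp
  then show "finite (pcoords n)" "finite (base_coords n)" by (auto simp: pcoords_def base_coords_def)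
qed

lemma root_sums_component:
  assumes K: "K permutes {1..n}" and L: "L permutes {1..n}"
  shows "root_sums n (component n K L p) = fixed_sums n K L p"
proof
  fix c
  have 1: "(\<Sum>a\<in>{1..k}. component n K L p (RootL k a)) = (\<Sum>l\<in>{1..k}. p (EquiL (K l)))" if "k < n" for k
  proof -
    have "(\<Sum>a\<in>{1..k}. component n K L p (RootL k a)) = (\<Sum>a\<in>{1..k}. fixed_roots K (\<lambda>i. p (EquiL i)) k a)"
      using that by (intro sum.cong refl) (auto simp: component_def pcoords_mem)
    then show ?thesis by (simp only: sum_fixed_roots[OF K])
  qed
  have 2: "(\<Sum>a\<in>{1..k}. component n K L p (RootR k a)) = (\<Sum>l\<in>{1..k}. p (EquiR (L l)))" if "k < n" for k
  proof -
    have "(\<Sum>a\<in>{1..k}. component n K L p (RootR k a)) = (\<Sum>a\<in>{1..k}. fixed_roots L (\<lambda>i. p (EquiR i)) k a)"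
      using that by (intro sum.cong refl) (auto simp: component_def pcoords_mem)
    then show ?thesis by (simp only: sum_fixed_roots[OF L])
  qed
  have 3: "component n K L p c = p c" if "c \<in> base_coords n" for c
    using that by (auto simp: component_def base_coords_def pcoords_def)
  have 4: "(\<Sum>i\<in>{1..n}. component n K L p (EquiL i)) = (\<Sum>i\<in>{1..n}. p (EquiL i))"
    "(\<Sum>i\<in>{1..n}. component n K L p (EquiR i)) = (\<Sum>i\<in>{1..n}. p (EquiR i))"
    by (intro sum.cong refl 3; simp add: pcoords_mem)+
  show "root_sums n (component n K L p) c = fixed_sums n K L p c"
    unfolding root_sums_def fixed_sums_def 4 by (cases c) (simp_all only: pcoord.case 1 2 3 cong: if_cong)
qed

text \<open>Permuting the roots of a level preserves their sum. A deck transformation thus acts on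
  root sums by a translation alone, the same at all points.\<close>

lemma deck_root_sums:
  assumes "\<gamma> \<in> deck q n"
  shows "\<exists>m b. int_vec m \<and> int_vec b \<and> (\<forall>x. root_sums n (\<gamma> x) = translate m b (root_sums n x))"
proof -
  obtain \<pi> \<pi>' v where \<pi>: "\<And>k. k \<in> {1..<n} \<Longrightarrow> \<pi> k permutes {1..k}" "\<And>k. k \<in> {1..<n} \<Longrightarrow> \<pi>' k permutes {1..k}"
    and v: "\<And>c. c \<in> pcoords n \<Longrightarrow> v c \<in> log_lattice q"
    and \<gamma>: "\<gamma> = (\<lambda>x. restrict (\<lambda>c. (case c of
            RootL k a \<Rightarrow> x (RootL k (\<pi> k a))
          | RootR k a \<Rightarrow> x (RootR k (\<pi>' k a))
          | _ \<Rightarrow> x c) + v c) (pcoords n))"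
    using assms unfolding deck_def by blast
  have split: "root_sums n (\<gamma> x) c = root_sums n x c + root_sums n v c" for x c
  proof -
    have sums: "(\<Sum>a\<in>{1..k}. \<gamma> x (RootL k a)) = (\<Sum>a\<in>{1..k}. x (RootL k a)) + (\<Sum>a\<in>{1..k}. v (RootL k a))"
      "(\<Sum>a\<in>{1..k}. \<gamma> x (RootR k a)) = (\<Sum>a\<in>{1..k}. x (RootR k a)) + (\<Sum>a\<in>{1..k}. v (RootR k a))"
      if k: "k < n" for k
    proof -
      have "(\<Sum>a\<in>{1..k}. \<gamma> x (RootL k a)) = (\<Sum>a\<in>{1..k}. x (RootL k (\<pi> k a)) + v (RootL k a))"
        "(\<Sum>a\<in>{1..k}. \<gamma> x (RootR k a)) = (\<Sum>a\<in>{1..k}. x (RootR k (\<pi>' k a)) + v (RootR k a))"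
        using k by (auto intro!: sum.cong simp: \<gamma> pcoords_mem)
      moreover have "(\<Sum>a\<in>{1..k}. x (RootL k (\<pi> k a))) = (\<Sum>a\<in>{1..k}. x (RootL k a))"
        "(\<Sum>a\<in>{1..k}. x (RootR k (\<pi>' k a))) = (\<Sum>a\<in>{1..k}. x (RootR k a))"
        using sum.permute[OF \<pi>(1)[of k], of "\<lambda>a. x (RootL k a)"] sum.permute[OF \<pi>(2)[of k], of "\<lambda>a. x (RootR k a)"] k
        by (cases "k = 0"; simp add: o_def)+
      ultimately show
        "(\<Sum>a\<in>{1..k}. \<gamma> x (RootL k a)) = (\<Sum>a\<in>{1..k}. x (RootL k a)) + (\<Sum>a\<in>{1..k}. v (RootL k a))"
        "(\<Sum>a\<in>{1..k}. \<gamma> x (RootR k a)) = (\<Sum>a\<in>{1..k}. x (RootR k a)) + (\<Sum>a\<in>{1..k}. v (RootR k a))"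
        by (simp_all only: sum.distrib)
    qed
    have base: "\<gamma> x c = x c + v c" if "c \<in> base_coords n" for c
      using that by (auto simp: \<gamma> pcoords_mem base_coords_def)
    have tot: "(\<Sum>i\<in>{1..n}. \<gamma> x (EquiL i)) = (\<Sum>i\<in>{1..n}. x (EquiL i)) + (\<Sum>i\<in>{1..n}. v (EquiL i))"
      "(\<Sum>i\<in>{1..n}. \<gamma> x (EquiR i)) = (\<Sum>i\<in>{1..n}. x (EquiR i)) + (\<Sum>i\<in>{1..n}. v (EquiR i))"
      unfolding sum.distrib[symmetric] by (intro sum.cong refl base; simp add: pcoords_mem)+
    show ?thesis
      unfolding root_sums_def using tot
      by (cases c) (auto simp: sums base simp del: One_nat_def atLeastAtMost_iff sum.cl_ivl_Suc)
  qed
  have "root_sums n v c \<in> log_lattice q" for c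
    using v by (cases c) (auto simp: root_sums_def pcoords_mem zero_in_log_lattice intro!: log_lattice_sum)
  then have "lattice_cong (\<lambda>_. 0) (root_sums n v)" by (simp add: lattice_cong_def)
  then obtain m b where *: "int_vec m" "int_vec b" "root_sums n v = translate m b (\<lambda>_. 0)"
    unfolding lattice_cong_translate by blast
  have "root_sums n (\<gamma> x) = translate m b (root_sums n x)" for x
    using fun_cong[OF *(3)] by (auto simp: fun_eq_iff split translate_def)
  with * show ?thesis by blast
qed

lemma same_point_root_sums: "same_point q n x y \<Longrightarrow> lattice_cong (root_sums n x) (root_sums n y)"
  unfolding same_point_def lattice_cong_translate using deck_root_sums by blast

lemma sep_entire_interface_form:
  assumes "\<And>k. sep_entire (\<lambda>x. s x k)" "\<And>k. sep_entire (\<lambda>x. s' x k)"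
    "\<And>k. sep_entire (\<lambda>x. z x k)" "\<And>k. sep_entire (\<lambda>x. z' x k)" "sep_entire h"
  shows "sep_entire (\<lambda>x. interface_form n (s x) (s' x) (z x) (z' x) (h x))"
  unfolding interface_form_def square_form_def power2_eq_square
  by (intro sep_entire_add sep_entire_diff sep_entire_mult sep_entire_sum sep_entire_const assms)

lemma sep_entire_mult_exp:
  assumes "sep_entire (\<lambda>x. Q (\<lambda>c. m c + T x c))" "sep_entire (\<lambda>x. Q (T x))"
  shows "sep_entire (\<lambda>x. mult_exp Q m b (T x))"
proof -
  have "sep_entire (\<lambda>x. \<i> * pi * (Q m + Q b) - (Q (\<lambda>c. m c + T x c) - Q m - Q (T x)) * (1 / 2) - Q m * \<tau> * (1 / 2))"
    by (intro sep_entire_diff sep_entire_mult sep_entire_const assms)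
  then show ?thesis unfolding mult_exp_def
    by (intro sep_entire_compose[where g = exp] holomorphic_on_exp) simp
qed

lemma sep_entire_root_sums: "sep_entire (\<lambda>x. root_sums n x c)"
  by (cases c) (auto simp: root_sums_def intro!: sep_entire_if)

lemma sep_entire_multiplier: "sep_entire (\<lambda>x. mult_exp (total_form n) m b (root_sums n x))"
  by (intro sep_entire_mult_exp)
     (unfold total_form_def, (intro sep_entire_interface_form sep_entire_add sep_entire_const sep_entire_root_sums)+)

text \<open>For a given deck transformation the translation of the root sums is constant, so the
  multiplier is the exponential of a polynomial.\<close>

lemma line_bundle_transition: "line_bundle q n (\<lambda>x y. transition n (root_sums n x) (root_sums n y))"
  unfolding line_bundle_def
proof (intro conjI allI impI ballI)
  fix \<gamma> assume "\<gamma> \<in> deck q n"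
  then obtain m b where "int_vec m" "int_vec b" "\<And>x. root_sums n (\<gamma> x) = translate m b (root_sums n x)"
    using deck_root_sums by blast
  then have "transition n (root_sums n x) (root_sums n (\<gamma> x)) = mult_exp (total_form n) m b (root_sums n x)" for x
    by (simp add: transition_translate)
  moreover have "ell_prod q n \<subseteq> pcoords n \<rightarrow>\<^sub>E UNIV" by (auto simp: ell_prod_def)
  ultimately show "holomorphic_along (pcoords n) (ell_prod q n) (\<lambda>x. transition n (root_sums n x) (root_sums n (\<gamma> x)))"
    using sep_entire_holomorphic_along[OF sep_entire_multiplier finite_coords(1)] by simp
qed (rule transition_nz transition_trans same_point_root_sums, assumption?)+


section \<open>Interface functions on single components\<close>

lemma regular_translate:
  fixes t :: "('c \<Rightarrow> complex) \<Rightarrow> nat \<Rightarrow> nat \<Rightarrow> complex"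
  assumes "int_linear h" "\<And>k j. int_linear (\<lambda>x. t x k j)" "int_vec m" "int_vec b"
  shows "regular_roots (h (translate m b x)) (t (translate m b x)) n \<longleftrightarrow> regular_roots (h x) (t x) n"
proof -
  have nz: "th (l (translate m b x)) = 0 \<longleftrightarrow> th (l x) = 0" if "int_linear l" for l :: "('c \<Rightarrow> complex) \<Rightarrow> complex"
    using quasi_th[OF that] assms(3,4) unfolding quasi_def by simp
  have "th (h (translate m b x) + t (translate m b x) k i - t (translate m b x) k j) = 0 \<longleftrightarrow> th (h x + t x k i - t x k j) = 0"
    "th (t (translate m b x) k i - t (translate m b x) k j) = 0 \<longleftrightarrow> th (t x k i - t x k j) = 0" for k i j
    using nz[of "\<lambda>x. h x + t x k i - t x k j"] nz[of "\<lambda>x. t x k i - t x k j"] assms(1,2)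
    by (simp_all add: int_linear_add int_linear_diff)
  then show ?thesis by (simp add: regular_roots_def)
qed

lemma regular_roots_cong:
  assumes "\<And>k j. k < n \<Longrightarrow> j \<in> {1..k} \<Longrightarrow> t k j = t' k j"
  shows "regular_roots h t n \<longleftrightarrow> regular_roots h t' n"
  unfolding regular_roots_def using assms by (intro all_cong ball_cong refl imp_cong) auto

text \<open>A function on a component depends on the base parameters alone; composition with
  \<open>cut\<close> enforces this on the larger coordinate space.\<close>

definition cut :: "nat \<Rightarrow> (pcoord \<Rightarrow> complex) \<Rightarrow> pcoord \<Rightarrow> complex" where
  "cut n p c = (if c \<in> base_coords n then p c else 0)"

lemma cut_simps: "i \<in> {1..n} \<Longrightarrow> cut n p (EquiL i) = p (EquiL i)" "i \<in> {1..n} \<Longrightarrow> cut n p (EquiR i) = p (EquiR i)"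
  "cut n p HbarP = p HbarP"
  by (auto simp: cut_def pcoords_mem)

lemma sep_entire_cut:
  assumes f: "sep_entire f"
  shows "sep_entire (\<lambda>p. f (cut n p))"
  unfolding sep_entire_def
proof (intro conjI allI)
  have "continuous_on UNIV (\<lambda>p. cut n p c)" for c
    by (cases "c \<in> base_coords n") (simp_all add: cut_def continuous_on_product_coordinates)
  then have "continuous_on UNIV (cut n)" by (intro continuous_on_coordinatewise_then_product)
  then show "continuous_on UNIV (\<lambda>p. f (cut n p))"
    by (rule continuous_on_compose2[OF sep_entire_continuous[OF f]]) auto
  fix p c
  have "cut n (p(c := w)) = (if c \<in> base_coords n then (cut n p)(c := w) else cut n p)" for w
    by (auto simp: cut_def fun_eq_iff)
  then show "(\<lambda>w. f (cut n (p(c := w)))) holomorphic_on UNIV"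
    using sep_entire_slice[OF f] by (cases "c \<in> base_coords n") simp_all
qed

definition left_regular :: "nat \<Rightarrow> (nat \<Rightarrow> nat) \<Rightarrow> (pcoord \<Rightarrow> complex) \<Rightarrow> bool" where
  "left_regular n K p \<longleftrightarrow> regular_roots (p HbarP) (\<lambda>_. (\<lambda>i. p (EquiL i)) \<circ> K) n"

definition right_regular :: "nat \<Rightarrow> (nat \<Rightarrow> nat) \<Rightarrow> (pcoord \<Rightarrow> complex) \<Rightarrow> bool" where
  "right_regular n L p \<longleftrightarrow> regular_roots (p HbarP) (\<lambda>_. (\<lambda>i. p (EquiR i)) \<circ> L) n"

definition left_value :: "nat \<Rightarrow> (nat \<Rightarrow> nat) \<Rightarrow> (nat \<Rightarrow> nat) \<Rightarrow> (pcoord \<Rightarrow> complex) \<Rightarrow> complex" where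
  "left_value n K L p = pos_W (inv L) (p HbarP) (\<lambda>i. p (EquiR i)) (\<lambda>_. (\<lambda>i. p (EquiL i)) \<circ> K) n ((\<lambda>i. p (EquiL i)) \<circ> inv L)"

definition right_value :: "nat \<Rightarrow> (nat \<Rightarrow> nat) \<Rightarrow> (nat \<Rightarrow> nat) \<Rightarrow> (pcoord \<Rightarrow> complex) \<Rightarrow> complex" where
  "right_value n K L p = (-1) ^ (n * (n - 1) div 2) * pos_W (longest_perm n \<circ> inv K) (p HbarP)
     (\<lambda>i. - p (EquiL i)) (\<lambda>_. (\<lambda>i. p (EquiR i)) \<circ> L) n ((\<lambda>i. p (EquiR i)) \<circ> inv K)"

definition is_interface :: "nat \<Rightarrow> (nat \<Rightarrow> nat) \<Rightarrow> (nat \<Rightarrow> nat) \<Rightarrow> ((pcoord \<Rightarrow> complex) \<Rightarrow> complex) \<Rightarrow> bool" where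
  "is_interface n K L f \<longleftrightarrow> sep_entire f \<and> (\<forall>p p'. (\<forall>c\<in>base_coords n. p c = p' c) \<longrightarrow> f p = f p') \<and>
     (\<forall>p. left_regular n K p \<longrightarrow> f p = left_value n K L p) \<and>
     (\<forall>p. right_regular n L p \<longrightarrow> f p = right_value n K L p)"

lemma is_interface_exists:
  assumes K: "K permutes {1..n}" and L: "L permutes {1..n}" and n: "n \<ge> 1"
  shows "\<exists>f. is_interface n K L f"
proof -
  have mem: "K i \<in> {1..n}" "L i \<in> {1..n}" "inv K i \<in> {1..n}" "inv L i \<in> {1..n}" if "i \<in> {1..n}" for i
    using that permutes_in_image[OF K] permutes_in_image[OF L]
      permutes_in_image[OF permutes_inv[OF K]] permutes_in_image[OF permutes_inv[OF L]] by blast+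
  have le: "j \<in> {1..n}" if "k < n" "j \<in> {1..k}" for j k using that by auto
  have reg: "left_regular n K (cut n p) \<longleftrightarrow> left_regular n K p" "right_regular n L (cut n p) \<longleftrightarrow> right_regular n L p" for p
    unfolding left_regular_def right_regular_def cut_simps(3)
    using mem le
    by (intro regular_roots_cong; simp only: o_apply cut_simps)+
  have val: "left_value n K L (cut n p) = left_value n K L p" "right_value n K L (cut n p) = right_value n K L p" for p
  proof -
    show "left_value n K L (cut n p) = left_value n K L p"
      unfolding left_value_def cut_simps(3)
      by (rule pos_W_cong) (insert mem le, simp_all only: o_apply cut_simps)
    show "right_value n K L (cut n p) = right_value n K L p"
      unfolding right_value_def cut_simps(3)
      by (intro arg_cong2[where f = "(*)"] refl pos_W_cong) (insert mem le, simp_all only: o_apply cut_simps)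
  qed
  obtain f where f: "sep_entire f" "\<And>p. left_regular n K p \<Longrightarrow> f p = left_value n K L p"
    "\<And>p. right_regular n L p \<Longrightarrow> f p = right_value n K L p"
    using interface_exists[OF K L n]
    unfolding left_regular_def[symmetric] right_regular_def[symmetric] left_value_def[symmetric] right_value_def[symmetric]
    by blast
  have "cut n p = cut n p'" if "\<forall>c\<in>base_coords n. p c = p' c" for p p'
    using that by (auto simp: cut_def fun_eq_iff)
  then have "is_interface n K L (\<lambda>p. f (cut n p))"
    unfolding is_interface_def using f reg val sep_entire_cut by metis
  then show ?thesis by blast
qed

lemma equal_of_generic:
  assumes "sep_entire f" "sep_entire g" "finite \<Lambda>" "\<And>l. l \<in> \<Lambda> \<Longrightarrow> theta_form l \<and> l u \<noteq> 0"
    and "\<And>s. (\<And>l. l \<in> \<Lambda> \<Longrightarrow> th (l (shifted p s u)) \<noteq> 0) \<Longrightarrow> f (shifted p s u) = g (shifted p s u)"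
  shows "f p = g p"
proof -
  have "f p - g p = 0"
    by (rule vanish_of_generic[where D = "\<lambda>p. f p - g p" and u = u, OF _ assms(3,4)])
       (use assms in \<open>auto intro!: continuous_on_diff sep_entire_continuous\<close>)
  then show ?thesis by simp
qed

definition hbar_forms :: "(nat \<Rightarrow> pcoord) \<Rightarrow> nat \<Rightarrow> ((pcoord \<Rightarrow> complex) \<Rightarrow> complex) set" where
  "hbar_forms E n = (\<lambda>(i, j) p. p HbarP + (p (E i) - p (E j))) ` ({1..n} \<times> {1..n})"

lemma hbar_forms_theta_form:
  assumes "\<And>i. E i \<noteq> HbarP" "l \<in> hbar_forms E n"
  shows "theta_form l"
proof -
  obtain i j where l: "l = (\<lambda>p. p HbarP + (p (E i) - p (E j)))" using assms(2) by (auto simp: hbar_forms_def)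
  show ?thesis unfolding l theta_form_def
    by (intro conjI allI sep_entire_diff sep_entire_add sep_entire_coord exI[of _ HbarP])
       (use assms(1) in \<open>auto simp: shifted_def algebra_simps\<close>)
qed

text \<open>The components of \<open>(K, L)\<close> and \<open>(K, L')\<close> meet where the right
  parameters match. In the left expression \<open>L\<close> enters through the index and the right
  parameters are the Kaehler ones, so the two indices differ by a permutation that preserves
  these.\<close>

lemma left_direction_equal:
  assumes L: "L permutes {1..n}" "L' permutes {1..n}" and K: "K permutes {1..n}" and n: "n \<ge> 1"
    and f: "is_interface n K L f" and g: "is_interface n K L' g"
    and eq: "\<And>k. k \<in> {1..n} \<Longrightarrow> p (EquiR (L k)) = p (EquiR (L' k))"
  shows "f p = g p"
proof -
  \<comment> \<open>Moves \<open>HbarP\<close> and the left parameters but fixes the right ones, so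
    the hypothesis \<open>eq\<close> survives while the left denominators become nonzero.\<close>
  define u :: "pcoord \<Rightarrow> complex" where "u c = (case c of EquiL i \<Rightarrow> of_nat i | HbarP \<Rightarrow> 1 / 2 | _ \<Rightarrow> 0)" for c
  show ?thesis
  proof (rule equal_of_generic[where f = f and g = g and u = u and \<Lambda> = "diff_forms EquiL id n \<union> hbar_forms EquiR n"])
    show "sep_entire f" "sep_entire g" using f g by (auto simp: is_interface_def)
    show "finite (diff_forms EquiL id n \<union> hbar_forms EquiR n)" by (simp add: finite_diff_forms hbar_forms_def)
    fix l assume "l \<in> diff_forms EquiL id n \<union> hbar_forms EquiR n"
    moreover have "\<forall>l\<in>diff_forms EquiL id n. l u \<noteq> 0"
      unfolding diff_forms_ball using half_plus_diff_nz by (auto simp: u_def)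
    moreover have "\<forall>l\<in>hbar_forms EquiR n. l u \<noteq> 0" by (auto simp: hbar_forms_def u_def)
    moreover have "theta_form l" if "l \<in> diff_forms EquiL id n"
      by (rule theta_form_diff[OF _ _ permutes_id that]) (auto simp: inj_def)
    moreover have "theta_form l" if "l \<in> hbar_forms EquiR n"
      by (rule hbar_forms_theta_form[OF _ that]) simp
    ultimately show "theta_form l \<and> l u \<noteq> 0" by blast
  next
    fix s
    define p' where "p' = shifted p s u"
    assume "\<And>l. l \<in> diff_forms EquiL id n \<union> hbar_forms EquiR n \<Longrightarrow> th (l (shifted p s u)) \<noteq> 0"
    then have gen: "\<forall>l\<in>diff_forms EquiL id n. th (l p') \<noteq> 0" and hb: "\<forall>l\<in>hbar_forms EquiR n. th (l p') \<noteq> 0"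
      unfolding p'_def by blast+
    have zz: "generic n (p' HbarP) (\<lambda>i. p' (EquiL i))" unfolding generic_forms by (rule gen)
    have reg: "left_regular n K p'"
      unfolding left_regular_def regular_forms[OF n] using gen diff_forms_mono[OF K, of "n - 1" EquiL] by auto
    have hb': "th (p' HbarP + (p' (EquiR i) - p' (EquiR j))) \<noteq> 0" if "i \<in> {1..n}" "j \<in> {1..n}" for i j
      using hb that unfolding hbar_forms_def by auto
    have "p' (EquiR i) = p (EquiR i)" for i by (simp add: p'_def shifted_def u_def)
    then have eq': "p' (EquiR (L k)) = p' (EquiR (L' k))" if "k \<in> {1..n}" for k using eq[OF that] by simp
    define h where "h = L \<circ> inv L'"
    have h: "h permutes {1..n}" unfolding h_def using permutes_inv[OF L(2)] L(1) by (rule permutes_compose)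
    have param: "p' (EquiR (h i)) = p' (EquiR i)" for i
    proof (cases "i \<in> {1..n}")
      case True
      then have "inv L' i \<in> {1..n}" using permutes_in_image[OF permutes_inv[OF L(2)]] by blast
      then show ?thesis using eq'[of "inv L' i"] by (simp add: h_def permutes_inverses(1)[OF L(2)])
    qed (simp add: permutes_not_in[OF h])
    have inv: "inv L \<circ> h = inv L'" by (auto simp: h_def permutes_inverses(2)[OF L(1)])
    have h0: "th (p' HbarP) \<noteq> 0" using hb'[of 1 1] n by simp
    have zne: "th (p' (EquiL i) - p' (EquiL j)) \<noteq> 0" if "i \<in> {1..n}" "j \<in> {1..n}" "i \<noteq> j" for i j
      using genericD(1)[OF zz] that by blast
    have "left_value n K L' p' = left_value n K L p'"
      unfolding left_value_def inv[symmetric]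
      by (rule pos_W_eq_of_equal_parameters[OF permutes_inv[OF L(1)] h, of "\<lambda>i. p' (EquiR i)" "p' HbarP"
            "\<lambda>_. (\<lambda>i. p' (EquiL i)) \<circ> K" "\<lambda>i. p' (EquiL i)", OF param reg[unfolded left_regular_def] h0 hb' zne])
    then show "f (shifted p s u) = g (shifted p s u)"
      using f g reg unfolding is_interface_def p'_def by simp
  qed
qed

text \<open>The mirror image: \<open>K\<close> enters the right expression through the index, and
  the negated left parameters are its Kaehler parameters.\<close>

lemma right_direction_equal:
  assumes K: "K permutes {1..n}" "K' permutes {1..n}" and L: "L permutes {1..n}" and n: "n \<ge> 1"
    and f: "is_interface n K L f" and g: "is_interface n K' L g"
    and eq: "\<And>k. k \<in> {1..n} \<Longrightarrow> p (EquiL (K k)) = p (EquiL (K' k))"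
  shows "f p = g p"
proof -
  define u :: "pcoord \<Rightarrow> complex" where "u c = (case c of EquiR i \<Rightarrow> of_nat i | HbarP \<Rightarrow> 1 / 2 | _ \<Rightarrow> 0)" for c
  show ?thesis
  proof (rule equal_of_generic[where f = f and g = g and u = u and \<Lambda> = "diff_forms EquiR id n \<union> hbar_forms EquiL n"])
    show "sep_entire f" "sep_entire g" using f g by (auto simp: is_interface_def)
    show "finite (diff_forms EquiR id n \<union> hbar_forms EquiL n)" by (simp add: finite_diff_forms hbar_forms_def)
    fix l assume "l \<in> diff_forms EquiR id n \<union> hbar_forms EquiL n"
    moreover have "\<forall>l\<in>diff_forms EquiR id n. l u \<noteq> 0"
      unfolding diff_forms_ball using half_plus_diff_nz by (auto simp: u_def)
    moreover have "\<forall>l\<in>hbar_forms EquiL n. l u \<noteq> 0" by (auto simp: hbar_forms_def u_def)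
    moreover have "theta_form l" if "l \<in> diff_forms EquiR id n"
      by (rule theta_form_diff[OF _ _ permutes_id that]) (auto simp: inj_def)
    moreover have "theta_form l" if "l \<in> hbar_forms EquiL n"
      by (rule hbar_forms_theta_form[OF _ that]) simp
    ultimately show "theta_form l \<and> l u \<noteq> 0" by blast
  next
    fix s
    define p' where "p' = shifted p s u"
    assume "\<And>l. l \<in> diff_forms EquiR id n \<union> hbar_forms EquiL n \<Longrightarrow> th (l (shifted p s u)) \<noteq> 0"
    then have gen: "\<forall>l\<in>diff_forms EquiR id n. th (l p') \<noteq> 0" and hb: "\<forall>l\<in>hbar_forms EquiL n. th (l p') \<noteq> 0"
      unfolding p'_def by blast+
    have zz: "generic n (p' HbarP) (\<lambda>i. p' (EquiR i))" unfolding generic_forms by (rule gen)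
    have reg: "right_regular n L p'"
      unfolding right_regular_def regular_forms[OF n] using gen diff_forms_mono[OF L, of "n - 1" EquiR] by auto
    have hb0: "th (p' HbarP + (p' (EquiL j) - p' (EquiL i))) \<noteq> 0" if "i \<in> {1..n}" "j \<in> {1..n}" for i j
      using hb that unfolding hbar_forms_def by auto
    have hb': "th (p' HbarP + (- p' (EquiL i) - - p' (EquiL j))) \<noteq> 0" if "i \<in> {1..n}" "j \<in> {1..n}" for i j
      using hb0[OF that] by (simp add: algebra_simps)
    have "p' (EquiL i) = p (EquiL i)" for i by (simp add: p'_def shifted_def u_def)
    then have eq': "p' (EquiL (K k)) = p' (EquiL (K' k))" if "k \<in> {1..n}" for k using eq[OF that] by simp
    define h where "h = K \<circ> inv K'"
    let ?w = "longest_perm n"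
    have h: "h permutes {1..n}" unfolding h_def using permutes_inv[OF K(2)] K(1) by (rule permutes_compose)
    have param: "- p' (EquiL (h i)) = - p' (EquiL i)" for i
    proof (cases "i \<in> {1..n}")
      case True
      then have "inv K' i \<in> {1..n}" using permutes_in_image[OF permutes_inv[OF K(2)]] by blast
      then show ?thesis using eq'[of "inv K' i"] by (simp add: h_def permutes_inverses(1)[OF K(2)])
    qed (simp add: permutes_not_in[OF h])
    have inv: "?w \<circ> inv K \<circ> h = ?w \<circ> inv K'" by (auto simp: h_def permutes_inverses(2)[OF K(1)])
    have w: "?w \<circ> inv K permutes {1..n}" using permutes_inv[OF K(1)] permutes_longest by (rule permutes_compose)
    have h0: "th (p' HbarP) \<noteq> 0" using hb'[of 1 1] n by simp
    have zne: "th (((\<lambda>i. p' (EquiR i)) \<circ> ?w) i - ((\<lambda>i. p' (EquiR i)) \<circ> ?w) j) \<noteq> 0"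
      if "i \<in> {1..n}" "j \<in> {1..n}" "i \<noteq> j" for i j
    proof -
      have "?w i \<in> {1..n}" "?w j \<in> {1..n}" "?w i \<noteq> ?w j"
        using permutes_in_image[OF permutes_longest] inj_eq[OF permutes_inj[OF permutes_longest]] that by blast+
      then show ?thesis unfolding o_apply using genericD(1)[OF zz] by blast
    qed
    have ww: "y \<circ> ?w \<circ> (?w \<circ> k) = y \<circ> k" for y :: "nat \<Rightarrow> complex" and k :: "nat \<Rightarrow> nat"
      by (auto simp: longest_involution)
    have "right_value n K' L p' = right_value n K L p'"
      unfolding right_value_def
      using pos_W_eq_of_equal_parameters[OF w h, of "\<lambda>i. - p' (EquiL i)" "p' HbarP"
            "\<lambda>_. (\<lambda>i. p' (EquiR i)) \<circ> L" "(\<lambda>i. p' (EquiR i)) \<circ> ?w", OF param reg[unfolded right_regular_def] h0 hb' zne]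
      unfolding inv ww by (rule arg_cong)
    then show "f (shifted p s u) = g (shifted p s u)"
      using f g reg unfolding is_interface_def p'_def by simp
  qed
qed

lemma interface_form_cong:
  assumes "\<And>k. k \<le> n \<Longrightarrow> s k = r k" "\<And>k. k \<le> n \<Longrightarrow> s' k = r' k"
    and "\<And>i. i \<in> {1..n} \<Longrightarrow> z i = y i" "\<And>i. i \<in> {1..n} \<Longrightarrow> z' i = y' i" "h = g"
  shows "interface_form n s s' z z' h = interface_form n r r' y y' g"
  unfolding interface_form_def square_form_def assms(5)
  by (intro arg_cong2[where f = "(+)"] arg_cong2[where f = "(-)"] arg_cong2[where f = "(*)"] sum.cong refl)
     (auto simp: assms(1-4))

lemma fixed_form:
  assumes L: "L permutes {1..n}" and K: "K permutes {1..n}" and n: "n \<ge> 1"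
  shows "total_form n (fixed_sums n K L p)
    = top_form (inv L) (p HbarP) (\<lambda>i. p (EquiR i)) n ((\<lambda>i. p (EquiL i)) \<circ> inv L)
      + rest_form (inv L) (p HbarP) (\<lambda>i. p (EquiR i)) (\<lambda>_. (\<lambda>i. p (EquiL i)) \<circ> K) n
         (\<Sum>j\<in>{1..n}. ((\<lambda>i. p (EquiL i)) \<circ> inv L) j)"
proof -
  have sumL: "(\<Sum>l\<in>{1..n}. f (K l)) = (\<Sum>i\<in>{1..n}. f i)" "(\<Sum>l\<in>{1..n}. f (L l)) = (\<Sum>i\<in>{1..n}. f i)"
    "(\<Sum>l\<in>{1..n}. f (inv L l)) = (\<Sum>i\<in>{1..n}. f i)" for f :: "nat \<Rightarrow> complex"
    using sum.permute[OF K, of f] sum.permute[OF L, of f] sum.permute[OF permutes_inv[OF L], of f]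
    by (simp_all add: o_def)
  define s where "s k = fixed_sums n K L p (RootL k 0)" for k
  have s: "s k = (\<Sum>l\<in>{1..k}. p (EquiL (K l)))" if "k \<le> n" for k
    using that sumL(1)[of "\<lambda>i. p (EquiL i)"] by (cases "k = n") (simp_all add: s_def fixed_sums_def)
  have s': "fixed_sums n K L p (RootR k 0) = (\<Sum>l\<in>{1..k}. p (EquiR (L l)))" if "k \<le> n" for k
    using that sumL(2)[of "\<lambda>i. p (EquiR i)"] by (cases "k = n") (simp_all add: fixed_sums_def)
  have base: "fixed_sums n K L p c = p c" if "c \<in> base_coords n" for c
    using that by (cases c) (auto simp: fixed_sums_def base_coords_def)
  have "total_form n (fixed_sums n K L p) = interface_form n s (\<lambda>k. fixed_sums n K L p (RootR k 0))
      (\<lambda>i. p (EquiL i)) (\<lambda>i. p (EquiR i)) (p HbarP)"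
    unfolding total_form_def s_def by (intro interface_form_cong base) (simp_all add: pcoords_mem)
  also have "\<dots> = top_form (inv L) (p HbarP) (\<lambda>i. p (EquiR i)) n ((\<lambda>i. p (EquiL i)) \<circ> inv L)
      + (\<Sum>k<n. level_form (inv L) (p HbarP) (\<lambda>i. p (EquiR i)) k (s k) (s (Suc k)))"
    by (rule interface_form_primary[OF L n _ _ s']) (use s[of 0] s[of n] sumL(1) in auto)
  also have "(\<Sum>k<n. level_form (inv L) (p HbarP) (\<lambda>i. p (EquiR i)) k (s k) (s (Suc k)))
    = rest_form (inv L) (p HbarP) (\<lambda>i. p (EquiR i)) (\<lambda>_. (\<lambda>i. p (EquiL i)) \<circ> K) n
         (\<Sum>j\<in>{1..n}. ((\<lambda>i. p (EquiL i)) \<circ> inv L) j)"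
    unfolding rest_form_def o_apply
  proof (intro sum.cong refl arg_cong2[where f = "level_form (inv L) (p HbarP) (\<lambda>i. p (EquiR i)) k" for k])
    fix k assume k: "k \<in> {..<n}"
    show "s k = (\<Sum>j\<in>{1..k}. p (EquiL (K j)))" using k by (intro s) simp
    show "s (Suc k) = (if Suc k = n then \<Sum>j\<in>{1..n}. p (EquiL (inv L j)) else \<Sum>j\<in>{1..Suc k}. p (EquiL (K j)))"
      using s[of "Suc k"] k sumL(1)[of "\<lambda>i. p (EquiL i)"] sumL(3)[of "\<lambda>i. p (EquiL i)"] by auto
  qed
  finally show ?thesis .
qed

text \<open>At regular points the value is a weight function and has the multiplier of its form.
  Both sides are entire, so the formula extends across the divisors.\<close>

lemma interface_translate:
  assumes K: "K permutes {1..n}" and L: "L permutes {1..n}" and n: "n \<ge> 1"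
    and f: "is_interface n K L f" and int: "int_vec m" "int_vec b"
  shows "f (translate m b p) = mult_exp (total_form n) (fixed_sums n K L m) (fixed_sums n K L b) (fixed_sums n K L p) * f p"
proof -
  let ?T = "fixed_sums n K L"
  let ?u = "\<lambda>c. case c of EquiL i \<Rightarrow> of_nat i | HbarP \<Rightarrow> 1 / 2 | _ \<Rightarrow> (0::complex)"
  have f': "sep_entire f" "\<And>p. left_regular n K p \<Longrightarrow> f p = left_value n K L p"
    using f by (auto simp: is_interface_def)
  show ?thesis
  proof (rule equal_of_generic[where f = "\<lambda>p. f (translate m b p)" and g = "\<lambda>p. mult_exp (total_form n) (?T m) (?T b) (?T p) * f p" and u = ?u and \<Lambda> = "diff_forms EquiL id n"])
    show "sep_entire (\<lambda>p. f (translate m b p))"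
      unfolding sep_entire_def
    proof (intro conjI allI)
      have "continuous_on UNIV (translate m b)"
        unfolding translate_def
        by (intro continuous_on_coordinatewise_then_product continuous_on_add continuous_on_product_coordinates continuous_on_const)
      then show "continuous_on UNIV (\<lambda>p. f (translate m b p))"
        by (rule continuous_on_compose2[OF sep_entire_continuous[OF f'(1)]]) auto
      fix p c
      have *: "translate m b (p(c := w)) = (translate m b p)(c := w + (m c * \<tau> + 2 * pi * \<i> * b c))" for w
        by (auto simp: translate_def)
      have "((\<lambda>w. f ((translate m b p)(c := w))) \<circ> (\<lambda>w. w + (m c * \<tau> + 2 * pi * \<i> * b c))) holomorphic_on UNIV"
        by (rule holomorphic_on_compose_gen[OF _ sep_entire_slice[OF f'(1)]]) (auto intro!: holomorphic_intros)
      then show "(\<lambda>w. f (translate m b (p(c := w)))) holomorphic_on UNIV"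
        unfolding * by (simp add: o_def)
    qed
    have T: "sep_entire (\<lambda>x. ?T x c)" for c
      by (cases c) (auto simp: fixed_sums_def intro!: sep_entire_if)
    show "sep_entire (\<lambda>p. mult_exp (total_form n) (?T m) (?T b) (?T p) * f p)"
      by (intro sep_entire_mult sep_entire_mult_exp f')
         (unfold total_form_def, (intro sep_entire_interface_form sep_entire_add sep_entire_const T)+)
    show "finite (diff_forms EquiL id n)" by (rule finite_diff_forms)
    fix l assume l: "l \<in> diff_forms EquiL id n"
    have "\<forall>l\<in>diff_forms EquiL id n. l ?u \<noteq> 0"
      unfolding diff_forms_ball using half_plus_diff_nz by auto
    moreover have "theta_form l" by (rule theta_form_diff[OF _ _ permutes_id l]) (auto simp: inj_def)
    ultimately show "theta_form l \<and> l ?u \<noteq> 0" using l by blast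
  next
    fix s
    define p' where "p' = shifted p s ?u"
    assume "\<And>l. l \<in> diff_forms EquiL id n \<Longrightarrow> th (l (shifted p s ?u)) \<noteq> 0"
    then have gen: "\<forall>l\<in>diff_forms EquiL id n. th (l p') \<noteq> 0" unfolding p'_def by blast
    have reg: "left_regular n K p'"
      unfolding left_regular_def regular_forms[OF n] using gen diff_forms_mono[OF K, of "n - 1" EquiL] by auto
    have reg': "left_regular n K (translate m b p')"
      using reg unfolding left_regular_def
      by (subst regular_translate[where h = "\<lambda>p. p HbarP" and t = "\<lambda>p _. (\<lambda>i. p (EquiL i)) \<circ> K"])
         (auto simp: int int_linear_coord)
    have "quasi (left_value n K L) (\<lambda>p. total_form n (?T p))"
      unfolding left_value_def[abs_def] fixed_form[OF L K n]
      by (rule quasi_pos_W) (auto simp: int_linear_coord permutes_inj_on[OF permutes_inv[OF L]])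
    then have "left_value n K L (translate m b p') = mult_exp (\<lambda>p. total_form n (?T p)) m b p' * left_value n K L p'"
      using int unfolding quasi_def by blast
    then show "f (translate m b (shifted p s ?u)) = mult_exp (total_form n) (?T m) (?T b) (?T (shifted p s ?u)) * f (shifted p s ?u)"
      unfolding p'_def[symmetric] f'(2)[OF reg] f'(2)[OF reg'] mult_exp_int_map[OF int_map_fixed_sums] .
  qed
qed

lemma interface_transition:
  assumes K: "K permutes {1..n}" and L: "L permutes {1..n}" and n: "n \<ge> 1"
    and f: "is_interface n K L f" and cong: "lattice_cong p p'"
  shows "f p' = transition n (fixed_sums n K L p) (fixed_sums n K L p') * f p"
proof -
  obtain m b where *: "int_vec m" "int_vec b" "p' = translate m b p"
    using cong unfolding lattice_cong_translate by blast
  note int = int_map_int_vec[OF int_map_fixed_sums *(1), of n K L] int_map_int_vec[OF int_map_fixed_sums *(2), of n K L]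
  show ?thesis
    unfolding *(3) int_map_translate[OF int_map_fixed_sums] transition_translate[OF int]
    by (rule interface_translate[OF K L n f *(1,2)])
qed

end

section \<open>The duality interface\<close>

context nome
begin

text \<open>Turns congruence into equality, both for multisets of residues and for the hypotheses of
  \<open>left_direction_equal\<close> and \<open>right_direction_equal\<close>.\<close>

definition rep :: "complex \<Rightarrow> complex" where
  "rep u = (SOME v. v - u \<in> log_lattice q)"

lemma rep_lattice: "rep u - u \<in> log_lattice q"
  unfolding rep_def by (rule someI[of _ u]) (simp add: zero_in_log_lattice)

lemma rep_eq_iff: "rep u = rep v \<longleftrightarrow> u - v \<in> log_lattice q"
proof
  assume "rep u = rep v"
  then show "u - v \<in> log_lattice q"
    using log_lattice_diff[OF rep_lattice[of v] rep_lattice[of u]] by simp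
next
  assume *: "u - v \<in> log_lattice q"
  have "w - u \<in> log_lattice q \<longleftrightarrow> w - v \<in> log_lattice q" for w
    using log_lattice_add[OF _ *, of "w - u"] log_lattice_diff[OF _ *, of "w - v"] by auto
  then show "rep u = rep v" by (simp add: rep_def)
qed

lemma lies_over_roots:
  assumes "lies_over q n K t z" and K: "K permutes {1..n}" and k: "k < n"
  shows "\<exists>\<rho>. \<rho> permutes {1..k} \<and> (\<forall>j\<in>{1..k}. t k (\<rho> j) - z (K j) \<in> log_lattice q)"
proof (cases "k = 0")
  case False
  then obtain \<pi> where \<pi>: "\<pi> permutes {1..k}" "\<And>l. l \<in> {1..k} \<Longrightarrow> t k (\<pi> l) - fixed_roots K z k l \<in> log_lattice q"
    using assms(1) k unfolding lies_over_def by force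
  obtain e where e: "e permutes {1..k}" "\<And>j. j \<in> {1..k} \<Longrightarrow> sorted_val K k (e j) = K j"
    using sorted_val_rank(1)[OF permutes_inj_on[OF K]] by metis
  have "t k ((\<pi> \<circ> e) j) - z (K j) \<in> log_lattice q" if "j \<in> {1..k}" for j
  proof -
    have "e j \<in> {1..k}" using permutes_in_image[OF e(1)] that by blast
    then show ?thesis using \<pi>(2)[of "e j"] e(2)[OF that] by (simp add: fixed_roots_def)
  qed
  moreover have "\<pi> \<circ> e permutes {1..k}" using e(1) \<pi>(1) by (rule permutes_compose)
  ultimately show ?thesis by blast
qed (auto intro: permutes_id)

text \<open>The residues of the roots of level \<open>k\<close> form a multiset determined by
  \<open>t\<close>, and it consists of the residues of \<open>z (K 1)\<close> up to
  \<open>z (K k)\<close>. Comparing consecutive levels isolates the residue of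
  \<open>z (K k)\<close>.\<close>

lemma lies_over_unique:
  assumes K: "K permutes {1..n}" "lies_over q n K t z" and K': "K' permutes {1..n}" "lies_over q n K' t z"
    and k: "k \<in> {1..n}"
  shows "rep (z (K k)) = rep (z (K' k))"
proof -
  define M :: "(nat \<Rightarrow> nat) \<Rightarrow> nat \<Rightarrow> complex multiset" where "M K k = image_mset (\<lambda>j. rep (z (K j))) (mset_set {1..k})" for K k
  have perm: "image_mset (\<lambda>j. f (\<rho> j)) (mset_set A) = image_mset f (mset_set A)"
    if "\<rho> permutes A" "finite A" for f :: "nat \<Rightarrow> complex" and \<rho> A
    using image_mset_mset_set[OF permutes_inj_on[OF that(1)], of A] permutes_image[OF that(1)]
    by (metis (no_types) comp_apply image_mset.compositionality multiset.map_cong0 multiset.map_comp)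
  have roots: "M K k = image_mset (\<lambda>j. rep (t k j)) (mset_set {1..k})"
    if hyp: "K permutes {1..n}" "lies_over q n K t z" "k < n" for K k
  proof -
    obtain \<rho> where \<rho>: "\<rho> permutes {1..k}" "\<And>j. j \<in> {1..k} \<Longrightarrow> t k (\<rho> j) - z (K j) \<in> log_lattice q"
      using lies_over_roots[OF hyp(2,1,3)] by blast
    have "M K k = image_mset (\<lambda>j. rep (t k (\<rho> j))) (mset_set {1..k})"
      unfolding M_def using \<rho>(2) rep_eq_iff by (intro image_mset_cong) (simp, metis atLeastAtMost_iff One_nat_def)
    also have "\<dots> = image_mset (\<lambda>j. rep (t k j)) (mset_set {1..k})"
      by (rule perm[OF \<rho>(1), of "\<lambda>j. rep (t k j)"]) simp
    finally show ?thesis .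
  qed
  have "M K n = image_mset (\<lambda>j. rep (z j)) (mset_set {1..n})" if "K permutes {1..n}" for K
    unfolding M_def by (rule perm[OF that, of "\<lambda>j. rep (z j)"]) simp
  then have eq: "M K k = M K' k" if "k \<le> n" for k
    using that roots[of K k] roots[of K' k] K K' by (cases "k = n") auto
  obtain i where i: "k = Suc i" using k by (cases k) auto
  have "{1..Suc i} = insert (Suc i) {1..i}" by auto
  then have "M K (Suc i) = add_mset (rep (z (K (Suc i)))) (M K i)" for K
    by (simp add: M_def)
  then show ?thesis using eq[of i] eq[of "Suc i"] k unfolding i by simp
qed

lemma lies_over_deck:
  assumes over: "lies_over q n K t z" and K: "K permutes {1..n}"
    and \<pi>: "\<And>k. k \<in> {1..<n} \<Longrightarrow> \<pi> k permutes {1..k}"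
    and t: "\<And>k a. k \<in> {1..<n} \<Longrightarrow> a \<in> {1..k} \<Longrightarrow> t' k a - t k (\<pi> k a) \<in> log_lattice q"
    and z: "\<And>i. i \<in> {1..n} \<Longrightarrow> z' i - z i \<in> log_lattice q"
  shows "lies_over q n K t' z'"
  unfolding lies_over_def
proof
  fix k assume k: "k \<in> {1..<n}"
  then obtain \<sigma> where \<sigma>: "\<sigma> permutes {1..k}" "\<And>l. l \<in> {1..k} \<Longrightarrow> t k (\<sigma> l) - fixed_roots K z k l \<in> log_lattice q"
    using over unfolding lies_over_def by blast
  have "t' k ((inv (\<pi> k) \<circ> \<sigma>) l) - fixed_roots K z' k l \<in> log_lattice q" if l: "l \<in> {1..k}" for l
  proof -
    have "\<sigma> l \<in> {1..k}" using permutes_in_image[OF \<sigma>(1)] l by blast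
    then have "inv (\<pi> k) (\<sigma> l) \<in> {1..k}" using permutes_in_image[OF permutes_inv[OF \<pi>[OF k]]] by blast
    then have 1: "t' k (inv (\<pi> k) (\<sigma> l)) - t k (\<sigma> l) \<in> log_lattice q"
      using t[OF k, of "inv (\<pi> k) (\<sigma> l)"] permutes_inverses(1)[OF \<pi>[OF k]] by simp
    have "sorted_val K k l \<in> {1..n}" using sorted_val_mem[OF K, of l k] k l by simp
    then have "fixed_roots K z' k l - fixed_roots K z k l \<in> log_lattice q"
      using z by (simp add: fixed_roots_def)
    from log_lattice_diff[OF log_lattice_add[OF 1 \<sigma>(2)[OF l]] this] show ?thesis by simp
  qed
  moreover have "inv (\<pi> k) \<circ> \<sigma> permutes {1..k}"
    using \<sigma>(1) permutes_inv[OF \<pi>[OF k]] by (rule permutes_compose)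
  ultimately show "\<exists>\<pi>. \<pi> permutes {1..k} \<and> (\<forall>l\<in>{1..k}. t' k (\<pi> l) - fixed_roots K z' k l \<in> log_lattice q)"
    by blast
qed

definition over :: "nat \<Rightarrow> (pcoord \<Rightarrow> complex) \<Rightarrow> (nat \<Rightarrow> nat) \<Rightarrow> (nat \<Rightarrow> nat) \<Rightarrow> bool" where
  "over n x K L \<longleftrightarrow> K permutes {1..n} \<and> L permutes {1..n} \<and>
     lies_over q n K (\<lambda>k a. x (RootL k a)) (\<lambda>i. x (EquiL i)) \<and>
     lies_over q n L (\<lambda>k a. x (RootR k a)) (\<lambda>i. x (EquiR i))"

lemma over_ell_prod: "x \<in> ell_prod q n \<Longrightarrow> \<exists>K L. over n x K L"
  unfolding ell_prod_def over_def by blast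

definition base_rep :: "nat \<Rightarrow> (pcoord \<Rightarrow> complex) \<Rightarrow> pcoord \<Rightarrow> complex" where
  "base_rep n x c = rep (cut n x c)"

lemma base_rep_cong: "lattice_cong (cut n x) (base_rep n x)"
  by (simp add: lattice_cong_def base_rep_def rep_lattice)

lemma base_rep_eq_iff: "base_rep n x = base_rep n y \<longleftrightarrow> (\<forall>c\<in>base_coords n. x c - y c \<in> log_lattice q)"
  by (auto simp: base_rep_def fun_eq_iff rep_eq_iff cut_def zero_in_log_lattice)

lemma fixed_sums_cut: "fixed_sums n K L (cut n p) = fixed_sums n K L p" if "K permutes {1..n}" "L permutes {1..n}"
proof
  have mem: "K l \<in> {1..n}" "L l \<in> {1..n}" if "k < n" "l \<in> {1..k}" for k l
  proof -
    have "l \<in> {1..n}" using that by auto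
    then show "K l \<in> {1..n}" "L l \<in> {1..n}"
      using permutes_in_image[OF \<open>K permutes {1..n}\<close>] permutes_in_image[OF \<open>L permutes {1..n}\<close>] by blast+
  qed
  fix c show "fixed_sums n K L (cut n p) c = fixed_sums n K L p c"
    unfolding fixed_sums_def
    by (cases c) (auto simp: cut_def pcoords_mem simp del: atLeastAtMost_iff One_nat_def intro!: sum.cong dest: mem)
qed

lemma same_point_over:
  assumes sp: "same_point q n x y" and over: "over n x K L"
  shows "over n y K L" "base_rep n y = base_rep n x"
proof -
  obtain \<pi> \<pi>' v where \<pi>: "\<And>k. k \<in> {1..<n} \<Longrightarrow> \<pi> k permutes {1..k}" "\<And>k. k \<in> {1..<n} \<Longrightarrow> \<pi>' k permutes {1..k}"
    and v: "\<And>c. c \<in> pcoords n \<Longrightarrow> v c \<in> log_lattice q"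
    and y: "y = restrict (\<lambda>c. (case c of
            RootL k a \<Rightarrow> x (RootL k (\<pi> k a))
          | RootR k a \<Rightarrow> x (RootR k (\<pi>' k a))
          | _ \<Rightarrow> x c) + v c) (pcoords n)"
    using sp unfolding same_point_def deck_def by blast
  have base: "y c - x c \<in> log_lattice q" if "c \<in> base_coords n" for c
    using that v[of c] by (auto simp: y base_coords_def pcoords_def)
  then show "base_rep n y = base_rep n x" by (simp add: base_rep_eq_iff)
  show "over n y K L"
    unfolding over_def
  proof (intro conjI)
    show KL: "K permutes {1..n}" "L permutes {1..n}" using over by (auto simp: over_def)
    show "lies_over q n K (\<lambda>k a. y (RootL k a)) (\<lambda>i. y (EquiL i))"
    proof (rule lies_over_deck[OF _ KL(1) \<pi>(1)])
      show "lies_over q n K (\<lambda>k a. x (RootL k a)) (\<lambda>i. x (EquiL i))" using over by (simp add: over_def)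
    qed (use v base in \<open>auto simp: y pcoords_mem\<close>)
    show "lies_over q n L (\<lambda>k a. y (RootR k a)) (\<lambda>i. y (EquiR i))"
    proof (rule lies_over_deck[OF _ KL(2) \<pi>(2)])
      show "lies_over q n L (\<lambda>k a. x (RootR k a)) (\<lambda>i. x (EquiR i))" using over by (simp add: over_def)
    qed (use v base in \<open>auto simp: y pcoords_mem\<close>)
  qed
qed

lemma over_fixed_sums:
  assumes over: "over n x K L"
  shows "lattice_cong (fixed_sums n K L x) (root_sums n x)"
  unfolding lattice_cong_def
proof
  have KL: "K permutes {1..n}" "L permutes {1..n}" using over by (auto simp: over_def)
  have sums: "(\<Sum>a\<in>{1..k}. t k a) - (\<Sum>l\<in>{1..k}. z (K l)) \<in> log_lattice q"
    if hyp: "lies_over q n K t z" "K permutes {1..n}" "k < n" for K t z k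
  proof -
    obtain \<rho> where \<rho>: "\<rho> permutes {1..k}" "\<And>j. j \<in> {1..k} \<Longrightarrow> t k (\<rho> j) - z (K j) \<in> log_lattice q"
      using lies_over_roots[OF hyp] by blast
    have "(\<Sum>a\<in>{1..k}. t k a) - (\<Sum>l\<in>{1..k}. z (K l)) = (\<Sum>j\<in>{1..k}. t k (\<rho> j) - z (K j))"
      using sum.permute[OF \<rho>(1), of "t k"] by (simp add: sum_subtractf o_def)
    also have "\<dots> \<in> log_lattice q" using \<rho>(2) by (rule log_lattice_sum)
    finally show ?thesis .
  qed
  fix c
  show "root_sums n x c - fixed_sums n K L x c \<in> log_lattice q"
    using sums[of K "\<lambda>k a. x (RootL k a)" "\<lambda>i. x (EquiL i)"] sums[of L "\<lambda>k a. x (RootR k a)" "\<lambda>i. x (EquiR i)"]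
      over KL unfolding over_def root_sums_def fixed_sums_def
    by (cases c) (auto simp: zero_in_log_lattice)
qed

text \<open>Evaluated on some component over \<open>x\<close>, at the chosen representatives of the
  parameters, and carried to \<open>x\<close> by the multiplier. By
  \<open>interface_base_rep\<close> every pair over \<open>x\<close> gives the same value.\<close>

definition interface ::
  "nat \<Rightarrow> ((nat \<Rightarrow> nat) \<Rightarrow> (nat \<Rightarrow> nat) \<Rightarrow> (pcoord \<Rightarrow> complex) \<Rightarrow> complex) \<Rightarrow> (pcoord \<Rightarrow> complex) \<Rightarrow> complex"
where
  "interface n F x = (case (SOME KL. over n x (fst KL) (snd KL)) of (K, L) \<Rightarrow>
     transition n (fixed_sums n K L (base_rep n x)) (root_sums n x) * F K L (base_rep n x))"

definition interface_family ::
  "nat \<Rightarrow> ((nat \<Rightarrow> nat) \<Rightarrow> (nat \<Rightarrow> nat) \<Rightarrow> (pcoord \<Rightarrow> complex) \<Rightarrow> complex) \<Rightarrow> bool"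
where
  "interface_family n F \<longleftrightarrow> (\<forall>K L. K permutes {1..n} \<longrightarrow> L permutes {1..n} \<longrightarrow> is_interface n K L (F K L))"

lemma interface_familyD:
  "interface_family n F \<Longrightarrow> K permutes {1..n} \<Longrightarrow> L permutes {1..n} \<Longrightarrow> is_interface n K L (F K L)"
  by (simp add: interface_family_def)

text \<open>At the representatives, parameters that are congruent at \<open>x\<close> are equal, so
  the functions of two components over \<open>x\<close> agree. The comparison passes through
  \<open>(K, L')\<close>, changing one index at a time.\<close>

lemma interface_base_rep:
  assumes F: "interface_family n F" and n: "n \<ge> 1"
    and over: "over n x K L"
  shows "interface n F x = transition n (fixed_sums n K L (base_rep n x)) (root_sums n x) * F K L (base_rep n x)"
proof -
  obtain K' L' where c: "(SOME KL. over n x (fst KL) (snd KL)) = (K', L')" by (metis surj_pair)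
  have over': "over n x K' L'"
    using someI[of "\<lambda>KL. over n x (fst KL) (snd KL)" "(K, L)"] over unfolding c by simp
  let ?r = "base_rep n x"
  note K = over[unfolded over_def] and K' = over'[unfolded over_def]
  have mem: "M k \<in> {1..n}" if "M permutes {1..n}" "k \<in> {1..n}" for M k
    using permutes_in_image[OF that(1)] that(2) by blast
  have eqK: "?r (EquiL (K k)) = ?r (EquiL (K' k))" if k: "k \<in> {1..n}" for k
    using lies_over_unique[of K n "\<lambda>k a. x (RootL k a)" "\<lambda>i. x (EquiL i)" K' k] K K' k mem[of K k] mem[of K' k]
    by (simp add: base_rep_def cut_simps)
  have eqL: "?r (EquiR (L k)) = ?r (EquiR (L' k))" if k: "k \<in> {1..n}" for k
    using lies_over_unique[of L n "\<lambda>k a. x (RootR k a)" "\<lambda>i. x (EquiR i)" L' k] K K' k mem[of L k] mem[of L' k]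
    by (simp add: base_rep_def cut_simps)
  have "F K' L' ?r = F K L' ?r"
    by (rule right_direction_equal[of K' n K L']) (use K K' interface_familyD[OF F] n eqK in auto)
  also have "\<dots> = F K L ?r"
    by (rule left_direction_equal[of L' n L K]) (use K K' interface_familyD[OF F] n eqL in auto)
  finally have "F K' L' ?r = F K L ?r" .
  moreover have "fixed_sums n K' L' ?r = fixed_sums n K L ?r"
  proof
    fix c
    have "(\<Sum>l\<in>{1..k}. ?r (EquiL (K' l))) = (\<Sum>l\<in>{1..k}. ?r (EquiL (K l)))"
      "(\<Sum>l\<in>{1..k}. ?r (EquiR (L' l))) = (\<Sum>l\<in>{1..k}. ?r (EquiR (L l)))" if "k < n" for k
      using that by (auto intro!: sum.cong eqK[symmetric] eqL[symmetric])
    then show "fixed_sums n K' L' ?r c = fixed_sums n K L ?r c"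
      by (cases c) (auto simp: fixed_sums_def)
  qed
  ultimately show ?thesis unfolding interface_def c by simp
qed

text \<open>Eliminates the representatives: the multiplier of \<open>F K L\<close> from
  \<open>x\<close> to \<open>base_rep n x\<close> composes with the transition that leads
  back.\<close>

lemma interface_over:
  assumes F: "interface_family n F" and n: "n \<ge> 1"
    and over: "over n x K L"
  shows "interface n F x = transition n (fixed_sums n K L x) (root_sums n x) * F K L x"
proof -
  have KL: "K permutes {1..n}" "L permutes {1..n}" using over by (auto simp: over_def)
  let ?T = "fixed_sums n K L" and ?r = "base_rep n x"
  have "F K L ?r = transition n (?T (cut n x)) (?T ?r) * F K L (cut n x)"
    by (rule interface_transition[OF KL n interface_familyD[OF F KL] base_rep_cong])
  also have "F K L (cut n x) = F K L x"
    using interface_familyD[OF F KL] unfolding is_interface_def by (auto simp: cut_def)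
  also have "?T (cut n x) = ?T x" by (rule fixed_sums_cut[OF KL])
  finally have 1: "F K L ?r = transition n (?T x) (?T ?r) * F K L x" .
  have "lattice_cong (?T (cut n x)) (?T ?r)"
    using base_rep_cong[of n x] int_map_int_vec[OF int_map_fixed_sums, of _ n K L] int_map_translate[OF int_map_fixed_sums, of n K L]
    unfolding lattice_cong_translate by metis
  then have 2: "lattice_cong (?T x) (?T ?r)" unfolding fixed_sums_cut[OF KL] .
  have 3: "lattice_cong (?T ?r) (root_sums n x)"
    by (rule lattice_cong_trans[OF lattice_cong_sym[OF 2] over_fixed_sums[OF over]])
  show ?thesis
    unfolding interface_base_rep[OF F n over] 1 transition_trans[OF 2 3] by (simp only: mult_ac)
qed

lemma is_section_interface:
  assumes F: "interface_family n F" and n: "n \<ge> 1"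
  shows "is_section q n (\<lambda>x y. transition n (root_sums n x) (root_sums n y)) (interface n F)"
  unfolding is_section_def
proof (intro allI impI)
  fix x y assume sp: "same_point q n x y"
  then obtain K L where over: "over n x K L" using over_ell_prod unfolding same_point_def by blast
  let ?T = "fixed_sums n K L (base_rep n x)"
  have KL: "K permutes {1..n}" "L permutes {1..n}" using over by (auto simp: over_def)
  have "lattice_cong (fixed_sums n K L (cut n x)) ?T"
    using base_rep_cong[of n x] int_map_int_vec[OF int_map_fixed_sums, of _ n K L] int_map_translate[OF int_map_fixed_sums, of n K L]
    unfolding lattice_cong_translate by metis
  then have "lattice_cong ?T (root_sums n x)"
    unfolding fixed_sums_cut[OF KL] using over_fixed_sums[OF over] lattice_cong_trans lattice_cong_sym by blast
  then have "transition n ?T (root_sums n y) = transition n ?T (root_sums n x) * transition n (root_sums n x) (root_sums n y)"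
    by (rule transition_trans[OF _ same_point_root_sums[OF sp]])
  then show "interface n F y = transition n (root_sums n x) (root_sums n y) * interface n F x"
    unfolding interface_base_rep[OF F n over] interface_base_rep[OF F n same_point_over(1)[OF sp over]]
      same_point_over(2)[OF sp over]
    by (simp add: mult_ac)
qed

lemma over_component:
  assumes "I permutes {1..n}" "J permutes {1..n}"
  shows "over n (component n I J p) I J"
  unfolding over_def
  using sorted_val_mem[OF assms(1)] sorted_val_mem[OF assms(2)]
  by (intro conjI assms lies_over_fixed) (auto simp: component_def pcoords_mem fixed_roots_def)

text \<open>On a component the root sums coincide with \<open>fixed_sums\<close>, so the transition
  is 1 and the restriction is the entire function \<open>F I J\<close>.\<close>

lemma holomorphic_section_interface:
  assumes F: "interface_family n F" and n: "n \<ge> 1"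
  shows "holomorphic_section n (interface n F)"
  unfolding holomorphic_section_def
proof (intro allI impI)
  fix I J assume IJ: "I permutes {1..n}" "J permutes {1..n}"
  have base: "component n I J p c = p c" if "c \<in> base_coords n" for p c
    using that by (auto simp: component_def base_coords_def pcoords_def)
  have "interface n F (component n I J p) = F I J p" for p
  proof -
    have "fixed_sums n I J (component n I J p) = fixed_sums n I J (cut n (component n I J p))"
      by (rule fixed_sums_cut[OF IJ, symmetric])
    also have "cut n (component n I J p) = cut n p" using base by (auto simp: cut_def fun_eq_iff)
    also have "fixed_sums n I J (cut n p) = root_sums n (component n I J p)"
      unfolding fixed_sums_cut[OF IJ] root_sums_component[OF IJ] ..
    finally have "interface n F (component n I J p) = F I J (component n I J p)"
      unfolding interface_over[OF F n over_component[OF IJ]] by (simp add: transition_refl)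
    also have "\<dots> = F I J p" using interface_familyD[OF F IJ] base unfolding is_interface_def by blast
    finally show ?thesis .
  qed
  then show "holomorphic_along (base_coords n) (base_coords n \<rightarrow>\<^sub>E UNIV) (\<lambda>p. interface n F (component n I J p))"
    using interface_familyD[OF F IJ] sep_entire_holomorphic_along[OF _ finite_coords(2) order_refl] unfolding is_interface_def by simp
qed


text \<open>\<open>x\<close> is related by a translation to the point whose roots are \<open>z \<circ> K\<close> on every level; both
  sides of the claim then transform by the same multiplier.\<close>

lemma pos_W_over:
  fixes x :: "xcoord \<Rightarrow> complex"
  assumes over: "lies_over q n K (\<lambda>k a. x (Root k a)) (\<lambda>i. x (Equi i))" and K: "K permutes {1..n}"
    and reg: "weight_regular q n x" and I: "I permutes {1..n}"
    and V: "int_map V" "\<And>y. (\<And>k. k < n \<Longrightarrow> (\<Sum>a\<in>{1..k}. y (Root k a)) = (\<Sum>a\<in>{1..k}. x (Root k a))) \<Longrightarrow>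
        (\<And>i. y (Equi i) = x (Equi i)) \<Longrightarrow> (\<And>i. y (Kahler i) = x (Kahler i)) \<Longrightarrow> y Hbar = x Hbar \<Longrightarrow> V y = V x"
    and V0: "\<And>y. (\<And>k. k < n \<Longrightarrow> (\<Sum>a\<in>{1..k}. y (Root k a)) = (\<Sum>a\<in>{1..k}. x (Equi (K a)))) \<Longrightarrow>
        (\<And>i. y (Equi i) = x (Equi i)) \<Longrightarrow> (\<And>i. y (Kahler i) = x (Kahler i)) \<Longrightarrow> y Hbar = x Hbar \<Longrightarrow> V y = X0"
    and \<mu>: "\<And>j. int_linear (\<lambda>y. \<mu> y j)"
      "\<And>y. (\<And>i. y (Kahler i) = x (Kahler i)) \<Longrightarrow> \<mu> y = \<mu> x"
    and form: "\<And>y. total_form n (V y) = top_form I (y Hbar) (\<mu> y) n ((\<lambda>i. y (Equi i)) \<circ> N)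
        + rest_form I (y Hbar) (\<mu> y) (\<lambda>k a. y (Root k a)) n (\<Sum>j\<in>{1..n}. ((\<lambda>i. y (Equi i)) \<circ> N) j)"
  shows "regular_roots (x Hbar) (\<lambda>_. (\<lambda>i. x (Equi i)) \<circ> K) n"
    and "pos_W I (x Hbar) (\<mu> x) (\<lambda>k a. x (Root k a)) n ((\<lambda>i. x (Equi i)) \<circ> N)
      = transition n X0 (V x) * pos_W I (x Hbar) (\<mu> x) (\<lambda>_. (\<lambda>i. x (Equi i)) \<circ> K) n ((\<lambda>i. x (Equi i)) \<circ> N)"
proof -
  obtain \<rho> where \<rho>: "\<And>k. k < n \<Longrightarrow> \<rho> k permutes {1..k}"
    "\<And>k j. k < n \<Longrightarrow> j \<in> {1..k} \<Longrightarrow> x (Root k (\<rho> k j)) - x (Equi (K j)) \<in> log_lattice q"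
    using lies_over_roots[OF over K] by metis
  \<comment> \<open>In \<open>x1\<close> the roots of \<open>x\<close> are reordered so that the one
    at position \<open>j\<close> is congruent to \<open>x (Equi (K j))\<close>; in \<open>x0\<close>
    it is replaced by that parameter itself. The two differ by a lattice vector.\<close>
  define x0 where "x0 c = (case c of Root k j \<Rightarrow> x (Equi (K j)) | _ \<Rightarrow> x c)" for c
  define x1 where "x1 c = (case c of Root k j \<Rightarrow> if k < n \<and> j \<in> {1..k} then x (Root k (\<rho> k j)) else x (Equi (K j)) | _ \<Rightarrow> x c)" for c
  have "x1 c - x0 c \<in> log_lattice q" for c
    using \<rho>(2) by (cases c) (auto simp: x0_def x1_def zero_in_log_lattice)
  then have "lattice_cong x0 x1" by (simp add: lattice_cong_def)
  then obtain m b where mb: "int_vec m" "int_vec b" "x1 = translate m b x0"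
    unfolding lattice_cong_translate by blast
  have x0: "x0 (Equi i) = x (Equi i)" "x0 (Kahler i) = x (Kahler i)" "x0 Hbar = x Hbar"
    "x0 (Root k j) = x (Equi (K j))" for i k j by (simp_all add: x0_def)
  have x1: "x1 (Equi i) = x (Equi i)" "x1 (Kahler i) = x (Kahler i)" "x1 Hbar = x Hbar" for i by (simp_all add: x1_def)
  have x1r: "x1 (Root k j) = x (Root k (\<rho> k j))" if "k < n" "j \<in> {1..k}" for k j using that by (simp add: x1_def)
  have \<rho>mem: "\<rho> k j \<in> {1..k}" if "k < n" "j \<in> {1..k}" for k j
    using permutes_in_image[OF \<rho>(1)[OF that(1)]] that(2) by blast
  have \<rho>inj: "\<rho> k i \<noteq> \<rho> k j" if "k < n" "i \<noteq> j" for k i j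
    using inj_eq[OF permutes_inj[OF \<rho>(1)[OF that(1)]]] that(2) by blast
  have "regular_roots (x1 Hbar) (\<lambda>k a. x1 (Root k a)) n"
    unfolding regular_roots_def
  proof (intro allI ballI impI)
    fix k i j assume k: "k < n" and ij: "i \<in> {1..k}" "j \<in> {1..k}" "i \<noteq> j"
    have "k \<in> {1..<n}" using k ij(1) by auto
    then show "th (x1 Hbar + x1 (Root k i) - x1 (Root k j)) \<noteq> 0 \<and> th (x1 (Root k i) - x1 (Root k j)) \<noteq> 0"
      unfolding x1(3) x1r[OF k ij(1)] x1r[OF k ij(2)]
      using reg[unfolded weight_regular_def] \<rho>mem[OF k ij(1)] \<rho>mem[OF k ij(2)] \<rho>inj[OF k ij(3)] by metis
  qed
  then have "regular_roots (x0 Hbar) (\<lambda>k a. x0 (Root k a)) n"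
    unfolding mb(3)
    by (subst (asm) regular_translate[where h = "\<lambda>x. x Hbar" and t = "\<lambda>x k a. x (Root k a)", OF _ _ mb(1,2)])
       (auto intro: int_linear_coord)
  then show "regular_roots (x Hbar) (\<lambda>_. (\<lambda>i. x (Equi i)) \<circ> K) n"
    unfolding x0 by (subst regular_roots_cong[where t' = "\<lambda>k a. x (Equi (K a))"]) simp_all
  let ?P = "\<lambda>y. pos_W I (y Hbar) (\<mu> y) (\<lambda>k a. y (Root k a)) n ((\<lambda>i. y (Equi i)) \<circ> N)"
  have "quasi ?P (\<lambda>y. total_form n (V y))"
    unfolding form by (rule quasi_pos_W) (auto simp: int_linear_coord permutes_inj_on[OF I] \<mu>)
  then have "?P x1 = mult_exp (\<lambda>y. total_form n (V y)) m b x0 * ?P x0"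
    using mb unfolding quasi_def by blast
  also have "mult_exp (\<lambda>y. total_form n (V y)) m b x0 = transition n (V x0) (V x1)"
    unfolding mb(3) int_map_translate[OF V(1)] mult_exp_int_map[OF V(1)]
    by (rule transition_translate[symmetric]) (intro int_map_int_vec[OF V(1)] mb)+
  also have "V x0 = X0" by (rule V0) (simp_all add: x0)
  also have "V x1 = V x"
  proof (rule V(2))
    fix k assume k: "k < n"
    have "(\<Sum>a\<in>{1..k}. x1 (Root k a)) = (\<Sum>a\<in>{1..k}. x (Root k (\<rho> k a)))" using x1r[OF k] by (rule sum.cong[OF refl])
    also have "\<dots> = (\<Sum>a\<in>{1..k}. x (Root k a))"
      using sum.permute[OF \<rho>(1)[OF k], of "\<lambda>a. x (Root k a)"] by (simp add: o_def)
    finally show "(\<Sum>a\<in>{1..k}. x1 (Root k a)) = (\<Sum>a\<in>{1..k}. x (Root k a))" .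
  qed (simp_all add: x1)
  also have "?P x1 = pos_W I (x Hbar) (\<mu> x) (\<lambda>k. (\<lambda>a. x (Root k a)) \<circ> \<rho> k) n ((\<lambda>i. x (Equi i)) \<circ> N)"
    unfolding x1 \<mu>(2)[of x1, OF x1(2)] by (rule pos_W_cong) (simp_all only: o_apply x1r)
  also have "\<dots> = pos_W I (x Hbar) (\<mu> x) (\<lambda>k a. x (Root k a)) n ((\<lambda>i. x (Equi i)) \<circ> N)"
    by (rule pos_W_permute_roots) (rule \<rho>(1))
  also have "?P x0 = pos_W I (x Hbar) (\<mu> x) (\<lambda>_. (\<lambda>i. x (Equi i)) \<circ> K) n ((\<lambda>i. x (Equi i)) \<circ> N)"
    unfolding x0 \<mu>(2)[of x0, OF x0(2)] by (rule pos_W_cong) simp_all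
  finally show "pos_W I (x Hbar) (\<mu> x) (\<lambda>k a. x (Root k a)) n ((\<lambda>i. x (Equi i)) \<circ> N)
      = transition n X0 (V x) * pos_W I (x Hbar) (\<mu> x) (\<lambda>_. (\<lambda>i. x (Equi i)) \<circ> K) n ((\<lambda>i. x (Equi i)) \<circ> N)" .
qed

text \<open>The root sums of \<open>embed_X n L y\<close> as an integral linear map of
  \<open>y\<close>, the form in which \<open>pos_W_over\<close> accepts them; see
  \<open>root_sums_embed\<close>.\<close>

definition primary_sums :: "nat \<Rightarrow> (nat \<Rightarrow> nat) \<Rightarrow> (xcoord \<Rightarrow> complex) \<Rightarrow> pcoord \<Rightarrow> complex" where
  "primary_sums n L y c = (case c of
       RootL k a \<Rightarrow> if k < n then \<Sum>a\<in>{1..k}. y (Root k a) else \<Sum>i\<in>{1..n}. y (Equi i)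
     | RootR k a \<Rightarrow> if k < n then \<Sum>l\<in>{1..k}. y (Kahler (L l)) else \<Sum>i\<in>{1..n}. y (Kahler i)
     | EquiL i \<Rightarrow> if i \<in> {1..n} then y (Equi i) else 0
     | EquiR i \<Rightarrow> if i \<in> {1..n} then y (Kahler i) else 0
     | HbarP \<Rightarrow> y Hbar)"

definition dual_sums :: "nat \<Rightarrow> (nat \<Rightarrow> nat) \<Rightarrow> (xcoord \<Rightarrow> complex) \<Rightarrow> pcoord \<Rightarrow> complex" where
  "dual_sums n K y c = (case c of
       RootL k a \<Rightarrow> if k < n then \<Sum>l\<in>{1..k}. y (Kahler (K l)) else \<Sum>i\<in>{1..n}. y (Kahler i)
     | RootR k a \<Rightarrow> if k < n then \<Sum>a\<in>{1..k}. y (Root k a) else \<Sum>i\<in>{1..n}. y (Equi i)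
     | EquiL i \<Rightarrow> if i \<in> {1..n} then y (Kahler i) else 0
     | EquiR i \<Rightarrow> if i \<in> {1..n} then y (Equi i) else 0
     | HbarP \<Rightarrow> y Hbar)"

lemma int_map_primary_sums: "int_map (primary_sums n L)"
  unfolding int_map_def
proof
  fix c show "int_linear (\<lambda>x. primary_sums n L x c)"
    by (cases c) (auto simp: primary_sums_def intro!: int_linear_if int_linear_sum int_linear_coord int_linear_zero)
qed

lemma int_map_dual_sums: "int_map (dual_sums n K)"
  unfolding int_map_def
proof
  fix c show "int_linear (\<lambda>x. dual_sums n K x c)"
    by (cases c) (auto simp: dual_sums_def intro!: int_linear_if int_linear_sum int_linear_coord int_linear_zero)
qed

lemma root_sums_embed:
  assumes J: "J permutes {1..n}"
  shows "root_sums n (embed_X n J x) = primary_sums n J x" "root_sums n (embed_X_dual n J x) = dual_sums n J x"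
proof -
  have roots: "(\<Sum>a\<in>{1..k}. embed_X n J x (RootR k a)) = (\<Sum>l\<in>{1..k}. x (Kahler (J l)))"
    "(\<Sum>a\<in>{1..k}. embed_X_dual n J x (RootL k a)) = (\<Sum>l\<in>{1..k}. x (Kahler (J l)))"
    "(\<Sum>a\<in>{1..k}. embed_X n J x (RootL k a)) = (\<Sum>a\<in>{1..k}. x (Root k a))"
    "(\<Sum>a\<in>{1..k}. embed_X_dual n J x (RootR k a)) = (\<Sum>a\<in>{1..k}. x (Root k a))" if k: "k < n" for k
  proof -
    have "(\<Sum>a\<in>{1..k}. embed_X n J x (RootR k a)) = (\<Sum>a\<in>{1..k}. fixed_roots J (\<lambda>i. x (Kahler i)) k a)"
      "(\<Sum>a\<in>{1..k}. embed_X_dual n J x (RootL k a)) = (\<Sum>a\<in>{1..k}. fixed_roots J (\<lambda>i. x (Kahler i)) k a)"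
      using k by (auto intro!: sum.cong simp: embed_X_def embed_X_dual_def pcoords_mem)
    then show "(\<Sum>a\<in>{1..k}. embed_X n J x (RootR k a)) = (\<Sum>l\<in>{1..k}. x (Kahler (J l)))"
      "(\<Sum>a\<in>{1..k}. embed_X_dual n J x (RootL k a)) = (\<Sum>l\<in>{1..k}. x (Kahler (J l)))"
      by (simp_all only: sum_fixed_roots[OF J])
  qed (use k in \<open>auto intro!: sum.cong simp: embed_X_def embed_X_dual_def pcoords_mem\<close>)
  have base: "embed_X n J x (EquiL i) = x (Equi i)" "embed_X n J x (EquiR i) = x (Kahler i)"
    "embed_X_dual n J x (EquiL i) = x (Kahler i)" "embed_X_dual n J x (EquiR i) = x (Equi i)" if "i \<in> {1..n}" for i
    using that by (auto simp: embed_X_def embed_X_dual_def pcoords_mem)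
  have h: "embed_X n J x HbarP = x Hbar" "embed_X_dual n J x HbarP = x Hbar"
    by (auto simp: embed_X_def embed_X_dual_def pcoords_mem)
  show "root_sums n (embed_X n J x) = primary_sums n J x"
  proof
    fix c show "root_sums n (embed_X n J x) c = primary_sums n J x c"
      by (cases c) (auto simp: root_sums_def primary_sums_def roots base h pcoords_mem
          simp del: atLeastAtMost_iff One_nat_def sum.cl_ivl_Suc)
  qed
  show "root_sums n (embed_X_dual n J x) = dual_sums n J x"
  proof
    fix c show "root_sums n (embed_X_dual n J x) c = dual_sums n J x c"
      by (cases c) (auto simp: root_sums_def dual_sums_def roots base h pcoords_mem
          simp del: atLeastAtMost_iff One_nat_def sum.cl_ivl_Suc)
  qed
qed

lemma rest_form_top:
  assumes "s n = s'" "\<And>k. k < n \<Longrightarrow> s k = (\<Sum>j\<in>{1..k}. t k j)"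
  shows "(\<Sum>k<n. level_form I h \<mu> k (s k) (s (Suc k))) = rest_form I h \<mu> t n s'"
  unfolding rest_form_def
proof (intro sum.cong refl arg_cong2[where f = "level_form I h \<mu> k" for k])
  fix k assume "k \<in> {..<n}"
  then show "s k = (\<Sum>j\<in>{1..k}. t k j)"
    "s (Suc k) = (if Suc k = n then s' else \<Sum>j\<in>{1..Suc k}. t (Suc k) j)"
    using assms(1) assms(2)[of k] assms(2)[of "Suc k"] by auto
qed

text \<open>Along \<open>X \<times> {L}\<close> the form of the bundle becomes that of the weight
  function of \<open>inv L\<close>, so the pullback has the multipliers of the stable
  envelope.\<close>

lemma primary_form:
  assumes L: "L permutes {1..n}" and n: "n \<ge> 1"
  shows "total_form n (primary_sums n L y) = top_form (inv L) (y Hbar) (\<lambda>i. y (Kahler i)) n ((\<lambda>i. y (Equi i)) \<circ> inv L)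
      + rest_form (inv L) (y Hbar) (\<lambda>i. y (Kahler i)) (\<lambda>k a. y (Root k a)) n (\<Sum>j\<in>{1..n}. ((\<lambda>i. y (Equi i)) \<circ> inv L) j)"
proof -
  have sumL: "(\<Sum>l\<in>{1..n}. f (L l)) = (\<Sum>i\<in>{1..n}. f i)" "(\<Sum>l\<in>{1..n}. f (inv L l)) = (\<Sum>i\<in>{1..n}. f i)"
    for f :: "nat \<Rightarrow> complex"
    using sum.permute[OF L, of f] sum.permute[OF permutes_inv[OF L], of f] by (simp_all add: o_def)
  define s where "s k = primary_sums n L y (RootL k 0)" for k
  have s': "primary_sums n L y (RootR k 0) = (\<Sum>l\<in>{1..k}. y (Kahler (L l)))" if "k \<le> n" for k
    using that sumL(1)[of "\<lambda>i. y (Kahler i)"] by (cases "k = n") (simp_all add: primary_sums_def)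
  have "total_form n (primary_sums n L y) = interface_form n s (\<lambda>k. primary_sums n L y (RootR k 0))
      (\<lambda>i. y (Equi i)) (\<lambda>i. y (Kahler i)) (y Hbar)"
    unfolding total_form_def s_def by (intro interface_form_cong) (simp_all add: primary_sums_def)
  also have "\<dots> = top_form (inv L) (y Hbar) (\<lambda>i. y (Kahler i)) n ((\<lambda>i. y (Equi i)) \<circ> inv L)
      + (\<Sum>k<n. level_form (inv L) (y Hbar) (\<lambda>i. y (Kahler i)) k (s k) (s (Suc k)))"
    by (rule interface_form_primary[OF L n _ _ s']) (use n in \<open>auto simp: s_def primary_sums_def\<close>)
  also have "(\<Sum>k<n. level_form (inv L) (y Hbar) (\<lambda>i. y (Kahler i)) k (s k) (s (Suc k)))
    = rest_form (inv L) (y Hbar) (\<lambda>i. y (Kahler i)) (\<lambda>k a. y (Root k a)) n (\<Sum>j\<in>{1..n}. ((\<lambda>i. y (Equi i)) \<circ> inv L) j)"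
    by (rule rest_form_top) (simp_all only: o_apply sumL(2)[of "\<lambda>i. y (Equi i)"], simp_all add: s_def primary_sums_def)
  finally show ?thesis .
qed

lemma dual_form:
  assumes K: "K permutes {1..n}" and n: "n \<ge> 1"
  defines "I \<equiv> longest_perm n \<circ> inv K"
  shows "total_form n (dual_sums n K y) = top_form I (y Hbar) (\<lambda>i. - y (Kahler i)) n ((\<lambda>i. y (Equi i)) \<circ> inv K)
      + rest_form I (y Hbar) (\<lambda>i. - y (Kahler i)) (\<lambda>k a. y (Root k a)) n (\<Sum>j\<in>{1..n}. ((\<lambda>i. y (Equi i)) \<circ> inv K) j)"
proof -
  have sumK: "(\<Sum>l\<in>{1..n}. f (K l)) = (\<Sum>i\<in>{1..n}. f i)" "(\<Sum>l\<in>{1..n}. f (inv K l)) = (\<Sum>i\<in>{1..n}. f i)"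
    for f :: "nat \<Rightarrow> complex"
    using sum.permute[OF K, of f] sum.permute[OF permutes_inv[OF K], of f] by (simp_all add: o_def)
  define s' where "s' k = dual_sums n K y (RootR k 0)" for k
  have s: "dual_sums n K y (RootL k 0) = (\<Sum>l\<in>{1..k}. y (Kahler (K l)))" if "k \<le> n" for k
    using that sumK(1)[of "\<lambda>i. y (Kahler i)"] by (cases "k = n") (simp_all add: dual_sums_def)
  have "total_form n (dual_sums n K y) = interface_form n (\<lambda>k. dual_sums n K y (RootL k 0)) s'
      (\<lambda>i. y (Kahler i)) (\<lambda>i. y (Equi i)) (y Hbar)"
    unfolding total_form_def s'_def by (intro interface_form_cong) (simp_all add: dual_sums_def)
  also have "\<dots> = top_form I (y Hbar) (\<lambda>i. - y (Kahler i)) n ((\<lambda>i. y (Equi i)) \<circ> inv K)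
      + (\<Sum>k<n. level_form I (y Hbar) (\<lambda>i. - y (Kahler i)) k (s' k) (s' (Suc k)))"
    unfolding I_def
    by (rule interface_form_dual[OF K n _ _ s]) (use n in \<open>auto simp: s'_def dual_sums_def\<close>)
  also have "(\<Sum>k<n. level_form I (y Hbar) (\<lambda>i. - y (Kahler i)) k (s' k) (s' (Suc k)))
    = rest_form I (y Hbar) (\<lambda>i. - y (Kahler i)) (\<lambda>k a. y (Root k a)) n (\<Sum>j\<in>{1..n}. ((\<lambda>i. y (Equi i)) \<circ> inv K) j)"
    by (rule rest_form_top) (simp_all only: o_apply sumK(2)[of "\<lambda>i. y (Equi i)"], simp_all add: s'_def dual_sums_def)
  finally show ?thesis .
qed

lemma over_embed:
  assumes J: "J permutes {1..n}" and K: "K permutes {1..n}"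
    "lies_over q n K (\<lambda>k a. x (Root k a)) (\<lambda>i. x (Equi i))"
  shows "over n (embed_X n J x) K J" "over n (embed_X_dual n J x) J K"
proof -
  have J': "lies_over q n J (\<lambda>k a. embed_X n J x (RootR k a)) (\<lambda>i. embed_X n J x (EquiR i))"
    "lies_over q n J (\<lambda>k a. embed_X_dual n J x (RootL k a)) (\<lambda>i. embed_X_dual n J x (EquiL i))"
    using sorted_val_mem[OF J]
    by (intro lies_over_fixed; auto simp: embed_X_def embed_X_dual_def pcoords_mem fixed_roots_def)+
  have K': "lies_over q n K (\<lambda>k a. embed_X n J x (RootL k a)) (\<lambda>i. embed_X n J x (EquiL i))"
    "lies_over q n K (\<lambda>k a. embed_X_dual n J x (RootR k a)) (\<lambda>i. embed_X_dual n J x (EquiR i))"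
    by (rule lies_over_cong[OF _ _ K]; auto simp: embed_X_def embed_X_dual_def pcoords_mem)+
  show "over n (embed_X n J x) K J" "over n (embed_X_dual n J x) J K"
    unfolding over_def using J K(1) J' K' by blast+
qed


text \<open>If \<open>x\<close> lies over \<open>K\<close>, its image lies over
  \<open>(K, J)\<close>, where the interface is a transition times the left value. By
  \<open>pos_W_over\<close> the weight function at the roots of \<open>x\<close> is the same
  product.\<close>

lemma interface_primary:
  assumes F: "interface_family n F" and n: "n \<ge> 1" and I: "I permutes {1..n}"
    and x: "x \<in> ext_ell_X q n" and reg: "weight_regular q n x"
  shows "interface n F (embed_X n (inv I) x) = Stab q n I x"
proof -
  obtain K where K: "K permutes {1..n}" "lies_over q n K (\<lambda>k a. x (Root k a)) (\<lambda>i. x (Equi i))"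
    using x unfolding ext_ell_X_def by blast
  define J where "J = inv I"
  have J: "J permutes {1..n}" and inv: "inv J = I"
    using permutes_inv[OF I] permutes_inv_inv[OF I] by (auto simp: J_def)
  define y where "y = embed_X n J x"
  have y: "y HbarP = x Hbar" "i \<in> {1..n} \<Longrightarrow> y (EquiL i) = x (Equi i)" "i \<in> {1..n} \<Longrightarrow> y (EquiR i) = x (Kahler i)" for i
    by (auto simp: y_def embed_X_def pcoords_mem)
  have mem: "K j \<in> {1..n}" "J j \<in> {1..n}" "I j \<in> {1..n}" if "j \<in> {1..n}" for j
    using that permutes_in_image[OF K(1)] permutes_in_image[OF J] permutes_in_image[OF I] by blast+
  have le: "j \<in> {1..n}" if "k < n" "j \<in> {1..k}" for j k using that by auto
  have sums: "(\<Sum>l\<in>{1..k}. x (Equi (K l))) = (\<Sum>l\<in>{1..k}. y (EquiL (K l)))"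
    "(\<Sum>l\<in>{1..k}. x (Kahler (J l))) = (\<Sum>l\<in>{1..k}. y (EquiR (J l)))" if "k < n" for k
    using le[OF that] mem y by (intro sum.cong refl; simp only:)+
  have tot: "(\<Sum>i\<in>{1..n}. x (Equi i)) = (\<Sum>i\<in>{1..n}. y (EquiL i))" "(\<Sum>i\<in>{1..n}. x (Kahler i)) = (\<Sum>i\<in>{1..n}. y (EquiR i))"
    using y by (intro sum.cong refl; simp only:)+
  have V: "primary_sums n J u = primary_sums n J x"
    if "\<And>k. k < n \<Longrightarrow> (\<Sum>a\<in>{1..k}. u (Root k a)) = (\<Sum>a\<in>{1..k}. x (Root k a))"
      "\<And>i. u (Equi i) = x (Equi i)" "\<And>i. u (Kahler i) = x (Kahler i)" "u Hbar = x Hbar" for u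
    unfolding fun_eq_iff primary_sums_def that(2-4) by (auto simp: that(1) simp del: atLeastAtMost_iff One_nat_def split: pcoord.split)
  have V0: "primary_sums n J u = fixed_sums n K J y"
    if "\<And>k. k < n \<Longrightarrow> (\<Sum>a\<in>{1..k}. u (Root k a)) = (\<Sum>a\<in>{1..k}. x (Equi (K a)))"
      "\<And>i. u (Equi i) = x (Equi i)" "\<And>i. u (Kahler i) = x (Kahler i)" "u Hbar = x Hbar" for u
    unfolding fun_eq_iff primary_sums_def fixed_sums_def that(2-4) tot
    by (auto simp: that(1) sums y pcoords_mem simp del: atLeastAtMost_iff One_nat_def split: pcoord.split)
  note main = pos_W_over[OF K(2,1) reg I int_map_primary_sums V V0, where \<mu> = "\<lambda>y i. y (Kahler i)" and N = I]
  have form: "total_form n (primary_sums n J u) = top_form I (u Hbar) (\<lambda>i. u (Kahler i)) n ((\<lambda>i. u (Equi i)) \<circ> I)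
      + rest_form I (u Hbar) (\<lambda>i. u (Kahler i)) (\<lambda>k a. u (Root k a)) n (\<Sum>j\<in>{1..n}. ((\<lambda>i. u (Equi i)) \<circ> I) j)" for u
    using primary_form[OF J n, of u] unfolding inv .
  have regular: "regular_roots (x Hbar) (\<lambda>_. (\<lambda>i. x (Equi i)) \<circ> K) n"
    by (rule main(1)) (simp_all add: int_linear_coord form)
  have val: "pos_W I (x Hbar) (\<lambda>i. x (Kahler i)) (\<lambda>k a. x (Root k a)) n ((\<lambda>i. x (Equi i)) \<circ> I)
      = transition n (fixed_sums n K J y) (primary_sums n J x)
        * pos_W I (x Hbar) (\<lambda>i. x (Kahler i)) (\<lambda>_. (\<lambda>i. x (Equi i)) \<circ> K) n ((\<lambda>i. x (Equi i)) \<circ> I)"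
    by (rule main(2)) (simp_all add: int_linear_coord form)
  have "left_regular n K y"
    using regular unfolding left_regular_def y(1)
    by (subst regular_roots_cong[where t' = "\<lambda>_. (\<lambda>i. x (Equi i)) \<circ> K"])
       (insert mem le y, simp_all only: o_apply)
  then have "F K J y = left_value n K J y"
    using interface_familyD[OF F K(1) J] unfolding is_interface_def by blast
  also have "\<dots> = pos_W I (x Hbar) (\<lambda>i. x (Kahler i)) (\<lambda>_. (\<lambda>i. x (Equi i)) \<circ> K) n ((\<lambda>i. x (Equi i)) \<circ> I)"
    unfolding left_value_def inv y(1) by (rule pos_W_cong) (insert mem le y, simp_all only: o_apply)
  finally have "F K J y = pos_W I (x Hbar) (\<lambda>i. x (Kahler i)) (\<lambda>_. (\<lambda>i. x (Equi i)) \<circ> K) n ((\<lambda>i. x (Equi i)) \<circ> I)" .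
  then have "interface n F y = pos_W I (x Hbar) (\<lambda>i. x (Kahler i)) (\<lambda>k a. x (Root k a)) n ((\<lambda>i. x (Equi i)) \<circ> I)"
    using interface_over[OF F n over_embed(1)[OF J K]] root_sums_embed(1)[OF J, of x]
    unfolding val y_def[symmetric] by (simp only:)
  then show ?thesis
    unfolding Stab_def weight_W_eq_pos_W[OF I] y_def J_def .
qed

text \<open>The analogue with the right value. The chamber composes the equivariant parameters with
  the longest permutation, and the index \<open>longest_perm n \<circ> inv I\<close> undoes this in
  the top variables.\<close>

lemma interface_dual:
  assumes F: "interface_family n F" and n: "n \<ge> 1" and I: "I permutes {1..n}"
    and x: "x \<in> ext_ell_X q n" and reg: "weight_regular q n x"
  shows "interface n F (embed_X_dual n I x) = Stab_dual q n (inv I) x"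
proof -
  obtain L where L: "L permutes {1..n}" "lies_over q n L (\<lambda>k a. x (Root k a)) (\<lambda>i. x (Equi i))"
    using x unfolding ext_ell_X_def by blast
  let ?w = "longest_perm n" and ?e = "(-1) ^ (n * (n - 1) div 2) :: complex"
  define J where "J = ?w \<circ> inv I"
  have J: "J permutes {1..n}"
    unfolding J_def using permutes_inv[OF I] permutes_longest by (rule permutes_compose)
  define y where "y = embed_X_dual n I x"
  have y: "y HbarP = x Hbar" "i \<in> {1..n} \<Longrightarrow> y (EquiL i) = x (Kahler i)" "i \<in> {1..n} \<Longrightarrow> y (EquiR i) = x (Equi i)" for i
    by (auto simp: y_def embed_X_dual_def pcoords_mem)
  have mem: "L j \<in> {1..n}" "inv I j \<in> {1..n}" "I j \<in> {1..n}" if "j \<in> {1..n}" for j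
    using that permutes_in_image[OF L(1)] permutes_in_image[OF permutes_inv[OF I]] permutes_in_image[OF I] by blast+
  have le: "j \<in> {1..n}" if "k < n" "j \<in> {1..k}" for j k using that by auto
  have sums: "(\<Sum>l\<in>{1..k}. x (Equi (L l))) = (\<Sum>l\<in>{1..k}. y (EquiR (L l)))"
    "(\<Sum>l\<in>{1..k}. x (Kahler (I l))) = (\<Sum>l\<in>{1..k}. y (EquiL (I l)))" if "k < n" for k
    using le[OF that] mem y by (intro sum.cong refl; simp only:)+
  have tot: "(\<Sum>i\<in>{1..n}. x (Equi i)) = (\<Sum>i\<in>{1..n}. y (EquiR i))" "(\<Sum>i\<in>{1..n}. x (Kahler i)) = (\<Sum>i\<in>{1..n}. y (EquiL i))"
    using y by (intro sum.cong refl; simp only:)+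
  have V: "dual_sums n I u = dual_sums n I x"
    if "\<And>k. k < n \<Longrightarrow> (\<Sum>a\<in>{1..k}. u (Root k a)) = (\<Sum>a\<in>{1..k}. x (Root k a))"
      "\<And>i. u (Equi i) = x (Equi i)" "\<And>i. u (Kahler i) = x (Kahler i)" "u Hbar = x Hbar" for u
    unfolding fun_eq_iff dual_sums_def that(2-4) by (auto simp: that(1) simp del: atLeastAtMost_iff One_nat_def split: pcoord.split)
  have V0: "dual_sums n I u = fixed_sums n I L y"
    if "\<And>k. k < n \<Longrightarrow> (\<Sum>a\<in>{1..k}. u (Root k a)) = (\<Sum>a\<in>{1..k}. x (Equi (L a)))"
      "\<And>i. u (Equi i) = x (Equi i)" "\<And>i. u (Kahler i) = x (Kahler i)" "u Hbar = x Hbar" for u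
    unfolding fun_eq_iff dual_sums_def fixed_sums_def that(2-4) tot
    by (auto simp: that(1) sums y pcoords_mem simp del: atLeastAtMost_iff One_nat_def split: pcoord.split)
  note main = pos_W_over[OF L(2,1) reg J int_map_dual_sums V V0, where \<mu> = "\<lambda>y i. - y (Kahler i)" and N = "inv I"]
  note form = dual_form[OF I n, folded J_def]
  have regular: "regular_roots (x Hbar) (\<lambda>_. (\<lambda>i. x (Equi i)) \<circ> L) n"
    by (rule main(1)) (simp_all add: int_linear_coord int_linear_minus form)
  have val: "pos_W J (x Hbar) (\<lambda>i. - x (Kahler i)) (\<lambda>k a. x (Root k a)) n ((\<lambda>i. x (Equi i)) \<circ> inv I)
      = transition n (fixed_sums n I L y) (dual_sums n I x)
        * pos_W J (x Hbar) (\<lambda>i. - x (Kahler i)) (\<lambda>_. (\<lambda>i. x (Equi i)) \<circ> L) n ((\<lambda>i. x (Equi i)) \<circ> inv I)"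
    by (rule main(2)) (simp_all add: int_linear_coord int_linear_minus form)
  have "right_regular n L y"
    using regular unfolding right_regular_def y(1)
    by (subst regular_roots_cong[where t' = "\<lambda>_. (\<lambda>i. x (Equi i)) \<circ> L"])
       (insert mem le y, simp_all only: o_apply)
  then have "F I L y = right_value n I L y"
    using interface_familyD[OF F I L(1)] unfolding is_interface_def by blast
  also have "\<dots> = ?e * pos_W J (x Hbar) (\<lambda>i. - x (Kahler i)) (\<lambda>_. (\<lambda>i. x (Equi i)) \<circ> L) n ((\<lambda>i. x (Equi i)) \<circ> inv I)"
    unfolding right_value_def J_def y(1)
    by (intro arg_cong2[where f = "(*)"] refl pos_W_cong) (insert mem le y, simp_all only: o_apply)
  finally have "F I L y = ?e * pos_W J (x Hbar) (\<lambda>i. - x (Kahler i)) (\<lambda>_. (\<lambda>i. x (Equi i)) \<circ> L) n ((\<lambda>i. x (Equi i)) \<circ> inv I)" .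
  then have main: "interface n F y = ?e * pos_W J (x Hbar) (\<lambda>i. - x (Kahler i)) (\<lambda>k a. x (Root k a)) n ((\<lambda>i. x (Equi i)) \<circ> inv I)"
    using interface_over[OF F n over_embed(2)[OF I L]] root_sums_embed(2)[OF I, of x]
    unfolding val y_def[symmetric] by (simp only: mult_ac)
  have w: "inv ?w = ?w" using longest_involution by (intro inv_equality) auto
  have ww: "(\<lambda>i. x (Equi i)) \<circ> ?w \<circ> J = (\<lambda>i. x (Equi i)) \<circ> inv I"
    by (simp add: fun_eq_iff J_def longest_involution)
  show ?thesis
    unfolding Stab_dual_def weight_W_chamber_def w J_def[symmetric] weight_W_eq_pos_W[OF J] ww
    unfolding main[symmetric] y_def ..
qed

lemma duality_interface:
  assumes n: "n \<ge> 1"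
  shows "\<exists>e m. line_bundle q n e \<and> is_section q n e m \<and> holomorphic_section n m \<and>
    (\<forall>I J. I permutes {1..n} \<longrightarrow> J = inv I \<longrightarrow>
       sections_agree q n (m \<circ> embed_X n J) (Stab q n I) \<and>
       sections_agree q n (m \<circ> embed_X_dual n I) (Stab_dual q n J))"
proof -
  have "\<forall>K L. \<exists>f. K permutes {1..n} \<longrightarrow> L permutes {1..n} \<longrightarrow> is_interface n K L f"
    using is_interface_exists n by blast
  then obtain F where "interface_family n F" unfolding interface_family_def by metis
  then show ?thesis
    using line_bundle_transition is_section_interface holomorphic_section_interface interface_primary interface_dual n
    unfolding sections_agree_def o_apply by blast
qed

end

theorem theorem1p3:
  fixes q :: complex and n :: nat
  assumes "q \<noteq> 0" and "norm q < 1" and "n \<ge> 1"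
  shows "\<exists>e m. line_bundle q n e \<and> is_section q n e m \<and> holomorphic_section n m \<and>
    (\<forall>I J. I permutes {1..n} \<longrightarrow> J = inv I \<longrightarrow>
       sections_agree q n (m \<circ> embed_X n J) (Stab q n I) \<and>
       sections_agree q n (m \<circ> embed_X_dual n I) (Stab_dual q n J))"
  using nome.duality_interface[of q n] assms by (simp add: nome_def)

end
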